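(* Let $G$ be a countable discrete abelian group. Let $r,s\in\mathbb{Z}$ be distinct nonzero integers such that $rG$, $sG$, $(r+s)G$ and $(r-s)G$ all have finite index in $G$. For any $E\subseteq G$ with $d^*(E)>0$ and any $\varepsilon>0$, the set $$\left\{ g\in G : d^*\left(E\cap(E-rg)\cap(E-sg)\cap(E-(r+s)g)\right) > d^*(E)^4-\varepsilon\right\}$$ is syndetic.
   Context: A Følner sequence in $G$ is a sequence of finite sets $F_N\subseteq G$ with $|(F_N+g)\triangle F_N|/|F_N|\to0$ for every $g\in G$. The upper Banach density of $E\subseteq G$ is $d^*(E)=\sup\{\limsup_{N\to\infty}|E\cap F_N|/|F_N| : (F_N)\text{ a Følner sequence in }G\}$. For $E\subseteq G$, $h\in G$, $E-h=\{e-h:e\in E\}$. A subset $S\subseteq G$ is syndetic if finitely many translates of $S$ cover $G$. *)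

theory Defs
  imports "HOL-Analysis.Analysis" "HOL-Library.Countable"
begin

definition zsmul :: "int \<Rightarrow> 'a::ab_group_add \<Rightarrow> 'a" where
  "zsmul k g = (if 0 \<le> k then (((+) g) ^^ nat k) 0 else - ((((+) g) ^^ nat (-k)) 0))"

definition mult_subgroup :: "int \<Rightarrow> 'a::ab_group_add set" where
  "mult_subgroup k = range (zsmul k)"

definition finite_index :: "'a::ab_group_add set \<Rightarrow> bool" where
  "finite_index H \<longleftrightarrow> finite ((\<lambda>g. (+) g ` H) ` UNIV)"

definition folner :: "(nat \<Rightarrow> 'a::ab_group_add set) \<Rightarrow> bool" where
  "folner F \<longleftrightarrow> (\<forall>N. finite (F N) \<and> F N \<noteq> {}) \<and>
     (\<forall>g. (\<lambda>N. real (card ((((\<lambda>x. x + g) ` F N) - F N) \<union> (F N - ((\<lambda>x. x + g) ` F N))))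
                  / real (card (F N))) \<longlonglongrightarrow> 0)"

text \<open>Upper Banach density (values lie in [0,1], so the real value is faithful).\<close>
definition upper_banach_density :: "'a::ab_group_add set \<Rightarrow> real" where
  "upper_banach_density E = real_of_ereal
     (SUP F \<in> {F. folner F}. limsup (\<lambda>N. ereal (real (card (E \<inter> F N)) / real (card (F N)))))"

definition syndetic :: "'a::ab_group_add set \<Rightarrow> bool" where
  "syndetic S \<longleftrightarrow> (\<exists>T. finite T \<and> (\<Union>t\<in>T. (+) t ` S) = UNIV)"

definition set_shift :: "'a::ab_group_add set \<Rightarrow> 'a \<Rightarrow> 'a set" where
  "set_shift E h = (\<lambda>e. e - h) ` E"

end

theory Submission
  imports Defs "HOL-Analysis.Analysis"
begin

text \<open>
Let m range over the invariant means on G. The supremum of L(1_E) over invariant means L is at least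
d*(E) and is attained at an extreme point L; extremality makes the completion of the bounded functions
for the L2(L)-seminorm an ergodic system in which every character of G is an eigenfunction.
If the set of good g were not syndetic, some invariant mean m would vanish on it.

Since at least one of r, s, r + s is even, 2G has finite index, so g may be restricted to 2h. After a
translation the correlation at 2h is the integral of f(x - ah) f(x + bh) f(x - bh) f(x + ah) with
a = r + s and b = r - s, that is, the inner product of D(h) and D(-h) up to conjugation, where
D(h) = f(. - ah) f(. + bh).

Van der Corput's inequality for m reduces f to its projection onto the span of the vectors v that are
eigenvectors modulo characters: for h in a Bohr neighbourhood of 0, the shift of v by h is nearly a
character times v, up to a unimodular constant. A product of two shifted vectors of this kind either is
asymptotically constant up to phase along Bohr neighbourhoods, in which case the phases at h and -h
agree, or all its correlations of the above kind have zero m-average against every character. So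
averaging the correlation against a positive trigonometric polynomial concentrated near 0 gives nearly
the squared norm of D(h), hence at least the square of its integral, which is nearly L(1_E)^4. As m
vanishes on the good set, the same average is at most d*(E)^4 - eps, a contradiction.
\<close>

section \<open>Integer multiples\<close>

text \<open>Two obstacles shape the argument. The span of the eigenvectors modulo characters
  contains functions without a common sup bound, so a projection of f onto it need not be bounded,
  while a fourfold product is not controlled by L2 norms alone. Hence no projection is formed: f is
  exchanged in one factor at a time for a member of a minimising sequence, and the order of the
  exchanges keeps enough sup bounds alive. Secondly, extreme points of compact convex sets stand in
  for spectral measures: they supply the ergodic means and also the characters, and the mean of a
  positive definite function is an infimum of finite quadratic averages, whatever the invariant
  mean. The eigenvectors arise as limits of vectors of almost minimal norm in convex hulls of
  twisted translates. The exponent 4 comes from Cauchy-Schwarz applied to D(h), whose integral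
  averages to at least L(1_E)^2; the weights have nonnegative Fourier coefficients so that this
  lower bound for a positive definite correlation survives the weighting.\<close>

abbreviation (input) cx :: "real => complex" where "cx \<equiv> of_real"

lemma zsmul_0 [simp]: "zsmul 0 g = 0"
 by (simp add: zsmul_def)

lemma zsmul_succ: "zsmul (k + 1) g = zsmul k g + g"
proof (cases "0 <= k")
 case True
 then have "nat (k + 1) = Suc (nat k)" by simp
 with True show ?thesis by (simp add: zsmul_def add.commute)
next
 case False
 show ?thesis
 proof (cases "k = -1")
  case True
  then show ?thesis by (simp add: zsmul_def)
 next
  case k: False
  with False have "nat (- k) = Suc (nat (- (k + 1)))" "~ 0 <= k + 1" by simp_all
  with False show ?thesis by (simp add: zsmul_def algebra_simps)
 qed
qed

lemma zsmul_pred: "zsmul (k - 1) g = zsmul k g - g"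
 using zsmul_succ[of "k - 1" g] by simp

lemma zsmul_1 [simp]: "zsmul 1 g = g"
 using zsmul_succ[of 0 g] by simp

lemma zsmul_add_left: "zsmul (j + k) g = zsmul j g + zsmul k g"
proof (induction k rule: int_induct[where k = 0])
 case (step1 i)
 then show ?case by (simp only: zsmul_succ add.assoc[symmetric])
next
 case (step2 i)
 then show ?case by (simp only: zsmul_pred add_diff_eq)
qed simp

lemma zsmul_minus_left: "zsmul (- k) g = - zsmul k g"
 using zsmul_add_left[of k "- k" g] by (simp add: eq_neg_iff_add_eq_0 add.commute)

lemma zsmul_diff_left: "zsmul (j - k) g = zsmul j g - zsmul k g"
 using zsmul_add_left[of j "- k" g] by (simp add: zsmul_minus_left)

lemma zsmul_add_right: "zsmul k (g + h) = zsmul k g + zsmul k h"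
proof (induction k rule: int_induct[where k = 0])
 case (step1 i)
 then show ?case unfolding zsmul_succ by (simp add: algebra_simps)
next
 case (step2 i)
 then show ?case unfolding zsmul_pred by (simp add: algebra_simps)
qed simp

lemma zsmul_0_right [simp]: "zsmul k 0 = 0"
 using zsmul_add_right[of k 0 0] by simp

lemma zsmul_minus_right: "zsmul k (- g) = - zsmul k g"
 using zsmul_add_right[of k g "- g"] by (simp add: eq_neg_iff_add_eq_0 add.commute)

lemma zsmul_diff_right: "zsmul k (g - h) = zsmul k g - zsmul k h"
 using zsmul_add_right[of k g "- h"] by (simp add: zsmul_minus_right)

lemma zsmul_mult: "zsmul (j * k) g = zsmul j (zsmul k g)"
proof (induction j rule: int_induct[where k = 0])
 case (step1 i)
 then show ?case unfolding zsmul_succ distrib_right by (simp add: zsmul_add_left)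
next
 case (step2 i)
 then show ?case unfolding zsmul_pred left_diff_distrib by (simp add: zsmul_diff_left)
qed simp

text \<open>The \<open>itself\<close> argument names the group, which the integer alone does not
  determine. Coset representatives are the form in which finite index is used below.\<close>

definition fin_idx :: "int => 'a::ab_group_add itself => bool" where
 "fin_idx p _ \<longleftrightarrow> (EX R::'a set. finite R & (ALL g. EX c:R. EX h. g = c + zsmul p h))"

lemma finite_index_fin_idx:
 assumes "finite_index (mult_subgroup p :: 'a::ab_group_add set)"
 shows "fin_idx p TYPE('a)"
proof -
 let ?c = "%g::'a. (+) g ` mult_subgroup p"
 from assms have "finite (range ?c)" by (simp add: finite_index_def)
 then obtain R where R: "finite R" "range ?c = ?c ` R"
  by (metis finite_subset_image subset_UNIV order_refl)
 have "EX c:R. EX h. g = c + zsmul p h" for g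
 proof -
  have "?c g : ?c ` R" using R(2) by blast
  then obtain c where c: "c : R" "?c g = ?c c" by blast
  have "zsmul p 0 : (mult_subgroup p :: 'a set)" unfolding mult_subgroup_def by (rule rangeI)
  then have "g + zsmul p 0 : ?c g" by (rule imageI)
  then have "g : ?c g" by simp
  with c(2) obtain h where "g = c + zsmul p h" by (auto simp: mult_subgroup_def)
  with c(1) show ?thesis by blast
 qed
 with R(1) show ?thesis unfolding fin_idx_def by blast
qed

lemma fin_idx_mult:
 assumes "fin_idx p TYPE('a::ab_group_add)" "fin_idx q TYPE('a)"
 shows "fin_idx (p * q) TYPE('a)"
proof -
 from assms obtain R S :: "'a set" where R: "finite R" "!!g. EX c:R. EX h. g = c + zsmul p h"
  and S: "finite S" "!!g. EX c:S. EX h. g = c + zsmul q h"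
  unfolding fin_idx_def by blast
 let ?T = "(%(c, d). c + zsmul p d) ` (R \<times> S)"
 have "EX c:?T. EX h. g = c + zsmul (p * q) h" for g
 proof -
  from R(2) obtain c h where c: "c : R" "g = c + zsmul p h" by blast
  from S(2) obtain d k where d: "d : S" "h = d + zsmul q k" by blast
  have "g = (c + zsmul p d) + zsmul (p * q) k"
   using c d by (simp add: zsmul_add_right zsmul_mult algebra_simps)
  with c(1) d(1) show ?thesis by force
 qed
 with R(1) S(1) show ?thesis unfolding fin_idx_def by (intro exI[of _ ?T]) auto
qed

lemma fin_idx_dvd:
 assumes "fin_idx p TYPE('a::ab_group_add)" "q dvd p"
 shows "fin_idx q TYPE('a)"
proof -
 from assms(2) obtain k where k: "p = q * k" by blast
 from assms(1) obtain R :: "'a set" where R: "finite R" "!!g. EX c:R. EX h. g = c + zsmul p h"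
  unfolding fin_idx_def by blast
 have "EX c:R. EX h. g = c + zsmul q h" for g
 proof -
  from R(2) obtain c h where "c : R" "g = c + zsmul p h" by blast
  then have "c : R" "g = c + zsmul q (zsmul k h)" by (simp_all add: k zsmul_mult)
  then show ?thesis by blast
 qed
 with R(1) show ?thesis unfolding fin_idx_def by blast
qed

lemma fin_idx_minus:
 assumes "fin_idx p TYPE('a::ab_group_add)"
 shows "fin_idx (- p) TYPE('a)"
 using assms by (rule fin_idx_dvd) simp

section \<open>Extreme points of compact sets of functions\<close>

definition face :: "('i => 'b::real_vector) set => ('i => 'b) set => bool" where
 "face C F \<longleftrightarrow> (ALL x:F. ALL y:C. ALL z:C. ALL t. 0 < t & t < 1 &
   x = (%i. t *\<^sub>R y i + (1 - t) *\<^sub>R z i) --> y : F & z : F)"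

text \<open>Krein-Milman argument: a minimal closed face inside \<open>F0\<close> is a single point,
  because the maximisers of a coordinate functional over it form a smaller closed face unless the
  functional is constant there. Starting from \<open>F0\<close> rather than \<open>C\<close> later
  places the extreme point among the maximisers of a given functional.\<close>

lemma exists_extreme_point:
 fixes C F0 :: "('i => 'b::euclidean_space) set"
 assumes C: "compact C" "closed F0" "F0 <= C" "F0 ~= {}" "face C F0"
 obtains x where "x : F0"
  "!!y z t. y : C ==> z : C ==> 0 < t ==> t < 1 ==>
    x = (%i. t *\<^sub>R y i + (1 - t) *\<^sub>R z i) ==> y = x & z = x"
proof -
 define \<FF> where "\<FF> = {F. closed F & F <= F0 & F ~= {} & face C F}"
 \<comment> \<open>Complements turn the search for a minimal face into one for a maximal set, so
   that Zorn's lemma for inclusion applies.\<close>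
 have "EX M:uminus ` \<FF>. ALL X:uminus ` \<FF>. M <= X --> X = M"
 proof (rule subset_Zorn)
  fix \<C> assume ch: "subset.chain (uminus ` \<FF>) \<C>"
  define \<D> where "\<D> = uminus ` \<C>"
  have sub: "\<D> <= \<FF>" using ch unfolding \<D>_def subset.chain_def by auto
  have lin: "X <= Y | Y <= X" if "X : \<D>" "Y : \<D>" for X Y
  proof -
   from that have "- X : \<C>" "- Y : \<C>" unfolding \<D>_def by auto
   then have "- X <= - Y | - Y <= - X" using ch unfolding subset.chain_def by blast
   then show ?thesis by blast
  qed
  show "EX U:uminus ` \<FF>. ALL X:\<C>. X <= U"
  proof (cases "\<C> = {}")
   case True
   have "F0 : \<FF>" unfolding \<FF>_def using C by blast
   with True show ?thesis by blast
  next
   case False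
   then have ne: "\<D> ~= {}" unfolding \<D>_def by blast
   have fin: "F' ~= {} --> \<Inter>F' \<in> \<D>" if "finite F'" "F' <= \<D>" for F'
    using that
   proof (induction F')
    case (insert X F')
    then show ?case
    proof (cases "F' = {}")
     case False
     with insert have i: "\<Inter>F' \<in> \<D>" "X : \<D>" by auto
     from lin[OF this] have "X \<inter> \<Inter>F' = X | X \<inter> \<Inter>F' = \<Inter>F'" by blast
     with i show ?thesis by auto
    qed auto
   qed auto
   \<comment> \<open>Compactness keeps the intersection of a chain of faces nonempty: every finite
     subfamily has its intersection in the chain itself.\<close>
   have "C \<inter> \<Inter>\<D> ~= {}"
   proof (rule compact_imp_fip[OF C(1)])
    show "closed T" if "T : \<D>" for T using sub that unfolding \<FF>_def by blast
    show "C \<inter> \<Inter>F' ~= {}" if "finite F'" "F' <= \<D>" for F'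
    proof (cases "F' = {}")
     case True
     then show ?thesis using C(3,4) by auto
    next
     case False
     with fin[OF that] have "\<Inter>F' \<in> \<FF>" using sub by blast
     then show ?thesis unfolding \<FF>_def using C(3) by blast
    qed
   qed
   then have nonemp: "\<Inter>\<D> ~= {}" by blast
   have "\<Inter>\<D> \<in> \<FF>"
   proof -
    have "closed (\<Inter>\<D>)" using sub unfolding \<FF>_def by (intro closed_Inter) blast
    moreover have "\<Inter>\<D> <= F0" using ne sub unfolding \<FF>_def by blast
    moreover have "face C (\<Inter>\<D>)"
     unfolding face_def
    proof (intro ballI allI impI)
     fix x y z t assume h: "x : \<Inter>\<D>" "y \<in> C" "z : C"
      "0 < t & t < 1 & x = (%i. t *\<^sub>R y i + (1 - t) *\<^sub>R z i)"
     have "y : F & z : F" if "F : \<D>" for F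
     proof -
      have "face C F" "x : F" using that sub h(1) unfolding \<FF>_def by auto
      then show ?thesis using h(2-) unfolding face_def by blast
     qed
     then show "y : \<Inter>\<D> & z \<in> \<Inter>\<D>" by blast
    qed
    ultimately show ?thesis unfolding \<FF>_def using nonemp by blast
   qed
   moreover have "X <= - \<Inter>\<D>" if "X \<in> \<C>" for X using that unfolding \<D>_def by blast
   ultimately show ?thesis by blast
  qed
 qed
 then obtain M' where M': "M' : uminus ` \<FF>" and mx: "ALL X:uminus ` \<FF>. M' <= X --> X = M'"
  by (rule bexE)
 have max: "X = M'" if "X : uminus ` \<FF>" "M' <= X" for X
  by (rule mp[OF bspec[OF mx that(1)] that(2)])
 from M' obtain M where M: "M : \<FF>" "M' = - M" by (rule imageE) simp
 have min: "F = M" if "F : \<FF>" "F <= M" for F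
 proof -
  have "- F = M'" using that M(2) by (intro max) auto
  then show ?thesis using M(2) by simp
 qed
 have Mp: "closed M" "M <= F0" "M ~= {}" "face C M" using M unfolding \<FF>_def by auto
 have MC: "M <= C" using Mp C by blast
 have cM: "compact M" using C(1) Mp(1) MC by (metis compact_Int_closed inf.absorb2)
 have single: "x = y" if "x : M" "y : M" for x y
 proof (rule ccontr)
  assume "x ~= y"
  then obtain i where "x i ~= y i" by blast
  then obtain b where b: "b : Basis" "x i \<bullet> b ~= y i \<bullet> b" by (metis euclidean_eqI)
  define ph where "ph z = z i \<bullet> b" for z :: "'i => 'b"
  have cont: "continuous_on UNIV ph" unfolding ph_def
   by (intro continuous_on_inner continuous_on_const continuous_on_product_coordinates)
  obtain z0 where z0: "z0 : M" "!!z. z : M ==> ph z <= ph z0"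
   using continuous_attains_sup[OF cM Mp(3) continuous_on_subset[OF cont]] by auto
  define F where "F = {z : M. ph z = ph z0}"
  have "F = M \<inter> ph -` {ph z0}" unfolding F_def by auto
  moreover have "closed (ph -` {ph z0})"
   using cont by (intro closed_vimage) auto
  ultimately have clF: "closed F" using Mp(1) by auto
  have "face C F"
   unfolding face_def
  proof (intro ballI allI impI)
   fix w u v t assume h: "w : F" "u : C" "v : C"
    "0 < t & t < 1 & w = (%i. t *\<^sub>R u i + (1 - t) *\<^sub>R v i)"
   have uv: "u : M" "v : M" using Mp(4) h unfolding face_def F_def by blast+
   have eq: "ph z0 = t * ph u + (1 - t) * ph v"
    using h unfolding F_def ph_def by (auto simp: inner_add_left)
   have le: "ph u <= ph z0" "ph v <= ph z0" using z0(2) uv by auto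
   have t: "0 < t" "0 < 1 - t" using h by auto
   have "ph u = ph z0"
   proof (rule ccontr)
    assume "ph u ~= ph z0"
    with le have "ph u < ph z0" by simp
    then have "t * ph u + (1 - t) * ph v < t * ph z0 + (1 - t) * ph z0"
     using le t by (intro add_less_le_mono mult_strict_left_mono mult_left_mono) auto
    with eq show False by (simp add: algebra_simps)
   qed
   moreover have "ph v = ph z0"
   proof (rule ccontr)
    assume "ph v ~= ph z0"
    with le have "ph v < ph z0" by simp
    then have "t * ph u + (1 - t) * ph v < t * ph z0 + (1 - t) * ph z0"
     using le t by (intro add_le_less_mono mult_strict_left_mono mult_left_mono) auto
    with eq show False by (simp add: algebra_simps)
   qed
   ultimately show "u : F & v : F" using uv unfolding F_def by auto
  qed
  then have "F : \<FF>" unfolding \<FF>_def using clF Mp(2) z0(1) F_def by auto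
  then have "F = M" using min[of F] unfolding F_def by blast
  then have "x : F" "y : F" using that by simp_all
  then have "ph x = ph y" unfolding F_def by simp
  then show False using b(2) unfolding ph_def by simp
 qed
 obtain x where x: "x : M" using Mp(3) by blast
 show ?thesis
 proof (rule that[of x])
  show "x : F0" using x Mp(2) by blast
  fix y z t assume h: "y : C" "z : C" "0 < t" "t < 1" "x = (%i. t *\<^sub>R y i + (1 - t) *\<^sub>R z i)"
  then have "y : M" "z : M" using Mp(4) x unfolding face_def by blast+
  then show "y = x & z = x" using single x by blast
 qed
qed

text \<open>Tychonoff's theorem for the pointwise topology on functions.\<close>

lemma compact_Pi_UNIV:
 fixes K :: "'i => 'b::topological_space set"
 assumes "!!i. compact (K i)"
 shows "compact {f. ALL i. f i : K i}"
proof -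
 have "compactin (product_topology (%i. euclidean) UNIV) (PiE UNIV K)"
  unfolding compactin_PiE using assms by simp
 then show ?thesis
  by (simp add: euclidean_product_topology PiE_UNIV_domain Pi_def)
qed

section \<open>Invariant means\<close>

definition bdd :: "('x => 'b::real_normed_vector) => bool" where
 "bdd f \<longleftrightarrow> (EX B. ALL x. norm (f x) <= B)"

named_theorems bdd_intros

lemma bddI: "(!!x. norm (f x) <= B) ==> bdd f"
 unfolding bdd_def by blast

lemma bddE:
 assumes "bdd f"
 obtains B where "0 <= B" "!!x. norm (f x) <= B"
 using assms unfolding bdd_def by (meson norm_ge_zero order_trans)

lemma bdd_const [bdd_intros]: "bdd (%x. c)"
 by (rule bddI[of _ "norm c"]) simp

lemma bdd_add [bdd_intros]: assumes "bdd f" "bdd g" shows "bdd (%x. f x + g x)"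
proof -
 obtain A B where "!!x. norm (f x) <= A" "!!x. norm (g x) <= B" using assms by (meson bddE)
 then show ?thesis by (intro bddI[of _ "A + B"] norm_triangle_le add_mono)
qed

lemma bdd_minus [bdd_intros]: assumes "bdd f" shows "bdd (%x. - f x)"
 using assms unfolding bdd_def by simp

lemma bdd_diff [bdd_intros]: assumes "bdd f" "bdd g" shows "bdd (%x. f x - g x)"
 using bdd_add[OF assms(1) bdd_minus[OF assms(2)]] by simp

lemma bdd_mult [bdd_intros]:
 fixes f g :: "'x => 'b::real_normed_algebra"
 assumes "bdd f" "bdd g" shows "bdd (%x. f x * g x)"
proof -
 obtain A B where AB: "0 <= A" "!!x. norm (f x) <= A" "0 <= B" "!!x. norm (g x) <= B" using assms by (meson bddE)
 have "norm (f x * g x) <= A * B" for x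
  using norm_mult_ineq[of "f x" "g x"] mult_mono[OF AB(2)[of x] AB(4)[of x]] AB(1,3) by fastforce
 then show ?thesis by (rule bddI)
qed

lemma bdd_power [bdd_intros]:
 fixes f :: "'x => 'b::real_normed_algebra_1"
 assumes "bdd f" shows "bdd (%x. f x ^ n)"
 by (induction n) (auto intro!: bdd_intros assms)

lemma bdd_compose: "bdd f ==> bdd (%x. f (h x))"
 unfolding bdd_def by blast

lemma bdd_norm [bdd_intros]: "bdd f ==> bdd (%x. norm (f x))"
 unfolding bdd_def by simp

lemma bdd_Re [bdd_intros]: "bdd f ==> bdd (%x. Re (f x))"
 unfolding bdd_def using abs_Re_le_cmod order_trans by (metis real_norm_def)

lemma bdd_Im [bdd_intros]: "bdd f ==> bdd (%x. Im (f x))"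
 unfolding bdd_def using abs_Im_le_cmod order_trans by (metis real_norm_def)

lemma bdd_cnj [bdd_intros]: "bdd f ==> bdd (%x. cnj (f x))"
 unfolding bdd_def by simp

lemma bdd_sum [bdd_intros]: "(!!i. i : I ==> bdd (f i)) ==> bdd (%x. \<Sum>i\<in>I. f i x)"
 by (induction I rule: infinite_finite_induct) (auto intro!: bdd_intros)

lemma bdd_indicator: "bdd (%x. indicat_real S (h x))"
 by (rule bddI[of _ 1]) (simp add: indicator_def)

lemma bdd_indicator' [bdd_intros]: "bdd (indicat_real S)"
 by (rule bddI[of _ 1]) (simp add: indicator_def)

text \<open>Unbounded functions are sent to 0, so that a mean is determined by its values on bounded
  functions. Equality of means is then equality of functions, and the set of means is compact in a
  full product space.\<close>

definition inv_mean :: "(('a::ab_group_add => real) => real) => bool" where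
 "inv_mean m \<longleftrightarrow> (ALL f. ~ bdd f --> m f = 0) &
   (ALL f g. bdd f --> bdd g --> m (%x. f x + g x) = m f + m g) &
   (ALL f c. bdd f --> m (%x. c * f x) = c * m f) &
   (ALL f. bdd f --> (ALL x. 0 <= f x) --> 0 <= m f) & m (%x. 1) = 1 &
   (ALL f g. bdd f --> m (%x. f (x + g)) = m f)"

locale imean =
 fixes m :: "('a::ab_group_add => real) => real"
 assumes im: "inv_mean m"
begin

lemma m_unbdd: "~ bdd f ==> m f = 0" using im by (simp add: inv_mean_def)
lemma m_add: "bdd f ==> bdd g ==> m (%x. f x + g x) = m f + m g" using im by (simp add: inv_mean_def)
lemma m_scale: "bdd f ==> m (%x. c * f x) = c * m f" using im by (simp add: inv_mean_def)
lemma m_nonneg: "bdd f ==> (!!x. 0 <= f x) ==> 0 <= m f" using im by (simp add: inv_mean_def)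
lemma m_const1: "m (%x. 1) = 1" using im by (simp add: inv_mean_def)
lemma m_shift: "bdd f ==> m (%x. f (x + g)) = m f" using im by (simp add: inv_mean_def)

lemma m_const [simp]: "m (%x. c) = c"
 using m_scale[of "%x. 1" c] m_const1 by (simp add: bdd_const)

lemma m_minus: "bdd f ==> m (%x. - f x) = - m f"
 using m_scale[of f "-1"] by simp

lemma m_diff: "bdd f ==> bdd g ==> m (%x. f x - g x) = m f - m g"
 using m_add[of f "%x. - g x"] m_minus[of g] bdd_minus[of g] by simp

lemma m_mono: assumes "bdd f" "bdd g" "!!x. f x <= g x" shows "m f <= m g"
 using m_nonneg[of "%x. g x - f x"] assms by (simp add: m_diff bdd_diff)

lemma m_le: "bdd f ==> (!!x. f x <= c) ==> m f <= c"
 using m_mono[of f "%x. c"] by (simp add: bdd_const)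

lemma m_ge: "bdd f ==> (!!x. c <= f x) ==> c <= m f"
 using m_mono[of "%x. c" f] by (simp add: bdd_const)

lemma m_sum: "(!!i. i : I ==> bdd (f i)) ==> m (%x. \<Sum>i\<in>I. f i x) = (\<Sum>i\<in>I. m (f i))"
 by (induction I rule: infinite_finite_induct) (auto simp: m_add bdd_sum)

text \<open>The variance of \<open>f\<close> under the mean is nonnegative.\<close>

lemma m_sq: assumes "bdd f" shows "(m f)^2 <= m (%x. (f x)^2)"
proof -
 have "0 <= m (%x. (f x - m f)^2)" by (rule m_nonneg) (auto intro!: bdd_intros assms)
 also have "(%x. (f x - m f)^2) = (%x. ((f x)^2 + (- 2 * m f) * f x) + (m f)^2)"
  by (auto simp: power2_eq_square algebra_simps)
 also have "m ... = m (%x. (f x)^2) + (- 2 * m f) * m f + (m f)^2"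
  by (subst m_add m_scale | intro bdd_intros assms)+ simp
 finally show ?thesis by (simp add: power2_eq_square)
qed

text \<open>Finitely additive, translation invariant probability attached to the mean.\<close>

definition msr :: "'a set => real" where "msr S = m (indicat_real S)"

lemma msr_mono: "S <= T ==> msr S <= msr T"
 unfolding msr_def by (intro m_mono bdd_indicator') (auto simp: indicator_def)

lemma msr_nonneg: "0 <= msr S"
 unfolding msr_def by (intro m_nonneg bdd_indicator') simp

lemma msr_UNIV [simp]: "msr UNIV = 1"
 unfolding msr_def indicator_def by (simp add: m_const1)

lemma msr_empty [simp]: "msr {} = 0"
 using m_const[of 0] unfolding msr_def indicator_def by simp

lemma msr_Un: "msr (S \<union> T) <= msr S + msr T"
proof -
 have "msr (S \<union> T) <= m (%x. indicat_real S x + indicat_real T x)"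
  unfolding msr_def by (intro m_mono bdd_intros) (auto simp: indicator_def)
 then show ?thesis by (simp add: msr_def m_add bdd_indicator')
qed

lemma msr_UN: "finite I ==> msr (\<Union>i\<in>I. S i) <= (\<Sum>i\<in>I. msr (S i))"
proof (induction I rule: finite_induct)
 case (insert i I)
 then show ?case using msr_Un[of "S i" "\<Union>i\<in>I. S i"] by simp
qed simp

lemma msr_pigeonhole:
 assumes "finite I" "S <= (\<Union>i\<in>I. T i)" "0 < msr S"
 shows "EX i:I. 0 < msr (T i)"
proof (rule ccontr)
 assume "~ ?thesis"
 then have "msr (T i) = 0" if "i : I" for i using that msr_nonneg[of "T i"] by force
 then have "(\<Sum>i\<in>I. msr (T i)) = 0" by simp
 then show False using msr_UN[OF assms(1), of T] msr_mono[OF assms(2)] assms(3) by simp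
qed

lemma msr_shift: "msr {x. x + g : S} = msr S"
proof -
 have "indicat_real {x. x + g : S} = (%x. indicat_real S (x + g))" by (auto simp: indicator_def)
 then show ?thesis unfolding msr_def by (simp add: m_shift bdd_indicator')
qed

lemma msr_pos_nonempty: "0 < msr S ==> EX x. x : S"
 by (metis all_not_in_conv less_irrefl msr_empty)

lemma msr_diff_null: "msr N = 0 ==> msr (S - N) = msr S"
 using msr_Un[of "S - N" N] msr_mono[of S "S - N \<union> N"] msr_mono[of "S - N" S] by fastforce

definition cm :: "('a => complex) => complex" where
 "cm f = Complex (m (%x. Re (f x))) (m (%x. Im (f x)))"

lemma Re_cm: "Re (cm f) = m (%x. Re (f x))" and Im_cm: "Im (cm f) = m (%x. Im (f x))"
 by (simp_all add: cm_def)

lemma cm_add: "bdd f ==> bdd g ==> cm (%x. f x + g x) = cm f + cm g"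
 by (simp add: complex_eq_iff Re_cm Im_cm m_add bdd_intros)

lemma cm_scale: assumes "bdd f" shows "cm (%x. c * f x) = c * cm f"
proof -
 have "m (%x. Re c * Re (f x) - Im c * Im (f x)) = Re c * m (%x. Re (f x)) - Im c * m (%x. Im (f x))"
  by (subst m_diff m_scale | intro bdd_intros assms)+ simp
 moreover have "m (%x. Re c * Im (f x) + Im c * Re (f x)) = Re c * m (%x. Im (f x)) + Im c * m (%x. Re (f x))"
  by (subst m_add m_scale | intro bdd_intros assms)+ simp
 ultimately show ?thesis by (simp add: complex_eq_iff Re_cm Im_cm)
qed

lemma cm_scale_right: assumes "bdd f" shows "cm (%x. f x * c) = cm f * c"
 using cm_scale[OF assms, of c] by (simp add: mult.commute)

lemma cm_const [simp]: "cm (%x. c) = c"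
 by (simp add: complex_eq_iff Re_cm Im_cm)

lemma cm_minus: "bdd f ==> cm (%x. - f x) = - cm f"
 using cm_scale[of f "-1"] by simp

lemma cm_diff: "bdd f ==> bdd g ==> cm (%x. f x - g x) = cm f - cm g"
 using cm_add[of f "%x. - g x"] cm_minus[of g] bdd_minus[of g] by simp

lemma cm_cnj: "bdd f ==> cm (%x. cnj (f x)) = cnj (cm f)"
 by (simp add: complex_eq_iff Re_cm Im_cm m_minus bdd_intros)

lemma cm_of_real: "cm (%x. cx (f x)) = cx (m f)"
 by (simp add: complex_eq_iff Re_cm Im_cm)

lemma cm_shift: "bdd f ==> cm (%x. f (x + g)) = cm f"
 by (simp add: complex_eq_iff Re_cm Im_cm m_shift[of "%x. Re (f x)"] m_shift[of "%x. Im (f x)"] bdd_intros)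

lemma cm_sum: "(!!i. i : I ==> bdd (f i)) ==> cm (%x. \<Sum>i\<in>I. f i x) = (\<Sum>i\<in>I. cm (f i))"
 by (induction I rule: infinite_finite_induct) (auto simp: cm_add bdd_sum)

lemma norm_cm_le: assumes "bdd f" shows "cmod (cm f) <= m (%x. cmod (f x))"
proof (cases "cm f = 0")
 case True
 then show ?thesis by (auto intro!: m_nonneg bdd_intros assms)
next
 case False
 \<comment> \<open>Rotation by \<open>u\<close> makes the mean a nonnegative real, which reduces the
   bound to real parts.\<close>
 define u where "u = cnj (cm f) / cmod (cm f)"
 have u: "cmod u = 1" using False by (simp add: u_def norm_divide)
 have "u * cm f = (cm f * cnj (cm f)) / cmod (cm f)" by (simp add: u_def mult.commute)
 also have "... = (cx (cmod (cm f)))^2 / cmod (cm f)" by (simp flip: complex_norm_square)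
 also have "... = cmod (cm f)" using False by (simp add: power2_eq_square)
 finally have "u * cm f = cmod (cm f)" .
 then have "cmod (cm f) = Re (cm (%x. u * f x))" by (simp add: cm_scale assms)
 also have "... = m (%x. Re (u * f x))" by (rule Re_cm)
 also have "... <= m (%x. cmod (f x))"
 proof (intro m_mono bdd_intros assms)
  show "Re (u * f x) <= cmod (f x)" for x
   using complex_Re_le_cmod[of "u * f x"] by (simp add: norm_mult u)
 qed
 finally show ?thesis .
qed

lemma norm_cm_bound: "bdd f ==> (!!x. cmod (f x) <= c) ==> cmod (cm f) <= c"
 using norm_cm_le[of f] m_le[of "%x. cmod (f x)" c] by (force intro: bdd_intros)

lemma norm_cm_sq: assumes "bdd f" shows "(cmod (cm f))^2 <= m (%x. (cmod (f x))^2)"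
proof -
 have "(cmod (cm f))^2 <= (m (%x. cmod (f x)))^2"
  using norm_cm_le[OF assms] by (intro power_mono) auto
 also have "... <= m (%x. (cmod (f x))^2)" by (intro m_sq bdd_intros assms)
 finally show ?thesis .
qed

end

subsection \<open>Means from Folner sequences\<close>

lemma folner_shift:
 assumes "folner F"
 shows "folner (%N. (+) (y N) ` F N)"
proof -
 have c: "card ((+) y ` A) = card A" for y :: 'a and A by (intro card_image) simp
 have i: "inj ((+) y)" for y :: 'a by simp
 have s: "(((%x. x + g) ` (+) y ` A) - (+) y ` A) \<union> ((+) y ` A - (%x. x + g) ` (+) y ` A)
   = (+) y ` ((((%x. x + g) ` A) - A) \<union> (A - ((%x. x + g) ` A)))" for y g :: 'a and A
 proof -
  have "(%x. x + g) ` (+) y ` A = (+) y ` (%x. x + g) ` A" by (simp add: image_image add.assoc)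
  then show ?thesis by (simp only: image_Un image_set_diff[OF i])
 qed
 show ?thesis using assms unfolding folner_def s c by auto
qed

lemma folner_subseq:
 assumes "folner F" "!!n. n <= r n"
 shows "folner (%N. F (r N))"
proof -
 have "filterlim r at_top sequentially"
  using assms(2) by (intro filterlim_at_top_mono[OF filterlim_ident]) (auto intro: always_eventually)
 then show ?thesis using assms(1) unfolding folner_def by (auto intro: filterlim_compose)
qed

definition avg :: "'a set => ('a => real) => real" where
 "avg A f = (\<Sum>x\<in>A. f x) / real (card A)"

lemma avg_abs_le:
 assumes "finite A" "A ~= {}" "!!x. \<bar>f x\<bar> <= B"
 shows "\<bar>avg A f\<bar> <= B"
proof -
 have "\<bar>\<Sum>x\<in>A. f x\<bar> <= (\<Sum>x\<in>A. B)" by (rule order_trans[OF sum_abs]) (intro sum_mono assms)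
 then show ?thesis using assms by (simp add: avg_def field_simps card_gt_0_iff abs_divide)
qed

text \<open>The mean is a cluster point of the averages along \<open>F\<close> in a compact product
  of intervals, and the Folner condition makes it invariant. Only lower bounds valid for every
  \<open>N\<close> are exported; the sequences used later are chosen so that the desired bound holds
  along all of them.\<close>

lemma mean_of_folner:
 fixes F :: "nat => 'a::ab_group_add set"
 assumes F: "folner F"
 obtains m where "inv_mean m" "!!f c. bdd f ==> (!!N. c <= avg (F N) f) ==> c <= m f"
proof -
 have fin: "finite (F N)" "F N ~= {}" for N using F by (auto simp: folner_def)
 \<comment> \<open>A chosen bound for every bounded function confines all averages to one compact
   box; unbounded functions get the interval consisting of 0.\<close>
 define B where "B f = (if bdd f then SOME B. ALL x. \<bar>f x\<bar> <= B else 0)" for f :: "'a => real"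
 have B: "\<bar>f x\<bar> <= B f" if "bdd f" for f x
 proof -
  have "EX B. ALL x. \<bar>f x\<bar> <= B" using that unfolding bdd_def by simp
  from someI_ex[OF this] show ?thesis using that by (simp add: B_def)
 qed
 define a where "a N f = (if bdd f then avg (F N) f else 0)" for N f
 define K where "K = {m :: ('a => real) => real. ALL f. m f : {- B f..B f}}"
 have "compact K" unfolding K_def by (rule compact_Pi_UNIV) simp
 moreover have "a N : K" for N
 proof -
  have "\<bar>a N f\<bar> <= B f" for f
   using avg_abs_le[OF fin, of f "B f"] B[of f] by (auto simp: a_def B_def)
  then show ?thesis unfolding K_def by (auto simp: abs_le_iff minus_le_iff)
 qed
 ultimately have "EX m:K. inf (nhds m) (filtermap a sequentially) ~= bot"
  unfolding compact_filter by (auto simp: eventually_filtermap filtermap_bot_iff)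
 then obtain m where G: "inf (nhds m) (filtermap a sequentially) ~= bot" by blast
 define G where "G = inf (nhds m) (filtermap a sequentially)"
 have Gn: "G <= nhds m" "G <= filtermap a sequentially" by (simp_all add: G_def)
 have coord: "((%m. m f) \<longlongrightarrow> m f) G" for f
 proof -
  have "((%m. m f) \<longlongrightarrow> m f) (nhds m)"
  proof (rule topological_tendstoI)
   fix U :: "real set" assume U: "open U" "m f : U"
   have "open ((%m. m f) -` U)" using U(1) by (intro open_vimage continuous_on_product_coordinates)
   then show "eventually (%m. m f : U) (nhds m)" using U(2) unfolding eventually_nhds by (intro exI[of _ "(%m. m f) -` U"]) simp
  qed
  then show ?thesis using Gn(1) by (rule tendsto_mono[rotated])
 qed
 have ev: "eventually P G" if "!!N. P (a N)" for P
  using that by (intro filter_leD[OF Gn(2)]) (simp add: eventually_filtermap)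
 \<comment> \<open>A limit of \<open>\<Psi>\<close> along the cluster filter agrees with its limit
   along the averages, so identities valid in the limit pass to \<open>m\<close>.\<close>
 have eqlim: "x = c" if "(\<Psi> \<longlongrightarrow> x) G" "(%N. \<Psi> (a N)) \<longlonglongrightarrow> c" for \<Psi> :: "_ => real" and x c
 proof -
  have "(\<Psi> \<longlongrightarrow> c) (filtermap a sequentially)" using that(2) by (simp add: filterlim_filtermap)
  then have "(\<Psi> \<longlongrightarrow> c) G" using Gn(2) by (rule tendsto_mono[rotated])
  then show ?thesis using that(1) tendsto_unique[OF G[folded G_def]] by blast
 qed
 have const: "x = c" if "(\<Psi> \<longlongrightarrow> x) G" "!!N. \<Psi> (a N) = c" for \<Psi> :: "_ => real" and x c
  using eqlim[OF that(1), of c] that(2) by simp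
 have avg_add: "avg A (%x. f x + g x) = avg A f + avg A g" for A and f g :: "'a => real"
  by (simp add: avg_def sum.distrib add_divide_distrib)
 have lower: "c <= m f" if "bdd f" "!!N. c <= avg (F N) f" for f c
  by (rule tendsto_lowerbound[OF coord _ G[folded G_def]]) (rule ev, use that in \<open>simp add: a_def\<close>)
 have "inv_mean m"
  unfolding inv_mean_def
 proof (intro conjI allI impI)
  show "m f = 0" if "~ bdd f" for f
   by (rule const[OF coord]) (use that in \<open>simp add: a_def\<close>)
  show "m (%x. f x + g x) = m f + m g" if "bdd f" "bdd g" for f g
  proof -
   have "m (%x. f x + g x) - m f - m g = 0"
    by (rule const[where \<Psi> = "%m. m (%x. f x + g x) - m f - m g"])
     (intro tendsto_intros coord, use that in \<open>simp add: a_def avg_add bdd_add\<close>)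
   then show ?thesis by simp
  qed
  show "m (%x. c * f x) = c * m f" if "bdd f" for f c
  proof -
   have b: "bdd (%x. c * f x)" using that by (intro bdd_intros)
   have "m (%x. c * f x) - c * m f = 0"
    by (rule const[where \<Psi> = "%m. m (%x. c * f x) - c * m f"])
     (intro tendsto_intros coord, use that b in \<open>simp add: a_def avg_def sum_distrib_left\<close>)
   then show ?thesis by simp
  qed
  show "0 <= m f" if "bdd f" "ALL x. 0 <= f x" for f
   by (rule lower) (use that in \<open>auto simp: avg_def intro!: divide_nonneg_nonneg sum_nonneg\<close>)
  show "m (%x. 1) = 1"
   by (rule const[OF coord]) (use fin in \<open>simp add: a_def avg_def bdd_const\<close>)
  show "m (%x. f (x + g)) = m f" if "bdd f" for f g
  proof -
   have b: "bdd (%x. f (x + g))" using that by (rule bdd_compose)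
   let ?D = "%N. (((%x. x + g) ` F N) - F N) \<union> (F N - ((%x. x + g) ` F N))"
   \<comment> \<open>Shifting the function moves the averaging set; what does not cancel lives on
     the symmetric difference.\<close>
   have le: "\<bar>a N (%x. f (x + g)) - a N f\<bar> <= B f * (real (card (?D N)) / real (card (F N)))" for N
   proof -
    let ?A = "(%x. x + g) ` F N"
    have "(\<Sum>x\<in>F N. f (x + g)) = (\<Sum>x\<in>?A. f x)" by (subst sum.reindex) auto
    also have "... - (\<Sum>x\<in>F N. f x) = (\<Sum>x\<in>?A - F N. f x) - (\<Sum>x\<in>F N - ?A. f x)"
     using sum.Int_Diff[of ?A f "F N"] sum.Int_Diff[of "F N" f ?A] fin by (simp add: Int_commute)
    finally have "\<bar>(\<Sum>x\<in>F N. f (x + g)) - (\<Sum>x\<in>F N. f x)\<bar> <= (\<Sum>x\<in>?A - F N. \<bar>f x\<bar>) + (\<Sum>x\<in>F N - ?A. \<bar>f x\<bar>)"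
     using sum_abs[of f "?A - F N"] sum_abs[of f "F N - ?A"] by linarith
    also have "... = (\<Sum>x\<in>?D N. \<bar>f x\<bar>)" using fin by (subst sum.union_disjoint) auto
    also have "... <= (\<Sum>x\<in>?D N. B f)" by (intro sum_mono B that)
    finally have "\<bar>(\<Sum>x\<in>F N. f (x + g)) - (\<Sum>x\<in>F N. f x)\<bar> <= B f * real (card (?D N))" by (simp add: mult.commute)
    then show ?thesis using that b
     by (simp add: a_def avg_def diff_divide_distrib[symmetric] abs_divide divide_right_mono)
   qed
   have "(%N. real (card (?D N)) / real (card (F N))) \<longlonglongrightarrow> 0"
    using F unfolding folner_def by blast
   then have lim0: "(%N. B f * (real (card (?D N)) / real (card (F N)))) \<longlonglongrightarrow> 0"
    by (rule tendsto_mult_right_zero)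
   have "(%N. a N (%x. f (x + g)) - a N f) \<longlonglongrightarrow> 0"
    by (rule Lim_null_comparison[OF _ lim0]) (rule always_eventually, rule allI, unfold real_norm_def, rule le)
   then have "m (%x. f (x + g)) - m f = 0"
    by (intro eqlim[where \<Psi> = "%m. m (%x. f (x + g)) - m f"] tendsto_intros coord)
   then show ?thesis by simp
  qed
 qed
 with lower show ?thesis using that by blast
qed

lemma avg_indicator:
 assumes "finite A" shows "avg A (indicat_real D) = real (card (D \<inter> A)) / real (card A)"
 using assms by (simp add: avg_def indicator_def sum.If_cases Int_commute)

text \<open>Averaging the translates of \<open>D\<close> over \<open>F N\<close> leaves the mean
  unchanged, so some translate of \<open>F N\<close> meets \<open>D\<close> with density at least
  the mean. These translates again form a Folner sequence, whatever the choice of the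
  translations.\<close>

lemma mean_le_density:
 fixes D :: "'a::ab_group_add set"
 assumes "inv_mean m" and F: "folner (F :: nat => 'a set)"
 shows "m (indicat_real D) <= upper_banach_density D"
proof -
 interpret imean m by unfold_locales fact
 have fin: "finite (F N)" "F N ~= {}" for N using F by (auto simp: folner_def)
 have "EX y. m (indicat_real D) <= real (card (D \<inter> (+) y ` F N)) / real (card (F N))" for N
 proof -
  \<comment> \<open>The counts are bounded by the cardinality of \<open>F N\<close>, so a translate
    with maximal count exists.\<close>
  let ?c = "%y. card (D \<inter> (+) y ` F N)"
  have cb: "?c y <= card (F N)" for y
   by (metis card_image_le card_mono fin(1) finite_imageI inf_le2 order_trans)
  then have fr: "finite (range ?c)" by (intro finite_subset[of "range ?c" "{..card (F N)}"]) auto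
  then have "Max (range ?c) : range ?c" by (rule Max_in) simp
  then obtain y where "Max (range ?c) = ?c y" by (rule imageE)
  then have y: "?c z <= ?c y" for z using Max_ge[OF fr rangeI[of ?c z]] by simp
  have eq: "(\<Sum>k\<in>F N. indicat_real D (z + k)) = real (?c z)" for z
  proof -
   have "(\<Sum>k\<in>F N. indicat_real D (z + k)) = (\<Sum>k\<in>(+) z ` F N. indicat_real D k)"
    by (subst sum.reindex) auto
   also have "... = real (?c z)" using fin by (simp add: indicator_def sum.If_cases Int_commute)
   finally show ?thesis .
  qed
  have "real (card (F N)) * m (indicat_real D) = (\<Sum>k\<in>F N. m (%z. indicat_real D (z + k)))"
   by (simp add: m_shift bdd_indicator')
  also have "... = m (%z. \<Sum>k\<in>F N. indicat_real D (z + k))" by (rule m_sum[symmetric]) (intro bdd_indicator)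
  also have "... <= real (?c y)"
   by (rule m_le) (intro bdd_intros bdd_indicator, use eq y in simp)
  finally show ?thesis using fin by (intro exI[of _ y]) (simp add: field_simps card_gt_0_iff)
 qed
 then obtain y where y: "!!N. m (indicat_real D) <= real (card (D \<inter> (+) (y N) ` F N)) / real (card (F N))"
  by metis
 define F' where "F' N = (+) (y N) ` F N" for N
 have F': "folner F'" unfolding F'_def using folner_shift[OF F] .
 have c: "card (F' N) = card (F N)" for N unfolding F'_def by (intro card_image) simp
 let ?L = "%F. limsup (%N. ereal (real (card (D \<inter> F N)) / real (card (F N))))"
 let ?S = "SUP F \<in> {F. folner F}. ?L F"
 have "ereal (m (indicat_real D)) <= ?L F'"
 proof -
  have "!!N. ereal (m (indicat_real D)) <= ereal (real (card (D \<inter> F' N)) / real (card (F' N)))"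
   using y by (simp add: c) (simp add: F'_def)
  then show ?thesis by (intro le_Limsup always_eventually allI) auto
 qed
 also have "... <= ?S" using F' by (intro SUP_upper) auto
 finally have lo: "ereal (m (indicat_real D)) <= ?S" .
 \<comment> \<open>The supremum is finite, so \<open>real_of_ereal\<close> returns its true value
   and not the default at infinity.\<close>
 have "?S <= 1"
 proof (rule SUP_least)
  fix F :: "nat => 'a set" assume "F : {F. folner F}"
  then have "finite (F N)" for N by (auto simp: folner_def)
  then have "real (card (D \<inter> F N)) / real (card (F N)) <= 1" for N
   by (auto intro!: divide_le_eq_1[THEN iffD2] card_mono simp: card_gt_0_iff)
  then show "?L F <= 1" by (intro Limsup_bounded always_eventually allI) (auto simp: one_ereal_def)
 qed
 with lo obtain x where x: "?S = ereal x" by (cases ?S) auto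
 with lo show ?thesis unfolding upper_banach_density_def x by simp
qed

text \<open>A limsup bound becomes a bound for every \<open>N\<close> after passing to a
  subsequence, which is the form \<open>mean_of_folner\<close> accepts.\<close>

lemma density_approx:
 fixes E :: "'a::ab_group_add set"
 assumes "0 < upper_banach_density E" "0 < eps"
 obtains F where "folner F" "!!N. upper_banach_density E - eps <= avg (F N) (indicat_real E)"
proof -
 let ?L = "%F. limsup (%N. ereal (real (card (E \<inter> F N)) / real (card (F N))))"
 let ?S = "SUP F \<in> {F. folner F}. ?L F"
 let ?d = "upper_banach_density E"
 have "?S = ereal ?d" using assms(1) unfolding upper_banach_density_def by (cases ?S) simp_all
 then have "ereal (?d - eps) < ?S" using assms(2) by simp
 then obtain F where F: "folner F" "ereal (?d - eps) < ?L F" by (auto simp: less_SUP_iff)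
 have fin: "finite (F N)" for N using F by (auto simp: folner_def)
 have "EX N>=n. ?d - eps <= avg (F N) (indicat_real E)" for n
 proof (rule ccontr)
  assume "~ ?thesis"
  then have "ereal (real (card (E \<inter> F N)) / real (card (F N))) <= ereal (?d - eps)" if "n <= N" for N
   using that by (force simp: avg_indicator fin)
  then have "?L F <= ereal (?d - eps)" by (intro Limsup_bounded eventually_sequentiallyI)
  with F(2) show False by simp
 qed
 then obtain r where "!!n. n <= r n" "!!n. ?d - eps <= avg (F (r n)) (indicat_real E)" by metis
 then show ?thesis using that[of "%N. F (r N)"] folner_subseq[OF F(1)] by blast
qed

text \<open>Finitely many translates of \<open>S\<close> never cover the group, so each
  \<open>F N\<close> has a translate disjoint from \<open>S\<close>; a mean along these translates
  ignores \<open>S\<close>.\<close>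

lemma nonsyndetic_mean:
 fixes S :: "'a::ab_group_add set"
 assumes "~ syndetic S" "folner (F :: nat => 'a set)"
 obtains m where "inv_mean m" "m (indicat_real S) = 0"
proof -
 have fin: "finite (F N)" "F N ~= {}" for N using assms by (auto simp: folner_def)
 have "EX y. (+) y ` F N \<inter> S = {}" for N
 proof -
  have "finite (uminus ` F N)" using fin by simp
  with assms(1) have "(\<Union>t\<in>uminus ` F N. (+) t ` S) ~= UNIV" unfolding syndetic_def by blast
  then obtain y where y: "y ~: (\<Union>t\<in>uminus ` F N. (+) t ` S)" by blast
  have "y + k ~: S" if "k : F N" for k
  proof
   assume "y + k : S"
   then have "- k + (y + k) : (+) (- k) ` S" by blast
   with y that show False by auto
  qed
  then show ?thesis by blast
 qed
 then obtain y where y: "!!N. (+) (y N) ` F N \<inter> S = {}" by metis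
 from mean_of_folner[OF folner_shift[OF assms(2), of y]]
 obtain m where m: "inv_mean m" "!!f c. bdd f ==> (!!N. c <= avg ((+) (y N) ` F N) f) ==> c <= m f" by blast
 interpret imean m by unfold_locales fact
 have "0 <= m (%x. - indicat_real S x)"
  by (rule m(2)) (intro bdd_intros, use y fin in \<open>auto simp: avg_def indicator_def sum_negf intro!: sum.neutral\<close>)
 then have "m (indicat_real S) = 0"
  using m_minus[of "indicat_real S"] msr_nonneg[of S] by (simp add: bdd_indicator' msr_def)
 with m(1) show ?thesis using that by blast
qed

section \<open>Positive definite functions\<close>

lemma bdd_shift [bdd_intros]: "bdd f ==> bdd (%x. f (x + h))"
 by (rule bdd_compose)

text \<open>The points \<open>p i\<close> may repeat. Reality of the form is stated separately and
  yields the Hermitian symmetry.\<close>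

definition pd :: "('a::ab_group_add => complex) => bool" where
 "pd ph \<longleftrightarrow> (ALL (n::nat) p c. 0 <= Re (\<Sum>i<n. \<Sum>j<n. c i * cnj (c j) * ph (p i - p j)) &
   Im (\<Sum>i<n. \<Sum>j<n. c i * cnj (c j) * ph (p i - p j)) = 0)"

lemma pdD:
 assumes "pd ph"
 shows "0 <= Re (\<Sum>i<n. \<Sum>j<(n::nat). c i * cnj (c j) * ph (p i - p j))"
  "Im (\<Sum>i<n. \<Sum>j<n. c i * cnj (c j) * ph (p i - p j)) = 0"
 using assms unfolding pd_def by blast+

lemma pd_zero: assumes "pd ph" shows "0 <= Re (ph 0)" "Im (ph 0) = 0"
 using pdD[OF assms, where n = 1 and c = "%_. 1" and p = "%_. 0"] by auto

lemma pd_two: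
 assumes "pd ph"
 shows "0 <= Re (ph 0 + c * cnj c * ph 0 + cnj c * ph h + c * ph (- h))"
  "Im (ph 0 + c * cnj c * ph 0 + cnj c * ph h + c * ph (- h)) = 0"
proof -
 let ?c = "%i::nat. if i = 0 then 1 else c" and ?p = "%i::nat. if i = 0 then h else 0"
 have "(\<Sum>i<2. \<Sum>j<2. ?c i * cnj (?c j) * ph (?p i - ?p j))
  = ph 0 + c * cnj c * ph 0 + cnj c * ph h + c * ph (- h)"
  by (simp add: lessThan_Suc numeral_2_eq_2 algebra_simps)
 then show "0 <= Re (ph 0 + c * cnj c * ph 0 + cnj c * ph h + c * ph (- h))"
  "Im (ph 0 + c * cnj c * ph 0 + cnj c * ph h + c * ph (- h)) = 0"
  using pdD[OF assms, where n = 2 and c = ?c and p = ?p] by metis+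
qed

lemma pd_uminus: assumes "pd ph" shows "ph (- h) = cnj (ph h)"
proof -
 have "Im (ph 0) = 0" using pd_zero[OF assms] by simp
 then show ?thesis
  using pd_two(2)[OF assms, of 1 h] pd_two(2)[OF assms, of \<i> h] by (simp add: complex_eq_iff)
qed

lemma pd_bound: assumes "pd ph" shows "cmod (ph h) <= Re (ph 0)"
proof (cases "ph h = 0")
 case True
 then show ?thesis using pd_zero[OF assms] by simp
next
 case False
 \<comment> \<open>Minus the phase of \<open>ph h\<close> makes both mixed terms of the two-point
   form equal to minus its modulus.\<close>
 define c where "c = - ph h / cmod (ph h)"
 have 1: "c * cnj c = 1" using False
  by (simp add: c_def complex_norm_square[symmetric] power2_eq_square)
 have 2: "cnj c * ph h = - cmod (ph h)"
 proof -
  have "cnj c * ph h = - (ph h * cnj (ph h)) / cmod (ph h)" by (simp add: c_def mult.commute)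
  also have "... = - cmod (ph h)" using False by (simp add: complex_norm_square[symmetric] power2_eq_square)
  finally show ?thesis .
 qed
 have 3: "c * ph (- h) = - cmod (ph h)"
  using arg_cong[OF 2, of cnj] by (simp add: pd_uminus[OF assms])
 show ?thesis using pd_two(1)[OF assms, of c h] unfolding 1 2 3 by simp
qed

lemma pd_bdd: "pd ph ==> bdd ph"
 by (rule bddI[of _ "Re (ph 0)"]) (rule pd_bound)

section \<open>Quadratic averages and the mean of a positive definite function\<close>

text \<open>For a correlation function this is the squared norm of the average of the translates by
  the points \<open>p i\<close>.\<close>

definition Qav :: "nat => (nat => 'a::ab_group_add) => ('a => complex) => real" where
 "Qav n p ph = Re (\<Sum>i<n. \<Sum>j<n. ph (p i - p j)) / (real n)^2"

lemma sum_lessThan_split: "(\<Sum>i<n + m. f i) = (\<Sum>i<n. f i) + (\<Sum>i<(m::nat). f (n + i))"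
 for f :: "nat => 'b::comm_monoid_add"
 by (induction m) (auto simp: add.assoc)

text \<open>Joining a configuration of points with its shift by \<open>l\<close> brings in the cross
  average of the two copies, whose mean over \<open>l\<close> is the mean of
  \<open>ph\<close>.\<close>

definition dbl :: "nat => (nat => 'a::ab_group_add) => 'a => nat => 'a" where
 "dbl n p l i = (if i < n then p i + l else p (i - n))"

lemma dbl_sum:
 fixes ph :: "'a::ab_group_add => complex"
 assumes "pd ph" "cnj e = e" "e * e = 1"
 shows "(\<Sum>i<n + n. \<Sum>j<n + n. (if i < n then 1 else e) * cnj (if j < n then 1 else e) * ph (dbl n p l i - dbl n p l j))
  = 2 * (\<Sum>i<n. \<Sum>j<n. ph (p i - p j)) + e * (2 * Re (\<Sum>i<n. \<Sum>j<n. ph (l + p i - p j)))"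
proof -
 have s: "(\<Sum>i<n. \<Sum>j<n. ph (p i - (p j + l))) = cnj (\<Sum>i<n. \<Sum>j<n. ph (l + p i - p j))"
 proof -
  have "(\<Sum>i<n. \<Sum>j<n. ph (p i - (p j + l))) = (\<Sum>j<n. \<Sum>i<n. ph (p i - (p j + l)))" by (rule sum.swap)
  also have "... = (\<Sum>j<n. \<Sum>i<n. cnj (ph (l + p j - p i)))"
  proof (intro sum.cong refl)
   fix i j
   have "p i - (p j + l) = - (l + p j - p i)" by simp
   then show "ph (p i - (p j + l)) = cnj (ph (l + p j - p i))" by (simp only: pd_uminus[OF assms(1)])
  qed
  finally show ?thesis by simp
 qed
 have "(\<Sum>i<n + n. \<Sum>j<n + n. (if i < n then 1 else e) * cnj (if j < n then 1 else e) * ph (dbl n p l i - dbl n p l j))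
  = (\<Sum>i<n. \<Sum>j<n. ph (p i - p j)) + e * (\<Sum>i<n. \<Sum>j<n. ph (l + p i - p j))
   + e * (\<Sum>i<n. \<Sum>j<n. ph (p i - (p j + l))) + (e * e) * (\<Sum>i<n. \<Sum>j<n. ph (p i - p j))"
  unfolding sum_lessThan_split by (simp add: dbl_def assms(2) sum.distrib sum_distrib_left algebra_simps)
 also have "... = 2 * (\<Sum>i<n. \<Sum>j<n. ph (p i - p j)) + e * (2 * Re (\<Sum>i<n. \<Sum>j<n. ph (l + p i - p j)))"
  unfolding s assms(3) by (simp add: complex_eq_iff sum_negf algebra_simps)
 finally show ?thesis .
qed

lemma Qav_dbl:
 assumes "pd ph" "0 < n"
 shows "Qav (n + n) (dbl n p l) ph = (Qav n p ph + Re (\<Sum>i<n. \<Sum>j<n. ph (l + p i - p j)) / (real n)^2) / 2"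
 using dbl_sum[OF assms(1), of 1 n p l] assms(2)
 by (simp add: Qav_def power2_eq_square field_simps)

lemma Qav_shift_le:
 assumes "pd ph" "0 < n"
 shows "Re (\<Sum>i<n. \<Sum>j<n. ph (l + p i - p j)) / (real n)^2 <= Qav n p ph"
 \<comment> \<open>Coefficients 1 on the shifted copy and -1 on the original give the difference of
   the two averages.\<close>
 using pdD(1)[OF assms(1), where n = "n + n" and c = "%i. if i < n then 1 else -1" and p = "dbl n p l"]
 unfolding dbl_sum[OF assms(1), of "-1" n p l, simplified] Qav_def by (simp add: divide_right_mono)

lemma (in imean) mean_Qav_shift:
 assumes "pd ph" "0 < n"
 shows "m (%l. Re (\<Sum>i<n. \<Sum>j<n. ph (l + p i - p j)) / (real n)^2) = Re (cm ph)"
proof -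
 have b: "bdd (%l. Re (ph (l + g)))" for g using bdd_Re[OF pd_bdd[OF assms(1)]] by (rule bdd_compose)
 have sh: "m (%l. Re (ph (l + g))) = Re (cm ph)" for g
  unfolding Re_cm using m_shift[OF bdd_Re[OF pd_bdd[OF assms(1)]]] .
 have "m (%l. Re (\<Sum>i<n. \<Sum>j<n. ph (l + p i - p j)) / (real n)^2)
  = m (%l. (1 / (real n)^2) * (\<Sum>i<n. \<Sum>j<n. Re (ph (l + (p i - p j)))))"
  by (simp add: add_diff_eq)
 also have "... = (1 / (real n)^2) * (\<Sum>i<n. \<Sum>j<n. m (%l. Re (ph (l + (p i - p j)))))"
  by (simp only: m_scale m_sum bdd_sum b)
 also have "... = Re (cm ph)" unfolding sh using assms(2) by (simp add: power2_eq_square)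
 finally show ?thesis .
qed

lemma (in imean) pd_mean_le:
 assumes "pd ph" "0 < n"
 shows "Re (cm ph) <= Qav n p ph"
proof -
 have b: "bdd (%l. Re (\<Sum>i<n. \<Sum>j<n. ph (l + p i - p j)) / (real n)^2)"
 proof -
  have "bdd (%l. (\<Sum>i<n. \<Sum>j<n. ph (l + p i - p j)))"
   using bdd_compose[OF pd_bdd[OF assms(1)]] by (intro bdd_sum)
  then obtain B where "!!l. cmod (\<Sum>i<n. \<Sum>j<n. ph (l + p i - p j)) <= B" by (rule bddE) auto
  then show ?thesis
   by (intro bddI[of _ "B / (real n)^2"]) (auto intro!: divide_right_mono order_trans[OF abs_Re_le_cmod] simp del: Re_sum)
 qed
 show ?thesis
  unfolding mean_Qav_shift[OF assms, of p, symmetric] by (rule m_le[OF b Qav_shift_le[OF assms]])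
qed

lemma Qav_nonneg: "pd ph ==> 0 <= Qav n p ph"
 using pdD(1)[where ph = ph and n = n and c = "%_. 1" and p = p] by (simp add: Qav_def del: Re_sum)

text \<open>Together with \<open>pd_mean_le\<close> this identifies the mean with the infimum of the
  quadratic averages. For a near minimal configuration the doubled one cannot go below the infimum,
  which bounds every cross average from below; their mean over the shift is the mean of
  \<open>ph\<close>. It is the mean ergodic theorem in convexity form.\<close>

lemma (in imean) pd_mean_inf:
 assumes "pd ph" "0 < eps"
 obtains n p where "0 < n" "Qav n p ph <= Re (cm ph) + eps"
proof -
 define S where "S = {Qav n p ph | n p. 0 < n}"
 have ne: "S ~= {}" unfolding S_def by auto
 have bb: "bdd_below S" unfolding S_def by (intro bdd_belowI[of _ 0]) (auto intro: Qav_nonneg assms)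
 obtain x where "x : S" "x < Inf S + eps / 2"
  using cInf_lessD[OF ne, of "Inf S + eps / 2"] assms(2) by auto
 then obtain n p where np: "0 < n" "Qav n p ph < Inf S + eps / 2" unfolding S_def by blast
 have lo: "Inf S <= Qav (n + n) (dbl n p l) ph" for l
  by (rule cInf_lower[OF _ bb]) (use np in \<open>auto simp: S_def\<close>)
 have ge: "Inf S - eps / 2 <= Re (\<Sum>i<n. \<Sum>j<n. ph (l + p i - p j)) / (real n)^2" for l
  using lo[of l] np(2) unfolding Qav_dbl[OF assms(1) np(1)] by simp
 have b: "bdd (%l. Re (\<Sum>i<n. \<Sum>j<n. ph (l + p i - p j)) / (real n)^2)"
  by (rule bddI[of _ "\<bar>Inf S - eps / 2\<bar> + \<bar>Qav n p ph\<bar>"])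
   (use ge Qav_shift_le[OF assms(1) np(1), of _ p] in \<open>smt (verit) real_norm_def\<close>)
 have "Inf S - eps / 2 <= Re (cm ph)"
  unfolding mean_Qav_shift[OF assms(1) np(1), of p, symmetric] by (rule m_ge[OF b ge])
 with np that[of n p] show ?thesis by simp
qed

section \<open>Ergodic means\<close>

definition ext_mean :: "(('a::ab_group_add => real) => real) => bool" where
 "ext_mean L \<longleftrightarrow> inv_mean L & (ALL y z t. inv_mean y --> inv_mean z --> 0 < t --> t < 1 -->
   L = (%f. t * y f + (1 - t) * z f) --> y = L & z = L)"

text \<open>The means maximising the value at \<open>f0\<close> form a closed face of the compact
  set of all means, and an extreme point of the whole set lies in that face.\<close>

lemma ext_mean_exists:
 fixes m0 :: "('a::ab_group_add => real) => real" and f0 :: "'a => real"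
 assumes "inv_mean m0"
 obtains L :: "('a => real) => real" where "ext_mean L" "!!m. inv_mean m ==> m f0 <= L f0"
proof -
 define C where "C = {m :: ('a => real) => real. inv_mean m}"
 define B where "B f = (if bdd f then SOME B. ALL x. \<bar>f x\<bar> <= B else 0)" for f :: "'a => real"
 have B: "\<bar>f x\<bar> <= B f" if "bdd f" for f x
 proof -
  have "EX B. ALL x. \<bar>f x\<bar> <= B" using that unfolding bdd_def by simp
  from someI_ex[OF this] show ?thesis using that by (simp add: B_def)
 qed
 define K where "K = {m :: ('a => real) => real. ALL f. m f : {- B f..B f}}"
 have cK: "compact K" unfolding K_def by (rule compact_Pi_UNIV) simp
 have CK: "C <= K"
 proof
  fix m assume "m : C"
  then interpret imean m by unfold_locales (simp add: C_def)
  have "- B f <= m f & m f <= B f" for f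
  proof (cases "bdd f")
   case True
   then show ?thesis using B[OF True] by (auto intro!: m_le m_ge simp: abs_le_iff minus_le_iff)
  qed (simp add: m_unbdd B_def)
  then show "m : K" by (simp add: K_def)
 qed
 have cont: "continuous_on UNIV (%m :: ('a => real) => real. m f)" for f
  by (rule continuous_on_product_coordinates)
 \<comment> \<open>Every clause of \<open>inv_mean\<close> is an equation or inequality between
   finitely many coordinates, under premises that do not involve the mean.\<close>
 have "closed C"
  unfolding C_def inv_mean_def
  by (intro closed_Collect_conj closed_Collect_all closed_Collect_imp open_Collect_const
    closed_Collect_eq closed_Collect_le continuous_on_add continuous_on_mult continuous_on_const cont)
 then have cC: "compact C" using cK CK by (metis compact_Int_closed inf.absorb2)
 have "C ~= {}" using assms(1) unfolding C_def by blast
 then obtain s where s: "s : C" "!!m. m : C ==> m f0 <= s f0"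
  using continuous_attains_sup[OF cC _ continuous_on_subset[OF cont[of f0]]] by auto
 define F where "F = C \<inter> {m. m f0 = s f0}"
 have "closed F" unfolding F_def
  by (intro closed_Int \<open>closed C\<close> closed_Collect_eq continuous_on_const cont)
 have "face C F"
  unfolding face_def
 proof (intro ballI allI impI)
  fix x y z t assume h: "x : F" "y : C" "z : C" "0 < t & t < 1 & x = (%i. t *\<^sub>R y i + (1 - t) *\<^sub>R z i)"
  have eq: "s f0 = t * y f0 + (1 - t) * z f0" using h by (auto simp: F_def)
  have le: "y f0 <= s f0" "z f0 <= s f0" using s h by auto
  have t: "0 < t" "0 < 1 - t" using h by auto
  have "t * (s f0 - y f0) + (1 - t) * (s f0 - z f0) = 0" using eq by (simp add: algebra_simps)
  moreover have "0 <= t * (s f0 - y f0)" "0 <= (1 - t) * (s f0 - z f0)" using le t by auto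
  ultimately have "t * (s f0 - y f0) = 0" "(1 - t) * (s f0 - z f0) = 0" by linarith+
  then show "y : F & z : F" using t h by (auto simp: F_def)
 qed
 obtain L where L: "L : F" "!!y z t. y : C ==> z : C ==> 0 < t ==> t < 1 ==>
    L = (%i. t *\<^sub>R y i + (1 - t) *\<^sub>R z i) ==> y = L & z = L"
  using exists_extreme_point[OF cC \<open>closed F\<close> _ _ \<open>face C F\<close>] s(1) unfolding F_def by blast
 show ?thesis
 proof (rule that[of L])
  show "ext_mean L" using L unfolding ext_mean_def F_def C_def by simp
  show "m f0 <= L f0" if "inv_mean m" for m using s(2)[of m] L(1) that by (simp add: F_def C_def)
 qed
qed

section \<open>Ergodicity of extreme means\<close>

locale emean =
 fixes L :: "('a::ab_group_add => real) => real"
 assumes ext: "ext_mean L"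
begin

sublocale imean L using ext by unfold_locales (simp add: ext_mean_def)

lemma bdd_m: assumes "bdd k" "bdd F" shows "bdd (%h. L (%x. k x * F (x + h)))"
proof -
 obtain A B where AB: "0 <= A" "!!x. norm (k x) <= A" "0 <= B" "!!x. norm (F x) <= B" using assms by (meson bddE)
 have b: "bdd (%x. k x * F (x + h))" for h by (intro bdd_mult assms bdd_shift)
 have le: "\<bar>k x * F (x + h)\<bar> <= A * B" for x h
  unfolding abs_mult using AB by (intro mult_mono) auto
 have "\<bar>L (%x. k x * F (x + h))\<bar> <= A * B" for h
 proof -
  have "k x * F (x + h) <= A * B" "- (A * B) <= k x * F (x + h)" for x using le[of x h] by linarith+
  then have "L (%x. k x * F (x + h)) <= A * B" "- (A * B) <= L (%x. k x * F (x + h))"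
   using b by (auto intro: m_le m_ge)
  then show ?thesis by simp
 qed
 then show ?thesis by (intro bddI[of _ "A * B"]) simp
qed

text \<open>Averaging the translates of \<open>F\<close> against \<open>k\<close> defines an
  invariant functional \<open>L1\<close> lying between 0 and \<open>L\<close>. If its total mass
  \<open>c\<close> is strictly between 0 and 1, then \<open>L\<close> is a convex combination of the
  means \<open>L1 / c\<close> and \<open>(L - L1) / (1 - c)\<close>, and extremality forces
  \<open>L1\<close> to be \<open>c\<close> times \<open>L\<close>. For \<open>c\<close> equal to 0
  or 1 the domination by multiples of \<open>F\<close> or by \<open>L\<close> decides.\<close>

lemma erg01:
 assumes F: "!!x. 0 <= F x" "!!x. F x <= 1" and k: "bdd k"
 shows "L (%h. L (%x. k x * F (x + h))) = L F * L k"
proof -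
 have bF: "bdd F" by (rule bddI[of _ 1]) (use F in simp)
 have bkF: "bdd (%x. k x * F (x + h))" if "bdd k" for k h by (intro bdd_mult that bdd_shift bF)
 define L1 where "L1 k = L (%h. L (%x. k x * F (x + h)))" for k
 define c where "c = L F"
 have c01: "0 <= c" "c <= 1" unfolding c_def by (auto intro!: m_nonneg m_le bF F)
 have L1_add: "L1 (%x. f x + g x) = L1 f + L1 g" if "bdd f" "bdd g" for f g
  using that unfolding L1_def by (simp add: distrib_right m_add bkF bdd_m[OF _ bF])
 have L1_scale: "L1 (%x. a * f x) = a * L1 f" if "bdd f" for f a
  using that unfolding L1_def by (simp add: mult.assoc m_scale bkF bdd_m[OF _ bF])
 have L1_nonneg: "0 <= L1 f" if "bdd f" "!!x. 0 <= f x" for f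
  unfolding L1_def using that F by (intro m_nonneg bdd_m bkF bF) auto
 have L1_1: "L1 (%x. 1) = c" unfolding L1_def c_def by (simp add: m_shift bF)
 \<comment> \<open>By invariance of the inner mean, shifting \<open>f\<close> amounts to shifting
   the outer variable \<open>h\<close> the opposite way.\<close>
 have L1_shift: "L1 (%x. f (x + g)) = L1 f" if "bdd f" for f g
 proof -
  have "L (%x. f (x + g) * F (x + h)) = L (%x. f x * F (x + (h - g)))" for h
   using m_shift[OF bkF[OF that, of "h - g"], of g] by (simp add: algebra_simps)
  then have "L1 (%x. f (x + g)) = L (%h. L (%x. f x * F (x + (h + - g))))" by (simp add: L1_def)
  also have "... = L1 f" unfolding L1_def by (rule m_shift[OF bdd_m[OF that bF]])
  finally show ?thesis .
 qed
 have L1_le: "L1 f <= L f" if "bdd f" "!!x. 0 <= f x" for f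
 proof -
  have le: "L (%x. f x * F (x + h)) <= L f" for h
   using that F by (intro m_mono bkF) (auto intro: mult_left_le)
  show ?thesis unfolding L1_def by (rule m_le[OF bdd_m[OF that(1) bF] le])
 qed
 obtain B where B: "0 <= B" "!!x. norm (k x) <= B" using k by (rule bddE) blast
 have nn: "bdd (%x. B + k x)" "!!x. 0 <= B + k x" "bdd (%x. B - k x)" "!!x. 0 <= B - k x"
 proof -
  have kb: "- B <= k x" "k x <= B" for x using B(2)[of x] by auto
  show "0 <= B + k x" "0 <= B - k x" for x using kb[of x] by auto
  show "bdd (%x. B + k x)" "bdd (%x. B - k x)" by (intro bdd_intros k)+
 qed
 have L1c: "L1 (%x. B + k x) = B * c + L1 k" "L1 (%x. B - k x) = B * c - L1 k"
  using L1_add[of "%x. B" k] L1_add[of "%x. B" "%x. -1 * k x"] L1_scale[of "%x. 1" B] L1_scale[of k "-1"] k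
  by (simp_all add: L1_1 bdd_const bdd_minus)
 have Lc: "L (%x. B + k x) = B + L k" "L (%x. B - k x) = B - L k" by (simp_all add: m_add m_diff k bdd_const)
 consider "c = 0" | "c = 1" | "0 < c" "c < 1" using c01 by linarith
 then have "L1 k = c * L k"
 proof cases
  case 1
  have "L1 (%x. B + k x) <= 0"
  proof -
   have le: "L (%x. (B + k x) * F (x + h)) <= 0" for h
   proof -
    have "L (%x. (B + k x) * F (x + h)) <= L (%x. (2 * B) * F (x + h))"
     using F B by (intro m_mono bkF nn bdd_mult bdd_const bdd_shift bF mult_right_mono) (auto simp: abs_le_iff)
    also have "... = (2 * B) * L F" by (simp only: m_scale m_shift bF bdd_shift)
    finally show ?thesis using 1 by (simp add: c_def)
   qed
   show ?thesis unfolding L1_def by (rule m_le[OF bdd_m[OF nn(1) bF] le])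
  qed
  moreover have "0 <= L1 (%x. B + k x)" by (intro L1_nonneg nn)
  ultimately show ?thesis using L1c 1 by simp
 next
  case 2
  have "L1 (%x. B + k x) <= L (%x. B + k x)" "L1 (%x. B - k x) <= L (%x. B - k x)" by (intro L1_le nn)+
  then show ?thesis using 2 by (simp add: L1c Lc)
 next
  case 3
  define y where "y f = (if bdd f then L1 f / c else 0)" for f
  define z where "z f = (if bdd f then (L f - L1 f) / (1 - c) else 0)" for f
  have "inv_mean y"
   unfolding inv_mean_def y_def using 3
   by (auto simp: L1_add L1_scale L1_nonneg L1_1 L1_shift bdd_add bdd_mult bdd_const bdd_shift add_divide_distrib)
  moreover have "inv_mean z"
   unfolding inv_mean_def z_def using 3
   by (auto simp: L1_add L1_scale L1_le L1_1 L1_shift m_add m_scale m_shift bdd_add bdd_mult bdd_const bdd_shift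
     diff_divide_distrib[symmetric] add_divide_distrib[symmetric] right_diff_distrib)
  moreover have "L = (%f. c * y f + (1 - c) * z f)"
   unfolding y_def z_def using 3 by (auto simp: m_unbdd)
  ultimately have "y = L" using ext 3 unfolding ext_mean_def by blast
  then have "y k = L k" by simp
  then show ?thesis using k 3 by (simp add: y_def field_simps)
 qed
 then show ?thesis by (simp add: L1_def c_def)
qed

lemma erg_real:
 assumes F: "bdd F" and k: "bdd k"
 shows "L (%h. L (%x. k x * F (x + h))) = L F * L k"
proof -
 obtain B' where B': "0 <= B'" "!!x. norm (F x) <= B'" using F by (rule bddE) blast
 define B where "B = B' + 1"
 have B: "0 < B" "!!x. \<bar>F x\<bar> <= B" using B' unfolding B_def by (auto intro: add_increasing2)
 define G where "G x = (F x + B) / (2 * B)" for x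
 have G: "0 <= G x" "G x <= 1" for x using B(2)[of x] B(1) by (auto simp: G_def abs_le_iff)
 have bG: "bdd G" by (rule bddI[of _ 1]) (use G in simp)
 have FG: "F = (%x. (2 * B) * G x + (- B))" using B(1) by (auto simp: G_def)
 have b: "bdd (%x. k x * G (x + h))" for h by (intro bdd_mult k bdd_shift bG)
 have "L (%x. k x * F (x + h)) = (2 * B) * L (%x. k x * G (x + h)) + (- B) * L k" for h
 proof -
  have "(%x. k x * F (x + h)) = (%x. (2 * B) * (k x * G (x + h)) + (- B) * k x)"
   by (subst FG) (auto simp: algebra_simps)
  then show ?thesis by (simp only: m_add m_scale b k bdd_mult bdd_const)
 qed
 then have "L (%h. L (%x. k x * F (x + h))) = (2 * B) * L (%h. L (%x. k x * G (x + h))) + (- B) * L k"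
  by (simp only: m_add m_scale bdd_m[OF k bG] bdd_mult bdd_const m_const)
 also have "... = (2 * B) * (L G * L k) + (- B) * L k" by (simp only: erg01[of G k, OF G k])
 also have "... = L F * L k"
 proof -
  have "L F = L (%x. (2 * B) * G x + (- B))" using FG by (rule arg_cong)
  also have "... = (2 * B) * L G + (- B)" by (simp only: m_add m_scale bG bdd_mult bdd_const m_const)
  finally have e: "L F = (2 * B) * L G + (- B)" .
  show ?thesis unfolding e by (simp add: algebra_simps)
 qed
 finally show ?thesis .
qed

lemma erg_complex:
 assumes F: "bdd F" and k: "bdd k"
 shows "cm (%h. cm (%x. k x * F (x + h))) = cm F * cm k"
proof -
 have e: "L (%h. L (%x. a (k x) * b (F (x + h)))) = L (%x. b (F x)) * L (%x. a (k x))"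
  and be: "bdd (%h. L (%x. a (k x) * b (F (x + h))))"
  and bx: "bdd (%x. a (k x) * b (F (x + h)))"
  if "a : {Re, Im}" "b : {Re, Im}" for a b h
 proof -
  have ab: "bdd (%x. a (k x))" "bdd (%x. b (F x))" using that by (auto intro: bdd_Re bdd_Im F k)
  show "L (%h. L (%x. a (k x) * b (F (x + h)))) = L (%x. b (F x)) * L (%x. a (k x))" by (rule erg_real[OF ab(2,1)])
  show "bdd (%h. L (%x. a (k x) * b (F (x + h))))" by (rule bdd_m[OF ab])
  show "bdd (%x. a (k x) * b (F (x + h)))" by (intro bdd_mult ab bdd_shift[OF ab(2)])
 qed
 show ?thesis
  by (simp add: complex_eq_iff Re_cm Im_cm m_add m_diff bdd_add bdd_diff
    e[of Re Re, simplified] e[of Re Im, simplified] e[of Im Re, simplified] e[of Im Im, simplified]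
    be[of Re Re, simplified] be[of Re Im, simplified] be[of Im Re, simplified] be[of Im Im, simplified]
    bx[of Re Re, simplified] bx[of Re Im, simplified] bx[of Im Re, simplified] bx[of Im Im, simplified])
qed

lemma pd_corr:
 assumes "bdd F"
 shows "pd (%h. cm (%x. F (x + h) * cnj (F x)))"
  "(\<Sum>i<n. \<Sum>j<n. c i * cnj (c j) * cm (%x. F (x + (p i - p j)) * cnj (F x)))
   = cx (L (%x. (cmod (\<Sum>i<(n::nat). c i * F (x + p i)))^2))"
proof -
 have b: "bdd (%x. F (x + g) * cnj (F (x + g')))" for g g' by (intro bdd_mult bdd_cnj bdd_shift assms)
 have sum: "(\<Sum>i<n. \<Sum>j<n. c i * cnj (c j) * cm (%x. F (x + (p i - p j)) * cnj (F x)))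
   = cx (L (%x. (cmod (\<Sum>i<n. c i * F (x + p i)))^2))" for n c p
 proof -
  have s: "cm (%x. F (x + (p i - p j)) * cnj (F x)) = cm (%x. F (x + p i) * cnj (F (x + p j)))" for i j
   using cm_shift[OF b[of "p i - p j" 0], of "p j"] by (simp add: algebra_simps)
  have "(\<Sum>i<n. \<Sum>j<n. c i * cnj (c j) * cm (%x. F (x + (p i - p j)) * cnj (F x)))
   = cm (%x. \<Sum>i<n. \<Sum>j<n. c i * cnj (c j) * (F (x + p i) * cnj (F (x + p j))))"
   unfolding s by (simp add: cm_sum cm_scale b bdd_sum bdd_mult bdd_const)
  also have "(%x. \<Sum>i<n. \<Sum>j<n. c i * cnj (c j) * (F (x + p i) * cnj (F (x + p j))))
   = (%x. cx ((cmod (\<Sum>i<n. c i * F (x + p i)))^2))"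
   unfolding complex_norm_square cnj_sum sum_product by (simp add: algebra_simps)
  finally show ?thesis by (simp only: cm_of_real)
 qed
 show "(\<Sum>i<n. \<Sum>j<n. c i * cnj (c j) * cm (%x. F (x + (p i - p j)) * cnj (F x)))
   = cx (L (%x. (cmod (\<Sum>i<n. c i * F (x + p i)))^2))" by (rule sum)
 have "0 <= L (%x. (cmod (\<Sum>i<n. c i * F (x + p i)))^2)" for n :: nat and c p
  by (intro m_nonneg bdd_power bdd_norm bdd_sum bdd_mult bdd_const bdd_shift assms) simp
 then show "pd (%h. cm (%x. F (x + h) * cnj (F x)))"
  unfolding pd_def sum by simp
qed

text \<open>Ergodicity identifies the mean of the correlation function with the squared modulus of
  the mean of \<open>F\<close>. By \<open>pd_mean_inf\<close> some quadratic average, that is the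
  squared norm of a finite average of translates, comes close to it.\<close>

lemma ergodic:
 assumes F: "bdd F" and "0 < eps"
 obtains n p where "0 < n" "L (%x. (cmod ((\<Sum>i<n. F (x + p i)) / of_nat n - cm F))^2) < eps"
proof -
 let ?ph = "%h. cm (%x. F (x + h) * cnj (F x))"
 have "cm ?ph = cm F * cnj (cm F)"
  using erg_complex[OF F bdd_cnj[OF F]] by (simp add: cm_cnj F mult.commute)
 then have Re: "Re (cm ?ph) = (cmod (cm F))^2" by (simp flip: complex_norm_square)
 obtain n p where np: "0 < n" "Qav n p ?ph <= (cmod (cm F))^2 + eps / 2"
  using pd_mean_inf[OF pd_corr(1)[OF F], of "eps / 2"] assms(2) unfolding Re by auto
 define A where "A x = (\<Sum>i<n. F (x + p i)) / of_nat n" for x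
 have bA: "bdd A"
 proof -
  have "A = (%x. (1 / of_nat n) * (\<Sum>i<n. F (x + p i)))" by (auto simp: A_def)
  then show ?thesis by (simp only:) (intro bdd_mult bdd_const bdd_sum bdd_shift F)
 qed
 have mA: "cm A = cm F"
 proof -
  have "A = (%x. (1 / of_nat n) * (\<Sum>i<n. F (x + p i)))" by (auto simp: A_def)
  then have "cm A = (1 / of_nat n) * (\<Sum>i<n. cm (%x. F (x + p i)))"
   by (simp only: cm_scale cm_sum bdd_sum bdd_shift F)
  then show ?thesis using np(1) by (simp add: cm_shift F)
 qed
 have sq: "L (%x. (cmod (A x))^2) = Qav n p ?ph"
 proof -
  have "L (%x. (cmod (A x))^2) = L (%x. (1 / (real n)^2) * (cmod (\<Sum>i<n. F (x + p i)))^2)"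
   by (simp add: A_def norm_divide power_divide)
  also have "... = (1 / (real n)^2) * L (%x. (cmod (\<Sum>i<n. F (x + p i)))^2)"
   by (intro m_scale bdd_power bdd_norm bdd_sum bdd_shift F)
  also have "... = Qav n p ?ph"
   using pd_corr(2)[OF F, where c = "%_. 1" and n = n and p = p] by (simp add: Qav_def)
  finally show ?thesis .
 qed
 have "L (%x. (cmod (A x - cm F))^2) = L (%x. (cmod (A x))^2) - (cmod (cm F))^2"
 proof -
  have "(cmod (A x - cm F))^2 = (cmod (A x))^2 - 2 * Re (cnj (cm F) * A x) + (cmod (cm F))^2" for x
   unfolding cmod_power2 by (simp add: power2_eq_square algebra_simps)
  then have "L (%x. (cmod (A x - cm F))^2) = L (%x. (cmod (A x))^2) - 2 * L (%x. Re (cnj (cm F) * A x)) + (cmod (cm F))^2"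
   by (simp only: m_add m_diff m_scale bdd_intros bA m_const)
  also have "L (%x. Re (cnj (cm F) * A x)) = Re (cnj (cm F) * cm A)"
   by (simp only: Re_cm[symmetric] cm_scale bA)
  also have "... = (cmod (cm F))^2" unfolding mA cmod_power2 by (simp add: power2_eq_square)
  finally show ?thesis by simp
 qed
 also have "... < eps" using np(2) assms(2) unfolding sq by simp
 finally show ?thesis using that[OF np(1), of p] by (simp add: A_def)
qed

end

section \<open>Ergodic systems\<close>

definition chr :: "('a::ab_group_add => complex) => bool" where
 "chr zt \<longleftrightarrow> (ALL x y. zt (x + y) = zt x * zt y) & (ALL x. cmod (zt x) = 1)"

lemma chr_add: "chr zt ==> zt (x + y) = zt x * zt y" and chr_norm: "chr zt ==> cmod (zt x) = 1"
 by (simp_all add: chr_def)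

lemma norm1_cnj: "cmod z = 1 ==> z * cnj z = 1" "cmod z = 1 ==> cnj z * z = 1"
 using complex_norm_square[of z] by (simp_all add: mult.commute)

lemma norm1_cnj_l: "cmod z = 1 ==> z * (cnj z * w) = w" "cmod z = 1 ==> cnj z * (z * w) = w"
 using norm1_cnj[of z] by (simp_all flip: mult.assoc)

lemma chr_nonzero: "chr zt ==> zt x ~= 0"
 using chr_norm[of zt x] by auto

lemma chr_zero: assumes "chr zt" shows "zt 0 = 1"
 using chr_add[OF assms, of 0 0] chr_nonzero[OF assms, of 0] by simp

lemma chr_minus: assumes "chr zt" shows "zt (- x) = cnj (zt x)"
proof -
 have "zt x * zt (- x) = 1" using chr_add[OF assms, of x "- x"] chr_zero[OF assms] by simp
 also have "... = zt x * cnj (zt x)" using norm1_cnj(1)[OF chr_norm[OF assms, of x]] by simp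
 finally show ?thesis using chr_nonzero[OF assms, of x] by simp
qed

lemma chr_diff: "chr zt ==> zt (x - y) = zt x * cnj (zt y)"
 using chr_add[of zt x "- y"] by (simp add: chr_minus)

lemma chr_one [simp]: "chr (%x. 1)"
 by (simp add: chr_def)

lemma chr_mult: "chr zt ==> chr ps ==> chr (%x. zt x * ps x)"
 by (simp add: chr_def norm_mult)

lemma chr_cnj: "chr zt ==> chr (%x. cnj (zt x))"
 by (simp add: chr_def)

lemma chr_zsmul: "chr zt ==> chr (%x. zt (zsmul k x))"
 by (simp add: chr_def zsmul_add_right)

lemma chr_bdd: "chr zt ==> bdd zt"
 by (rule bddI[of _ 1]) (simp add: chr_norm)

lemma (in imean) cm_chr: assumes "chr zt" shows "cm zt = (if zt = (%x. 1) then 1 else 0)"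
proof (cases "zt = (%x. 1)")
 case False
 then obtain g where g: "zt g ~= 1" by blast
 have "cm zt = cm (%x. zt (x + g))" by (rule cm_shift[symmetric]) (rule chr_bdd[OF assms])
 also have "... = cm zt * zt g" by (simp add: chr_add[OF assms] cm_scale_right chr_bdd[OF assms])
 finally have "cm zt * (zt g - 1) = 0" by (simp add: algebra_simps)
 with g False show ?thesis by simp
qed simp

lemma (in imean) cm_chr_orth: assumes "chr zt" "chr ps" shows "cm (%h. zt h * cnj (ps h)) = (if zt = ps then 1 else 0)"
proof -
 have "(%x. zt x * cnj (ps x)) = (%x. 1) \<longleftrightarrow> zt = ps"
 proof
  assume eq: "(%x. zt x * cnj (ps x)) = (%x. 1)"
  have "zt x = ps x" for x
  proof -
   have "zt x * cnj (ps x) * ps x = ps x" using fun_cong[OF eq, of x] by simp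
   then show ?thesis using norm1_cnj(2)[OF chr_norm[OF assms(2), of x]] by (simp add: mult.assoc)
  qed
  then show "zt = ps" by blast
 qed (simp add: norm1_cnj(1) chr_norm[OF assms(2)])
 then show ?thesis using cm_chr[OF chr_mult[OF assms(1) chr_cnj[OF assms(2)]]] by simp
qed

text \<open>
  A stands for the essentially bounded functions of an ergodic system with integral I and action tau.
  The equivariant map pr to the group turns each character into an eigenfunction. Working with functions
  rather than classes, null functions are kept, and completeness is only asked on sup-norm balls.
\<close>

locale sys =
 fixes A :: "('x => complex) set" and I :: "('x => complex) => complex"
  and \<tau> :: "'a::{ab_group_add, countable} => 'x => 'x" and pr :: "'x => 'a"
 assumes A_const: "(%x. c) : A"
  and A_add: "F : A ==> G : A ==> (%x. F x + G x) : A"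
  and A_mult: "F : A ==> G : A ==> (%x. F x * G x) : A"
  and A_cnj: "F : A ==> (%x. cnj (F x)) : A"
  and A_tau: "F : A ==> (%x. F (\<tau> g x)) : A"
  and A_chr: "chr zt ==> (%x. zt (pr x)) : A"
  and A_bdd: "F : A ==> bdd F"
  and I_add: "F : A ==> G : A ==> I (%x. F x + G x) = I F + I G"
  and I_scale: "F : A ==> I (%x. c * F x) = c * I F"
  and I_cnj: "F : A ==> I (%x. cnj (F x)) = cnj (I F)"
  and I_nonneg: "F : A ==> (!!x. Im (F x) = 0) ==> (!!x. 0 <= Re (F x)) ==> 0 <= Re (I F)"
  and I_1: "I (%x. 1) = 1"
  and I_tau: "F : A ==> I (%x. F (\<tau> g x)) = I F"
  and pr_tau: "pr (\<tau> g x) = pr x + g"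
  and tau_add: "\<tau> (g + h) x = \<tau> g (\<tau> h x)"
  and tau_0: "\<tau> 0 x = x"
  and erg: "F : A ==> 0 < eps ==> EX n>0. EX p. Re (I (%x. ((\<Sum>i<n. F (\<tau> (p i) x)) / of_nat n - I F) *
     cnj ((\<Sum>i<n. F (\<tau> (p i) x)) / of_nat n - I F))) < eps"
  and complete: "(!!k::nat. S k : A) ==> (!!k x. cmod (S k x) <= C) ==>
    (!!eps. 0 < eps ==> EX N. ALL k>=N. ALL l>=N. Re (I (%x. (S k x - S l x) * cnj (S k x - S l x))) < eps) ==>
    EX G:A. (ALL x. cmod (G x) <= C) &
     (ALL eps>0. EX N. ALL k>=N. Re (I (%x. (S k x - G x) * cnj (S k x - G x))) < (eps::real))"
begin

definition tr :: "'a => ('x => complex) => 'x => complex" where "tr g F x = F (\<tau> g x)"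
definition ch :: "('a => complex) => 'x => complex" where "ch zt x = zt (pr x)"
definition ip :: "('x => complex) => ('x => complex) => complex" where "ip F G = I (%x. F x * cnj (G x))"
definition n2 :: "('x => complex) => real" where "n2 F = Re (ip F F)"
definition nrm :: "('x => complex) => real" where "nrm F = sqrt (n2 F)"

abbreviation dst :: "('x => complex) => ('x => complex) => real" where "dst F G == nrm (%x. F x - G x)"

abbreviation cor3 where "cor3 p1 p2 G F1 F2 h == I (%x. G x * tr (zsmul p1 h) F1 x * tr (zsmul p2 h) F2 x)"

abbreviation cor4 where
 "cor4 q0 q1 q2 q3 G F1 F2 F3 h == I (%x. tr (zsmul q0 h) G x * tr (zsmul q1 h) F1 x * tr (zsmul q2 h) F2 x * tr (zsmul q3 h) F3 x)"

lemma tr_tr: "tr g (tr h F) = tr (g + h) F"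
 by (rule ext) (simp add: tr_def add.commute[of g h] flip: tau_add)

lemma tr_0 [simp]: "tr 0 F = F" by (rule ext) (simp add: tr_def tau_0)
lemma tr_mult: "tr g (%x. F x * G x) x = tr g F x * tr g G x" by (simp add: tr_def)
lemma tr_diff: "tr g (%x. F x - G x) x = tr g F x - tr g G x" by (simp add: tr_def)
lemma tr_cnj: "tr g (%x. cnj (F x)) x = cnj (tr g F x)" by (simp add: tr_def)
lemma tr_const [simp]: "tr g (%x. c) = (%x. c)" by (rule ext) (simp add: tr_def)
lemma tr_sum: "tr g (%x. \<Sum>i\<in>J. F i x) x = (\<Sum>i\<in>J. tr g (F i) x)" by (simp add: tr_def)
lemma tr_scale: "tr g (%x. c * F x) x = c * tr g F x" by (simp add: tr_def)
lemma tr_ch: "chr zt ==> tr g (ch zt) = (%x. zt g * ch zt x)"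
 by (rule ext) (simp add: tr_def ch_def pr_tau chr_add mult.commute)
lemma ch_norm: "chr zt ==> cmod (ch zt x) = 1" by (simp add: ch_def chr_norm)
lemma ch_one [simp]: "ch (%x. 1) = (%x. 1)" by (rule ext) (simp add: ch_def)
lemma ch_mult: "ch (%x. zt x * ps x) x = ch zt x * ch ps x" by (simp add: ch_def)
lemma ch_cnj: "ch (%x. cnj (zt x)) x = cnj (ch zt x)" by (simp add: ch_def)

lemma A_tr: "F : A ==> tr g F : A" unfolding tr_def[abs_def] by (rule A_tau)
lemma A_ch: "chr zt ==> ch zt : A" unfolding ch_def[abs_def] by (rule A_chr)
lemma A_minus: "F : A ==> (%x. - F x) : A" using A_mult[OF A_const[of "-1"]] by simp
lemma A_diff: "F : A ==> G : A ==> (%x. F x - G x) : A" using A_add[of F "%x. - G x"] A_minus by simp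
lemma A_sum: "(!!i. i : J ==> F i : A) ==> (%x. \<Sum>i\<in>J. F i x) : A"
 by (induction J rule: infinite_finite_induct) (auto intro: A_add A_const)

lemmas A_intros = A_const A_add A_mult A_cnj A_tr A_ch A_minus A_diff A_sum

lemma I_const [simp]: "I (%x. c) = c"
 using I_scale[OF A_const[of 1], of c] I_1 by simp
lemma I_minus: "F : A ==> I (%x. - F x) = - I F" using I_scale[of F "-1"] by simp
lemma I_diff: "F : A ==> G : A ==> I (%x. F x - G x) = I F - I G"
 using I_add[of F "%x. - G x"] I_minus[of G] A_minus by simp
lemma I_sum: "(!!i. i : J ==> F i : A) ==> I (%x. \<Sum>i\<in>J. F i x) = (\<Sum>i\<in>J. I (F i))"
 by (induction J rule: infinite_finite_induct) (auto simp: I_add A_sum)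
lemma I_tr: "F : A ==> I (tr g F) = I F" unfolding tr_def[abs_def] by (rule I_tau)

lemma ip_add_left: "F : A ==> G : A ==> H : A ==> ip (%x. F x + G x) H = ip F H + ip G H"
 unfolding ip_def distrib_right by (intro I_add A_intros)
lemma ip_diff_left: "F : A ==> G : A ==> H : A ==> ip (%x. F x - G x) H = ip F H - ip G H"
 unfolding ip_def left_diff_distrib by (intro I_diff A_intros)
lemma ip_scale_left: "F : A ==> G : A ==> ip (%x. c * F x) G = c * ip F G"
 unfolding ip_def mult.assoc by (intro I_scale A_intros)
lemma ip_cnj: "F : A ==> G : A ==> cnj (ip F G) = ip G F"
 unfolding ip_def by (subst I_cnj[symmetric]) (auto intro!: A_intros simp: mult.commute)
lemma ip_add_right: "F : A ==> G : A ==> H : A ==> ip H (%x. F x + G x) = ip H F + ip H G"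
 unfolding ip_def complex_cnj_add distrib_left by (intro I_add A_intros)
lemma ip_diff_right: "F : A ==> G : A ==> H : A ==> ip H (%x. F x - G x) = ip H F - ip H G"
 unfolding ip_def complex_cnj_diff right_diff_distrib by (intro I_diff A_intros)
lemma ip_scale_right: "F : A ==> G : A ==> ip F (%x. c * G x) = cnj c * ip F G"
 unfolding ip_def complex_cnj_mult using I_scale[of "%x. F x * cnj (G x)" "cnj c"]
 by (simp add: A_intros mult.left_commute)
lemma ip_sum_left: "(!!i. i : J ==> F i : A) ==> G : A ==> ip (%x. \<Sum>i\<in>J. F i x) G = (\<Sum>i\<in>J. ip (F i) G)"
 unfolding ip_def sum_distrib_right by (intro I_sum A_intros)
lemma ip_sum_right: "(!!i. i : J ==> F i : A) ==> G : A ==> ip G (%x. \<Sum>i\<in>J. F i x) = (\<Sum>i\<in>J. ip G (F i))"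
 unfolding ip_def cnj_sum sum_distrib_left by (intro I_sum A_intros)
lemma ip_tr: "F : A ==> G : A ==> ip (tr g F) (tr g G) = ip F G"
 using I_tr[of "%x. F x * cnj (G x)" g] unfolding ip_def tr_def[abs_def] by (simp add: A_intros)

lemma n2_nonneg: assumes "F : A" shows "0 <= n2 F" "Im (ip F F) = 0"
proof -
 show "0 <= n2 F" unfolding n2_def ip_def
  by (rule I_nonneg[OF A_mult[OF assms A_cnj[OF assms]]]) (simp_all flip: complex_norm_square)
 have "cnj (ip F F) = ip F F" by (rule ip_cnj[OF assms assms])
 then show "Im (ip F F) = 0" by (simp add: complex_eq_iff)
qed

lemma ip_self: "F : A ==> ip F F = cx (n2 F)"
 using n2_nonneg(2) by (simp add: n2_def complex_eq_iff)

lemma nrm_nonneg: "F : A ==> 0 <= nrm F" by (simp add: nrm_def n2_nonneg)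
lemma nrm_sq: "F : A ==> (nrm F)^2 = n2 F" by (simp add: nrm_def n2_nonneg)

lemma n2_add: assumes "F : A" "G : A" shows "n2 (%x. F x + G x) = n2 F + 2 * Re (ip F G) + n2 G"
proof -
 have "Re (ip G F) = Re (ip F G)" using arg_cong[OF ip_cnj[OF assms], of Re] by simp
 then show ?thesis unfolding n2_def by (simp add: ip_add_left ip_add_right A_intros assms)
qed

lemma n2_scale: assumes "F : A" shows "n2 (%x. c * F x) = (cmod c)^2 * n2 F"
proof -
 have "ip (%x. c * F x) (%x. c * F x) = (c * cnj c) * ip F F"
  by (simp add: ip_scale_left ip_scale_right A_intros assms)
 also have "... = cx ((cmod c)^2 * n2 F)" by (simp add: ip_self assms complex_norm_square[symmetric])
 finally show ?thesis by (simp add: n2_def)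
qed

lemma n2_diff: assumes "F : A" "G : A" shows "n2 (%x. F x - G x) = n2 F - 2 * Re (ip F G) + n2 G"
 using n2_add[of F "%x. - 1 * G x"] n2_scale[of G "- 1"] ip_scale_right[of F G "- 1"] assms A_intros by simp

lemma cauchy_schwarz: assumes "F : A" "G : A" shows "cmod (ip F G) <= nrm F * nrm G"
proof -
 define r where "r = cmod (ip F G)"
 have q: "0 <= n2 F - 2 * t * r + t^2 * n2 G" for t :: real
 proof (cases "ip F G = 0")
  case True
  then show ?thesis using n2_nonneg assms by (simp add: r_def)
 next
  case False
  define c where "c = t * (ip F G / r)"
  have r: "r ~= 0" using False by (simp add: r_def)
  have c: "cmod c = \<bar>t\<bar>" using r by (simp add: c_def norm_mult norm_divide r_def)
  have "cnj c * ip F G = t * (ip F G * cnj (ip F G)) / r" by (simp add: c_def mult.commute)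
  also have "... = cx (t * r)" using r
   by (simp add: complex_norm_square[symmetric] r_def[symmetric] power2_eq_square)
  finally have "Re (ip F (%x. c * G x)) = t * r" by (simp add: ip_scale_right assms)
  then have "n2 (%x. F x - c * G x) = n2 F - 2 * (t * r) + t^2 * n2 G"
   by (simp add: n2_diff n2_scale A_intros assms c)
  then show ?thesis using n2_nonneg(1)[of "%x. F x - c * G x"] assms by (simp add: A_intros)
 qed
 have "r^2 <= n2 F * n2 G"
 proof (cases "n2 G = 0")
  \<comment> \<open>The form is only a seminorm: when \<open>G\<close> has norm 0 the inequality
    \<open>q\<close> is linear in \<open>t\<close>, and a large \<open>t\<close> violates it unless
    \<open>r\<close> is 0.\<close>
  case True
  have "r = 0"
  proof (rule ccontr)
   assume "r ~= 0"
   then have "0 < r" by (simp add: r_def)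
   then show False using q[of "(n2 F + 1) / r"] True n2_nonneg(1)[OF assms(1)] by simp
  qed
  then show ?thesis by (simp add: True)
 next
  case False
  then have "0 < n2 G" using n2_nonneg(1)[OF assms(2)] by simp
  then show ?thesis using q[of "r / n2 G"] by (simp add: power2_eq_square field_simps)
 qed
 then have "r <= sqrt (n2 F * n2 G)" by (simp add: real_le_rsqrt)
 then show ?thesis by (simp add: r_def nrm_def real_sqrt_mult)
qed

lemma Re_ip_le: "F : A ==> G : A ==> \<bar>Re (ip F G)\<bar> <= nrm F * nrm G"
 using cauchy_schwarz abs_Re_le_cmod order_trans by blast

lemma nrm_scale: "F : A ==> nrm (%x. c * F x) = cmod c * nrm F"
 by (simp add: nrm_def n2_scale real_sqrt_mult)

lemma nrm_triangle: assumes "F : A" "G : A" shows "nrm (%x. F x + G x) <= nrm F + nrm G"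
proof -
 have "n2 (%x. F x + G x) <= (nrm F + nrm G)^2"
  using Re_ip_le[OF assms] nrm_sq assms by (simp add: n2_add power2_sum abs_le_iff)
 then show ?thesis using nrm_nonneg assms by (simp add: nrm_def real_le_lsqrt)
qed

lemma nrm_minus: "F : A ==> nrm (%x. - F x) = nrm F" using nrm_scale[of F "- 1"] by simp

lemma nrm_diff_triangle: "F : A ==> G : A ==> nrm (%x. F x - G x) <= nrm F + nrm G"
 using nrm_triangle[of F "%x. - G x"] nrm_minus[of G] A_minus[of G] by simp

lemma nrm_triangle3: assumes "F : A" "G : A" "H : A"
 shows "nrm (%x. F x - H x) <= nrm (%x. F x - G x) + nrm (%x. G x - H x)"
 using nrm_triangle[of "%x. F x - G x" "%x. G x - H x"] assms by (simp add: A_intros)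

lemma nrm_diff_commute: assumes "F : A" "G : A" shows "nrm (%x. F x - G x) = nrm (%x. G x - F x)"
 using nrm_minus[of "%x. F x - G x"] assms by (simp add: A_intros)

lemma nrm_diff_ge: assumes "F : A" "G : A" shows "nrm F <= nrm G + nrm (%x. F x - G x)"
 using nrm_triangle[of G "%x. F x - G x"] assms by (simp add: A_intros)

lemma nrm_sum: "(!!i. i : J ==> F i : A) ==> nrm (%x. \<Sum>i\<in>J. F i x) <= (\<Sum>i\<in>J. nrm (F i))"
proof (induction J rule: infinite_finite_induct)
 case (insert i J)
 then show ?case using nrm_triangle[of "F i" "%x. \<Sum>i\<in>J. F i x"] by (force simp: A_sum)
qed (simp_all add: nrm_def n2_def ip_def)

lemma nrm_tr: "F : A ==> nrm (tr g F) = nrm F" by (simp add: nrm_def n2_def ip_tr)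

lemma nrm_mono: assumes "F : A" "G : A" "!!x. cmod (F x) <= cmod (G x)" shows "nrm F <= nrm G"
proof -
 have "0 <= Re (I (%x. G x * cnj (G x) - F x * cnj (F x)))"
 proof (rule I_nonneg)
  fix x
  have e: "G x * cnj (G x) - F x * cnj (F x) = cx ((cmod (G x))^2 - (cmod (F x))^2)"
   by (simp only: of_real_diff complex_norm_square)
  show "Im (G x * cnj (G x) - F x * cnj (F x)) = 0" unfolding e by simp
  show "0 <= Re (G x * cnj (G x) - F x * cnj (F x))" unfolding e using assms(3)[of x] by (simp add: power_mono)
 qed (intro A_intros assms)
 then have "n2 F <= n2 G" unfolding n2_def ip_def by (subst (asm) I_diff) (auto intro!: A_intros assms)
 then show ?thesis by (simp add: nrm_def)
qed

lemma nrm_mult_bound: assumes "F : A" "G : A" "!!x. cmod (F x) <= C"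
 shows "nrm (%x. F x * G x) <= C * nrm G" "nrm (%x. G x * F x) <= C * nrm G"
proof -
 have C: "0 <= C" using assms(3) norm_ge_zero order_trans by blast
 have "nrm (%x. F x * G x) <= nrm (%x. cx C * G x)"
  using C by (intro nrm_mono A_intros assms) (auto simp: norm_mult intro!: mult_right_mono assms)
 then show "nrm (%x. F x * G x) <= C * nrm G" using C by (simp add: nrm_scale assms)
 then show "nrm (%x. G x * F x) <= C * nrm G" by (simp add: mult.commute)
qed

lemma nrm_mult1: assumes "F : A" "G : A" "!!x. cmod (F x) = 1"
 shows "nrm (%x. F x * G x) = nrm G"
 by (rule antisym; rule nrm_mono) (auto intro!: A_intros assms simp: norm_mult assms)

lemma nrm_one [simp]: "nrm (%x. 1) = 1" by (simp add: nrm_def n2_def ip_def)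

lemma nrm_const [simp]: "nrm (%x. c) = cmod c" using nrm_scale[OF A_const[of 1], of c] by simp

lemma nrm_bound: "F : A ==> (!!x. cmod (F x) <= C) ==> nrm F <= C"
 using nrm_mult_bound(1)[of F "%x. 1" C] A_const by simp

lemma ip_bound: "F : A ==> G : A ==> nrm F <= a ==> nrm G <= b ==> cmod (ip F G) <= a * b"
 using cauchy_schwarz[of F G] mult_mono[of "nrm F" a "nrm G" b] nrm_nonneg[of F] nrm_nonneg[of G] by linarith

lemma I_le_nrm: "F : A ==> cmod (I F) <= nrm F"
 using cauchy_schwarz[of F "%x. 1"] A_const by (simp add: ip_def)

lemma A_bound: assumes "F : A" obtains C where "0 < C" "!!x. cmod (F x) <= C"
proof -
 obtain B where "0 <= B" "!!x. cmod (F x) <= B" using A_bdd[OF assms] by (rule bddE) blast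
 then have "0 < B + 1" "cmod (F x) <= B + 1" for x using add_increasing2[of 1 "cmod (F x)" B] by simp_all
 then show ?thesis by (rule that)
qed

subsection \<open>Fourier coefficients\<close>

definition co :: "('a => complex) => ('x => complex) => complex" where "co zt F = ip F (ch zt)"

lemma ch_orth: assumes "chr zt" "chr ps" shows "ip (ch zt) (ch ps) = (if zt = ps then 1 else 0)"
proof (cases "zt = ps")
 case True
 then show ?thesis using norm1_cnj(1)[OF ch_norm[OF assms(1)]] by (simp add: ip_def)
next
 case False
 then obtain g where g: "zt g ~= ps g" by blast
 have "ip (ch zt) (ch ps) = ip (tr g (ch zt)) (tr g (ch ps))" by (simp add: ip_tr A_ch assms)
 also have "... = (zt g * cnj (ps g)) * ip (ch zt) (ch ps)"
  by (simp add: tr_ch assms ip_scale_left ip_scale_right A_intros)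
 finally have "(zt g * cnj (ps g) - 1) * ip (ch zt) (ch ps) = 0" by (simp add: algebra_simps)
 moreover have "zt g * cnj (ps g) ~= 1"
 proof
  assume "zt g * cnj (ps g) = 1"
  then have "ps g * (zt g * cnj (ps g)) = ps g" by simp
  moreover have "ps g * (zt g * cnj (ps g)) = zt g"
   using norm1_cnj(1)[OF chr_norm[OF assms(2), of g]] by (simp add: mult.left_commute)
  ultimately show False using g by simp
 qed
 ultimately show ?thesis using False by simp
qed

definition dec :: "('a => complex) set => ('x => complex) => 'x => complex" where
 "dec X F x = F x - (\<Sum>zt\<in>X. co zt F * ch zt x)"

lemma A_dec: assumes "F : A" "X <= Collect chr" shows "dec X F : A"
proof -
 have "(%x. F x - (\<Sum>zt\<in>X. co zt F * ch zt x)) : A"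
  using assms by (intro A_diff A_sum A_mult A_const A_ch) auto
 then show ?thesis unfolding dec_def[abs_def] .
qed

lemma co_dec: assumes "F : A" "finite X" "X <= Collect chr" "chr ps"
 shows "co ps (dec X F) = (if ps : X then 0 else co ps F)"
proof -
 have "co ps (dec X F) = co ps F - (\<Sum>zt\<in>X. co zt F * ip (ch zt) (ch ps))"
 proof -
  have "(%x. co zt F * ch zt x) : A" if "zt : X" for zt using that assms by (intro A_mult A_const A_ch) auto
  then have "ip (dec X F) (ch ps) = ip F (ch ps) - (\<Sum>zt\<in>X. ip (%x. co zt F * ch zt x) (ch ps))"
   unfolding dec_def[abs_def] by (simp add: ip_diff_left ip_sum_left A_sum A_ch assms)
  also have "(\<Sum>zt\<in>X. ip (%x. co zt F * ch zt x) (ch ps)) = (\<Sum>zt\<in>X. co zt F * ip (ch zt) (ch ps))"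
   using assms by (intro sum.cong refl ip_scale_left A_ch) auto
  finally show ?thesis by (simp add: co_def)
 qed
 also have "(\<Sum>zt\<in>X. co zt F * ip (ch zt) (ch ps)) = (\<Sum>zt\<in>X. if zt = ps then co zt F else 0)"
  using assms by (intro sum.cong refl) (auto simp: ch_orth)
 also have "... = (if ps : X then co ps F else 0)" using assms(2) by (simp add: sum.delta')
 finally show ?thesis by auto
qed

lemma n2_dec: assumes "F : A" "finite X" "X <= Collect chr"
 shows "n2 (dec X F) = n2 F - (\<Sum>zt\<in>X. (cmod (co zt F))^2)"
proof -
 have D: "dec X F : A" using assms by (intro A_dec)
 have t: "(%x. co zt F * ch zt x) : A" if "zt : X" for zt using that assms by (intro A_mult A_const A_ch) auto
 have z: "ip (dec X F) (%x. \<Sum>zt\<in>X. co zt F * ch zt x) = 0"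
 proof -
  have "ip (dec X F) (%x. \<Sum>zt\<in>X. co zt F * ch zt x) = (\<Sum>zt\<in>X. cnj (co zt F) * co zt (dec X F))"
   using assms D t by (subst ip_sum_right) (auto simp: co_def intro!: sum.cong ip_scale_right A_ch)
  also have "... = 0"
  proof (intro sum.neutral ballI)
   fix zt assume "zt : X"
   then show "cnj (co zt F) * co zt (dec X F) = 0" using co_dec[OF assms, of zt] assms(3) by auto
  qed
  finally show ?thesis .
 qed
 have "ip (dec X F) (dec X F) = ip (dec X F) F - ip (dec X F) (%x. \<Sum>zt\<in>X. co zt F * ch zt x)"
  by (subst (2) dec_def[abs_def]) (intro ip_diff_right A_sum t D assms)
 also have "... = ip F F - (\<Sum>zt\<in>X. co zt F * ip (ch zt) F)"
 proof -
  have "ip (dec X F) F = ip F F - ip (%x. \<Sum>zt\<in>X. co zt F * ch zt x) F"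
   by (subst (1) dec_def[abs_def]) (intro ip_diff_left A_sum t D assms)
  also have "ip (%x. \<Sum>zt\<in>X. co zt F * ch zt x) F = (\<Sum>zt\<in>X. co zt F * ip (ch zt) F)"
   using assms t by (subst ip_sum_left) (auto intro!: sum.cong ip_scale_left A_ch)
  finally show ?thesis by (simp add: z)
 qed
 also have "(\<Sum>zt\<in>X. co zt F * ip (ch zt) F) = (\<Sum>zt\<in>X. cx ((cmod (co zt F))^2))"
 proof (intro sum.cong refl)
  fix zt assume "zt : X"
  then have "ip (ch zt) F = cnj (co zt F)" unfolding co_def using assms by (subst ip_cnj) (auto intro: A_ch)
  then show "co zt F * ip (ch zt) F = cx ((cmod (co zt F))^2)" by (simp add: complex_norm_square del: of_real_power)
 qed
 finally show ?thesis unfolding n2_def by simp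
qed

lemma nrm_dec: assumes "F : A" "finite X" "X <= Collect chr" shows "nrm (dec X F) <= nrm F"
 unfolding nrm_def using n2_dec[OF assms] sum_nonneg[of X "%zt. (cmod (co zt F))^2"] by simp

lemma bessel: assumes "F : A" "finite X" "X <= Collect chr"
 shows "(\<Sum>zt\<in>X. (cmod (co zt F))^2) <= n2 F"
 using n2_dec[OF assms] n2_nonneg(1)[OF A_dec[OF assms(1,3)]] by simp

text \<open>Bessel's inequality with Chebyshev's counting. The bound depends on \<open>F\<close>
  through its norm only and is therefore uniform over families of bounded norm.\<close>

lemma spec_card: assumes "F : A" "0 < \<eta>" "X <= {zt. chr zt & \<eta> <= cmod (co zt F)}" "finite X"
 shows "real (card X) <= n2 F / \<eta>\<^sup>2"
proof -
 have "real (card X) * \<eta>\<^sup>2 = (\<Sum>zt\<in>X. \<eta>\<^sup>2)" by simp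
 also have "... <= (\<Sum>zt\<in>X. (cmod (co zt F))^2)" using assms by (intro sum_mono power_mono) auto
 also have "... <= n2 F" using assms by (intro bessel) auto
 finally show ?thesis using assms(2) by (simp add: pos_le_divide_eq)
qed

lemma spec_finite: assumes "F : A" "0 < \<eta>" shows "finite {zt. chr zt & \<eta> <= cmod (co zt F)}"
proof (rule ccontr)
 assume inf: "infinite {zt. chr zt & \<eta> <= cmod (co zt F)}"
 obtain X where X: "X <= {zt. chr zt & \<eta> <= cmod (co zt F)}" "finite X" "card X = Suc (nat \<lceil>n2 F / \<eta>\<^sup>2\<rceil>)"
  using infinite_arbitrarily_large[OF inf] by blast
 have "real (card X) <= n2 F / \<eta>\<^sup>2" using spec_card[OF assms X(1,2)] .
 then show False using X(3) by linarith
qed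

end

section \<open>Correlations and Fourier coefficients\<close>

text \<open>In terms of spectral measures this is multiplication by the nonnegative density 1 plus
  the real part of \<open>c\<close> times the character value at \<open>g\<close>. Directly, the
  form at \<open>n\<close> points is half the form of \<open>ph\<close> at the doubled set of points
  \<open>p i\<close> and \<open>p i + g\<close> with coefficients \<open>d i\<close> and
  \<open>c * d i\<close>.\<close>

lemma pd_closed_sum:
 assumes "pd ph" "cmod c = 1"
 shows "pd (%h. ph h + (c * ph (h + g) + cnj c * ph (h - g)) / 2)"
 unfolding pd_def
proof (intro allI)
 fix n :: nat and p :: "nat => 'a" and d :: "nat => complex"
 define q where "q i = (if i < n then p i else p (i - n) + g)" for i
 define e where "e i = (if i < n then d i else c * d (i - n))" for i
 have cc: "c * cnj c = 1" by (rule norm1_cnj(1)[OF assms(2)])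
 let ?s = "\<Sum>i<n. \<Sum>j<n. d i * cnj (d j) * (ph (p i - p j) + (c * ph (p i - p j + g) + cnj c * ph (p i - p j - g)) / 2)"
 define S1 where "S1 = (\<Sum>i<n. \<Sum>j<n. d i * cnj (d j) * ph (p i - p j))"
 define S2 where "S2 = (\<Sum>i<n. \<Sum>j<n. d i * cnj (d j) * (c * ph (p i - p j + g)))"
 define S3 where "S3 = (\<Sum>i<n. \<Sum>j<n. d i * cnj (d j) * (cnj c * ph (p i - p j - g)))"
 have s: "?s = S1 + (S2 + S3) / 2"
  unfolding S1_def S2_def S3_def by (simp add: sum.distrib sum_divide_distrib add_divide_distrib distrib_left)
 have 1: "(\<Sum>i<n. \<Sum>j<n. e i * cnj (e j) * ph (q i - q j)) = S1"
  unfolding S1_def by (intro sum.cong refl) (simp add: e_def q_def)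
 have 2: "(\<Sum>i<n. \<Sum>j<n. e i * cnj (e (n + j)) * ph (q i - q (n + j))) = S3"
  unfolding S3_def by (intro sum.cong refl) (simp add: e_def q_def diff_diff_eq)
 have 3: "(\<Sum>i<n. \<Sum>j<n. e (n + i) * cnj (e j) * ph (q (n + i) - q j)) = S2"
  unfolding S2_def by (intro sum.cong refl) (simp add: e_def q_def algebra_simps)
 have 4: "(\<Sum>i<n. \<Sum>j<n. e (n + i) * cnj (e (n + j)) * ph (q (n + i) - q (n + j))) = S1"
  unfolding S1_def
 proof (intro sum.cong refl)
  fix i j
  have "e (n + i) * cnj (e (n + j)) = (c * cnj c) * (d i * cnj (d j))" by (simp add: e_def)
  then show "e (n + i) * cnj (e (n + j)) * ph (q (n + i) - q (n + j)) = d i * cnj (d j) * ph (p i - p j)"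
   by (simp add: cc q_def)
 qed
 have "(\<Sum>i<n + n. \<Sum>j<n + n. e i * cnj (e j) * ph (q i - q j)) = 2 * ?s"
  unfolding sum_lessThan_split sum.distrib 1 2 3 4 s by simp
 then show "0 <= Re ?s & Im ?s = 0"
  using pdD[OF assms(1), where n = "n + n" and c = e and p = q] by simp
qed

lemma pd_limit_closed: "closed {ph :: 'a::ab_group_add => complex. pd ph}"
 unfolding pd_def
 by (intro closed_Collect_conj closed_Collect_all closed_Collect_eq closed_Collect_le continuous_on_const
   continuous_on_Re continuous_on_Im continuous_on_sum continuous_on_mult continuous_on_product_coordinates)

lemma fun_tendsto_coord:
 fixes f :: "nat => 'i => 'b::topological_space"
 assumes "f \<longlonglongrightarrow> l" shows "(%k. f k h) \<longlonglongrightarrow> l h"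
proof (rule topological_tendstoI)
 fix U :: "'b set" assume U: "open U" "l h : U"
 have "open ((%m. m h) -` U)" using U(1) by (intro open_vimage continuous_on_product_coordinates)
 from topological_tendstoD[OF assms this] U(2) show "\<forall>\<^sub>F k in sequentially. f k h : U" by simp
qed

text \<open>\<open>ph\<close> is half the sum of the positive definite functions
  \<open>ps c g\<close> and \<open>ps (- c) g\<close>. Extremality makes each proportional to
  \<open>ph\<close>, and the cases of \<open>c\<close> equal to 1 and \<i> together give
  multiplicativity; unimodularity follows from \<open>ph (- g) = cnj (ph g)\<close>.\<close>

lemma extreme_pd_char:
 fixes ph :: "'a::ab_group_add => complex"
 assumes ph: "pd ph" "ph 0 = 1"
  and ex: "!!y z t. pd y ==> y 0 = 1 ==> pd z ==> z 0 = 1 ==> 0 < t ==> t < (1::real) ==>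
    ph = (%i. t *\<^sub>R y i + (1 - t) *\<^sub>R z i) ==> y = ph & z = ph"
 shows "chr ph"
proof -
 define ps where "ps c g h = ph h + (c * ph (h + g) + cnj c * ph (h - g)) / 2" for c g h
 have neg: "ph (- g) = cnj (ph g)" for g by (rule pd_uminus[OF ph(1)])
 have pdps: "pd (ps c g)" if "cmod c = 1" for c g
  unfolding ps_def by (rule pd_closed_sum[OF ph(1) that])
 have ps0: "ps c g 0 = cx (1 + Re (c * ph g))" for c g
  by (simp add: ps_def ph(2) neg complex_eq_iff)
 have zero: "ps c g h = 0" if "cmod c = 1" "1 + Re (c * ph g) = 0" for c g h
  using pd_bound[OF pdps[OF that(1)], of g h] that(2) unfolding ps0 by simp
 have sum: "ps c g h + ps (- c) g h = 2 * ph h" for c g h by (simp add: ps_def field_simps)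
 have key: "ps c g h = (1 + Re (c * ph g)) * ph h" if c: "cmod c = 1" for c g h
 proof -
  define w where "w = 1 + Re (c * ph g)"
  have c': "cmod (- c) = 1" using c by simp
  have w: "0 <= w" "0 <= 2 - w"
   using pd_zero(1)[OF pdps[OF c]] pd_zero(1)[OF pdps[OF c']] unfolding ps0 w_def by simp_all
  \<comment> \<open>\<open>w\<close> and \<open>2 - w\<close> are the masses of the two halves; if
    one of them is 0, the corresponding function vanishes identically by
    \<open>pd_bound\<close>.\<close>
  consider "w = 0" | "w = 2" | "0 < w" "w < 2" using w by linarith
  then have "ps c g h = w * ph h"
  proof cases
   case 1
   then show ?thesis using zero[OF c, of g] by (simp add: w_def)
  next
   case 2
   then have "ps (- c) g h = 0" using zero[OF c', of g h] by (simp add: w_def)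
   then show ?thesis using sum[of c g h] 2 by simp
  next
   case 3
   define y where "y h = ps c g h / w" for h
   define z where "z h = ps (- c) g h / (2 - w)" for h
   have sc: "pd (%h. \<alpha> h / r)" if "pd \<alpha>" "0 < r" for \<alpha> :: "'a => complex" and r :: real
    unfolding pd_def
   proof (intro allI)
    fix n :: nat and p :: "nat => 'a" and d :: "nat => complex"
    have "(\<Sum>i<n. \<Sum>j<n. d i * cnj (d j) * (\<alpha> (p i - p j) / r)) = (\<Sum>i<n. \<Sum>j<n. d i * cnj (d j) * \<alpha> (p i - p j)) / r"
     by (simp add: sum_divide_distrib)
    then show "0 <= Re (\<Sum>i<n. \<Sum>j<n. d i * cnj (d j) * (\<alpha> (p i - p j) / r)) &
     Im (\<Sum>i<n. \<Sum>j<n. d i * cnj (d j) * (\<alpha> (p i - p j) / r)) = 0"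
     using pdD[OF that(1), where n = n and p = p and c = d] that(2) by (simp del: Re_sum Im_sum)
   qed
   have 1: "pd y" "pd z" unfolding y_def z_def using 3 pdps[OF c, of g] pdps[OF c', of g]
     sc[of "ps c g" w] sc[of "ps (- c) g" "2 - w"] by simp_all
   have "ps c g 0 = cx w" "ps (- c) g 0 = cx (2 - w)"
    unfolding ps0 w_def by simp_all
   moreover have "cx w ~= 0" "cx (2 - w) ~= 0" using 3 by (simp_all del: of_real_diff)
   ultimately have 2: "y 0 = 1" "z 0 = 1" unfolding y_def z_def by (simp_all del: of_real_diff)
   have eq: "ph = (%i. (w / 2) *\<^sub>R y i + (1 - w / 2) *\<^sub>R z i)"
   proof
    fix i
    have a: "(w / 2) *\<^sub>R y i = ps c g i / 2" using 3 by (simp add: y_def scaleR_conv_of_real)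
    have b: "(1 - w / 2) *\<^sub>R z i = ps (- c) g i / 2"
    proof -
     have e: "cx (1 - w / 2) = cx (2 - w) / 2" by simp
     have nz: "cx (2 - w) ~= 0" using 3 by (simp del: of_real_diff)
     have W: "W / 2 * (v / W) = v / 2" if "W ~= 0" for W v :: complex using that by simp
     show ?thesis unfolding z_def scaleR_conv_of_real e by (rule W[OF nz])
    qed
    show "ph i = (w / 2) *\<^sub>R y i + (1 - w / 2) *\<^sub>R z i"
     unfolding a b add_divide_distrib[symmetric] sum by simp
   qed
   have "0 < w / 2" "w / 2 < 1" using 3 by simp_all
   from ex[OF 1(1) 2(1) 1(2) 2(2) this eq] have "y h = ph h" by simp
   then show ?thesis using 3 by (simp add: y_def field_simps)
  qed
  then show ?thesis by (simp add: w_def)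
 qed
 have add: "ph (h + g) = ph h * ph g" for h g
 proof -
  have k1: "ph (h + g) + ph (h - g) = 2 * (cx (Re (ph g)) * ph h)"
   using key[of 1 g h] by (simp add: ps_def distrib_right)
  have "\<i> * (ph (h + g) - ph (h - g)) = - (2 * (cx (Im (ph g)) * ph h))"
   using key[of \<i> g h] by (simp add: ps_def left_diff_distrib right_diff_distrib)
  then have "\<i> * (\<i> * (ph (h + g) - ph (h - g))) = \<i> * (- (2 * (cx (Im (ph g)) * ph h)))" by simp
  then have k2: "ph (h + g) - ph (h - g) = 2 * (\<i> * cx (Im (ph g)) * ph h)"
   by (simp flip: mult.assoc) (simp add: algebra_simps)
  have "2 * ph (h + g) = (ph (h + g) + ph (h - g)) + (ph (h + g) - ph (h - g))" by simp
  also have "... = 2 * ((cx (Re (ph g)) + \<i> * cx (Im (ph g))) * ph h)"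
   unfolding k1 k2 by (simp add: algebra_simps)
  also have "cx (Re (ph g)) + \<i> * cx (Im (ph g)) = ph g" by (simp add: complex_eq_iff)
  finally show ?thesis by (simp add: mult.commute)
 qed
 have "cmod (ph g) = 1" for g
 proof -
  have "ph g * cnj (ph g) = 1" using add[of g "- g"] by (simp add: neg ph(2))
  then have "cx ((cmod (ph g))^2) = 1" by (simp add: complex_norm_square del: of_real_power)
  then have "(cmod (ph g))^2 = 1" by (simp only: of_real_eq_1_iff)
  then show ?thesis by (simp add: power2_eq_1_iff) (use norm_ge_zero[of "ph g"] in linarith)
 qed
 with add show ?thesis by (simp add: chr_def)
qed

context sys
begin

lemma gam_sum:
 assumes "F : A"
 shows "(\<Sum>i<n. \<Sum>j<n. c i * cnj (c j) * ip (tr (p i - p j) F) F) = cx (n2 (%x. \<Sum>i<(n::nat). c i * tr (p i) F x))"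
proof -
 have s: "ip (tr (p i - p j) F) F = ip (tr (p i) F) (tr (p j) F)" for i j
  using ip_tr[of "tr (p i - p j) F" F "p j"] by (simp add: assms A_tr tr_tr)
 have "ip (%x. \<Sum>i<n. c i * tr (p i) F x) (%x. \<Sum>i<n. c i * tr (p i) F x) =
  (\<Sum>i<n. \<Sum>j<n. c i * cnj (c j) * ip (tr (p i) F) (tr (p j) F))"
  by (simp add: ip_sum_left ip_sum_right ip_scale_left ip_scale_right A_intros assms sum_distrib_left mult.assoc)
 then show ?thesis unfolding s by (simp add: ip_self A_intros assms)
qed

lemma gam_pd: assumes "F : A" shows "pd (%h. ip (tr h F) F)"
 unfolding pd_def gam_sum[OF assms] by (simp add: n2_nonneg A_intros assms)

text \<open>Schur product argument: pointwise in \<open>x\<close> the form is that of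
  \<open>ph\<close> with coefficients \<open>c i * cnj (tr (p i) F x)\<close>, and integration
  preserves its sign.\<close>

lemma pd_gam_prod:
 assumes "F : A" "pd ph"
 shows "pd (%h. ph h * cnj (ip (tr h F) F))"
 unfolding pd_def
proof (intro allI)
 fix n :: nat and p :: "nat => 'a" and c :: "nat => complex"
 have s: "cnj (ip (tr (p i - p j) F) F) = I (%x. tr (p j) F x * cnj (tr (p i) F x))" for i j
  using ip_tr[of F "tr (p i - p j) F" "p j"] by (simp add: assms A_tr tr_tr ip_cnj) (simp add: ip_def)
 define H where "H x = (\<Sum>i<n. \<Sum>j<n. (c i * cnj (tr (p i) F x)) * cnj (c j * cnj (tr (p j) F x)) * ph (p i - p j))" for x
 have "(\<Sum>i<n. \<Sum>j<n. c i * cnj (c j) * (ph (p i - p j) * cnj (ip (tr (p i - p j) F) F)))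
  = I (%x. \<Sum>i<n. \<Sum>j<n. (c i * cnj (c j) * ph (p i - p j)) * (tr (p j) F x * cnj (tr (p i) F x)))"
  unfolding s by (simp add: I_sum I_scale A_intros assms mult.assoc)
 also have "... = I H" unfolding H_def[abs_def] by (simp add: algebra_simps)
 finally have e: "(\<Sum>i<n. \<Sum>j<n. c i * cnj (c j) * (ph (p i - p j) * cnj (ip (tr (p i - p j) F) F))) = I H" .
 have HA: "H : A" unfolding H_def[abs_def] by (intro A_intros assms)
 have H: "0 <= Re (H x)" "Im (H x) = 0" for x unfolding H_def by (rule pdD[OF assms(2)])+
 have "cnj (H x) = H x" for x using H(2)[of x] by (simp add: complex_eq_iff)
 then have "(%x. cnj (H x)) = H" by (rule ext)
 with I_cnj[OF HA] have "cnj (I H) = I H" by (simp only:)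
 then have "Im (I H) = 0" by (simp add: complex_eq_iff)
 moreover have "0 <= Re (I H)" using H HA by (intro I_nonneg)
 ultimately show "0 <= Re (\<Sum>i<n. \<Sum>j<n. c i * cnj (c j) * (ph (p i - p j) * cnj (ip (tr (p i - p j) F) F))) &
  Im (\<Sum>i<n. \<Sum>j<n. c i * cnj (c j) * (ph (p i - p j) * cnj (ip (tr (p i - p j) F) F))) = 0" unfolding e by simp
qed

lemma erg_nrm: assumes "F : A" "0 < eps"
 obtains n p where "0 < n" "nrm (%x. (\<Sum>i<n. tr (p i) F x) / of_nat n) <= cmod (I F) + eps"
proof -
 have "0 < eps\<^sup>2" using assms(2) by simp
 from erg[OF assms(1) this] obtain n p where np: "0 < n"
  "n2 (%x. (\<Sum>i<n. tr (p i) F x) / of_nat n - I F) < eps\<^sup>2" by (auto simp: n2_def ip_def tr_def)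
 have av: "(%x. (\<Sum>i<n. tr (p i) F x) / of_nat n) : A"
  using A_mult[OF A_const[of "1 / of_nat n"] A_sum[of "{..<n}" "%i. tr (p i) F"]] A_tr[OF assms(1)] by simp
 have "nrm (%x. (\<Sum>i<n. tr (p i) F x) / of_nat n - I F) <= eps"
  using np(2) assms(2) by (simp add: nrm_def real_le_lsqrt)
 moreover have "nrm (%x. (\<Sum>i<n. tr (p i) F x) / of_nat n) <= nrm (%x. I F) + nrm (%x. (\<Sum>i<n. tr (p i) F x) / of_nat n - I F)"
  by (rule nrm_diff_ge[OF av A_const])
 ultimately show ?thesis using that[OF np(1), of p] by simp
qed

end

section \<open>Averages of correlations over a second invariant mean\<close>

text \<open>The mean \<open>m\<close> that averages over the group is independent of the one that
  produces the system: the latter realises the density, while the former will be one that vanishes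
  on the good set.\<close>

locale sysm = sys A I \<tau> pr + imean m
 for A :: "('x => complex) set" and I :: "('x => complex) => complex"
  and \<tau> :: "'a::{ab_group_add, countable} => 'x => 'x" and pr :: "'x => 'a"
  and m :: "('a => real) => real"
begin

lemma bdd_ip:
 assumes "!!h. Y h : A" "!!h. Z h : A" "!!h. nrm (Y h) <= a" "!!h. nrm (Z h) <= b"
 shows "bdd (%h. ip (Y h) (Z h))"
 by (rule bddI[of _ "a * b"]) (intro ip_bound assms)

lemma bdd_I:
 assumes "!!h. Y h : A" "!!h. nrm (Y h) <= a"
 shows "bdd (%h. I (Y h))"
 by (rule bddI[of _ a]) (meson I_le_nrm assms order_trans)

lemma bdd_gam: "F : A ==> G : A ==> bdd (%h. ip (tr (f h) F) G)"
 by (rule bdd_ip[of _ _ "nrm F" "nrm G"]) (auto simp: A_tr nrm_tr)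

text \<open>Twisting \<open>F\<close> by the conjugate character absorbs \<open>zt\<close> into the
  correlation function. For the trivial character the bound is \<open>pd_mean_le\<close> at the
  points supplied by the ergodic theorem.\<close>

lemma mean_gam_char_le:
 assumes F: "F : A" and z: "chr zt"
 shows "Re (cm (%h. cnj (zt h) * ip (tr h F) F)) <= (cmod (co zt F))^2"
proof -
 define G where "G x = F x * cnj (ch zt x)" for x
 have GA: "G : A" unfolding G_def[abs_def] by (intro A_intros F z)
 have cn: "cnj (zt h) * ip (tr h F) F = ip (tr h G) G" for h
 proof -
  have "tr h G x * cnj (G x) = cnj (zt h) * (tr h F x * cnj (F x))" for x
   using norm1_cnj(2)[OF ch_norm[OF z, of x]]
   by (simp add: G_def tr_def ch_def pr_tau chr_add[OF z] mult.commute mult.left_commute)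
  then show ?thesis unfolding ip_def by (simp add: I_scale A_intros F)
 qed
 have IG: "I G = co zt F" unfolding co_def ip_def G_def[abs_def] by simp
 have "Re (cm (%h. ip (tr h G) G)) <= (cmod (I G) + eps)^2" if e: "0 < eps" for eps
 proof -
  obtain n p where np: "0 < n" "nrm (%x. (\<Sum>i<n. tr (p i) G x) / of_nat n) <= cmod (I G) + eps"
   using erg_nrm[OF GA e] by blast
  have sA: "(%x. \<Sum>i<n. tr (p i) G x) : A" by (intro A_intros GA)
  have "Re (cm (%h. ip (tr h G) G)) <= Qav n p (%h. ip (tr h G) G)" by (rule pd_mean_le[OF gam_pd[OF GA] np(1)])
  also have "... = n2 (%x. \<Sum>i<n. tr (p i) G x) / (real n)^2"
   using gam_sum[OF GA, where c = "%_. 1" and n = n and p = p] by (simp add: Qav_def)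
  also have "... = n2 (%x. (1 / of_nat n) * (\<Sum>i<n. tr (p i) G x))"
   using n2_scale[OF sA, of "1 / of_nat n"] by (simp add: norm_divide power_divide)
  also have "... = (nrm (%x. (\<Sum>i<n. tr (p i) G x) / of_nat n))^2"
   using nrm_sq[OF A_mult[OF A_const[of "1 / of_nat n"] sA]] by simp
  also have "... <= (cmod (I G) + eps)^2"
   using np(2) nrm_nonneg[OF A_mult[OF A_const[of "1 / of_nat n"] sA]] by (intro power_mono) simp_all
  finally show ?thesis .
 qed
 then have "Re (cm (%h. ip (tr h G) G)) <= (cmod (I G) + 0)^2"
  by (intro tendsto_lowerbound[where F = "at_right 0" and f = "%eps. (cmod (I G) + eps)^2"] tendsto_intros)
   (auto simp: eventually_at_filter)
 then show ?thesis by (simp add: cn IG)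
qed

text \<open>A Wiener type estimate by convexity. The functional \<open>Lf\<close> on normalised
  positive definite functions is an infimum of continuous ones, hence upper semicontinuous, and it
  attains its maximum at an extreme point, that is at a character, where
  \<open>mean_gam_char_le\<close> bounds it by the square of \<sigma>. Its value at the normalised
  correlation function of \<open>F\<close> is the quantity to be bounded.\<close>

lemma W0:
 assumes F: "F : A" and \<sigma>: "!!zt. chr zt ==> cmod (co zt F) <= \<sigma>"
 shows "m (%h. (cmod (ip (tr h F) F))^2) <= n2 F * \<sigma>\<^sup>2"
proof -
 define \<gamma> where "\<gamma> h = ip (tr h F) F" for h
 have \<gamma>b: "cmod (\<gamma> h) <= n2 F" for h
  using cauchy_schwarz[of "tr h F" F] F by (simp add: \<gamma>_def A_tr nrm_tr nrm_sq flip: power2_eq_square)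
 show ?thesis
 proof (cases "n2 F = 0")
  case True
  then have "cmod (\<gamma> h) = 0" for h using \<gamma>b[of h] by simp
  then show ?thesis using True by (simp add: \<gamma>_def)
 next
  case False
  then have npos: "0 < n2 F" using n2_nonneg(1)[OF F] by simp
  define PP where "PP = {ph :: 'a => complex. pd ph & ph 0 = 1}"
  define Lf where "Lf ph = Re (cm (%h. ph h * cnj (\<gamma> h)))" for ph :: "'a => complex"
  have prod: "pd (%h. ph h * cnj (\<gamma> h))" if "ph : PP" for ph
   using pd_gam_prod[OF F] that unfolding PP_def \<gamma>_def by simp
  have clPP: "closed PP"
  proof -
   have "PP = {ph. pd ph} \<inter> {ph. ph 0 = 1}" by (auto simp: PP_def)
   then show ?thesis
    by (simp only:) (intro closed_Int pd_limit_closed closed_Collect_eq continuous_on_const continuous_on_product_coordinates)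
  qed
  have norm1: "cmod (ph h) <= 1" if "ph : PP" for ph h using pd_bound[of ph h] that by (simp add: PP_def)
  have cPP: "compact PP"
  proof -
   have "compact {ph :: 'a => complex. ALL h. ph h : cball 0 1}" by (rule compact_Pi_UNIV) simp
   moreover have "PP <= {ph. ALL h. ph h : cball 0 1}" using norm1 by auto
   ultimately show ?thesis using clPP by (metis compact_Int_closed inf.absorb2)
  qed
  have Lfb: "Lf ph <= n2 F" if "ph : PP" for ph
  proof -
   have "cmod (cm (%h. ph h * cnj (\<gamma> h))) <= n2 F"
    by (rule norm_cm_bound[OF pd_bdd[OF prod[OF that]]])
     (use norm1[OF that] \<gamma>b in \<open>auto simp: norm_mult intro: mult_le_one order_trans[OF mult_mono[where b = 1]]\<close>)
   then show ?thesis unfolding Lf_def using complex_Re_le_cmod order_trans by blast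
  qed
  \<comment> \<open>A finite quadratic average close to \<open>Lf l\<close> is continuous in the
    positive definite function, and at the approximants it dominates \<open>Lf\<close>.\<close>
  have usc: "S <= Lf l" if U: "!!k. f k : PP" "l : PP" "f \<longlonglongrightarrow> l" "!!k. S - 1 / real (Suc k) <= Lf (f k)" for f l S
  proof (rule field_le_epsilon)
   fix eps :: real assume "0 < eps"
   then obtain n p where np: "0 < n" "Qav n p (%h. l h * cnj (\<gamma> h)) <= Lf l + eps"
    using pd_mean_inf[OF prod[OF U(2)]] unfolding Lf_def by blast
   have "(%k. Qav n p (%h. f k h * cnj (\<gamma> h))) \<longlonglongrightarrow> Qav n p (%h. l h * cnj (\<gamma> h))"
    unfolding Qav_def using np(1) by (intro tendsto_intros fun_tendsto_coord[OF U(3)]) simp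
   moreover have "(%k. S - 1 / real (Suc k)) \<longlonglongrightarrow> S - 0"
    by (intro tendsto_intros LIMSEQ_Suc lim_1_over_n)
   moreover have "S - 1 / real (Suc k) <= Qav n p (%h. f k h * cnj (\<gamma> h))" for k
    using U(4)[of k] pd_mean_le[OF prod[OF U(1)[of k]] np(1), of p] unfolding Lf_def by linarith
   ultimately have "S - 0 <= Qav n p (%h. l h * cnj (\<gamma> h))"
    by (intro LIMSEQ_le[of "%k. S - 1 / real (Suc k)"]) auto
   then show "S <= Lf l + eps" using np(2) by simp
  qed
  define \<gamma>0 where "\<gamma>0 h = cx (1 / n2 F) * \<gamma> h" for h
  have \<gamma>0: "\<gamma>0 : PP"
  proof -
   have "pd \<gamma>0"
    unfolding pd_def
   proof (intro allI)
    fix n :: nat and p :: "nat => 'a" and c :: "nat => complex"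
    have "(\<Sum>i<n. \<Sum>j<n. c i * cnj (c j) * \<gamma>0 (p i - p j)) = cx (1 / n2 F) * (\<Sum>i<n. \<Sum>j<n. c i * cnj (c j) * ip (tr (p i - p j) F) F)"
     by (simp add: \<gamma>0_def \<gamma>_def sum_distrib_left sum_divide_distrib)
    also have "... = cx ((1 / n2 F) * n2 (%x. \<Sum>i<n. c i * tr (p i) F x))"
     unfolding gam_sum[OF F] by simp
    finally show "0 <= Re (\<Sum>i<n. \<Sum>j<n. c i * cnj (c j) * \<gamma>0 (p i - p j)) & Im (\<Sum>i<n. \<Sum>j<n. c i * cnj (c j) * \<gamma>0 (p i - p j)) = 0"
     using npos n2_nonneg(1)[of "%x. \<Sum>i<n. c i * tr (p i) F x"] by (simp add: A_intros F del: Re_sum Im_sum)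
   qed
   moreover have "\<gamma>0 0 = 1" using npos by (simp add: \<gamma>0_def \<gamma>_def ip_self[OF F])
   ultimately show ?thesis by (simp add: PP_def)
  qed
  define S where "S = Sup (Lf ` PP)"
  have bab: "bdd_above (Lf ` PP)" using Lfb by (intro bdd_aboveI2)
  have leS: "Lf ph <= S" if "ph : PP" for ph unfolding S_def using bab that by (intro cSUP_upper)
  have "EX ph:PP. S - 1 / real (Suc k) <= Lf ph" for k
  proof -
   have "S - 1 / real (Suc k) < Sup (Lf ` PP)" by (simp add: S_def)
   then have "EX y:Lf ` PP. S - 1 / real (Suc k) < y" using \<gamma>0 bab by (subst (asm) less_cSup_iff) auto
   then show ?thesis by (auto intro: less_imp_le)
  qed
  then obtain f where f: "!!k. f k : PP" "!!k. S - 1 / real (Suc k) <= Lf (f k)" by metis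
  \<comment> \<open>Sequences suffice because the group is countable, which makes the pointwise
    topology first countable.\<close>
  obtain l r where lr: "l : PP" "strict_mono (r :: nat => nat)" "(f \<circ> r) \<longlonglongrightarrow> l"
   using compact_imp_seq_compact[OF cPP] f(1) unfolding seq_compact_def by blast
  have "S <= Lf l"
  proof (rule usc[OF _ lr(1) lr(3)])
   fix k
   show "(f \<circ> r) k : PP" using f by simp
   have "1 / real (Suc (r k)) <= 1 / real (Suc k)" using seq_suble[OF lr(2), of k] by (intro divide_left_mono) auto
   then show "S - 1 / real (Suc k) <= Lf ((f \<circ> r) k)" using f(2)[of "r k"] by simp
  qed
  define K where "K = {ph : PP. Lf ph = S}"
  have lK: "l : K" using \<open>S <= Lf l\<close> leS[OF lr(1)] lr(1) by (simp add: K_def)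
  have clK: "closed K"
   unfolding closed_sequential_limits
  proof (intro allI impI, elim conjE)
   fix g l' assume g: "ALL k. g k : K" "g \<longlonglongrightarrow> l'"
   then have gP: "g k : PP" for k by (simp add: K_def)
   have l': "l' : PP" using clPP gP g(2) unfolding closed_sequential_limits by blast
   have "S <= Lf l'"
    by (rule usc[OF gP l' g(2)]) (use g(1) in \<open>simp add: K_def\<close>)
   then show "l' : K" using leS[OF l'] l' by (simp add: K_def)
  qed
  have lin: "Lf (%i. t *\<^sub>R y i + (1 - t) *\<^sub>R z i) = t * Lf y + (1 - t) * Lf z" if "y : PP" "z : PP" for t y z
  proof -
   have "(%h. (t *\<^sub>R y h + (1 - t) *\<^sub>R z h) * cnj (\<gamma> h))
    = (%h. cx t * (y h * cnj (\<gamma> h)) + cx (1 - t) * (z h * cnj (\<gamma> h)))"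
    by (auto simp: scaleR_conv_of_real algebra_simps)
   then show ?thesis unfolding Lf_def
    using pd_bdd[OF prod[OF that(1)]] pd_bdd[OF prod[OF that(2)]]
    by (simp only: cm_add cm_scale bdd_mult bdd_const) simp
  qed
  have "face PP K"
   unfolding face_def
  proof (intro ballI allI impI)
   fix x y z t assume h: "x : K" "y : PP" "z : PP" "0 < t & t < 1 & x = (%i. t *\<^sub>R y i + (1 - t) *\<^sub>R z i)"
   have eq: "S = t * Lf y + (1 - t) * Lf z" using h lin[of y z t] by (auto simp: K_def)
   have t: "0 < t" "0 < 1 - t" using h by auto
   have "t * (S - Lf y) + (1 - t) * (S - Lf z) = 0" using eq by (simp add: algebra_simps)
   moreover have "0 <= t * (S - Lf y)" "0 <= (1 - t) * (S - Lf z)" using leS h t by auto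
   ultimately have "t * (S - Lf y) = 0" "(1 - t) * (S - Lf z) = 0" by linarith+
   then show "y : K & z : K" using t h by (auto simp: K_def)
  qed
  then obtain ph where ph: "ph : K" "!!y z t. y : PP ==> z : PP ==> 0 < t ==> t < 1 ==>
    ph = (%i. t *\<^sub>R y i + (1 - t) *\<^sub>R z i) ==> y = ph & z = ph"
   using exists_extreme_point[OF cPP clK _ _ \<open>face PP K\<close>] lK unfolding K_def by blast
  have "chr ph"
  proof (rule extreme_pd_char)
   show "pd ph" "ph 0 = 1" using ph(1) by (auto simp: K_def PP_def)
   show "y = ph & z = ph" if "pd y" "y 0 = 1" "pd z" "z 0 = 1" "0 < t" "t < 1" "ph = (%i. t *\<^sub>R y i + (1 - t) *\<^sub>R z i)" for y z t
    using that by (intro ph(2)) (auto simp: PP_def)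
  qed
  have "S = Re (cm (%h. ph h * cnj (\<gamma> h)))" using ph(1) by (simp add: K_def Lf_def)
  also have "... = Re (cnj (cm (%h. ph h * cnj (\<gamma> h))))" by simp
  also have "cnj (cm (%h. ph h * cnj (\<gamma> h))) = cm (%h. cnj (ph h * cnj (\<gamma> h)))"
   using ph(1) by (intro cm_cnj[symmetric] pd_bdd prod) (simp add: K_def)
  also have "... = cm (%h. cnj (ph h) * ip (tr h F) F)" by (simp add: \<gamma>_def)
  finally have "S <= (cmod (co ph F))^2" using mean_gam_char_le[OF F \<open>chr ph\<close>] by simp
  also have "... <= \<sigma>\<^sup>2" using \<sigma>[OF \<open>chr ph\<close>] by (intro power_mono) auto
  finally have "Lf \<gamma>0 <= \<sigma>\<^sup>2" using leS[OF \<gamma>0] by simp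
  moreover have "Lf \<gamma>0 = (1 / n2 F) * m (%h. (cmod (\<gamma> h))^2)"
  proof -
   have "(%h. \<gamma>0 h * cnj (\<gamma> h)) = (%h. cx ((1 / n2 F) * (cmod (\<gamma> h))^2))"
    by (simp add: \<gamma>0_def complex_norm_square mult.assoc fun_eq_iff del: of_real_power)
   then have "Lf \<gamma>0 = m (%h. (1 / n2 F) * (cmod (\<gamma> h))^2)" unfolding Lf_def by (simp only: cm_of_real Re_complex_of_real)
   also have "... = (1 / n2 F) * m (%h. (cmod (\<gamma> h))^2)"
    by (intro m_scale bdd_power bdd_norm) (simp add: \<gamma>_def bdd_gam F)
   finally show ?thesis .
  qed
  ultimately show ?thesis using npos by (simp add: \<gamma>_def field_simps)
 qed
qed

section \<open>Van der Corput's inequality for an invariant mean\<close>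

text \<open>The mean over \<open>y\<close> of the sum of \<open>cmod (\<gamma> (y - l i))\<close> is
  \<open>n\<close> times the mean of \<open>cmod (\<gamma> h)\<close>, so a next shift exists whose
  sum exceeds this by at most 1. A finite list of well spread shifts thus replaces an average over
  differences.\<close>

lemma vdc_list:
 assumes "bdd (\<gamma> :: 'a => complex)"
 shows "EX l :: nat => 'a. ALL j<n. (\<Sum>i<j. cmod (\<gamma> (l j - l i))) <= real j * m (%h. cmod (\<gamma> h)) + 1"
proof (induction n)
 case (Suc n)
 then obtain l where l: "!!j. j < n ==> (\<Sum>i<j. cmod (\<gamma> (l j - l i))) <= real j * m (%h. cmod (\<gamma> h)) + 1" by blast
 have b: "bdd (%y. cmod (\<gamma> (y - g)))" for g using bdd_shift[OF bdd_norm[OF assms], of "- g"] by simp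
 have e: "m (%y. cmod (\<gamma> (y - g))) = m (%h. cmod (\<gamma> h))" for g using m_shift[OF bdd_norm[OF assms], of "- g"] by simp
 have "EX y. (\<Sum>i<n. cmod (\<gamma> (y - l i))) <= real n * m (%h. cmod (\<gamma> h)) + 1"
 proof (rule ccontr)
  assume "~ ?thesis"
  then have "real n * m (%h. cmod (\<gamma> h)) + 1 <= (\<Sum>i<n. cmod (\<gamma> (y - l i)))" for y by (meson less_imp_le not_le)
  then have "real n * m (%h. cmod (\<gamma> h)) + 1 <= m (%y. \<Sum>i<n. cmod (\<gamma> (y - l i)))" by (intro m_ge bdd_sum b)
  also have "... = real n * m (%h. cmod (\<gamma> h))" by (simp add: m_sum b e)
  finally show False by simp
 qed
 then obtain y where y: "(\<Sum>i<n. cmod (\<gamma> (y - l i))) <= real n * m (%h. cmod (\<gamma> h)) + 1" by blast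
 show ?case
 proof (intro exI[of _ "l(n := y)"] allI impI)
  fix j assume "j < Suc n"
  then show "(\<Sum>i<j. cmod (\<gamma> ((l(n := y)) j - (l(n := y)) i))) <= real j * m (%h. cmod (\<gamma> h)) + 1"
   using l[of j] y by (cases "j = n") auto
 qed
qed simp

text \<open>Averaging \<open>Y\<close> over the shifts of such a list does not change its mean.
  Cauchy-Schwarz then leaves the mean squared norm of the average, whose mixed terms are values of
  \<gamma> at differences of shifts.\<close>

lemma vdc:
 assumes Y: "!!h. Y h : A" "!!h. nrm (Y h) <= C" and k: "k : A"
 shows "(cmod (cm (%h. ip (Y h) k)))^2 <= n2 k * m (%l. cmod (cm (%h. ip (Y (h + l)) (Y h))))"
proof -
 define \<gamma> where "\<gamma> l = cm (%h. ip (Y (h + l)) (Y h))" for l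
 have bY: "bdd (%h. ip (Y (h + l)) (Y (h + l')))" for l l' by (rule bdd_ip[of _ _ C C]) (auto intro: Y)
 have bY0: "bdd (%h. ip (Y (h + l)) (Y h))" for l by (rule bdd_ip[of _ _ C C]) (auto intro: Y)
 have bYk: "bdd (%h. ip (Y h) k)" by (rule bdd_ip[of _ _ C "nrm k"]) (auto intro: Y k)
 have sh: "cm (%h. ip (Y (h + l)) (Y (h + l'))) = \<gamma> (l - l')" for l l'
  unfolding \<gamma>_def using cm_shift[OF bY0[of "l - l'"], of l'] by (simp add: algebra_simps)
 have C0: "0 <= C" using Y nrm_nonneg order_trans by blast
 have \<gamma>C: "cmod (\<gamma> l) <= C * C" for l unfolding \<gamma>_def
  by (rule norm_cm_bound[OF bY0]) (intro ip_bound Y)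
 have \<gamma>b: "bdd \<gamma>" by (rule bddI[of _ "C * C"]) (rule \<gamma>C)
 have sym: "cmod (\<gamma> (l - l')) = cmod (\<gamma> (l' - l))" for l l'
 proof -
  have "cnj (\<gamma> (l - l')) = cm (%h. cnj (ip (Y (h + l)) (Y (h + l'))))" unfolding sh[symmetric] by (rule cm_cnj[symmetric]) (rule bY)
  also have "... = \<gamma> (l' - l)" by (simp add: ip_cnj Y sh)
  finally show ?thesis by (metis complex_mod_cnj)
 qed
 define \<mu> where "\<mu> = m (%l. cmod (\<gamma> l))"
 \<comment> \<open>\<open>C * C\<close> is the diagonal contribution and 2 comes from the slack of
   the list; both are divided by \<open>n\<close> and disappear in the limit.\<close>
 have main: "(cmod (cm (%h. ip (Y h) k)))^2 <= n2 k * (\<mu> + (C * C + 2) / real n)" if n: "0 < n" for n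
 proof -
  obtain l :: "nat => 'a" where l: "!!j. j < n ==> (\<Sum>i<j. cmod (\<gamma> (l j - l i))) <= real j * \<mu> + 1"
   using vdc_list[OF \<gamma>b, of n] unfolding \<mu>_def by blast
  define Z where "Z h x = (1 / of_nat n) * (\<Sum>i<n. Y (h + l i) x)" for h x
  have ZA: "Z h : A" for h unfolding Z_def[abs_def] by (intro A_intros Y)
  have "cm (%h. ip (Z h) k) = (1 / of_nat n) * (\<Sum>i<n. cm (%h. ip (Y (h + l i)) k))"
  proof -
   have "ip (Z h) k = (1 / of_nat n) * (\<Sum>i<n. ip (Y (h + l i)) k)" for h
    unfolding Z_def[abs_def] by (simp add: ip_scale_left ip_sum_left A_intros Y k del: times_divide_eq_left)
   then show ?thesis by (simp only: cm_scale cm_sum bdd_sum bdd_shift[OF bYk])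
  qed
  also have "... = cm (%h. ip (Y h) k)" using n by (simp add: cm_shift[OF bYk])
  finally have e: "cm (%h. ip (Z h) k) = cm (%h. ip (Y h) k)" .
  have Zn: "nrm (Z h) <= C" for h
  proof -
   have "nrm (Z h) = (1 / real n) * nrm (%x. \<Sum>i<n. Y (h + l i) x)"
    unfolding Z_def[abs_def] by (subst nrm_scale) (auto intro!: A_intros Y simp: norm_divide)
   also have "... <= (1 / real n) * (\<Sum>i<n. nrm (Y (h + l i)))"
    by (intro mult_left_mono nrm_sum Y) simp
   also have "... <= (1 / real n) * (\<Sum>i<n. C)" by (intro mult_left_mono sum_mono Y) simp
   finally show ?thesis using n by simp
  qed
  have bn2: "bdd (%h. n2 (Z h))"
  proof (rule bddI)
   fix h
   have "n2 (Z h) <= C^2" unfolding nrm_sq[OF ZA, symmetric] by (intro power_mono Zn nrm_nonneg ZA)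
   then show "norm (n2 (Z h)) <= C^2" using n2_nonneg(1)[OF ZA] by simp
  qed
  have "(cmod (cm (%h. ip (Z h) k)))^2 <= m (%h. (cmod (ip (Z h) k))^2)"
   by (rule norm_cm_sq) (rule bdd_ip[of _ _ C "nrm k"], auto intro: ZA Zn k)
  also have "... <= m (%h. n2 k * n2 (Z h))"
  proof (intro m_mono bdd_mult bdd_const bn2 bdd_power bdd_norm bdd_ip[of _ _ C "nrm k"] ZA Zn k order_refl)
   fix h
   have "(cmod (ip (Z h) k))^2 <= (nrm (Z h) * nrm k)^2" by (intro power_mono cauchy_schwarz ZA k) simp
   then show "(cmod (ip (Z h) k))^2 <= n2 k * n2 (Z h)" by (simp add: power_mult_distrib nrm_sq ZA k mult.commute)
  qed
  also have "... = n2 k * m (%h. n2 (Z h))" by (rule m_scale[OF bn2])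
  also have "m (%h. n2 (Z h)) <= \<mu> + (C * C + 2) / real n"
  proof -
   have "ip (Z h) (Z h) = (1 / of_nat n)^2 * (\<Sum>i<n. \<Sum>j<n. ip (Y (h + l i)) (Y (h + l j)))" for h
    unfolding Z_def[abs_def]
    by (simp add: ip_scale_left ip_scale_right ip_sum_left ip_sum_right A_intros Y power2_eq_square del: times_divide_eq_left)
   then have "m (%h. n2 (Z h)) = Re (cm (%h. (1 / of_nat n)^2 * (\<Sum>i<n. \<Sum>j<n. ip (Y (h + l i)) (Y (h + l j)))))"
    by (simp add: Re_cm n2_def)
   also have "... = Re ((1 / of_nat n)^2 * (\<Sum>i<n. \<Sum>j<n. \<gamma> (l i - l j)))"
    by (simp only: cm_scale cm_sum bdd_sum bY sh)
   also have "... <= cmod ((1 / of_nat n)^2 * (\<Sum>i<n. \<Sum>j<n. \<gamma> (l i - l j)))" by (rule complex_Re_le_cmod)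
   also have "... = (1 / real n)^2 * cmod (\<Sum>i<n. \<Sum>j<n. \<gamma> (l i - l j))" by (simp add: norm_mult norm_power norm_divide)
   also have "... <= (1 / real n)^2 * (\<Sum>i<n. \<Sum>j<n. cmod (\<gamma> (l i - l j)))"
    by (intro mult_left_mono sum_norm_le norm_sum) auto
   also have "(\<Sum>i<n. \<Sum>j<n. cmod (\<gamma> (l i - l j))) <= real n * (C * C) + 2 * (\<Sum>j<n. \<Sum>i<j. cmod (\<gamma> (l j - l i)))"
   proof (induction n)
    case (Suc n)
    have "(\<Sum>i<Suc n. \<Sum>j<Suc n. cmod (\<gamma> (l i - l j))) = (\<Sum>i<n. \<Sum>j<n. cmod (\<gamma> (l i - l j)))
     + (\<Sum>i<n. cmod (\<gamma> (l i - l n))) + (\<Sum>j<n. cmod (\<gamma> (l n - l j))) + cmod (\<gamma> (l n - l n))"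
     by (simp add: sum.distrib)
    also have "(\<Sum>i<n. cmod (\<gamma> (l i - l n))) = (\<Sum>i<n. cmod (\<gamma> (l n - l i)))" by (simp add: sym)
    finally show ?case using Suc \<gamma>C[of "l n - l n"] by (simp add: algebra_simps)
   qed simp
   also have "(\<Sum>j<n. \<Sum>i<j. cmod (\<gamma> (l j - l i))) <= (\<Sum>j<n. real j * \<mu> + 1)" by (intro sum_mono l) simp
   also have "... = (\<Sum>j<n. real j) * \<mu> + real n" by (simp add: sum.distrib sum_distrib_right)
   also have "(\<Sum>j<n. real j) <= real n * real n / 2"
    by (induction n) (auto simp: algebra_simps)
   finally have "m (%h. n2 (Z h)) <= (1 / real n)^2 * (real n * (C * C) + 2 * (real n * real n / 2 * \<mu> + real n))"
    using m_nonneg[of "%l. cmod (\<gamma> l)"] \<gamma>b by (simp add: \<mu>_def bdd_norm mult_right_mono mult_left_mono)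
   also have "... = \<mu> + (C * C + 2) / real n" using n by (simp add: power2_eq_square field_simps)
   finally show ?thesis .
  qed
  finally show ?thesis using n2_nonneg(1)[OF k] e by (simp add: mult_left_mono)
 qed
 have "(%n. n2 k * (\<mu> + (C * C + 2) / real (Suc n))) \<longlonglongrightarrow> n2 k * (\<mu> + 0)"
  by (intro tendsto_intros LIMSEQ_Suc lim_const_over_n)
 moreover have "(cmod (cm (%h. ip (Y h) k)))^2 <= n2 k * (\<mu> + (C * C + 2) / real (Suc n))" for n by (rule main) simp
 ultimately have "(cmod (cm (%h. ip (Y h) k)))^2 <= n2 k * (\<mu> + 0)" by (intro LIMSEQ_le_const) auto
 then show ?thesis by (simp add: \<mu>_def \<gamma>_def)
qed

text \<open>Van der Corput is applied to the translates of \<open>F\<close> weighted by the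
  conjugates of the correlations themselves, so that the average to be bounded is \<open>a\<close>.
  The outcome is \<open>a\<close> squared at most \<open>a\<close> times a bound from
  \<open>W0\<close>, and one factor cancels.\<close>

lemma W1:
 assumes F: "F : A" and G: "G : A" and \<sigma>: "0 <= \<sigma>" "!!zt. chr zt ==> cmod (co zt F) <= \<sigma>"
 shows "m (%h. (cmod (ip (tr h F) G))^2) <= n2 G * (nrm F * \<sigma>)"
proof -
 define c where "c h = ip (tr h F) G" for h
 have bc: "bdd c" unfolding c_def by (rule bdd_gam[OF F G])
 define a where "a = m (%h. (cmod (c h))^2)"
 have a0: "0 <= a" unfolding a_def by (intro m_nonneg bdd_power bdd_norm bc) simp
 have cb: "cmod (c h) <= nrm F * nrm G" for h unfolding c_def using cauchy_schwarz[of "tr h F" G] F G by (simp add: A_tr nrm_tr)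
 have "cm (%h. ip (%x. cnj (c h) * tr h F x) G) = cm (%h. cx ((cmod (c h))^2))"
  by (simp add: ip_scale_left A_tr F G complex_norm_square mult.commute del: of_real_power) (simp add: c_def mult.commute)
 then have e: "cm (%h. ip (%x. cnj (c h) * tr h F x) G) = cx a" by (simp only: cm_of_real a_def)
 have "(cmod (cm (%h. ip (%x. cnj (c h) * tr h F x) G)))^2 <= n2 G *
   m (%l. cmod (cm (%h. ip (%x. cnj (c (h + l)) * tr (h + l) F x) (%x. cnj (c h) * tr h F x))))"
 proof (rule vdc)
  show "(%x. cnj (c h) * tr h F x) : A" for h by (intro A_intros F)
  show "nrm (%x. cnj (c h) * tr h F x) <= nrm F * nrm G * nrm F" for h
   using cb[of h] nrm_nonneg[OF F] by (simp add: nrm_scale A_tr F nrm_tr mult_right_mono)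
 qed (rule G)
 also have "m (%l. cmod (cm (%h. ip (%x. cnj (c (h + l)) * tr (h + l) F x) (%x. cnj (c h) * tr h F x))))
  <= m (%l. a * cmod (ip (tr l F) F))"
 proof -
  have cc: "cmod (cm (%h. cnj (c (h + l)) * c h)) <= a" for l
  proof -
   have "cmod (cm (%h. cnj (c (h + l)) * c h)) <= m (%h. cmod (cnj (c (h + l)) * c h))"
    by (intro norm_cm_le bdd_mult bdd_cnj bdd_shift bc)
   also have "... <= m (%h. (1 / 2) * (cmod (c (h + l)))^2 + (1 / 2) * (cmod (c h))^2)"
   proof (intro m_mono bdd_add bdd_mult bdd_const bdd_norm bdd_power bdd_cnj bdd_shift bc)
    show "cmod (cnj (c (h + l)) * c h) <= (1 / 2) * (cmod (c (h + l)))^2 + (1 / 2) * (cmod (c h))^2" for h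
     using sum_squares_bound[of "cmod (c (h + l))" "cmod (c h)"] by (simp add: norm_mult)
   qed
   also have "... = a"
    using m_shift[OF bdd_power[OF bdd_norm[OF bc], of 2], of l]
    by (simp only: m_add m_scale bdd_mult bdd_const bdd_power bdd_norm bdd_shift bc a_def)
   finally show ?thesis .
  qed
  have eq: "cm (%h. ip (%x. cnj (c (h + l)) * tr (h + l) F x) (%x. cnj (c h) * tr h F x))
   = cm (%h. cnj (c (h + l)) * c h) * ip (tr l F) F" for l
  proof -
   have "ip (tr (h + l) F) (tr h F) = ip (tr l F) F" for h
    using ip_tr[of "tr l F" F h] by (simp add: A_tr F tr_tr)
   then have "ip (%x. cnj (c (h + l)) * tr (h + l) F x) (%x. cnj (c h) * tr h F x)
    = (cnj (c (h + l)) * c h) * ip (tr l F) F" for h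
    by (simp add: ip_scale_left ip_scale_right A_intros F)
   then show ?thesis by (simp only: cm_scale_right bdd_mult bdd_cnj bdd_shift bc)
  qed
  have bl: "bdd (%l. a * cmod (ip (tr l F) F))" by (intro bdd_mult bdd_const bdd_norm bdd_gam F)
  have le: "cmod (cm (%h. cnj (c (h + l)) * c h) * ip (tr l F) F) <= a * cmod (ip (tr l F) F)" for l
   unfolding norm_mult by (intro mult_right_mono cc) simp
  show ?thesis
   unfolding eq
  proof (rule m_mono[OF _ bl le])
   obtain B where B: "!!l. norm (a * cmod (ip (tr l F) F)) <= B" using bl by (rule bddE) auto
   show "bdd (%l. cmod (cm (%h. cnj (c (h + l)) * c h) * ip (tr l F) F))"
   proof (rule bddI[of _ B])
    fix l
    have "norm (cmod (cm (%h. cnj (c (h + l)) * c h) * ip (tr l F) F)) <= norm (a * cmod (ip (tr l F) F))"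
     using le[of l] a0 by (simp only: real_norm_def abs_mult abs_norm_cancel abs_of_nonneg)
    then show "norm (cmod (cm (%h. cnj (c (h + l)) * c h) * ip (tr l F) F)) <= B" using B[of l] by linarith
   qed
  qed
 qed
 also have "... = a * m (%l. cmod (ip (tr l F) F))" by (intro m_scale bdd_norm bdd_gam F)
 also have "m (%l. cmod (ip (tr l F) F)) <= nrm F * \<sigma>"
 proof -
  have "(m (%l. cmod (ip (tr l F) F)))^2 <= m (%l. (cmod (ip (tr l F) F))^2)" by (intro m_sq bdd_norm bdd_gam F)
  also have "... <= n2 F * \<sigma>\<^sup>2" by (rule W0[OF F \<sigma>(2)])
  also have "... = (nrm F * \<sigma>)^2" by (simp add: power_mult_distrib nrm_sq F)
  finally have "(m (%l. cmod (ip (tr l F) F)))^2 <= (nrm F * \<sigma>)^2" .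
  moreover have "0 <= nrm F * \<sigma>" using \<sigma>(1) nrm_nonneg[OF F] by simp
  ultimately show ?thesis by (rule power2_le_imp_le)
 qed
 finally have "a^2 <= n2 G * (a * (nrm F * \<sigma>))" unfolding e using a0 n2_nonneg(1)[OF G] by (simp add: mult_left_mono)
 then have "a * a <= a * (n2 G * (nrm F * \<sigma>))" by (simp only: power2_eq_square mult.left_commute)
 moreover have "0 <= n2 G * (nrm F * \<sigma>)" using n2_nonneg(1)[OF G] nrm_nonneg[OF F] \<sigma>(1) by simp
 ultimately have "a <= n2 G * (nrm F * \<sigma>)"
 proof (cases "a = 0")
  case False
  then have "0 < a" using a0 by simp
  moreover assume "a * a <= a * (n2 G * (nrm F * \<sigma>))"
  ultimately show ?thesis by (simp only: mult_le_cancel_left_pos)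
 qed simp
 then show ?thesis by (simp add: a_def c_def)
qed

end

lemma sqrt_eps_le:
 fixes x y c :: real
 assumes "!!t. 0 < t ==> x <= y + sqrt (c * t)"
 shows "x <= y"
proof -
 have "(%n. y + sqrt (c * (1 / real (Suc n)))) \<longlonglongrightarrow> y + sqrt (c * 0)"
  by (intro tendsto_intros LIMSEQ_Suc lim_1_over_n)
 moreover have "x <= y + sqrt (c * (1 / real (Suc n)))" for n by (rule assms) simp
 ultimately have "x <= y + sqrt (c * 0)" by (intro LIMSEQ_le_const) auto
 then show ?thesis by simp
qed

section \<open>Means and characters along multiples of an integer\<close>

text \<open>\<open>N\<close> averages \<open>m\<close> along \<open>c + zsmul p l\<close> over one
  representative \<open>c\<close> of each coset; the coset of 0 is one of its terms, and
  \<open>K\<close> is the number of cosets. This transfers mean estimates in a free variable to the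
  variable \<open>zsmul p l\<close>.\<close>

lemma fin_idx_mean:
 assumes "fin_idx p TYPE('a::ab_group_add)"
 shows "EX K>0. ALL m :: ('a => real) => real. inv_mean m -->
  (EX N. inv_mean N & (ALL k. bdd k --> (ALL x. 0 <= k x) --> m (%l. k (zsmul p l)) <= K * N k))"
proof -
 obtain R :: "'a set" where R: "finite R" "!!g. EX c:R. EX h. g = c + zsmul p h"
  using assms unfolding fin_idx_def by blast
 define P where "P = range (zsmul p :: 'a => 'a)"
 have P_add: "x + y : P" if "x : P" "y : P" for x y
  using that unfolding P_def by (auto simp flip: zsmul_add_right)
 have P_minus: "- x : P" if "x : P" for x
  using that unfolding P_def by (auto simp flip: zsmul_minus_right)
 have P_diff: "x - y : P" if "x : P" "y : P" for x y using P_add[OF that(1) P_minus[OF that(2)]] by simp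
 define rep where "rep g = (SOME c. c : R & g - c : P)" for g
 have rep: "rep g : R" "g - rep g : P" for g
 proof -
  obtain c h where "c : R" "g = c + zsmul p h" using R(2) by blast
  then have "EX c. c : R & g - c : P" by (intro exI[of _ c]) (auto simp: P_def)
  from someI_ex[OF this] show "rep g : R" "g - rep g : P" by (auto simp: rep_def)
 qed
 have rep_eq: "rep g = rep g'" if "g - g' : P" for g g'
 proof -
  have "(g - c : P) = (g' - c : P)" for c
   using P_add[of "g - g'" "g' - c"] P_diff[of "g - c" "g - g'"] that by auto
  then show ?thesis by (simp add: rep_def)
 qed
 define R' where "R' = range rep"
 have R': "finite R'" using rep(1) R(1) unfolding R'_def by (auto intro: finite_subset)
 have rr: "rep c = c" if "c : R'" for c
 proof -
  from that obtain g where "c = rep g" unfolding R'_def by blast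
  with rep_eq[OF rep(2)[of g]] show ?thesis by simp
 qed
 have ne: "0 < card R'" using R' by (auto simp: card_gt_0_iff R'_def)
 \<comment> \<open>Translation by \<open>g\<close> permutes the cosets, which gives the invariance
   of \<open>N\<close>.\<close>
 have bij: "bij_betw (%c. rep (c + g)) R' R'" for g
 proof -
  have "inj_on (%c. rep (c + g)) R'"
  proof (rule inj_onI)
   fix c c' assume c: "c : R'" "c' : R'" "rep (c + g) = rep (c' + g)"
   have "(c + g - rep (c + g)) - (c' + g - rep (c' + g)) : P" by (intro P_diff rep)
   then have "c - c' : P" using c(3) by simp
   then show "c = c'" using rep_eq rr c by metis
  qed
  moreover have "(%c. rep (c + g)) ` R' <= R'" by (auto simp: R'_def)
  ultimately show ?thesis using endo_inj_surj[OF R'] by (simp add: bij_betw_def)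
 qed
 show ?thesis
 proof (intro exI[of _ "real (card R')"] conjI allI impI)
  show "0 < real (card R')" using ne by simp
  fix m :: "('a => real) => real" assume "inv_mean m"
  then interpret imean m by unfold_locales
  have bk: "bdd (%l. k (c + zsmul p l))" if "bdd k" for k :: "'a => real" and c using that by (rule bdd_compose)
  define N where "N k = (if bdd k then (\<Sum>c\<in>R'. m (%l. k (c + zsmul p l))) / real (card R') else 0)" for k
  have shift: "m (%l. k (c + zsmul p (l + t))) = m (%l. k (c + zsmul p l))" if "bdd k" for k c t
   by (rule m_shift[OF bk[OF that]])
  have "inv_mean N"
   unfolding inv_mean_def
  proof (intro conjI allI impI)
   show "N f = 0" if "~ bdd f" for f using that by (simp add: N_def)
   show "N (%x. f x + g x) = N f + N g" if "bdd f" "bdd g" for f g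
    using that by (simp add: N_def bdd_add m_add bk sum.distrib add_divide_distrib)
   show "N (%x. c * f x) = c * N f" if "bdd f" for f c
    using that by (simp add: N_def bdd_mult bdd_const m_scale bk sum_distrib_left)
   show "0 <= N f" if "bdd f" "ALL x. 0 <= f x" for f
    using that by (auto simp: N_def intro!: divide_nonneg_nonneg sum_nonneg m_nonneg bk)
   show "N (%x. 1) = 1" using ne by (simp add: N_def bdd_const)
   show "N (%x. f (x + g)) = N f" if "bdd f" for f g
   proof -
    have "m (%l. f (c + zsmul p l + g)) = m (%l. f (rep (c + g) + zsmul p l))" for c
    proof -
     obtain t where t: "c + g - rep (c + g) = zsmul p t" using rep(2)[of "c + g"] by (auto simp: P_def)
     have "c + zsmul p l + g = rep (c + g) + zsmul p (l + t)" for l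
      unfolding zsmul_add_right t[symmetric] by simp
     then show ?thesis by (simp add: shift that)
    qed
    then have "N (%x. f (x + g)) = (\<Sum>c\<in>R'. m (%l. f (rep (c + g) + zsmul p l))) / real (card R')"
     using that by (simp add: N_def bdd_shift)
    also have "(\<Sum>c\<in>R'. m (%l. f (rep (c + g) + zsmul p l))) = (\<Sum>c\<in>R'. m (%l. f (c + zsmul p l)))"
     by (rule sum.reindex_bij_betw[OF bij])
    finally show ?thesis using that by (simp add: N_def)
   qed
  qed
  moreover have "m (%l. k (zsmul p l)) <= real (card R') * N k" if k: "bdd k" "ALL x. 0 <= k x" for k
  proof -
   obtain t where t: "0 - rep 0 = zsmul p t" using rep(2)[of 0] by (auto simp: P_def)
   have z: "zsmul p l = rep 0 + zsmul p (l + t)" for l unfolding zsmul_add_right t[symmetric] by simp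
   have "(%l. k (zsmul p l)) = (%l. k (rep 0 + zsmul p (l + t)))" by (rule ext) (rule arg_cong[OF z])
   then have "m (%l. k (zsmul p l)) = m (%l. k (rep 0 + zsmul p (l + t)))" by (rule arg_cong)
   also have "... = m (%l. k (rep 0 + zsmul p l))" by (rule shift[OF k(1)])
   also have "... <= (\<Sum>c\<in>R'. m (%l. k (c + zsmul p l)))"
    by (rule member_le_sum[of _ _ "%c. m (%l. k (c + zsmul p l))"])
     (use R' k in \<open>auto simp: R'_def intro!: m_nonneg bk\<close>)
   finally show ?thesis using ne k by (simp add: N_def)
  qed
  ultimately show "EX N. inv_mean N & (ALL k. bdd k --> (ALL x. 0 <= k x) --> m (%l. k (zsmul p l)) <= real (card R') * N k)"
   by blast
 qed
qed

text \<open>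
  The characters whose pullback along multiplication by p is the conjugate of a given one; their number
  is bounded by the index of the image.
\<close>

definition idxset :: "int => ('a::ab_group_add => complex) => ('a => complex) set" where
 "idxset p \<xi> = {zt. chr zt & (ALL h. \<xi> h * zt (zsmul p h) = 1)}"

text \<open>Members of one such set agree on the image of multiplication by \<open>p\<close>. The
  sum of \<open>n\<close> of them has modulus \<open>n\<close> there and mean square
  \<open>n\<close> overall, while the image has measure at least 1 over the number of
  representatives; comparison bounds \<open>n\<close>.\<close>

lemma (in imean) idxset_card:
 assumes "fin_idx p TYPE('a)"
 obtains C where "!!\<xi>. finite (idxset p \<xi> :: ('a => complex) set)" "!!\<xi>. card (idxset p \<xi> :: ('a => complex) set) <= C"
proof -
 obtain R :: "'a set" where R: "finite R" "!!g. EX c:R. EX h. g = c + zsmul p h"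
  using assms unfolding fin_idx_def by blast
 define P where "P = range (zsmul p :: 'a => 'a)"
 have P: "1 <= real (card R) * msr P"
 proof -
  have "UNIV <= (\<Union>c\<in>R. {x. x + - c : P})"
  proof
   fix x
   obtain c h where "c : R" "x = c + zsmul p h" using R(2) by blast
   then show "x : (\<Union>c\<in>R. {x. x + - c : P})" by (intro UN_I[of c]) (auto simp: P_def)
  qed
  from msr_mono[OF this] have "1 <= msr (\<Union>c\<in>R. {x. x + - c : P})" by simp
  also have "... <= (\<Sum>c\<in>R. msr {x. x + - c : P})" by (rule msr_UN[OF R(1)])
  also have "... = real (card R) * msr P" unfolding msr_shift by simp
  finally show ?thesis .
 qed
 have main: "card X <= card R" if X: "finite X" "X <= idxset p \<xi>" for X :: "('a => complex) set" and \<xi> :: "'a => complex"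
 proof (cases "X = {}")
  case False
  then obtain zt0 where z0: "zt0 : X" by blast
  define n where "n = card X"
  have chX: "chr zt" if "zt : X" for zt using X that by (auto simp: idxset_def)
  define f where "f x = (\<Sum>zt\<in>X. zt x)" for x
  have bf: "bdd f" unfolding f_def by (intro bdd_sum chr_bdd chX)
  have nf: "cmod (f x) = real n" if "x : P" for x
  proof -
   from that obtain h where h: "x = zsmul p h" by (auto simp: P_def)
   have "zt x = zt0 x" if "zt : X" for zt
   proof -
    have "\<xi> h * zt x = 1" "\<xi> h * zt0 x = 1" using X that z0 h by (auto simp: idxset_def)
    then have "\<xi> h * zt x = \<xi> h * zt0 x" "\<xi> h ~= 0" by auto
    then show ?thesis by simp
   qed
   then have "f x = (\<Sum>zt\<in>X. zt0 x)" unfolding f_def by (rule sum.cong[OF refl])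
   then have "f x = of_nat n * zt0 x" by (simp add: n_def)
   then show ?thesis using chr_norm[OF chX[OF z0]] by (simp add: norm_mult)
  qed
  have "(real n)^2 * msr P <= m (%x. (cmod (f x))^2)"
  proof -
   have "(real n)^2 * msr P = m (%x. (real n)^2 * indicat_real P x)" by (simp add: m_scale bdd_indicator' msr_def)
   also have "... <= m (%x. (cmod (f x))^2)"
    by (intro m_mono bdd_mult bdd_const bdd_indicator' bdd_power bdd_norm bf) (simp add: indicator_def nf)
   finally show ?thesis .
  qed
  also have "... = real n"
  proof -
   have b: "bdd (%x. zt x * cnj (ps x))" if "zt : X" "ps : X" for zt ps
    using that by (intro bdd_mult bdd_cnj chr_bdd chX)
   have o: "cm (%x. zt x * cnj (ps x)) = (if zt = ps then 1 else 0)" if "zt : X" "ps : X" for zt ps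
    using that by (intro cm_chr_orth chX)
   have "cx (m (%x. (cmod (f x))^2)) = cm (%x. f x * cnj (f x))"
    by (simp only: cm_of_real[symmetric] complex_norm_square)
   also have "... = cm (%x. \<Sum>zt\<in>X. \<Sum>ps\<in>X. zt x * cnj (ps x))" by (simp add: f_def sum_product)
   also have "... = (\<Sum>zt\<in>X. cm (%x. \<Sum>ps\<in>X. zt x * cnj (ps x)))" by (intro cm_sum bdd_sum b)
   also have "... = (\<Sum>zt\<in>X. \<Sum>ps\<in>X. cm (%x. zt x * cnj (ps x)))" by (intro sum.cong refl cm_sum b)
   also have "... = (\<Sum>zt\<in>X. \<Sum>ps\<in>X. if zt = ps then 1 else 0)" by (intro sum.cong refl o)
   also have "... = of_nat n" using X(1) by (simp add: n_def)
   finally have "cx (m (%x. (cmod (f x))^2)) = cx (real n)" by simp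
   then show ?thesis by (simp only: of_real_eq_iff)
  qed
  finally have "(real n)^2 * msr P <= real n" .
  moreover have "0 < real n" using X(1) False by (simp add: n_def card_gt_0_iff)
  ultimately have "real n * msr P <= 1" by (simp add: power2_eq_square mult.assoc)
  then have "real n * (real (card R) * msr P) <= real (card R)"
   using mult_left_mono[of "real n * msr P" 1 "real (card R)"] by (simp add: algebra_simps)
  moreover have "real n <= real n * (real (card R) * msr P)" using P by (simp add: mult_le_cancel_left1)
  ultimately show ?thesis by (simp add: n_def)
 qed simp
 have fin: "finite (idxset p \<xi> :: ('a => complex) set)" for \<xi>
 proof (rule ccontr)
  assume "infinite (idxset p \<xi> :: ('a => complex) set)"
  then obtain X :: "('a => complex) set" where "X <= idxset p \<xi>" "finite X" "card X = Suc (card R)"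
   using infinite_arbitrarily_large by blast
  with main[of X \<xi>] show False by simp
 qed
 show ?thesis by (rule that[of "card R"]) (use fin main in auto)
qed

context sysm
begin

lemma gam_mean:
 assumes "fin_idx q TYPE('a)"
 obtains K where "0 < K" "!!F G \<sigma>. F : A ==> G : A ==> 0 <= \<sigma> ==> (!!zt. chr zt ==> cmod (co zt F) <= \<sigma>) ==>
  m (%l. cmod (ip (tr (zsmul q l) F) G)) <= sqrt (K * (n2 G * (nrm F * \<sigma>)))"
proof -
 obtain K where K: "0 < K" "!!m :: ('a => real) => real. inv_mean m ==>
  (EX N. inv_mean N & (ALL k. bdd k --> (ALL x. 0 <= k x) --> m (%l. k (zsmul q l)) <= K * N k))"
  using fin_idx_mean[OF assms] by blast
 obtain N where N: "inv_mean N" "!!k. bdd k ==> (!!x. 0 <= k x) ==> m (%l. k (zsmul q l)) <= K * N k"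
  using K(2)[OF im] by blast
 interpret N: sysm A I \<tau> pr N by unfold_locales (rule N(1))
 show ?thesis
 proof (rule that[OF K(1)])
  fix F G \<sigma> assume F: "F : A" and G: "G : A" and \<sigma>: "0 <= \<sigma>" "!!zt. chr zt ==> cmod (co zt F) <= \<sigma>"
  have "(m (%l. cmod (ip (tr (zsmul q l) F) G)))^2 <= m (%l. (cmod (ip (tr (zsmul q l) F) G))^2)"
   by (intro m_sq bdd_norm bdd_gam F G)
  also have "... <= K * N (%h. (cmod (ip (tr h F) G))^2)"
   using N(2)[of "%h. (cmod (ip (tr h F) G))^2"] bdd_gam[OF F G, of "%h. h"] by (simp add: bdd_power bdd_norm)
  also have "... <= K * (n2 G * (nrm F * \<sigma>))" using K(1) by (intro mult_left_mono N.W1 F G \<sigma>) auto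
  finally show "m (%l. cmod (ip (tr (zsmul q l) F) G)) <= sqrt (K * (n2 G * (nrm F * \<sigma>)))" by (rule real_le_rsqrt)
 qed
qed

lemma co_norm_le: "F : A ==> chr zt ==> cmod (co zt F) <= nrm F"
 unfolding co_def using cauchy_schwarz[of F "ch zt"] nrm_mult1[of "ch zt" "%x. 1"]
 by (simp add: A_ch ch_norm A_const)

lemma dec_small:
 assumes F: "F : A" and "0 < \<tau>'" and X: "finite X" "{zt. chr zt & \<tau>' <= cmod (co zt F)} <= X" "X <= Collect chr" and z: "chr zt"
 shows "cmod (co zt (dec X F)) <= \<tau>'"
 using co_dec[OF F X(1,3) z] X(2) z assms(2) by (auto intro: less_imp_le simp: not_le[symmetric])

lemma tr_split: assumes "X <= Collect chr" shows "tr g F x = tr g (dec X F) x + (\<Sum>zt\<in>X. (co zt F * zt g) * ch zt x)"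
proof -
 have "(\<Sum>zt\<in>X. co zt F * ch zt (\<tau> g x)) = (\<Sum>zt\<in>X. (co zt F * zt g) * ch zt x)"
  using assms by (intro sum.cong refl) (auto simp: ch_def pr_tau chr_add)
 then show ?thesis by (simp add: tr_def dec_def)
qed

lemma ip_split: assumes F: "F : A" and G: "G : A" and X: "X <= Collect chr"
 shows "ip (tr g F) G = ip (tr g (dec X F)) G + (\<Sum>zt\<in>X. co zt F * zt g * cnj (co zt G))"
proof -
 have "ip (tr g F) G = ip (%x. tr g (dec X F) x + (\<Sum>zt\<in>X. (co zt F * zt g) * ch zt x)) G"
  by (simp flip: tr_split[OF X])
 also have "... = ip (tr g (dec X F)) G + (\<Sum>zt\<in>X. ip (%x. (co zt F * zt g) * ch zt x) G)"
  using X A_dec[OF F X] by (subst ip_add_left) (auto intro!: A_intros G ip_sum_left)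
 also have "(\<Sum>zt\<in>X. ip (%x. (co zt F * zt g) * ch zt x) G) = (\<Sum>zt\<in>X. co zt F * zt g * cnj (co zt G))"
  using X by (intro sum.cong refl) (auto simp: ip_scale_left A_ch G co_def ip_cnj)
 finally show ?thesis .
qed

text \<open>The Fourier components of \<open>F\<close> in \<open>X\<close> contribute averages of
  characters, which survive only on \<open>idxset p \<xi>\<close>. The remainder has small
  coefficients and a small average by \<open>gam_mean\<close>; its threshold \<open>t\<close> then
  tends to 0.\<close>

lemma gam_bound:
 assumes F: "F : A" and G: "G : A" and \<xi>: "chr \<xi>" and p: "fin_idx p TYPE('a)"
 shows "cmod (cm (%h. \<xi> h * ip (tr (zsmul p h) F) G)) <= (\<Sum>zt\<in>idxset p \<xi>. cmod (co zt F) * cmod (co zt G))"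
proof -
 obtain K where K: "0 < K" "!!F G \<sigma>. F : A ==> G : A ==> 0 <= \<sigma> ==> (!!zt. chr zt ==> cmod (co zt F) <= \<sigma>) ==>
  m (%l. cmod (ip (tr (zsmul p l) F) G)) <= sqrt (K * (n2 G * (nrm F * \<sigma>)))"
  using gam_mean[OF p] by blast
 obtain C where fin: "finite (idxset p \<xi>)" using idxset_card[OF p] by blast
 have bx: "bdd (%h. \<xi> h * ip (tr (f h) F) G)" if "F : A" "G : A" for F G f
  using that by (intro bdd_mult chr_bdd \<xi> bdd_gam)
 let ?S = "\<Sum>zt\<in>idxset p \<xi>. cmod (co zt F) * cmod (co zt G)"
 have main: "cmod (cm (%h. \<xi> h * ip (tr (zsmul p h) F) G)) <= ?S + sqrt (K * (n2 G * (nrm F * t)))" if t: "0 < t" for t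
 proof -
  define X where "X = {zt. chr zt & t <= cmod (co zt F)} \<union> idxset p \<xi>"
  have X: "finite X" "{zt. chr zt & t <= cmod (co zt F)} <= X" "X <= Collect chr" "idxset p \<xi> <= X"
   using fin spec_finite[OF F t] by (auto simp: X_def idxset_def)
  let ?D = "dec X F"
  have D: "?D : A" by (rule A_dec[OF F X(3)])
  note split = ip_split[OF F G X(3)]
  have "cm (%h. \<xi> h * ip (tr (zsmul p h) F) G) = cm (%h. \<xi> h * ip (tr (zsmul p h) ?D) G
    + (\<Sum>zt\<in>X. (co zt F * cnj (co zt G)) * (\<xi> h * zt (zsmul p h))))"
   unfolding split by (simp add: distrib_left sum_distrib_left algebra_simps)
  also have "... = cm (%h. \<xi> h * ip (tr (zsmul p h) ?D) G) + (\<Sum>zt\<in>X. (co zt F * cnj (co zt G)) * cm (%h. \<xi> h * zt (zsmul p h)))"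
  proof -
   have "bdd (%h. \<xi> h * zt (zsmul p h))" if "zt : X" for zt using that X(3) by (intro chr_bdd chr_mult \<xi> chr_zsmul) auto
   then show ?thesis
    by (subst cm_add) (auto intro!: bx D G bdd_sum bdd_mult[OF bdd_const] simp: cm_sum cm_scale bdd_mult[OF bdd_const])
  qed
  also have "(\<Sum>zt\<in>X. (co zt F * cnj (co zt G)) * cm (%h. \<xi> h * zt (zsmul p h))) = (\<Sum>zt\<in>X. if zt : idxset p \<xi> then co zt F * cnj (co zt G) else 0)"
  proof (intro sum.cong refl)
   fix zt assume "zt : X"
   then have z: "chr zt" using X(3) by auto
   have "(%h. \<xi> h * zt (zsmul p h)) = (%h. 1) \<longleftrightarrow> zt : idxset p \<xi>"
    using z by (auto simp: idxset_def fun_eq_iff)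
   then show "(co zt F * cnj (co zt G)) * cm (%h. \<xi> h * zt (zsmul p h)) = (if zt : idxset p \<xi> then co zt F * cnj (co zt G) else 0)"
    using cm_chr[OF chr_mult[OF \<xi> chr_zsmul[OF z, of p]]] by simp
  qed
  also have "... = (\<Sum>zt\<in>idxset p \<xi>. co zt F * cnj (co zt G))"
   using X by (simp add: sum.inter_restrict[symmetric] Int_absorb1)
  finally have "cmod (cm (%h. \<xi> h * ip (tr (zsmul p h) F) G)) <=
    cmod (cm (%h. \<xi> h * ip (tr (zsmul p h) ?D) G)) + cmod (\<Sum>zt\<in>idxset p \<xi>. co zt F * cnj (co zt G))"
   using norm_triangle_ineq by (simp only:)
  also have "cmod (\<Sum>zt\<in>idxset p \<xi>. co zt F * cnj (co zt G)) <= ?S"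
   by (rule order_trans[OF norm_sum]) (simp add: norm_mult)
  also have "cmod (cm (%h. \<xi> h * ip (tr (zsmul p h) ?D) G)) <= m (%h. cmod (\<xi> h * ip (tr (zsmul p h) ?D) G))"
   by (intro norm_cm_le bx D G)
  also have "... = m (%h. cmod (ip (tr (zsmul p h) ?D) G))" by (simp add: norm_mult chr_norm[OF \<xi>])
  also have "... <= sqrt (K * (n2 G * (nrm ?D * t)))"
   using t by (intro K(2) D G dec_small[OF F t X(1-3)]) auto
  also have "... <= sqrt (K * (n2 G * (nrm F * t)))"
   using t K(1) n2_nonneg(1)[OF G] nrm_dec[OF F X(1,3)]
   by (intro real_sqrt_le_mono mult_left_mono mult_right_mono) auto
  finally show ?thesis by simp
 qed
 show ?thesis
  by (rule sqrt_eps_le[where c = "K * n2 G * nrm F"]) (use main in \<open>simp only: mult.assoc\<close>)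
qed

lemma tr_tau: "tr a F (\<tau> c x) = tr (a + c) F x" by (simp add: tr_def tau_add)

lemma co_cnj_ch:
 assumes "G : A" "chr zt" "chr ps"
 shows "cmod (co ps (%x. cnj (G x * ch zt x))) = cmod (co (%h. cnj (zt h * ps h)) G)"
proof -
 have "co ps (%x. cnj (G x * ch zt x)) = I (%x. cnj (G x * (ch zt x * ch ps x)))"
  unfolding co_def ip_def by (simp add: mult.assoc)
 also have "... = cnj (I (%x. G x * (ch zt x * ch ps x)))" by (intro I_cnj A_intros assms)
 also have "I (%x. G x * (ch zt x * ch ps x)) = co (%h. cnj (zt h * ps h)) G"
  unfolding co_def ip_def by (simp add: ch_def)
 finally show ?thesis by simp
qed

lemma nrm_prod3: assumes "F : A" "G : A" "H : A" "!!x. cmod (F x) <= a" "!!x. cmod (G x) <= b" "nrm H <= c"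
 shows "nrm (%x. F x * G x * H x) <= a * b * c"
proof -
 have a: "0 <= a" "0 <= b" using assms(4,5) norm_ge_zero order_trans by blast+
 have "nrm (%x. (F x * G x) * H x) <= (a * b) * nrm H"
  using assms a by (intro nrm_mult_bound A_intros) (auto simp: norm_mult intro!: mult_mono)
 also have "... <= (a * b) * c" using a assms(6) by (intro mult_left_mono) auto
 finally show ?thesis .
qed

lemma tr_cmod_le: "(!!x. cmod (F x) <= a) ==> cmod (tr g F x) <= a" by (simp add: tr_def)

section \<open>Correlations of three and four functions\<close>

text \<open>Van der Corput in \<open>h\<close> removes \<open>K2\<close> and leaves two-term
  correlations of the derivatives \<open>dG l\<close> and \<open>dD l\<close>. The Fourier
  coefficients of \<open>dD l\<close> are correlations of a translate of \<open>D\<close> with a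
  twist of \<open>D\<close>, which are small on average over \<open>l\<close>. A bound
  \<open>t^2\<close> on the coefficients of \<open>D\<close> makes this average linear in
  \<open>t\<close>; the constant depends on \<open>G\<close> but not on \<open>D\<close>.\<close>

lemma three_err:
 assumes p: "fin_idx p1 TYPE('a)" and q: "fin_idx (p1 - p2) TYPE('a)"
  and G: "G : A" and K2: "K2 : A" "nrm K2 <= 1"
 obtains c where "!!D t. D : A ==> nrm D <= 1 ==> 0 < t ==> (!!zt. chr zt ==> cmod (co zt D) <= t^2) ==>
  cmod (cm (%h. cor3 p1 p2 G D K2 h)) <= sqrt (c * t)"
proof -
 define q where "q = p1 - p2"
 obtain B where B: "0 < B" "!!x. cmod (G x) <= B" by (rule A_bound[OF G]) blast
 obtain K where K: "0 < K" "!!F G \<sigma>. F : A ==> G : A ==> 0 <= \<sigma> ==> (!!zt. chr zt ==> cmod (co zt F) <= \<sigma>) ==>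
  m (%l. cmod (ip (tr (zsmul q l) F) G)) <= sqrt (K * (n2 G * (nrm F * \<sigma>)))"
  using gam_mean[OF assms(2)] unfolding q_def by blast
 define X where "X = (idxset p1 (%h. 1) :: ('a => complex) set)"
 have X: "finite X" using idxset_card[OF p] unfolding X_def by blast
 have Xc: "chr ps" if "ps : X" for ps using that by (simp add: X_def idxset_def)
 define c where "c = real (card X) * (B * B) * sqrt K"
 show ?thesis
 proof (rule that)
  fix D t assume D: "D : A" "nrm D <= 1" and t: "0 < t" and s: "!!zt. chr zt ==> cmod (co zt D) <= t^2"
  define Y where "Y h x = tr (zsmul (- p2) h) G x * tr (zsmul q h) D x" for h x
  have YA: "Y h : A" for h unfolding Y_def[abs_def] by (intro A_intros G D)
  have Yn: "nrm (Y h) <= B" for h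
  proof -
   have "nrm (Y h) <= B * nrm (tr (zsmul q h) D)" unfolding Y_def[abs_def]
    by (intro nrm_mult_bound A_intros G D tr_cmod_le B)
   also have "... <= B * 1" using D B by (intro mult_left_mono) (auto simp: nrm_tr)
   finally show ?thesis by simp
  qed
  have e: "cor3 p1 p2 G D K2 h = ip (Y h) (%x. cnj (K2 x))" for h
  proof -
   have "cor3 p1 p2 G D K2 h
    = I (%x. G (\<tau> (zsmul (-p2) h) x) * tr (zsmul p1 h) D (\<tau> (zsmul (-p2) h) x) * tr (zsmul p2 h) K2 (\<tau> (zsmul (-p2) h) x))"
    by (rule I_tau[symmetric]) (intro A_intros G D K2)
   also have "... = ip (Y h) (%x. cnj (K2 x))"
    unfolding ip_def Y_def tr_tau by (simp add: q_def zsmul_diff_left zsmul_minus_left) (simp add: tr_def)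
   finally show ?thesis .
  qed
  define dG where "dG l x = tr (zsmul (-p2) l) G x * cnj (G x)" for l x
  define dD where "dD l x = tr (zsmul q l) D x * cnj (D x)" for l x
  have dA: "dG l : A" "dD l : A" for l unfolding dG_def[abs_def] dD_def[abs_def] by (intro A_intros G D)+
  have dGb: "cmod (cnj (dG l x)) <= B * B" for l x
   unfolding dG_def using B by (auto simp: norm_mult tr_def intro!: mult_mono)
  have ge: "ip (Y (h + l)) (Y h) = 1 * ip (tr (zsmul p1 h) (dD l)) (%x. cnj (dG l x))" for h l
  proof -
   have "ip (Y (h + l)) (Y h) = I (%x. tr (zsmul (-p2) h) (dG l) x * tr (zsmul q h) (dD l) x)"
    unfolding ip_def Y_def dG_def[abs_def] dD_def[abs_def] tr_mult tr_cnj tr_tr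
    by (simp add: zsmul_add_right add.commute mult_ac tr_tr)
   also have "... = I (%x. tr (zsmul (-p2) h) (dG l) (\<tau> (zsmul p2 h) x) * tr (zsmul q h) (dD l) (\<tau> (zsmul p2 h) x))"
    by (rule I_tau[symmetric]) (intro A_intros dA)
   also have "... = 1 * ip (tr (zsmul p1 h) (dD l)) (%x. cnj (dG l x))"
    unfolding ip_def tr_tau by (simp add: q_def zsmul_diff_left zsmul_minus_left mult.commute)
   finally show ?thesis .
  qed
  have gb: "cmod (cm (%h. ip (Y (h + l)) (Y h))) <= (\<Sum>ps\<in>X. (B * B) * cmod (ip (tr (zsmul q l) D) (%x. D x * ch ps x)))" for l
  proof -
   have "cmod (cm (%h. ip (Y (h + l)) (Y h))) <= (\<Sum>zt\<in>X. cmod (co zt (dD l)) * cmod (co zt (%x. cnj (dG l x))))"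
    unfolding ge X_def by (rule gam_bound[OF dA(2) A_cnj[OF dA(1)] chr_one p])
   also have "... <= (\<Sum>ps\<in>X. (B * B) * cmod (ip (tr (zsmul q l) D) (%x. D x * ch ps x)))"
   proof (intro sum_mono)
    fix ps assume psi: "ps : X"
    have "co ps (dD l) = ip (tr (zsmul q l) D) (%x. D x * ch ps x)"
     unfolding co_def ip_def dD_def by (simp add: mult.assoc)
    moreover have "cmod (co ps (%x. cnj (dG l x))) <= B * B"
     by (rule order_trans[OF co_norm_le[OF A_cnj[OF dA(1)] Xc[OF psi]]]) (rule nrm_bound[OF A_cnj[OF dA(1)] dGb])
    ultimately show "cmod (co ps (dD l)) * cmod (co ps (%x. cnj (dG l x))) <= (B * B) * cmod (ip (tr (zsmul q l) D) (%x. D x * ch ps x))"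
     by (simp add: mult.commute mult_right_mono)
   qed
   finally show ?thesis .
  qed
  have bip: "bdd (%l. cmod (ip (tr (zsmul q l) D) (%x. D x * ch ps x)))" if "ps : X" for ps
   by (intro bdd_norm bdd_gam A_intros D Xc that)
  have bY: "bdd (%h. ip (Y (h + l)) (Y h))" for l by (rule bdd_ip[of _ _ B B]) (auto intro: YA Yn)
  have bg: "bdd (%l. cmod (cm (%h. ip (Y (h + l)) (Y h))))"
  proof (rule bddI[of _ "B * B"])
   fix l
   have "cmod (ip (Y (h + l)) (Y h)) <= B * B" for h by (intro ip_bound YA Yn)
   then show "norm (cmod (cm (%h. ip (Y (h + l)) (Y h)))) <= B * B" using norm_cm_bound[OF bY] by simp
  qed
  have "m (%l. cmod (cm (%h. ip (Y (h + l)) (Y h)))) <= m (%l. \<Sum>ps\<in>X. (B * B) * cmod (ip (tr (zsmul q l) D) (%x. D x * ch ps x)))"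
   by (intro m_mono bg gb bdd_sum bdd_mult bdd_const bip)
  also have "... = (\<Sum>ps\<in>X. (B * B) * m (%l. cmod (ip (tr (zsmul q l) D) (%x. D x * ch ps x))))"
   by (simp add: m_sum m_scale bip bdd_mult bdd_const)
  also have "... <= (\<Sum>ps\<in>X. (B * B) * sqrt (K * t^2))"
  proof (intro sum_mono mult_left_mono)
   fix ps assume psi: "ps : X"
   have A: "(%x. D x * ch ps x) : A" by (intro A_intros D Xc psi)
   have "nrm (%x. ch ps x * D x) = nrm D" by (intro nrm_mult1 A_ch D Xc psi ch_norm)
   then have n: "n2 (%x. D x * ch ps x) = n2 D" by (simp add: nrm_def mult.commute)
   have n1: "n2 D <= 1" using D nrm_sq[OF D(1)] nrm_nonneg[OF D(1)] power_mono[of "nrm D" 1 2] by simp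
   have "m (%l. cmod (ip (tr (zsmul q l) D) (%x. D x * ch ps x))) <= sqrt (K * (n2 (%x. D x * ch ps x) * (nrm D * t^2)))"
    by (rule K(2)[OF D(1) A]) (auto intro: s)
   also have "... <= sqrt (K * (1 * (1 * t^2)))" unfolding n using n1 n2_nonneg(1)[OF D(1)] nrm_nonneg[OF D(1)] D(2) K(1)
    by (intro real_sqrt_le_mono mult_left_mono mult_mono) auto
   finally show "m (%l. cmod (ip (tr (zsmul q l) D) (%x. D x * ch ps x))) <= sqrt (K * t^2)" by simp
  qed (use B in auto)
  also have "... = c * t" using t by (simp add: c_def real_sqrt_mult)
  finally have mm: "m (%l. cmod (cm (%h. ip (Y (h + l)) (Y h)))) <= c * t" .
  have kk: "n2 (%x. cnj (K2 x)) <= 1"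
  proof -
   have "nrm (%x. cnj (K2 x)) <= nrm K2" by (intro nrm_mono A_cnj K2) simp
   then have "nrm (%x. cnj (K2 x)) <= 1" using K2(2) by simp
   then show ?thesis using nrm_sq[OF A_cnj[OF K2(1)]] nrm_nonneg[OF A_cnj[OF K2(1)]] power_mono[of "nrm (%x. cnj (K2 x))" 1 2] by simp
  qed
  have m0: "0 <= m (%l. cmod (cm (%h. ip (Y (h + l)) (Y h))))" by (intro m_nonneg bg) simp
  have "(cmod (cm (%h. ip (Y h) (%x. cnj (K2 x)))))^2 <= n2 (%x. cnj (K2 x)) * m (%l. cmod (cm (%h. ip (Y (h + l)) (Y h))))"
   by (rule vdc[OF YA Yn A_cnj[OF K2(1)]])
  also have "... <= 1 * m (%l. cmod (cm (%h. ip (Y (h + l)) (Y h))))" by (rule mult_right_mono[OF kk m0])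
  also have "... <= c * t" using mm by simp
  finally show "cmod (cm (%h. cor3 p1 p2 G D K2 h)) <= sqrt (c * t)"
   unfolding e by (rule real_le_rsqrt)
 qed
qed

lemma bessel1: assumes "F : A" "nrm F <= 1" "finite X" "X <= Collect chr"
 shows "(\<Sum>zt\<in>X. (cmod (co zt F))^2) <= 1"
proof -
 have "n2 F <= 1" using assms(2) nrm_sq[OF assms(1)] nrm_nonneg[OF assms(1)] power_mono[of "nrm F" 1 2] by simp
 then show ?thesis using bessel[OF assms(1,3,4)] by simp
qed

text \<open>The point is a constant uniform in the three functions. \<open>K1\<close> is split at a
  threshold: its remainder is negligible by \<open>three_err\<close>, and each retained character
  leaves a two-term correlation of \<open>K2\<close> with a twist of \<open>G\<close>, whose
  coefficients are at most \<eta>. The resulting double sum is controlled by Bessel because the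
  relation between the two characters has bounded degree on both sides.\<close>

lemma three:
 assumes p1: "fin_idx p1 TYPE('a)" and p2: "fin_idx p2 TYPE('a)" and q: "fin_idx (p1 - p2) TYPE('a)"
 obtains C where "0 < C" "!!G K1 K2 \<eta>. G : A ==> K1 : A ==> K2 : A ==> nrm K1 <= 1 ==> nrm K2 <= 1 ==>
   0 <= \<eta> ==> (!!zt. chr zt ==> cmod (co zt G) <= \<eta>) ==>
   cmod (cm (%h. cor3 p1 p2 G K1 K2 h)) <= C * \<eta>"
proof -
 obtain C1 where C1: "!!\<xi>. finite (idxset p1 \<xi> :: ('a => complex) set)" "!!\<xi>. card (idxset p1 \<xi> :: ('a => complex) set) <= C1"
  by (rule idxset_card[OF p1]) blast
 obtain C2 where C2: "!!\<xi>. finite (idxset p2 \<xi> :: ('a => complex) set)" "!!\<xi>. card (idxset p2 \<xi> :: ('a => complex) set) <= C2"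
  by (rule idxset_card[OF p2]) blast
 define C where "C = real C1 + real C2 + 1"
 show ?thesis
 proof (rule that)
  show "0 < C" by (simp add: C_def)
  fix G K1 K2 \<eta> assume G: "G : A" and K1: "K1 : A" and K2: "K2 : A" and n: "nrm K1 <= 1" "nrm K2 <= 1"
   and eta: "0 <= (\<eta>::real)" "!!zt. chr zt ==> cmod (co zt G) <= \<eta>"
  obtain c where c: "!!D t. D : A ==> nrm D <= 1 ==> 0 < t ==> (!!zt. chr zt ==> cmod (co zt D) <= t^2) ==>
   cmod (cm (%h. cor3 p1 p2 G D K2 h)) <= sqrt (c * t)"
   by (rule three_err[OF p1 q G K2 n(2)]) blast
  obtain B where B: "0 < B" "!!x. cmod (G x) <= B" by (rule A_bound[OF G]) blast
  obtain B2 where B2: "0 < B2" "!!x. cmod (K2 x) <= B2" by (rule A_bound[OF K2]) blast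
  have bI: "bdd (%h. cor3 p1 p2 G D K2 h)" if D: "D : A" for D
  proof (rule bdd_I[of _ "B * B2 * nrm D"])
   fix h
   have "nrm (%x. G x * tr (zsmul p2 h) K2 x * tr (zsmul p1 h) D x) <= B * B2 * nrm D"
    using D by (intro nrm_prod3 A_intros G K2 B tr_cmod_le B2) (simp_all add: nrm_tr)
   then show "nrm (%x. G x * tr (zsmul p1 h) D x * tr (zsmul p2 h) K2 x) <= B * B2 * nrm D" by (simp add: mult_ac)
  qed (intro A_intros G K2 D)
  show "cmod (cm (%h. cor3 p1 p2 G K1 K2 h)) <= C * \<eta>"
  proof (rule sqrt_eps_le[where c = c])
   fix t :: real assume t: "0 < t"
   define X where "X = {zt. chr zt & t^2 <= cmod (co zt K1)}"
   have t2: "0 < t^2" using t by simp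
   have X: "finite X" "{zt. chr zt & t^2 <= cmod (co zt K1)} <= X" "X <= Collect chr"
    using spec_finite[OF K1 t2] by (auto simp: X_def)
   have Xc: "chr zt" if "zt : X" for zt using that X(3) by auto
   define D where "D = dec X K1"
   have D: "D : A" "nrm D <= 1" unfolding D_def using A_dec[OF K1 X(3)] nrm_dec[OF K1 X(1,3)] n(1) by auto
   have Dc: "cmod (co zt D) <= t^2" if "chr zt" for zt unfolding D_def by (rule dec_small[OF K1 t2 X that])
   define \<xi> where "\<xi> zt h = zt (zsmul p1 h)" for zt :: "'a => complex" and h
   have xc: "chr (\<xi> zt)" if "zt : X" for zt unfolding \<xi>_def[abs_def] by (intro chr_zsmul Xc that)
   define H where "H zt x = cnj (G x * ch zt x)" for zt x
   have HA: "H zt : A" if "zt : X" for zt unfolding H_def[abs_def] by (intro A_intros G Xc that)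
   have split: "cor3 p1 p2 G K1 K2 h =
     cor3 p1 p2 G D K2 h + (\<Sum>zt\<in>X. co zt K1 * (\<xi> zt h * ip (tr (zsmul p2 h) K2) (H zt)))" for h
   proof -
    have e: "tr g K1 x = tr g D x + (\<Sum>zt\<in>X. (co zt K1 * zt g) * ch zt x)" for g x
     unfolding D_def by (rule tr_split[OF X(3)])
    have "cor3 p1 p2 G K1 K2 h =
     I (%x. G x * tr (zsmul p1 h) D x * tr (zsmul p2 h) K2 x + (\<Sum>zt\<in>X. (co zt K1 * \<xi> zt h) * (tr (zsmul p2 h) K2 x * cnj (H zt x))))"
     unfolding e by (simp add: \<xi>_def H_def algebra_simps sum_distrib_left)
    also have "... = cor3 p1 p2 G D K2 h + (\<Sum>zt\<in>X. I (%x. (co zt K1 * \<xi> zt h) * (tr (zsmul p2 h) K2 x * cnj (H zt x))))"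
     by (subst I_add) (auto intro!: A_intros G D K2 HA I_sum)
    also have "(\<Sum>zt\<in>X. I (%x. (co zt K1 * \<xi> zt h) * (tr (zsmul p2 h) K2 x * cnj (H zt x)))) = (\<Sum>zt\<in>X. co zt K1 * (\<xi> zt h * ip (tr (zsmul p2 h) K2) (H zt)))"
     unfolding ip_def mult.assoc[symmetric, of "co _ K1"] by (intro sum.cong refl I_scale A_intros K2 HA)
    finally show ?thesis .
   qed
   have bs: "bdd (%h. \<xi> zt h * ip (tr (zsmul p2 h) K2) (H zt))" if "zt : X" for zt
    by (intro bdd_mult chr_bdd xc bdd_gam K2 HA that)
   have "cm (%h. cor3 p1 p2 G K1 K2 h) =
    cm (%h. cor3 p1 p2 G D K2 h) + cm (%h. \<Sum>zt\<in>X. co zt K1 * (\<xi> zt h * ip (tr (zsmul p2 h) K2) (H zt)))"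
    unfolding split by (intro cm_add bI D bdd_sum bdd_mult[OF bdd_const] bs)
   also have "cm (%h. \<Sum>zt\<in>X. co zt K1 * (\<xi> zt h * ip (tr (zsmul p2 h) K2) (H zt))) = (\<Sum>zt\<in>X. co zt K1 * cm (%h. \<xi> zt h * ip (tr (zsmul p2 h) K2) (H zt)))"
    by (simp add: cm_sum cm_scale bs bdd_mult[OF bdd_const])
   finally have "cmod (cm (%h. cor3 p1 p2 G K1 K2 h)) <=
    cmod (cm (%h. cor3 p1 p2 G D K2 h)) + cmod (\<Sum>zt\<in>X. co zt K1 * cm (%h. \<xi> zt h * ip (tr (zsmul p2 h) K2) (H zt)))"
    using norm_triangle_ineq by (simp only:)
   also have "cmod (cm (%h. cor3 p1 p2 G D K2 h)) <= sqrt (c * t)"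
    by (rule c[OF D t Dc])
   also have "cmod (\<Sum>zt\<in>X. co zt K1 * cm (%h. \<xi> zt h * ip (tr (zsmul p2 h) K2) (H zt))) <= C * \<eta>"
   proof -
    define Z where "Z zt = (idxset p2 (\<xi> zt) :: ('a => complex) set)" for zt
    have Z: "finite (Z zt)" "card (Z zt) <= C2" for zt unfolding Z_def by (rule C2)+
    have Zc: "chr ps" if "ps : Z zt" for ps zt using that by (simp add: Z_def idxset_def)
    define a where "a zt = cmod (co zt K1)" for zt
    define b where "b zt = cmod (co zt K2)" for zt
    have a1: "(\<Sum>zt\<in>X. (a zt)^2) <= 1" unfolding a_def by (rule bessel1[OF K1 n(1) X(1,3)])
    have "cmod (co zt K1 * cm (%h. \<xi> zt h * ip (tr (zsmul p2 h) K2) (H zt))) <= (\<Sum>ps\<in>Z zt. \<eta> * ((a zt)^2 + (b ps)^2))" if z: "zt : X" for zt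
    proof -
     have "cmod (cm (%h. \<xi> zt h * ip (tr (zsmul p2 h) K2) (H zt))) <= (\<Sum>ps\<in>Z zt. cmod (co ps K2) * cmod (co ps (H zt)))"
      unfolding Z_def by (rule gam_bound[OF K2 HA[OF z] xc[OF z] p2])
     also have "... <= (\<Sum>ps\<in>Z zt. b ps * \<eta>)"
     proof (intro sum_mono)
      fix ps assume psi: "ps : Z zt"
      have "cmod (co ps (H zt)) <= \<eta>" unfolding H_def[abs_def] co_cnj_ch[OF G Xc[OF z] Zc[OF psi]]
       by (intro eta chr_cnj chr_mult Xc z Zc[OF psi])
      then show "cmod (co ps K2) * cmod (co ps (H zt)) <= b ps * \<eta>" unfolding b_def by (rule mult_left_mono) simp
     qed
     finally have "cmod (co zt K1 * cm (%h. \<xi> zt h * ip (tr (zsmul p2 h) K2) (H zt))) <= a zt * (\<Sum>ps\<in>Z zt. b ps * \<eta>)"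
      unfolding norm_mult a_def by (rule mult_left_mono) simp
     also have "... = (\<Sum>ps\<in>Z zt. \<eta> * (a zt * b ps))" by (simp add: sum_distrib_left mult_ac)
     also have "... <= (\<Sum>ps\<in>Z zt. \<eta> * ((a zt)^2 + (b ps)^2))"
     proof (intro sum_mono mult_left_mono eta(1))
      fix ps
      have "0 <= (a zt - b ps)^2 + (a zt)^2 + (b ps)^2" by simp
      then show "a zt * b ps <= (a zt)^2 + (b ps)^2" by (simp add: power2_diff)
     qed
     finally show ?thesis .
    qed
    then have "cmod (\<Sum>zt\<in>X. co zt K1 * cm (%h. \<xi> zt h * ip (tr (zsmul p2 h) K2) (H zt))) <= (\<Sum>zt\<in>X. \<Sum>ps\<in>Z zt. \<eta> * ((a zt)^2 + (b ps)^2))"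
     by (rule sum_norm_le)
    also have "... = \<eta> * ((\<Sum>zt\<in>X. \<Sum>ps\<in>Z zt. (a zt)^2) + (\<Sum>zt\<in>X. \<Sum>ps\<in>Z zt. (b ps)^2))"
     by (simp only: sum.distrib[symmetric] sum_distrib_left)
    \<comment> \<open>Each \<open>zt\<close> has at most \<open>C2\<close> partners and each
      \<open>ps\<close> at most \<open>C1\<close>; the second sum is rearranged over
      \<open>ps\<close> before Bessel is applied.\<close>
    also have "... <= \<eta> * (real C2 + real C1)"
    proof (intro mult_left_mono add_mono eta(1))
     have "(\<Sum>zt\<in>X. \<Sum>ps\<in>Z zt. (a zt)^2) <= (\<Sum>zt\<in>X. real C2 * (a zt)^2)"
      by (intro sum_mono) (simp add: mult_right_mono Z)
     also have "... <= real C2 * 1" unfolding sum_distrib_left[symmetric] using a1 by (intro mult_left_mono) auto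
     finally show "(\<Sum>zt\<in>X. \<Sum>ps\<in>Z zt. (a zt)^2) <= real C2" by simp
     define U where "U = (\<Union>zt\<in>X. Z zt)"
     have U: "finite U" "U <= Collect chr" unfolding U_def using X(1) Z Zc by auto
     have "(\<Sum>zt\<in>X. \<Sum>ps\<in>Z zt. (b ps)^2) = (\<Sum>zt\<in>X. \<Sum>ps\<in>{ps:U. ps : Z zt}. (b ps)^2)"
      by (intro sum.cong refl) (auto simp: U_def)
     also have "... = (\<Sum>ps\<in>U. \<Sum>zt\<in>{zt:X. ps : Z zt}. (b ps)^2)" by (rule sum.swap_restrict[OF X(1) U(1)])
     also have "... <= (\<Sum>ps\<in>U. real C1 * (b ps)^2)"
     proof (intro sum_mono)
      fix ps assume "ps : U"
      have "{zt:X. ps : Z zt} <= idxset p1 (%h. ps (zsmul p2 h))"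
       using Xc by (auto simp: Z_def idxset_def \<xi>_def mult.commute)
      then have "card {zt:X. ps : Z zt} <= C1" using card_mono[OF C1(1)] C1(2) order_trans by blast
      then show "(\<Sum>zt\<in>{zt:X. ps : Z zt}. (b ps)^2) <= real C1 * (b ps)^2" by (simp add: mult_right_mono)
     qed
     also have "... <= real C1 * 1" unfolding sum_distrib_left[symmetric] b_def
      by (intro mult_left_mono bessel1 K2 n U) auto
     finally show "(\<Sum>zt\<in>X. \<Sum>ps\<in>Z zt. (b ps)^2) <= real C1" by simp
    qed
    also have "... <= C * \<eta>" unfolding C_def using eta(1) by (simp add: algebra_simps)
    finally show ?thesis .
   qed
   finally show "cmod (cm (%h. cor3 p1 p2 G K1 K2 h)) <= C * \<eta> + sqrt (c * t)" by simp
  qed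
 qed
qed

text \<open>Van der Corput removes \<open>k3\<close> and leaves, for each \<open>l\<close>, a
  three-term correlation of multiplicative derivatives. Either all Fourier coefficients of the
  derivative of \<open>g\<close> are at most \<eta> and \<open>three\<close> applies, or
  \<open>l\<close> is exceptional and the trivial bound 1 is used. Sup bounds are imposed on
  \<open>k1\<close> and \<open>k2\<close>, whose derivatives must have norm at most 1; for
  \<open>g\<close> and \<open>k3\<close> L2 bounds suffice.\<close>

lemma gvn:
 assumes p1: "fin_idx (q1 - q0) TYPE('a)" and p2: "fin_idx (q2 - q0) TYPE('a)" and p3: "fin_idx (q1 - q2) TYPE('a)"
 obtains C where "0 < C" "!!g k1 k2 k3 \<xi> \<eta>. g : A ==> k1 : A ==> k2 : A ==> k3 : A ==> nrm g <= 1 ==> (!!x. cmod (k1 x) <= 1) ==>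
   (!!x. cmod (k2 x) <= 1) ==> nrm k3 <= 1 ==> chr \<xi> ==> 0 <= \<eta> ==>
   (cmod (cm (%h. \<xi> h * cor4 q0 q1 q2 q3 g k1 k2 k3 h)))^2 <=
   C * \<eta> + msr {l. EX zt. chr zt & \<eta> < cmod (ip (tr (zsmul (q0 - q3) l) g) (%x. ch zt x * g x))}"
proof -
 have "fin_idx ((q1 - q0) - (q2 - q0)) TYPE('a)" using p3 by simp
 from three[OF p1 p2 this]
 obtain C where C: "0 < C" "!!G K1 K2 \<eta>. G : A ==> K1 : A ==> K2 : A ==> nrm K1 <= 1 ==> nrm K2 <= 1 ==>
   0 <= \<eta> ==> (!!zt. chr zt ==> cmod (co zt G) <= \<eta>) ==>
   cmod (cm (%h. I (%x. G x * tr (zsmul (q1 - q0) h) K1 x * tr (zsmul (q2 - q0) h) K2 x))) <= C * \<eta>" by blast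
 show ?thesis
 proof (rule that[OF C(1)])
  fix g k1 k2 k3 \<xi> \<eta>
  assume g: "g : A" and k1: "k1 : A" and k2: "k2 : A" and k3: "k3 : A" and ng: "nrm g <= 1"
   and b1: "!!x. cmod (k1 x) <= 1" and b2: "!!x. cmod (k2 x) <= 1" and n3: "nrm k3 <= 1" and xi: "chr (\<xi> :: 'a => complex)" and eta: "0 <= (\<eta>::real)"
  define Y where "Y h x = \<xi> h * (tr (zsmul (q1 - q3) h) k1 x * tr (zsmul (q2 - q3) h) k2 x * tr (zsmul (q0 - q3) h) g x)" for h :: 'a and x
  have YA: "Y h : A" for h unfolding Y_def[abs_def] by (intro A_intros g k1 k2)
  have Yn: "nrm (Y h) <= 1" for h
  proof -
   have "nrm (%x. tr (zsmul (q1 - q3) h) k1 x * tr (zsmul (q2 - q3) h) k2 x * tr (zsmul (q0 - q3) h) g x) <= 1 * 1 * 1"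
    by (intro nrm_prod3 A_intros g k1 k2 tr_cmod_le b1 b2) (simp_all add: nrm_tr g ng)
   then show ?thesis unfolding Y_def[abs_def] by (subst nrm_scale) (auto intro!: A_intros g k1 k2 simp: chr_norm[OF xi])
  qed
  have e: "\<xi> h * cor4 q0 q1 q2 q3 g k1 k2 k3 h = ip (Y h) (%x. cnj (k3 x))" for h
  proof -
   let ?c = "zsmul (- q3) h"
   have "cor4 q0 q1 q2 q3 g k1 k2 k3 h
    = I (%x. tr (zsmul q0 h) g (\<tau> ?c x) * tr (zsmul q1 h) k1 (\<tau> ?c x) * tr (zsmul q2 h) k2 (\<tau> ?c x) * tr (zsmul q3 h) k3 (\<tau> ?c x))"
    by (rule I_tau[symmetric]) (intro A_intros g k1 k2 k3)
   also have "... = I (%x. tr (zsmul (q1 - q3) h) k1 x * tr (zsmul (q2 - q3) h) k2 x * tr (zsmul (q0 - q3) h) g x * cnj (cnj (k3 x)))"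
    unfolding tr_tau by (simp add: zsmul_diff_left zsmul_minus_left mult_ac)
   finally show ?thesis unfolding ip_def Y_def mult.assoc[of "\<xi> h"] by (subst I_scale) (auto intro!: A_intros g k1 k2 k3)
  qed
  define d where "d p f l x = tr (zsmul p l) f x * cnj (f x)" for p :: int and f and l :: 'a and x
  have dA: "d p f l : A" if "f : A" for p f l unfolding d_def[abs_def] by (intro A_intros that)
  have dn: "nrm (d p f l) <= 1" if "f : A" "!!x. cmod (f x) <= 1" for p f l
  proof (rule nrm_bound[OF dA[OF that(1)]])
   have "cmod (tr (zsmul p l) f x) * cmod (f x) <= 1 * 1" for x by (intro mult_mono tr_cmod_le that) auto
   then show "cmod (d p f l x) <= 1" for x by (simp add: d_def norm_mult)
  qed
  have ge: "ip (Y (h + l)) (Y h) = \<xi> l * I (%x. d (q0 - q3) g l x * tr (zsmul (q1 - q0) h) (d (q1 - q3) k1 l) x * tr (zsmul (q2 - q0) h) (d (q2 - q3) k2 l) x)" for h l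
  proof -
   let ?c = "zsmul (q3 - q0) h"
   have x1: "\<xi> (h + l) * cnj (\<xi> h) = \<xi> l"
    using norm1_cnj(1)[OF chr_norm[OF xi, of h]] by (simp add: chr_add[OF xi] mult_ac)
   have "ip (Y (h + l)) (Y h) = I (%x. (\<xi> (h + l) * cnj (\<xi> h)) * (tr (zsmul (q0 - q3) h) (d (q0 - q3) g l) x * tr (zsmul (q1 - q3) h) (d (q1 - q3) k1 l) x * tr (zsmul (q2 - q3) h) (d (q2 - q3) k2 l) x))"
    unfolding ip_def Y_def d_def[abs_def] tr_mult tr_cnj tr_tr
    by (simp add: zsmul_add_right mult_ac tr_tr)
   also have "... = \<xi> l * I (%x. tr (zsmul (q0 - q3) h) (d (q0 - q3) g l) x * tr (zsmul (q1 - q3) h) (d (q1 - q3) k1 l) x * tr (zsmul (q2 - q3) h) (d (q2 - q3) k2 l) x)"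
    unfolding x1 by (rule I_scale) (intro A_intros dA g k1 k2)
   also have "I (%x. tr (zsmul (q0 - q3) h) (d (q0 - q3) g l) x * tr (zsmul (q1 - q3) h) (d (q1 - q3) k1 l) x * tr (zsmul (q2 - q3) h) (d (q2 - q3) k2 l) x)
    = I (%x. tr (zsmul (q0 - q3) h) (d (q0 - q3) g l) (\<tau> ?c x) * tr (zsmul (q1 - q3) h) (d (q1 - q3) k1 l) (\<tau> ?c x) * tr (zsmul (q2 - q3) h) (d (q2 - q3) k2 l) (\<tau> ?c x))"
    by (rule I_tau[symmetric]) (intro A_intros dA g k1 k2)
   also have "... = I (%x. d (q0 - q3) g l x * tr (zsmul (q1 - q0) h) (d (q1 - q3) k1 l) x * tr (zsmul (q2 - q0) h) (d (q2 - q3) k2 l) x)"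
    unfolding tr_tau by (simp add: zsmul_diff_left)
   finally show ?thesis .
  qed
  have bY: "bdd (%h. ip (Y (h + l)) (Y h))" for l by (rule bdd_ip[of _ _ 1 1]) (auto intro: YA Yn)
  have g1: "cmod (cm (%h. ip (Y (h + l)) (Y h))) <= 1" for l
  proof -
   have "cmod (ip (Y (h + l)) (Y h)) <= 1 * 1" for h by (intro ip_bound YA Yn)
   then show ?thesis using norm_cm_bound[OF bY] by simp
  qed
  have bI: "bdd (%h. I (%x. d (q0 - q3) g l x * tr (zsmul (q1 - q0) h) (d (q1 - q3) k1 l) x * tr (zsmul (q2 - q0) h) (d (q2 - q3) k2 l) x))" for l
  proof -
   have "bdd (%h. cnj (\<xi> l) * ip (Y (h + l)) (Y h))" by (intro bdd_mult bdd_const bY)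
   then show ?thesis unfolding ge using norm1_cnj_l(2)[OF chr_norm[OF xi]] by simp
  qed
  define S where "S = {l. EX zt. chr zt & \<eta> < cmod (ip (tr (zsmul (q0 - q3) l) g) (%x. ch zt x * g x))}"
  have gl: "cmod (cm (%h. ip (Y (h + l)) (Y h))) <= C * \<eta> + indicat_real S l" for l
  proof (cases "l : S")
   case True
   then show ?thesis using g1[of l] C(1) eta by (simp add: add_increasing)
  next
   case False
   have "cmod (co zt (d (q0 - q3) g l)) <= \<eta>" if "chr zt" for zt
   proof -
    have "co zt (d (q0 - q3) g l) = ip (tr (zsmul (q0 - q3) l) g) (%x. ch zt x * g x)"
     unfolding co_def ip_def d_def by (simp add: mult_ac)
    then show ?thesis using False that by (auto simp: S_def not_less)
   qed
   then have "cmod (cm (%h. I (%x. d (q0 - q3) g l x * tr (zsmul (q1 - q0) h) (d (q1 - q3) k1 l) x * tr (zsmul (q2 - q0) h) (d (q2 - q3) k2 l) x))) <= C * \<eta>"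
    by (intro C dA dn g k1 k2 b1 b2 eta)
   then show ?thesis unfolding ge using False by (simp add: cm_scale bI norm_mult chr_norm[OF xi])
  qed
  have bg: "bdd (%l. cmod (cm (%h. ip (Y (h + l)) (Y h))))" by (rule bddI[of _ 1]) (simp add: g1)
  have "m (%l. cmod (cm (%h. ip (Y (h + l)) (Y h)))) <= m (%l. C * \<eta> + indicat_real S l)"
   by (intro m_mono bg gl bdd_add bdd_const bdd_indicator')
  also have "... = C * \<eta> + msr S" by (simp add: m_add bdd_const bdd_indicator' msr_def)
  finally have mm: "m (%l. cmod (cm (%h. ip (Y (h + l)) (Y h)))) <= C * \<eta> + msr S" .
  have kk: "n2 (%x. cnj (k3 x)) <= 1"
  proof -
   have "nrm (%x. cnj (k3 x)) <= nrm k3" by (intro nrm_mono A_cnj k3) simp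
   then have "nrm (%x. cnj (k3 x)) <= 1" using n3 by simp
   then show ?thesis using nrm_sq[OF A_cnj[OF k3]] nrm_nonneg[OF A_cnj[OF k3]] power_mono[of "nrm (%x. cnj (k3 x))" 1 2] by simp
  qed
  have m0: "0 <= m (%l. cmod (cm (%h. ip (Y (h + l)) (Y h))))" by (intro m_nonneg bg) simp
  have "(cmod (cm (%h. ip (Y h) (%x. cnj (k3 x)))))^2 <= n2 (%x. cnj (k3 x)) * m (%l. cmod (cm (%h. ip (Y (h + l)) (Y h))))"
   by (rule vdc[OF YA Yn A_cnj[OF k3]])
  also have "... <= 1 * m (%l. cmod (cm (%h. ip (Y (h + l)) (Y h))))" by (rule mult_right_mono[OF kk m0])
  also have "... <= C * \<eta> + msr S" using mm by simp
  finally show "(cmod (cm (%h. \<xi> h * cor4 q0 q1 q2 q3 g k1 k2 k3 h)))^2 <=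
   C * \<eta> + msr {l. EX zt. chr zt & \<eta> < cmod (ip (tr (zsmul (q0 - q3) l) g) (%x. ch zt x * g x))}"
   unfolding e S_def .
 qed
qed

end

section \<open>The system of an ergodic mean\<close>

context imean
begin

definition l2 :: "('a => complex) => real" where "l2 f = m (%x. (cmod (f x))^2)"

lemma bdd_l2: "bdd f ==> bdd (%x. (cmod (f x))^2)" by (intro bdd_intros)

lemma l2_nonneg: "bdd f ==> 0 <= l2 f" unfolding l2_def by (intro m_nonneg bdd_l2) auto

lemma l2_add: assumes "bdd f" "bdd g" shows "l2 (%x. f x + g x) <= 2 * l2 f + 2 * l2 g"
proof -
 have "l2 (%x. f x + g x) <= m (%x. 2 * (cmod (f x))^2 + 2 * (cmod (g x))^2)"
  unfolding l2_def
 proof (intro m_mono bdd_l2 bdd_add bdd_mult bdd_const assms)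
  fix x
  have "(cmod (f x + g x))^2 <= (cmod (f x) + cmod (g x))^2" by (intro power_mono norm_triangle_ineq) auto
  also have "... <= 2 * (cmod (f x))^2 + 2 * (cmod (g x))^2"
   using zero_le_power2[of "cmod (f x) - cmod (g x)"] by (simp add: power2_sum power2_diff)
  finally show "(cmod (f x + g x))^2 <= 2 * (cmod (f x))^2 + 2 * (cmod (g x))^2" .
 qed
 also have "... = 2 * l2 f + 2 * l2 g" by (simp add: m_add m_scale bdd_l2 bdd_mult bdd_const assms l2_def)
 finally show ?thesis .
qed

lemma l2_add3: assumes "bdd f" "bdd g" "bdd h"
 shows "l2 (%x. f x + g x + h x) <= 4 * l2 f + 4 * l2 g + 4 * l2 h"
proof -
 have "l2 (%x. f x + g x + h x) <= 2 * l2 (%x. f x + g x) + 2 * l2 h" by (intro l2_add bdd_add assms)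
 also have "... <= 2 * (2 * l2 f + 2 * l2 g) + 2 * l2 h" using l2_add[OF assms(1,2)] by simp
 finally show ?thesis using l2_nonneg[OF assms(3)] by simp
qed

lemma l2_tri: assumes "bdd a" "bdd b" "bdd c" "bdd d"
 shows "l2 (%x. a x - d x) <= 4 * l2 (%x. a x - b x) + 4 * l2 (%x. b x - c x) + 4 * l2 (%x. c x - d x)"
 using l2_add3[of "%x. a x - b x" "%x. b x - c x" "%x. c x - d x"] assms by (simp add: bdd_diff)

lemma l2_shift: "bdd f ==> l2 (%x. f (x + g)) = l2 f"
 unfolding l2_def by (rule m_shift[OF bdd_l2])

text \<open>Convexity of the square together with translation invariance.\<close>

lemma l2_avg: assumes "bdd f" "0 < n" shows "l2 (%x. (\<Sum>i<n. f (x + p i)) / of_nat n) <= l2 f"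
proof -
 have b: "bdd (%x. (\<Sum>i<n. f (x + p i)) / of_nat n)"
  using bdd_mult[OF bdd_sum[of "{..<n}" "%i x. f (x + p i)"] bdd_const[of "inverse (of_nat n)"]]
  by (simp add: divide_inverse bdd_shift assms)
 have "l2 (%x. (\<Sum>i<n. f (x + p i)) / of_nat n) <= m (%x. (1 / real n) * (\<Sum>i<n. (cmod (f (x + p i)))^2))"
  unfolding l2_def
 proof (intro m_mono bdd_l2 b bdd_mult bdd_const bdd_sum bdd_shift assms)
  fix x
  have "(cmod ((\<Sum>i<n. f (x + p i)) / of_nat n))^2 <= ((\<Sum>i<n. cmod (f (x + p i))) / real n)^2"
   by (intro power_mono) (simp_all add: norm_divide divide_right_mono norm_sum)
  also have "... = (\<Sum>i<n. cmod (f (x + p i)))^2 / (real n)^2" by (simp add: power_divide)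
  also have "... <= ((\<Sum>i<n. (cmod (f (x + p i)))^2) * real n) / (real n)^2"
   using sum_squared_le_sum_of_squares[of "%i. cmod (f (x + p i))" "{..<n}"] by (intro divide_right_mono) auto
  also have "... = (1 / real n) * (\<Sum>i<n. (cmod (f (x + p i)))^2)" using assms(2) by (simp add: power2_eq_square)
  finally show "(cmod ((\<Sum>i<n. f (x + p i)) / of_nat n))^2 <= (1 / real n) * (\<Sum>i<n. (cmod (f (x + p i)))^2)" .
 qed
 also have "... = (1 / real n) * (\<Sum>i<n. m (%x. (cmod (f (x + p i)))^2))"
  by (subst m_scale) (auto intro!: bdd_sum bdd_l2 bdd_shift assms m_sum)
 also have "... = l2 f" using l2_shift[OF assms(1)] assms(2) by (simp add: l2_def)
 finally show ?thesis .
qed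

lemma cm_diff_sq: assumes "bdd f" "bdd g" shows "(cmod (cm f - cm g))^2 <= l2 (%x. f x - g x)"
 unfolding l2_def cm_diff[OF assms, symmetric] by (intro norm_cm_sq bdd_diff assms)

lemma cm_sq: "bdd f ==> cm (%x. f x * cnj (f x)) = cx (l2 f)"
 by (simp only: complex_norm_square[symmetric] of_real_power[symmetric] cm_of_real l2_def)

text \<open>
  The completion consists of bounded L2-Cauchy sequences of functions, coded as functions on pairs.
\<close>

definition GA :: "(nat \<times> 'a => complex) set" where
 "GA = {F. bdd F & (ALL eps>0. EX N. ALL k>=N. ALL l>=N. l2 (%x. F (k, x) - F (l, x)) < eps)}"

definition GI :: "(nat \<times> 'a => complex) => complex" where
 "GI F = lim (%n. cm (%x. F (n, x)))"

definition Gtau :: "'a => nat \<times> 'a => nat \<times> 'a" where "Gtau g z = (fst z, snd z + g)"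

lemma GA_bdd: assumes "F : GA" shows "bdd F" "bdd (%x. F (n, x))"
 using assms unfolding GA_def by (auto intro: bdd_compose)

lemma GA_cauchy: assumes "F : GA" "0 < eps" obtains N where "!!k l. N <= k ==> N <= l ==> l2 (%x. F (k, x) - F (l, x)) < eps"
 using assms unfolding GA_def by blast

lemma GA_I: assumes "bdd F" "!!eps. 0 < eps ==> EX N. ALL k>=N. ALL l>=N. l2 (%x. F (k, x) - F (l, x)) <= c * eps" "0 < c"
 shows "F : GA"
proof -
 have "EX N. ALL k>=N. ALL l>=N. l2 (%x. F (k, x) - F (l, x)) < eps" if "0 < eps" for eps
 proof -
  have "0 < eps / (2 * c)" "c * (eps / (2 * c)) < eps" using that assms(3) by (simp_all add: field_simps)
  with assms(2)[of "eps / (2 * c)"] show ?thesis by (meson le_less_trans)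
 qed
 then show ?thesis using assms(1) by (simp add: GA_def)
qed

lemma GI_lim: assumes "F : GA" shows "(%n. cm (%x. F (n, x))) \<longlonglongrightarrow> GI F"
proof -
 have "Cauchy (%n. cm (%x. F (n, x)))"
 proof (rule metric_CauchyI)
  fix e :: real assume e: "0 < e"
  then have "0 < e^2" by simp
  from GA_cauchy[OF assms this] obtain N where N: "!!k l. N <= k ==> N <= l ==> l2 (%x. F (k, x) - F (l, x)) < e^2" by blast
  have "dist (cm (%x. F (k, x))) (cm (%x. F (l, x))) < e" if "N <= k" "N <= l" for k l
  proof -
   have "(cmod (cm (%x. F (k, x)) - cm (%x. F (l, x))))^2 < e^2"
    by (rule le_less_trans[OF cm_diff_sq[OF GA_bdd(2)[OF assms] GA_bdd(2)[OF assms]] N[OF that]])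
   then show ?thesis using e by (simp add: dist_norm power2_less_imp_less)
  qed
  then show "EX M. ALL k>=M. ALL l>=M. dist (cm (%x. F (k, x))) (cm (%x. F (l, x))) < e" by blast
 qed
 then show ?thesis unfolding GI_def by (simp add: Cauchy_convergent_iff convergent_LIMSEQ_iff)
qed

lemma GI_unique: "F : GA ==> (%n. cm (%x. F (n, x))) \<longlonglongrightarrow> c ==> GI F = c"
 using GI_lim LIMSEQ_unique by blast

lemma l2_mult: assumes "bdd f" "!!x. cmod (b x) <= B" "0 <= B" shows "l2 (%x. b x * f x) <= B^2 * l2 f"
proof -
 have bb: "bdd b" by (rule bddI[of _ B]) (rule assms)
 have "l2 (%x. b x * f x) <= m (%x. B^2 * (cmod (f x))^2)"
  unfolding l2_def using assms by (intro m_mono bdd_l2 bdd_mult bb bdd_const)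
   (auto simp: norm_mult power_mult_distrib intro!: mult_right_mono power_mono)
 then show ?thesis by (simp add: m_scale bdd_l2 assms l2_def)
qed

lemma GA_const: "(%x. c) : GA" by (auto simp: GA_def l2_def bdd_const)

lemma GA_chr: "bdd zt ==> (%z. zt (snd z)) : GA" by (auto simp: GA_def l2_def bdd_compose)

lemma GA_cnj: assumes "F : GA" shows "(%z. cnj (F z)) : GA"
proof -
 have "l2 (%x. cnj (F (k, x)) - cnj (F (l, x))) = l2 (%x. F (k, x) - F (l, x))" for k l
  unfolding l2_def complex_cnj_diff[symmetric] complex_mod_cnj ..
 then show ?thesis using assms unfolding GA_def by (auto intro: bdd_cnj)
qed

lemma GA_tau: assumes "F : GA" shows "(%z. F (Gtau g z)) : GA"
proof -
 have "l2 (%x. F (k, x + g) - F (l, x + g)) = l2 (%x. F (k, x) - F (l, x))" for k l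
  using l2_shift[of "%x. F (k, x) - F (l, x)" g] GA_bdd(2)[OF assms] by (simp add: bdd_diff)
 moreover have "bdd (%z. F (Gtau g z))" by (rule bdd_compose[OF GA_bdd(1)[OF assms]])
 ultimately show ?thesis using assms unfolding GA_def by (simp add: Gtau_def)
qed

lemma GA_add: assumes "F : GA" "G : GA" shows "(%z. F z + G z) : GA"
proof (rule GA_I[where c = 4])
 fix eps :: real assume e: "0 < eps"
 obtain N where N: "!!k l. N <= k ==> N <= l ==> l2 (%x. F (k, x) - F (l, x)) < eps" using GA_cauchy[OF assms(1) e] by blast
 obtain M where M: "!!k l. M <= k ==> M <= l ==> l2 (%x. G (k, x) - G (l, x)) < eps" using GA_cauchy[OF assms(2) e] by blast
 have "l2 (%x. F (k, x) + G (k, x) - (F (l, x) + G (l, x))) <= 4 * eps" if "max N M <= k" "max N M <= l" for k l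
 proof -
  have "l2 (%x. F (k, x) + G (k, x) - (F (l, x) + G (l, x))) = l2 (%x. (F (k, x) - F (l, x)) + (G (k, x) - G (l, x)))"
   by (simp add: algebra_simps)
  also have "... <= 2 * l2 (%x. F (k, x) - F (l, x)) + 2 * l2 (%x. G (k, x) - G (l, x))"
   by (intro l2_add bdd_diff GA_bdd assms)
  finally show ?thesis using N[of k l] M[of k l] that by simp
 qed
 then show "EX N. ALL k>=N. ALL l>=N. l2 (%x. F (k, x) + G (k, x) - (F (l, x) + G (l, x))) <= 4 * eps" by blast
qed (rule bdd_add[OF GA_bdd(1)[OF assms(1)] GA_bdd(1)[OF assms(2)]], simp)

lemma GA_mult: assumes "F : GA" "G : GA" shows "(%z. F z * G z) : GA"
proof -
 obtain A where A: "0 <= A" "!!x. cmod (F x) <= A" using GA_bdd(1)[OF assms(1)] by (rule bddE) blast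
 obtain B where B: "0 <= B" "!!x. cmod (G x) <= B" using GA_bdd(1)[OF assms(2)] by (rule bddE) blast
 show ?thesis
 proof (rule GA_I[where c = "2 * B^2 + 2 * A^2 + 1"])
  fix eps :: real assume e: "0 < eps"
  obtain N where N: "!!k l. N <= k ==> N <= l ==> l2 (%x. F (k, x) - F (l, x)) < eps" using GA_cauchy[OF assms(1) e] by blast
  obtain M where M: "!!k l. M <= k ==> M <= l ==> l2 (%x. G (k, x) - G (l, x)) < eps" using GA_cauchy[OF assms(2) e] by blast
  have "l2 (%x. F (k, x) * G (k, x) - F (l, x) * G (l, x)) <= (2 * B^2 + 2 * A^2 + 1) * eps" if "max N M <= k" "max N M <= l" for k l
  proof -
   have bd: "bdd (%x. F (k, x) - F (l, x))" "bdd (%x. G (k, x) - G (l, x))" by (intro bdd_diff GA_bdd assms)+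
   have "l2 (%x. F (k, x) * G (k, x) - F (l, x) * G (l, x)) = l2 (%x. G (k, x) * (F (k, x) - F (l, x)) + F (l, x) * (G (k, x) - G (l, x)))"
    by (simp add: algebra_simps)
   also have "... <= 2 * l2 (%x. G (k, x) * (F (k, x) - F (l, x))) + 2 * l2 (%x. F (l, x) * (G (k, x) - G (l, x)))"
    by (intro l2_add bdd_diff bdd_mult GA_bdd assms)
   also have "... <= 2 * (B^2 * l2 (%x. F (k, x) - F (l, x))) + 2 * (A^2 * l2 (%x. G (k, x) - G (l, x)))"
    by (intro add_mono mult_left_mono l2_mult bd A B) auto
   also have "... <= 2 * (B^2 * eps) + 2 * (A^2 * eps)"
    using N[of k l] M[of k l] that by (intro add_mono mult_left_mono) auto
   also have "... <= (2 * B^2 + 2 * A^2 + 1) * eps" using e by (simp add: algebra_simps)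
   finally show ?thesis .
  qed
  then show "EX N. ALL k>=N. ALL l>=N. l2 (%x. F (k, x) * G (k, x) - F (l, x) * G (l, x)) <= (2 * B^2 + 2 * A^2 + 1) * eps" by blast
 qed (rule bdd_mult[OF GA_bdd(1)[OF assms(1)] GA_bdd(1)[OF assms(2)]], simp add: add_nonneg_pos)
qed

lemma GA_diff: "F : GA ==> G : GA ==> (%z. F z - G z) : GA"
 using GA_add[of F "%z. - 1 * G z"] GA_mult[OF GA_const[of "- 1"], of G] by simp

lemma GI_sq_lim: assumes "F : GA" shows "(%n. l2 (%x. F (n, x))) \<longlonglongrightarrow> Re (GI (%z. F z * cnj (F z)))"
 using tendsto_Re[OF GI_lim[OF GA_mult[OF assms GA_cnj[OF assms]]]] by (simp add: cm_sq GA_bdd(2)[OF assms])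

end

section \<open>Ergodicity and completeness of the completion\<close>

text \<open>Ergodicity is applied to one function far out in the Cauchy sequence; the same averages
  serve all later functions because averaging does not increase the seminorm. Three errors enter
  with factor 4 each, which spends 12 of the 20 parts of \<open>eps\<close>.\<close>

lemma (in emean) gns_erg:
 assumes F: "F : GA" and e: "0 < eps"
 shows "EX n>0. EX p. Re (GI (%z. ((\<Sum>i<(n::nat). F (Gtau (p i) z)) / of_nat n - GI F) *
     cnj ((\<Sum>i<n. F (Gtau (p i) z)) / of_nat n - GI F))) < eps"
proof -
 define e' where "e' = eps / 20"
 have e': "0 < e'" using e by (simp add: e'_def)
 obtain N where N: "!!k l. N <= k ==> N <= l ==> l2 (%x. F (k, x) - F (l, x)) < e'" using GA_cauchy[OF F e'] by blast
 have b: "bdd (%x. F (k, x))" for k by (rule GA_bdd[OF F])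
 have third: "(cmod (cm (%x. F (N, x)) - GI F))^2 <= e'"
 proof (rule LIMSEQ_le_const2)
  show "(%k. (cmod (cm (%x. F (N, x)) - cm (%x. F (k, x))))^2) \<longlonglongrightarrow> (cmod (cm (%x. F (N, x)) - GI F))\<^sup>2"
   by (intro tendsto_intros GI_lim F)
  show "EX M. ALL k>=M. (cmod (cm (%x. F (N, x)) - cm (%x. F (k, x))))^2 <= e'"
   using order_trans[OF cm_diff_sq[OF b b] less_imp_le[OF N]] by blast
 qed
 obtain n p where np: "0 < n" "l2 (%x. (\<Sum>i<n. F (N, x + p i)) / of_nat n - cm (%x. F (N, x))) < e'"
  using ergodic[OF b e', of N] unfolding l2_def by blast
 define av where "av k x = (\<Sum>i<n. F (k, x + p i)) / of_nat n" for k x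
 have bav: "bdd (av k)" for k
  unfolding av_def divide_inverse by (intro bdd_mult bdd_sum bdd_const bdd_shift b)
 have le: "l2 (%x. av k x - GI F) <= 12 * e'" if "N <= k" for k
 proof -
  have "l2 (%x. av k x - av N x) = l2 (%x. (\<Sum>i<n. (%x. F (k, x) - F (N, x)) (x + p i)) / of_nat n)"
   by (simp add: av_def sum_subtractf diff_divide_distrib)
  also have "... <= l2 (%x. F (k, x) - F (N, x))" by (intro l2_avg bdd_diff b np)
  finally have 1: "l2 (%x. av k x - av N x) <= e'" using N[of k N] that by simp
  have 2: "l2 (%x. av N x - cm (%x. F (N, x))) <= e'" using np(2) by (simp add: av_def)
  have 3: "l2 (%x. cm (%x. F (N, x)) - GI F) <= e'" using third by (simp add: l2_def)
  show ?thesis using l2_tri[of "av k" "av N" "%x. cm (%x. F (N, x))" "%x. GI F"] 1 2 3 by (simp add: bav bdd_const)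
 qed
 define W where "W z = (\<Sum>i<n. F (Gtau (p i) z)) / of_nat n - GI F" for z
 have sA: "(%z. \<Sum>i<(j::nat). F (Gtau (p i) z)) : GA" for j
  by (induction j) (simp_all add: GA_const GA_add[OF _ GA_tau[OF F]])
 have WA: "W : GA"
  unfolding W_def[abs_def] divide_inverse by (intro GA_diff GA_mult sA GA_const)
 have "Re (GI (%z. W z * cnj (W z))) <= 12 * e'"
 proof (rule LIMSEQ_le_const2[OF GI_sq_lim[OF WA]])
  have "(%x. W (k, x)) = (%x. av k x - GI F)" for k by (simp add: W_def av_def Gtau_def)
  then show "EX N. ALL k>=N. l2 (%x. W (k, x)) <= 12 * e'" using le by auto
 qed
 also have "... < eps" using e by (simp add: e'_def)
 finally show ?thesis using np(1) unfolding W_def by blast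
qed

text \<open>Diagonal construction: level \<open>k\<close> of the limit is level \<open>M k\<close>
  of \<open>S k\<close>, from where on \<open>S k\<close> oscillates by less than
  \<open>1 / real (Suc k)\<close>. The sup bound passes to the diagonal.\<close>

lemma (in imean) gns_complete:
 fixes S :: "nat => nat \<times> 'a => complex"
 assumes S: "!!k. S k : GA" and C: "!!k z. cmod (S k z) <= C"
  and cau: "!!eps. 0 < eps ==> EX N. ALL k>=N. ALL l>=N. Re (GI (%z. (S k z - S l z) * cnj (S k z - S l z))) < (eps::real)"
 shows "EX G:GA. (ALL z. cmod (G z) <= C) &
     (ALL eps>0. EX N. ALL k>=N. Re (GI (%z. (S k z - G z) * cnj (S k z - G z))) < (eps::real))"
proof -
 have "EX M. ALL i>=M. ALL j>=M. l2 (%x. S k (i, x) - S k (j, x)) < 1 / real (Suc k)" for k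
  using GA_cauchy[OF S, of "1 / real (Suc k)" k] by (metis of_nat_0_less_iff zero_less_Suc zero_less_divide_1_iff)
 then obtain M where M: "!!k i j. M k <= i ==> M k <= j ==> l2 (%x. S k (i, x) - S k (j, x)) < 1 / real (Suc k)" by metis
 define G where "G z = S (fst z) (M (fst z), snd z)" for z
 have GC: "cmod (G z) <= C" for z unfolding G_def by (rule C)
 have b: "bdd (%x. S k (i, x))" for k i by (rule GA_bdd[OF S])
 have ev: "EX i>=j. l2 (%x. S k (i, x) - S l (i, x)) < e"
  if "Re (GI (%z. (S k z - S l z) * cnj (S k z - S l z))) < e" for k l j e
 proof -
  from order_tendstoD(2)[OF GI_sq_lim[OF GA_diff[OF S S]] that]
  obtain N where "!!n. N <= n ==> l2 (%x. S k (n, x) - S l (n, x)) < e" unfolding eventually_sequentially by blast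
  then show ?thesis by (intro exI[of _ "max j N"]) simp
 qed
 have GG: "l2 (%x. S k (i, x) - G (l, x)) <= 4 * (1 / real (Suc k)) + 4 * e + 4 * (1 / real (Suc l))"
  if i: "M k <= i" and small: "Re (GI (%z. (S k z - S l z) * cnj (S k z - S l z))) < e" for k l e i
 proof -
  obtain j where j: "max (M k) (M l) <= j" "l2 (%x. S k (j, x) - S l (j, x)) < e" using ev[OF small] by blast
  have "l2 (%x. S k (i, x) - G (l, x)) <= 4 * l2 (%x. S k (i, x) - S k (j, x)) + 4 * l2 (%x. S k (j, x) - S l (j, x)) + 4 * l2 (%x. S l (j, x) - S l (M l, x))"
   using l2_tri[OF b[of k i] b[of k j] b[of l j] b[of l "M l"]] by (simp add: G_def)
  then show ?thesis using M[of k i j] M[of l j "M l"] i j by simp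
 qed
 have sm: "EX N. ALL k>=N. 1 / real (Suc k) <= e" if "0 < e" for e :: real
 proof -
  obtain N where N: "inverse (real (Suc N)) < e" using reals_Archimedean[OF \<open>0 < e\<close>] by blast
  have "1 / real (Suc k) <= e" if "N <= k" for k
  proof -
   have "1 / real (Suc k) <= 1 / real (Suc N)" using that by (intro divide_left_mono) auto
   then show ?thesis using N by (simp add: inverse_eq_divide)
  qed
  then show ?thesis by blast
 qed
 have unif: "EX N. ALL k>=N. ALL l>=N. ALL i>=M k. l2 (%x. S k (i, x) - G (l, x)) <= 12 * e" if e: "0 < e" for e
 proof -
  obtain N1 where N1: "!!k. N1 <= k ==> 1 / real (Suc k) <= e" using sm[OF e] by blast
  obtain N2 where N2: "!!k l. N2 <= k ==> N2 <= l ==> Re (GI (%z. (S k z - S l z) * cnj (S k z - S l z))) < e" using cau[OF e] by blast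
  have "l2 (%x. S k (i, x) - G (l, x)) <= 12 * e" if "max N1 N2 <= k" "max N1 N2 <= l" "M k <= i" for k l i
   using GG[OF that(3) N2[of k l]] N1[of k] N1[of l] that by simp
  then show ?thesis by blast
 qed
 have GA: "G : GA"
 proof (rule GA_I[where c = 12])
  fix e :: real assume "0 < e"
  from unif[OF this] obtain N where N: "!!k l i. N <= k ==> N <= l ==> M k <= i ==> l2 (%x. S k (i, x) - G (l, x)) <= 12 * e" by blast
  have "l2 (%x. G (k, x) - G (l, x)) <= 12 * e" if "N <= k" "N <= l" for k l
   using N[OF that order_refl] by (simp add: G_def)
  then show "EX N. ALL k>=N. ALL l>=N. l2 (%x. G (k, x) - G (l, x)) <= 12 * e" by blast
 qed (auto intro: bddI[of _ C] GC)
 have "EX N. ALL k>=N. Re (GI (%z. (S k z - G z) * cnj (S k z - G z))) < eps" if "0 < eps" for eps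
 proof -
  have e: "0 < eps / 24" using that by simp
  from unif[OF this] obtain N where N: "!!k l i. N <= k ==> N <= l ==> M k <= i ==> l2 (%x. S k (i, x) - G (l, x)) <= 12 * (eps / 24)" by blast
  have "Re (GI (%z. (S k z - G z) * cnj (S k z - G z))) < eps" if "N <= k" for k
  proof -
   have "Re (GI (%z. (S k z - G z) * cnj (S k z - G z))) <= 12 * (eps / 24)"
    by (rule LIMSEQ_le_const2[OF GI_sq_lim[OF GA_diff[OF S GA]]])
     (use N that in \<open>auto intro!: exI[of _ "max N (M k)"]\<close>)
   then show ?thesis using \<open>0 < eps\<close> by simp
  qed
  then show ?thesis by blast
 qed
 with GA GC show ?thesis by blast
qed

lemma gns:
 fixes L :: "('a::{ab_group_add, countable} => real) => real"
 assumes "ext_mean L"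
 shows "sys (imean.GA L) (imean.GI L) imean.Gtau snd"
proof -
 interpret emean L by unfold_locales fact
 have lim: "(%n. cm (%x. F (n, x))) \<longlonglongrightarrow> GI F" if "F : GA" for F by (rule GI_lim[OF that])
 show ?thesis
 proof (unfold_locales, goal_cases)
  case (1 c) show ?case by (rule GA_const)
 next
  case (2 F G) then show ?case by (rule GA_add)
 next
  case (3 F G) then show ?case by (rule GA_mult)
 next
  case (4 F) then show ?case by (rule GA_cnj)
 next
  case (5 F g) then show ?case by (rule GA_tau)
 next
  case (6 zt) then show ?case by (intro GA_chr chr_bdd)
 next
  case (7 F) then show ?case by (rule GA_bdd)
 next
  case (8 F G)
  show ?case
  proof (rule GI_unique[OF GA_add[OF 8]])
   have "cm (%x. F (n, x) + G (n, x)) = cm (%x. F (n, x)) + cm (%x. G (n, x))" for n by (intro cm_add GA_bdd 8)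
   then show "(%n. cm (%x. F (n, x) + G (n, x))) \<longlonglongrightarrow> GI F + GI G" using tendsto_add[OF lim[OF 8(1)] lim[OF 8(2)]] by simp
  qed
 next
  case (9 F c)
  show ?case
  proof (rule GI_unique[OF GA_mult[OF GA_const 9]])
   have "cm (%x. c * F (n, x)) = c * cm (%x. F (n, x))" for n by (intro cm_scale GA_bdd 9)
   then show "(%n. cm (%x. c * F (n, x))) \<longlonglongrightarrow> c * GI F" using tendsto_mult_left[OF lim[OF 9]] by simp
  qed
 next
  case (10 F)
  show ?case
  proof (rule GI_unique[OF GA_cnj[OF 10]])
   have "cm (%x. cnj (F (n, x))) = cnj (cm (%x. F (n, x)))" for n by (intro cm_cnj GA_bdd 10)
   then show "(%n. cm (%x. cnj (F (n, x)))) \<longlonglongrightarrow> cnj (GI F)" using tendsto_cnj[OF lim[OF 10]] by simp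
  qed
 next
  case (11 F)
  have "0 <= Re (cm (%x. F (n, x)))" for n unfolding Re_cm by (intro m_nonneg bdd_Re GA_bdd 11)
  then show ?case using LIMSEQ_le_const[OF tendsto_Re[OF lim[OF 11(1)]]] by blast
 next
  case 12
  show ?case by (rule GI_unique[OF GA_const]) simp
 next
  case (13 F g)
  show ?case
  proof (rule GI_unique[OF GA_tau[OF 13]])
   have "cm (%x. F (n, x + g)) = cm (%x. F (n, x))" for n using cm_shift[OF GA_bdd(2)[OF 13]] .
   then show "(%n. cm (%x. F (Gtau g (n, x)))) \<longlonglongrightarrow> GI F" using lim[OF 13] by (simp add: Gtau_def)
  qed
 next
  case (14 g x) show ?case by (simp add: Gtau_def)
 next
  case (15 g h x) show ?case by (simp add: Gtau_def add_ac)
 next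
  case (16 x) show ?case by (simp add: Gtau_def)
 next
  case (17 F eps) then show ?case by (rule gns_erg)
 next
  case (18 S C) then show ?case by (rule gns_complete)
 qed
qed

section \<open>Bohr neighbourhoods\<close>

definition bset :: "('a => complex) set => real => 'a set" where
 "bset \<Phi> \<rho> = {h. ALL zt:\<Phi>. cmod (zt h - 1) < \<rho>}"

text \<open>The filter of Bohr neighbourhoods of 0. It lets statements about all sufficiently small
  \<open>h\<close> be combined without naming characters and radii.\<close>

definition bohr :: "'a::ab_group_add filter" where
 "bohr = Abs_filter (%P. EX \<Phi> \<rho>. finite \<Phi> & \<Phi> <= Collect chr & 0 < \<rho> & (ALL h:bset \<Phi> \<rho>. P h))"

lemma bset_mono: "\<Phi> <= \<Phi>' ==> \<rho>' <= \<rho> ==> bset \<Phi>' \<rho>' <= bset \<Phi> \<rho>"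
 unfolding bset_def by fastforce

lemma eventually_bohr:
 "eventually P (bohr :: 'a::ab_group_add filter) \<longleftrightarrow> (EX \<Phi> \<rho>. finite \<Phi> & \<Phi> <= Collect chr & 0 < \<rho> & (ALL h:bset \<Phi> \<rho>. P h))"
 unfolding bohr_def
proof (rule eventually_Abs_filter, rule is_filter.intro, goal_cases)
 case 1
 show ?case by (intro exI[of _ "{}"] exI[of _ 1]) auto
next
 case (2 P Q)
 then obtain \<Phi> \<rho> \<Phi>' \<rho>' where h: "finite \<Phi>" "\<Phi> <= Collect chr" "0 < \<rho>" "ALL h:bset \<Phi> \<rho>. P h"
  "finite \<Phi>'" "\<Phi>' <= Collect chr" "0 < \<rho>'" "ALL h:bset \<Phi>' \<rho>'. Q h" by blast
 have "bset (\<Phi> \<union> \<Phi>') (min \<rho> \<rho>') <= bset \<Phi> \<rho>" "bset (\<Phi> \<union> \<Phi>') (min \<rho> \<rho>') <= bset \<Phi>' \<rho>'" by (intro bset_mono; simp)+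
 with h show ?case by (intro exI[of _ "\<Phi> \<union> \<Phi>'"] exI[of _ "min \<rho> \<rho>'"]) (simp add: subset_iff)
next
 case (3 P Q)
 then show ?case by blast
qed

lemma bohr_bset: "finite \<Phi> ==> \<Phi> <= Collect chr ==> 0 < \<rho> ==> eventually (%h. h : bset \<Phi> \<rho>) bohr"
 unfolding eventually_bohr by blast

lemma bohr_chr: "chr zt ==> 0 < \<rho> ==> eventually (%h. cmod (zt h - 1) < \<rho>) bohr"
 using bohr_bset[of "{zt}" \<rho>] by (simp add: bset_def)

lemma bset_add:
 assumes "\<Phi> <= Collect chr" "a : bset \<Phi> \<rho>" "b : bset \<Phi> \<rho>"
 shows "a + b : bset \<Phi> (2 * \<rho>)" "a - b : bset \<Phi> (2 * \<rho>)"
proof -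
 have p: "cmod (zt (a + b) - 1) < 2 * \<rho>" "cmod (zt (a - b) - 1) < 2 * \<rho>" if z: "zt : \<Phi>" for zt
 proof -
  have c: "chr zt" using z assms(1) by auto
  have ab: "cmod (zt a - 1) < \<rho>" "cmod (zt b - 1) < \<rho>" using assms z by (auto simp: bset_def)
  have "zt (a + b) - 1 = zt a * (zt b - 1) + (zt a - 1)" by (simp add: chr_add[OF c] algebra_simps)
  then show "cmod (zt (a + b) - 1) < 2 * \<rho>"
   using norm_triangle_ineq[of "zt a * (zt b - 1)" "zt a - 1"] ab by (simp only: norm_mult chr_norm[OF c])
  have "zt (a - b) - 1 = cnj (zt b) * (zt a - 1) + cnj (zt b - 1)" by (simp add: chr_diff[OF c] algebra_simps)
  then show "cmod (zt (a - b) - 1) < 2 * \<rho>"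
   using norm_triangle_ineq[of "cnj (zt b) * (zt a - 1)" "cnj (zt b - 1)"] ab
   by (simp only: norm_mult complex_mod_cnj chr_norm[OF c])
 qed
 then show "a + b : bset \<Phi> (2 * \<rho>)" "a - b : bset \<Phi> (2 * \<rho>)" by (simp_all add: bset_def)
qed

lemma bohr_half:
 assumes "eventually P (bohr :: 'a::ab_group_add filter)"
 obtains Q where "eventually Q (bohr :: 'a filter)" "!!a b. Q a ==> Q b ==> P (a + b)" "!!a b. Q a ==> Q b ==> P (a - b)"
proof -
 obtain \<Phi> \<rho> where h: "finite \<Phi>" "\<Phi> <= Collect chr" "0 < \<rho>" "!!h. h : bset \<Phi> \<rho> ==> P h"
  using assms unfolding eventually_bohr by blast
 show ?thesis
 proof (rule that)
  show "eventually (%h. h : bset \<Phi> (\<rho> / 2)) bohr" by (rule bohr_bset) (use h in auto)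
  show "P (a + b)" "P (a - b)" if "a : bset \<Phi> (\<rho> / 2)" "b : bset \<Phi> (\<rho> / 2)" for a b
   using bset_add[OF h(2) that] h(4) by simp_all
 qed
qed

lemma bohr_zsmul:
 assumes "eventually P (bohr :: 'a::ab_group_add filter)"
 shows "eventually (%h. P (zsmul k h)) (bohr :: 'a filter)"
proof -
 obtain \<Phi> \<rho> where h: "finite \<Phi>" "\<Phi> <= Collect chr" "0 < \<rho>" "!!h. h : bset \<Phi> \<rho> ==> P h"
  using assms unfolding eventually_bohr by blast
 have "eventually (%h. h : bset ((%zt x. zt (zsmul k x)) ` \<Phi>) \<rho>) bohr"
  using h by (intro bohr_bset) (auto intro: chr_zsmul)
 then show ?thesis by eventually_elim (rule h(4), auto simp: bset_def)
qed

lemma bohr_uminus: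
 assumes "eventually P (bohr :: 'a::ab_group_add filter)"
 shows "eventually (%h. P (- h)) (bohr :: 'a filter)"
 using bohr_zsmul[OF assms, of "- 1"] by (simp add: zsmul_minus_left zsmul_1)

lemma complex_disc_net:
 assumes "0 < (dl::real)"
 obtains N :: "complex set" where "finite N" "!!z. cmod z <= B ==> EX c:N. cmod (z - c) < dl"
proof -
 have "compact (cball (0::complex) B)" by (rule compact_cball)
 then obtain N where N: "finite N" "cball (0::complex) B <= (\<Union>c\<in>N. ball c dl)"
  using assms unfolding compact_eq_totally_bounded by blast
 show ?thesis
 proof (rule that[OF N(1)])
  fix z :: complex assume "cmod z <= B"
  then have "z : cball 0 B" by simp
  with N(2) have "z : (\<Union>c\<in>N. ball c dl)" by (rule subsetD)
  then show "EX c:N. cmod (z - c) < dl" by (auto simp: dist_norm norm_minus_commute)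
 qed
qed

context imean
begin

lemma msr_classes:
 assumes "finite I" "!!x. x : S ==> EX i:I. P i x" "0 < msr S"
 obtains i where "i : I" "0 < msr {x : S. P i x}"
proof -
 have "S <= (\<Union>i\<in>I. {x : S. P i x})" using assms(2) by blast
 from msr_pigeonhole[OF assms(1) this assms(3)] show ?thesis using that by blast
qed

lemma msr_phase:
 assumes "0 < msr S" "!!x. x : S ==> cmod (\<omega> x) <= B" "0 < (dl::real)"
 obtains S' where "S' <= S" "0 < msr S'" "!!x y. x : S' ==> y : S' ==> cmod (\<omega> x - \<omega> y) < dl"
proof -
 have "0 < dl / 2" using assms(3) by simp
 from complex_disc_net[OF this, of B]
 obtain N where N: "finite N" "!!z. cmod z <= B ==> EX c:N. cmod (z - c) < dl / 2" by blast
 have "EX c:N. cmod (\<omega> x - c) < dl / 2" if "x : S" for x by (rule N(2)) (rule assms(2)[OF that])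
 from msr_classes[where P = "%c x. cmod (\<omega> x - c) < dl / 2", OF N(1) this assms(1)] obtain c where c: "0 < msr {x : S. cmod (\<omega> x - c) < dl / 2}" by blast
 show ?thesis
 proof (rule that[OF _ c])
  fix x y assume "x : {x : S. cmod (\<omega> x - c) < dl / 2}" "y : {x : S. cmod (\<omega> x - c) < dl / 2}"
  then show "cmod (\<omega> x - \<omega> y) < dl" using norm_triangle_ineq4[of "\<omega> x - c" "\<omega> y - c"] by simp
 qed auto
qed

lemma msr_phases:
 assumes "finite J" "0 < msr S" "!!j x. j : J ==> x : S ==> cmod (\<omega> j x) <= B" "0 < (dl::real)"
 shows "EX S'<=S. 0 < msr S' & (ALL j:J. ALL x:S'. ALL y:S'. cmod (\<omega> j x - \<omega> j y) < dl)"
 using assms(1,3)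
proof (induction J rule: finite_induct)
 case empty
 then show ?case using assms(2) by blast
next
 case (insert j J)
 from insert.IH insert.prems obtain T where T: "T <= S" "0 < msr T" "ALL j:J. ALL x:T. ALL y:T. cmod (\<omega> j x - \<omega> j y) < dl" by blast
 have "cmod (\<omega> j x) <= B" if "x : T" for x using insert.prems T(1) that by blast
 from msr_phase[where \<omega> = "\<omega> j", OF T(2) this assms(4)] obtain S' where S': "S' <= T" "0 < msr S'"
  "!!x y. x : S' ==> y : S' ==> cmod (\<omega> j x - \<omega> j y) < dl" by blast
 show ?case
 proof (intro exI[of _ S'] conjI ballI)
  fix i x y assume h: "i : insert j J" "x : S'" "y : S'"
  then have "x : T" "y : T" using S'(1) by blast+
  with h show "cmod (\<omega> i x - \<omega> i y) < dl" using S'(1,3) T(3) by (cases "i = j") auto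
 qed (use S' T in auto)
qed

text \<open>Finitely many cells of phases cover the group, so on some set of positive measure all
  phases agree within \<rho>; the translate of this set by minus one of its points lies in the Bohr
  set.\<close>

lemma bohr_pos:
 assumes "eventually P bohr"
 shows "0 < msr {h. P h}"
proof -
 obtain \<Phi> \<rho> where h: "finite \<Phi>" "\<Phi> <= Collect chr" "0 < \<rho>" "!!h. h : bset \<Phi> \<rho> ==> P h"
  using assms unfolding eventually_bohr by blast
 have "cmod (zt x) <= 1" if "zt : \<Phi>" for zt x using that h(2) by (auto simp: chr_norm)
 with msr_phases[OF h(1) _ _ h(3), of UNIV "%zt. zt" 1]
 obtain S where S: "0 < msr S" "ALL zt:\<Phi>. ALL x:S. ALL y:S. cmod (zt x - zt y) < \<rho>" by auto
 obtain y where y: "y : S" using msr_pos_nonempty[OF S(1)] by blast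
 have "x + - y : bset \<Phi> \<rho>" if x: "x : S" for x
  unfolding bset_def
 proof (intro CollectI ballI)
  fix zt assume z: "zt : \<Phi>"
  then have c: "chr zt" using h(2) by auto
  have "zt (x + - y) - 1 = cnj (zt y) * (zt x - zt y)"
   using norm1_cnj(2)[OF chr_norm[OF c, of y]] by (simp add: chr_add[OF c] chr_minus[OF c] chr_diff[OF c] algebra_simps)
  then show "cmod (zt (x + - y) - 1) < \<rho>" using S(2) x y z by (simp add: norm_mult chr_norm[OF c])
 qed
 then have "S <= {x. x + - y : {h. P h}}" using h(4) by auto
 from msr_mono[OF this] show ?thesis using S(1) by (simp only: msr_shift)
qed

end

section \<open>Bogolyubov's theorem\<close>

text \<open>If the correlation function \<gamma> of \<open>H\<close> is nonzero at both
  \<open>k\<close> and \<open>k - h\<close>, then \<open>h\<close> has the required form. If that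
  happened for no \<open>k\<close>, the self-correlation at \<open>h\<close> of the trigonometric
  part \<open>s\<close> of \<gamma> would be small; yet it equals the sum of \<open>(c zt)^2\<close>
  times \<open>zt h\<close>, whose terms have nonnegative real part for \<open>h\<close> near 0 and
  include the trivial character.\<close>

lemma bogolyubov:
 fixes m :: "('a::{ab_group_add, countable} => real) => real"
 assumes m: "inv_mean m" and H: "0 < m (indicat_real H)"
 shows "eventually (%d. EX a:H. EX b:H. EX c:H. EX e:H. d = a + b - c - e) bohr"
proof -
 \<comment> \<open>The given mean need not be extreme, so it is exchanged for an extreme one that
   gives \<open>H\<close> at least the same measure.\<close>
 obtain L :: "('a => real) => real" where L: "ext_mean L" "m (indicat_real H) <= L (indicat_real H)"
  by (rule ext_mean_exists[OF m, of "indicat_real H"]) (use m in blast)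
 interpret emean L by unfold_locales fact
 interpret sysm GA GI Gtau snd L using gns[OF L(1)] im by (intro sysm.intro imean.intro)
 have HL: "0 < L (indicat_real H)" using H L(2) by simp
 define F :: "nat \<times> 'a => complex" where "F z = of_bool (snd z : H)" for z
 have bF: "bdd F" by (rule bddI[of _ 1]) (simp add: F_def)
 have FA: "F : GA" by (simp add: GA_def bF l2_def F_def)
 have FI: "GI G = cm (%x. G (0, x))" if "!!n x. G (n, x) = G (0, x)" for G :: "nat \<times> 'a => complex"
 proof -
  have "(%n. cm (%x. G (n, x))) = (%n. cm (%x. G (0, x)))"
   by (rule HOL.ext, rule arg_cong[where f = cm], rule HOL.ext, rule that)
  then show ?thesis unfolding GI_def by (simp only: lim_const)
 qed
 have F1: "cmod (F x) <= 1" for x by (simp add: F_def)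
 have nF: "nrm F <= 1" by (rule nrm_bound[OF FA F1])
 define a where "a = L (indicat_real H)"
 have a: "0 < a" "a <= 1" using HL unfolding a_def by (auto intro!: m_le bdd_indicator' simp: indicator_def)
 have IF: "GI F = cx a"
 proof -
  have "(%x. F (0, x)) = (%x. cx (indicat_real H x))" by (auto simp: F_def indicator_def)
  then show ?thesis using FI[of F] by (simp add: F_def cm_of_real a_def)
 qed
 define \<gamma> where "\<gamma> h = ip (tr h F) F" for h
 have g_pos: "EX x. x : H & x + h : H" if "\<gamma> h ~= 0" for h
 proof (rule ccontr)
  assume "~ ?thesis"
  then have "(%z. tr h F z * cnj (F z)) = (%z. 0)"
   by (intro HOL.ext) (auto simp: tr_def F_def Gtau_def)
  then have "\<gamma> h = 0" unfolding \<gamma>_def ip_def by simp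
  with that show False by simp
 qed
 have g1: "cmod (\<gamma> h) <= 1" for h
  unfolding \<gamma>_def using ip_bound[of "tr h F" F 1 1] FA nF by (simp add: A_tr nrm_tr)
 \<comment> \<open>Chosen so that the error \<open>3 * sqrt t\<close> stays below
   \<open>a ^ 4\<close>, the contribution of the trivial character.\<close>
 define t where "t = a ^ 8 / 16"
 have t: "0 < t" "t <= a"
 proof -
  show "0 < t" using a by (simp add: t_def)
  have "a ^ 8 <= a ^ 1" by (rule power_decreasing) (use a in auto)
  then show "t <= a" using a unfolding t_def by simp
 qed
 have st: "sqrt t = a ^ 4 / 4"
 proof -
  have "t = (a ^ 4 / 4)^2" by (simp add: t_def power_divide flip: power_mult)
  then show ?thesis using a by (simp only: real_sqrt_abs) simp
 qed
 define X where "X = {zt. chr zt & t <= cmod (co zt F)}"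
 have X: "finite X" "{zt. chr zt & t <= cmod (co zt F)} <= X" "X <= Collect chr"
  using spec_finite[OF FA t(1)] by (auto simp: X_def)
 have Xc: "chr zt" if "zt : X" for zt using that by (simp add: X_def)
 define D where "D = dec X F"
 have D: "D : GA" "nrm D <= 1" unfolding D_def using A_dec[OF FA X(3)] nrm_dec[OF FA X(1,3)] nF by auto
 have Dc: "cmod (co zt D) <= t" if "chr zt" for zt unfolding D_def by (rule dec_small[OF FA t(1) X that])
 define c where "c zt = (cmod (co zt F))^2" for zt
 define s where "s h = (\<Sum>zt\<in>X. cx (c zt) * zt h)" for h
 define e where "e h = ip (tr h D) F" for h
 have split: "\<gamma> h = e h + s h" for h
  unfolding \<gamma>_def e_def s_def D_def c_def complex_norm_square ip_split[OF FA FA X(3)] by (simp add: mult_ac)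
 have be: "bdd e" unfolding e_def by (rule bdd_gam[OF D(1) FA])
 have bs: "bdd s" unfolding s_def by (intro bdd_sum bdd_mult bdd_const chr_bdd Xc)
 have e1: "cmod (e h) <= 1" for h unfolding e_def using ip_bound[of "tr h D" F 1 1] FA nF D by (simp add: A_tr nrm_tr)
 have s2: "cmod (s h) <= 2" for h
 proof -
  have "s h = \<gamma> h - e h" by (simp add: split)
  then show ?thesis using norm_triangle_ineq4[of "\<gamma> h" "e h"] g1[of h] e1[of h] by simp
 qed
 have me: "L (%h. cmod (e h)) <= sqrt t"
 proof (rule real_le_rsqrt)
  have "(L (%h. cmod (e h)))^2 <= L (%h. (cmod (e h))^2)" by (intro m_sq bdd_norm be)
  also have "... <= n2 F * (nrm D * t)" unfolding e_def using t by (intro W1 D FA Dc) auto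
  also have "... <= 1 * (1 * t)"
   using t D nF nrm_sq[OF FA] nrm_nonneg[OF FA] nrm_nonneg[OF D(1)] power_mono[of "nrm F" 1 2]
   by (intro mult_mono) auto
  finally show "(L (%h. cmod (e h)))^2 <= t" by simp
 qed
 have bg: "bdd \<gamma>" by (rule bddI[of _ 1]) (rule g1)
 have key: "EX k. \<gamma> k ~= 0 & \<gamma> (k - h) ~= 0" if h: "h : bset X 1" for h
 proof (rule ccontr)
  assume "~ ?thesis"
  then have z: "\<gamma> k * cnj (\<gamma> (k - h)) = 0" for k by auto
  have b': "bdd (%k. f (k - h))" if "bdd f" for f :: "'a => complex" using that by (rule bdd_compose)
  have "cm (%k. s k * cnj (s (k - h))) = (\<Sum>zt\<in>X. cx ((c zt)^2) * zt h)"
  proof -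
   have bb: "bdd (%k. (cx (c zt) * zt k) * cnj (cx (c ps) * ps (k - h)))" if "zt : X" "ps : X" for zt ps
    by (intro bdd_mult bdd_cnj bdd_const b' chr_bdd Xc that)
   have "cm (%k. s k * cnj (s (k - h))) = cm (%k. \<Sum>zt\<in>X. \<Sum>ps\<in>X. (cx (c zt) * zt k) * cnj (cx (c ps) * ps (k - h)))"
    unfolding s_def cnj_sum sum_product ..
   also have "... = (\<Sum>zt\<in>X. \<Sum>ps\<in>X. cm (%k. (cx (c zt) * zt k) * cnj (cx (c ps) * ps (k - h))))"
    by (subst cm_sum, intro bdd_sum bb, assumption+) (intro sum.cong refl cm_sum bb)
   also have "... = (\<Sum>zt\<in>X. \<Sum>ps\<in>X. if ps = zt then cx ((c zt)^2) * zt h else 0)"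
   proof (intro sum.cong refl)
    fix zt ps assume zp: "zt : X" "ps : X"
    have "cm (%k. (cx (c zt) * zt k) * cnj (cx (c ps) * ps (k - h))) = cm (%k. (cx (c zt * c ps) * ps h) * (zt k * cnj (ps k)))"
     by (simp add: chr_diff[OF Xc[OF zp(2)]] mult_ac)
    also have "... = (cx (c zt * c ps) * ps h) * cm (%k. zt k * cnj (ps k))"
     by (intro cm_scale bdd_mult bdd_cnj chr_bdd Xc zp)
    also have "cm (%k. zt k * cnj (ps k)) = (if zt = ps then 1 else 0)"
     by (rule cm_chr_orth[OF Xc[OF zp(1)] Xc[OF zp(2)]])
    finally show "cm (%k. (cx (c zt) * zt k) * cnj (cx (c ps) * ps (k - h))) = (if ps = zt then cx ((c zt)^2) * zt h else 0)"
     by (simp add: power2_eq_square)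
   qed
   also have "... = (\<Sum>zt\<in>X. cx ((c zt)^2) * zt h)" using X(1) by (intro sum.cong refl) (simp add: sum.delta)
   finally show ?thesis .
  qed
  moreover have "a ^ 4 <= Re (\<Sum>zt\<in>X. cx ((c zt)^2) * zt h)"
  proof -
   have co1: "co (%x. 1) F = cx a" by (simp add: co_def ip_def IF)
   have one: "(%x. 1) : X" using t a by (simp add: X_def co1)
   have "0 <= Re (cx ((c zt)^2) * zt h)" if "zt : X" for zt
   proof -
    have "cmod (zt h - 1) < 1" using h that by (simp add: bset_def)
    then have "\<bar>Re (zt h) - 1\<bar> < 1" using abs_Re_le_cmod[of "zt h - 1"] by simp
    then show ?thesis by simp
   qed
   then have "Re (cx ((c (%x. 1))^2) * 1) <= (\<Sum>zt\<in>X. Re (cx ((c zt)^2) * zt h))"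
    using member_le_sum[OF one, of "%zt. Re (cx ((c zt)^2) * zt h)"] X(1) by simp
   then show ?thesis using a by (simp add: c_def co1 flip: power_mult)
  qed
  moreover have "cmod (cm (%k. s k * cnj (s (k - h)))) <= 3 * sqrt t"
  proof -
   have p: "cmod (s k * cnj (s (k - h))) <= cmod (e k) + 2 * cmod (e (k - h))" for k
   proof -
    have "s k * cnj (s (k - h)) = \<gamma> k * cnj (\<gamma> (k - h)) - e k * cnj (\<gamma> (k - h)) - s k * cnj (e (k - h))"
     unfolding split by (simp add: algebra_simps)
    then have "s k * cnj (s (k - h)) = - (e k * cnj (\<gamma> (k - h)) + s k * cnj (e (k - h)))" unfolding z by simp
    then have "cmod (s k * cnj (s (k - h))) = cmod (e k * cnj (\<gamma> (k - h)) + s k * cnj (e (k - h)))" by (simp only: norm_minus_cancel)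
    also have "... <= cmod (e k) * cmod (\<gamma> (k - h)) + cmod (s k) * cmod (e (k - h))"
     using norm_triangle_ineq[of "e k * cnj (\<gamma> (k - h))" "s k * cnj (e (k - h))"] by (simp add: norm_mult)
    also have "... <= cmod (e k) * 1 + 2 * cmod (e (k - h))" by (intro add_mono mult_left_mono mult_right_mono g1 s2) auto
    finally show ?thesis by simp
   qed
   have "cmod (cm (%k. s k * cnj (s (k - h)))) <= L (%k. cmod (s k * cnj (s (k - h))))"
    by (intro norm_cm_le bdd_mult bdd_cnj b' bs)
   also have "... <= L (%k. cmod (e k) + 2 * cmod (e (k - h)))"
    by (intro m_mono p bdd_norm bdd_mult bdd_cnj bdd_add bdd_const b' bs be)
   also have "... = L (%k. cmod (e k)) + 2 * L (%k. cmod (e (k + - h)))"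
    by (simp add: m_add m_scale bdd_norm bdd_mult bdd_const b' be)
   also have "L (%k. cmod (e (k + - h))) = L (%k. cmod (e k))" using m_shift[OF bdd_norm[OF be], of "- h"] .
   finally show ?thesis using me by simp
  qed
  moreover have "3 * sqrt t < a ^ 4" using a unfolding st by simp
  ultimately show False using complex_Re_le_cmod[of "cm (%k. s k * cnj (s (k - h)))"] by simp
 qed
 have "eventually (%h. h : bset X 1) bohr" by (rule bohr_bset[OF X(1,3)]) simp
 then show ?thesis
 proof eventually_elim
  case (elim h)
  from key[OF elim] obtain k where k: "\<gamma> k ~= 0" "\<gamma> (k - h) ~= 0" by blast
  obtain x where x: "x : H" "x + k : H" using g_pos[OF k(1)] by blast
  obtain y where y: "y : H" "y + (k - h) : H" using g_pos[OF k(2)] by blast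
  have "h = (x + k) + y - x - (y + (k - h))" by simp
  with x y show ?case by blast
 qed
qed

text \<open>The comparison in \<open>fin_idx_mean\<close> shows that the image of \<open>H\<close>
  under multiplication by \<open>n\<close> has positive measure for another invariant mean, to which
  the theorem applies.\<close>

lemma bogolyubov_zsmul:
 fixes m :: "('a::{ab_group_add, countable} => real) => real"
 assumes m: "inv_mean m" and H: "0 < m (indicat_real H)" and n: "fin_idx n TYPE('a)"
 shows "eventually (%d. EX a:H. EX b:H. EX c:H. EX e:H. d = zsmul n (a + b - c - e)) bohr"
proof -
 obtain K N where K: "0 < K" and N: "inv_mean N" "!!k. bdd k ==> (!!x. 0 <= k x) ==> m (%l. k (zsmul n l)) <= K * N k"
  using fin_idx_mean[OF n] m by blast
 interpret imean m by unfold_locales fact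
 let ?H = "zsmul n ` H"
 have "m (indicat_real H) <= m (%l. indicat_real ?H (zsmul n l))"
  by (intro m_mono bdd_indicator' bdd_indicator) (auto simp: indicator_def)
 also have "... <= K * N (indicat_real ?H)" by (rule N(2)) (auto intro: bdd_indicator')
 finally have "m (indicat_real H) <= K * N (indicat_real ?H)" .
 then have "0 < K * N (indicat_real ?H)" using H by linarith
 then have "0 < N (indicat_real ?H)" by (rule zero_less_mult_pos[OF _ K])
 from bogolyubov[OF N(1) this] show ?thesis
  by eventually_elim (auto simp: zsmul_add_right zsmul_diff_right)
qed

section \<open>Eigenvectors modulo characters\<close>

context sys
begin

abbreviation R :: "('x => complex) => ('x => complex) => real" where "R F G \<equiv> Re (ip F G)"

lemma R_sym: assumes "F : A" "G : A" shows "R F G = R G F"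
 using arg_cong[OF ip_cnj[OF assms], of Re] by simp

lemma R_self: "F : A ==> R F F = (nrm F)^2" by (simp add: nrm_sq n2_def)

lemma R_le: "F : A ==> G : A ==> R F G <= nrm F * nrm G"
 using Re_ip_le[of F G] by linarith

lemma nrm_add_sq: "F : A ==> G : A ==> (nrm (%x. F x + G x))^2 = (nrm F)^2 + 2 * R F G + (nrm G)^2"
 by (simp add: nrm_sq n2_add A_add)

lemma nrm_diff_sq: "F : A ==> G : A ==> (dst F G)^2 = (nrm F)^2 - 2 * R F G + (nrm G)^2"
 by (simp add: nrm_sq n2_diff A_diff)

lemma nrm_line_sq: assumes "F : A" "G : A"
 shows "(nrm (%x. F x + cx t * G x))^2 = (nrm F)^2 + 2 * t * R F G + t^2 * (nrm G)^2"
 using assms by (simp add: nrm_add_sq A_intros nrm_scale ip_scale_right power_mult_distrib)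

lemma complete_nrm:
 fixes S :: "nat => 'x => complex"
 assumes "!!k. S k : A" "!!k x. cmod (S k x) <= C" "!!eps. 0 < eps ==> EX N. ALL k>=N. ALL l>=N. dst (S k) (S l) < eps"
 obtains G where "G : A" "!!x. cmod (G x) <= C" "!!eps. 0 < eps ==> EX N. ALL k>=N. dst (S k) G < eps"
proof -
 have lt: "n2 F < eps\<^sup>2 \<longleftrightarrow> nrm F < eps" if "0 < eps" "F : A" for F eps
 proof
  assume "n2 F < eps\<^sup>2"
  then have "(nrm F)^2 < eps\<^sup>2" using that by (simp add: nrm_sq)
  then show "nrm F < eps" by (rule power2_less_imp_less) (rule less_imp_le[OF that(1)])
 next
  assume "nrm F < eps"
  then have "(nrm F)^2 < eps\<^sup>2" using nrm_nonneg[OF that(2)] by (intro power_strict_mono) auto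
  then show "n2 F < eps\<^sup>2" using that by (simp add: nrm_sq)
 qed
 have 1: "EX N. ALL k>=N. ALL l>=N. n2 (%x. S k x - S l x) < eps" if "0 < eps" for eps
 proof -
  have e: "0 < sqrt eps" "eps = (sqrt eps)^2" using that by simp_all
  have "n2 (%x. S k x - S l x) < eps \<longleftrightarrow> dst (S k) (S l) < sqrt eps" for k l
   by (subst e(2), rule lt) (use e in \<open>auto intro: A_diff assms(1)\<close>)
  then show ?thesis using assms(3)[OF e(1)] by simp
 qed
 obtain G where G: "G : A" "ALL x. cmod (G x) <= C" "ALL eps>0. EX N. ALL k>=N. n2 (%x. S k x - G x) < eps"
  using complete[of S C, OF assms(1,2)] 1 unfolding n2_def ip_def by blast
 show ?thesis
 proof (rule that[OF G(1)])
  show "cmod (G x) <= C" for x using G(2) by blast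
  show "EX N. ALL k>=N. dst (S k) G < eps" if "0 < eps" for eps
  proof -
   have "0 < eps\<^sup>2" using that by simp
   with G(3) obtain N where "!!k. N <= k ==> n2 (%x. S k x - G x) < eps\<^sup>2" by blast
   then show ?thesis using lt[OF that A_diff[OF assms(1) G(1)]] by blast
  qed
 qed
qed

text \<open>An approximate eigenvector relation in which the eigenvalue is a unimodular constant
  times an eigenfunction of the system.\<close>

definition relc :: "('x => complex) => 'a => ('a => complex) => real => bool" where
 "relc v h zt eps \<longleftrightarrow> chr zt & (EX c. cmod c = 1 & nrm (%x. tr h v x - c * (ch zt x * v x)) <= eps)"

definition rel :: "('x => complex) => 'a => real => bool" where
 "rel v h eps \<longleftrightarrow> (EX zt. relc v h zt eps)"

lemma relcI: "chr zt ==> cmod c = 1 ==> nrm (%x. tr h v x - c * (ch zt x * v x)) <= eps ==> relc v h zt eps"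
 unfolding relc_def by blast

lemma relI: "relc v h zt eps ==> rel v h eps"
 unfolding rel_def by blast

lemma relcE: assumes "relc v h zt eps"
 obtains c where "chr zt" "cmod c = 1" "nrm (%x. tr h v x - c * (ch zt x * v x)) <= eps"
 using assms unfolding relc_def by blast

text \<open>The eigenvectors modulo characters. The relation is demanded up to every error, on a
  Bohr neighbourhood that may depend on the error; by \<open>rel_close\<close> this is stable under
  limits in the seminorm.\<close>

definition pure :: "('x => complex) => bool" where
 "pure v \<longleftrightarrow> v : A & (ALL eps>0. eventually (%h. rel v h eps) bohr)"

text \<open>The constant picks up \<open>ps h\<close>, since shifting by \<open>h\<close> multiplies
  the eigenfunction of \<open>ps\<close> by that value.\<close>

lemma relc_add: assumes v: "v : A" and "relc v h zt eps" "relc v k ps dl" shows "relc v (h + k) (%x. zt x * ps x) (eps + dl)"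
proof -
 obtain c d where h: "chr zt" "cmod c = 1" "nrm (%x. tr h v x - c * (ch zt x * v x)) <= eps"
  "chr ps" "cmod d = 1" "nrm (%x. tr k v x - d * (ch ps x * v x)) <= dl"
  using assms unfolding relc_def by blast
 have cm: "chr (%x. zt x * ps x)" by (intro chr_mult h)
 have u: "cmod (d * ps h * c) = 1" using h by (simp add: norm_mult chr_norm)
 let ?M = "%x. d * ps h * (ch ps x * tr h v x)"
 have "nrm (%x. tr (h + k) v x - (d * ps h * c) * (ch (%x. zt x * ps x) x * v x))
  <= nrm (%x. tr (h + k) v x - ?M x) + nrm (%x. ?M x - (d * ps h * c) * (ch (%x. zt x * ps x) x * v x))"
  by (rule nrm_triangle3) (intro A_intros v h cm)+
 also have "nrm (%x. tr (h + k) v x - ?M x) = nrm (tr h (%x. tr k v x - d * (ch ps x * v x)))"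
  unfolding tr_diff[abs_def] tr_scale[abs_def] tr_mult[abs_def] tr_tr tr_ch[OF h(4)] by (simp add: mult_ac)
 also have "... <= dl" using h by (simp add: nrm_tr A_intros v)
 also have "nrm (%x. ?M x - (d * ps h * c) * (ch (%x. zt x * ps x) x * v x)) = nrm (%x. (d * ps h * ch ps x) * (tr h v x - c * (ch zt x * v x)))"
  unfolding ch_mult by (simp add: algebra_simps)
 also have "... = nrm (%x. tr h v x - c * (ch zt x * v x))"
  by (intro nrm_mult1 A_intros v h) (simp add: norm_mult h chr_norm ch_norm)
 also have "... <= eps" by (rule h)
 finally show ?thesis by (intro relcI[OF cm u]) simp
qed

lemma relc_uminus: assumes v: "v : A" and "relc v h zt eps" shows "relc v (- h) (%x. cnj (zt x)) eps"
proof -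
 obtain c where h: "chr zt" "cmod c = 1" "nrm (%x. tr h v x - c * (ch zt x * v x)) <= eps"
  using assms by (elim relcE)
 have cm: "chr (%x. cnj (zt x))" by (intro chr_cnj h)
 let ?c = "cnj c * zt h"
 have u: "cmod ?c = 1" using h by (simp add: norm_mult chr_norm)
 have e: "tr (- h) v x - ?c * (ch (%x. cnj (zt x)) x * v x) = (- ?c * cnj (ch zt x)) * tr (- h) (%x. tr h v x - c * (ch zt x * v x)) x" for x
 proof -
  have t: "tr (- h) (%x. tr h v x - c * (ch zt x * v x)) x = v x - c * (cnj (zt h) * ch zt x * tr (- h) v x)"
   unfolding tr_diff tr_scale tr_mult tr_tr tr_ch[OF h(1)] by (simp add: chr_minus[OF h(1)] mult_ac)
  have one: "c * cnj c = 1" "zt h * cnj (zt h) = 1" "ch zt x * cnj (ch zt x) = 1"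
   by (rule norm1_cnj(1), simp add: h chr_norm ch_norm)+
  have "(- ?c * cnj (ch zt x)) * (v x - c * (cnj (zt h) * ch zt x * tr (- h) v x))
   = (c * cnj c) * (zt h * cnj (zt h)) * (ch zt x * cnj (ch zt x)) * tr (- h) v x - ?c * (cnj (ch zt x) * v x)"
   by (simp add: algebra_simps)
  then show ?thesis unfolding t one by (simp add: ch_cnj)
 qed
 have "nrm (%x. tr (- h) v x - ?c * (ch (%x. cnj (zt x)) x * v x)) = nrm (tr (- h) (%x. tr h v x - c * (ch zt x * v x)))"
  unfolding e by (intro nrm_mult1 A_intros v h) (simp add: norm_mult h chr_norm ch_norm)
 also have "... <= eps" using h by (simp add: nrm_tr A_intros v)
 finally show ?thesis by (rule relcI[OF cm u])
qed

lemma rel_add: assumes "v : A" "rel v h eps" "rel v k dl" shows "rel v (h + k) (eps + dl)"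
 using relc_add[OF assms(1)] assms(2,3) unfolding rel_def by blast

lemma rel_uminus: assumes "v : A" "rel v h eps" shows "rel v (- h) eps"
 using relc_uminus[OF assms(1)] assms(2) unfolding rel_def by blast

lemma rel_close: assumes v: "v : A" "u : A" and "rel u h eps" "dst v u <= dl" shows "rel v h (eps + 2 * dl)"
proof -
 obtain zt c where h: "chr zt" "cmod c = 1" "nrm (%x. tr h u x - c * (ch zt x * u x)) <= eps"
  using assms unfolding rel_def relc_def by blast
 have "nrm (%x. tr h v x - c * (ch zt x * v x)) <= nrm (%x. tr h v x - tr h u x) + nrm (%x. tr h u x - c * (ch zt x * v x))"
  by (intro nrm_triangle3 A_intros v h)
 also have "nrm (%x. tr h u x - c * (ch zt x * v x)) <= nrm (%x. tr h u x - c * (ch zt x * u x)) + nrm (%x. c * (ch zt x * u x) - c * (ch zt x * v x))"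
  by (intro nrm_triangle3 A_intros v h)
 also have "nrm (%x. tr h v x - tr h u x) = dst v u"
  unfolding tr_diff[abs_def, symmetric] by (intro nrm_tr A_intros v)
 also have "nrm (%x. c * (ch zt x * u x) - c * (ch zt x * v x)) = nrm (%x. (- c * ch zt x) * (v x - u x))"
  by (simp add: algebra_simps)
 also have "... = dst v u" by (intro nrm_mult1 A_intros v h) (simp add: norm_mult h ch_norm)
 finally have "nrm (%x. tr h v x - c * (ch zt x * v x)) <= eps + 2 * dl" using h(3) assms(4) by simp
 then show ?thesis by (intro relI[OF relcI[OF h(1,2)]])
qed

lemma rel_mono: "rel v h eps ==> eps <= dl ==> rel v h dl" unfolding rel_def relc_def using order_trans by blast

lemma rel_bogo: assumes "v : A" "rel v a eps" "rel v b eps" "rel v c eps" "rel v e eps" shows "rel v (a + b - c - e) (4 * eps)"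
 using rel_add[OF assms(1) rel_add[OF assms(1) rel_add[OF assms(1,2,3)] rel_uminus[OF assms(1,4)]] rel_uminus[OF assms(1,5)]]
 by simp

end

section \<open>Convex hulls of twisted translates\<close>

text \<open>The situation on the exceptional set of \<open>gvn\<close>: for \<open>l\<close> in a
  set of positive measure the translate of \<open>g\<close> by \<open>zsmul p l\<close>, untwisted
  by a character \<open>z l\<close> and rotated by a phase \<open>w l\<close>, has real correlation
  at least \<eta> with \<open>g\<close>.\<close>

locale pvec = sysm A I \<tau> pr m
 for A :: "('x => complex) set" and I :: "('x => complex) => complex"
  and \<tau> :: "'a::{ab_group_add, countable} => 'x => 'x" and pr :: "'x => 'a"
  and m :: "('a => real) => real" +
 fixes g :: "'x => complex" and p :: int and S :: "'a set" and z :: "'a => 'a => complex"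
  and w :: "'a => complex" and \<eta> B :: real
 assumes gA: "g : A" and gn: "nrm g <= 1" and gB: "cmod (g x) <= B" and S0: "0 < msr S" and p: "fin_idx p TYPE('a)"
  and z: "l : S ==> chr (z l)" and w: "l : S ==> cmod (w l) = 1" and eta: "0 < \<eta>"
  and corr: "l : S ==> \<eta> <= Re (ip (%x. w l * (cnj (ch (z l) x) * tr (zsmul p l) g x)) g)"
begin

definition pv :: "'a => 'x => complex" where "pv l x = w l * (cnj (ch (z l) x) * tr (zsmul p l) g x)"

inductive_set cvx :: "'a set => ('x => complex) set" for T where
 hull_base: "l : T ==> pv l : cvx T"
| hull_conv: "u : cvx T ==> v : cvx T ==> 0 <= t ==> t <= 1 ==>
  (%x. cx t * u x + cx (1 - t) * v x) : cvx T"

lemma pvA: "l : S ==> pv l : A" unfolding pv_def[abs_def] by (intro A_intros gA z)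

lemma pv_bound: "l : S ==> cmod (pv l x) <= B"
 using gB by (simp add: pv_def norm_mult w ch_norm z tr_def)

lemma pv_nrm: assumes "l : S" shows "nrm (pv l) <= 1"
proof -
 have "nrm (%x. (w l * cnj (ch (z l) x)) * tr (zsmul p l) g x) = nrm (tr (zsmul p l) g)"
  by (intro nrm_mult1 A_intros gA z assms) (simp add: norm_mult w assms ch_norm z)
 then show ?thesis using gn by (simp add: pv_def[abs_def] mult.assoc nrm_tr gA)
qed

lemma convex_bound:
 assumes "0 <= t" "t <= 1" "a <= c" "b <= c" shows "t * a + (1 - t) * b <= (c::real)"
proof -
 have "t * a + (1 - t) * b <= t * c + (1 - t) * c" using assms by (intro add_mono mult_left_mono) auto
 then show ?thesis by (simp add: algebra_simps)
qed

lemma hull_props: assumes "u : cvx T" "T <= S" shows "u : A & (ALL x. cmod (u x) <= B) & nrm u <= 1"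
 using assms(1)
proof (induction rule: cvx.induct)
 case (hull_base l)
 then show ?case using assms(2) pvA pv_bound pv_nrm by auto
next
 case (hull_conv u v t)
 have "cmod (cx t * u x + cx (1 - t) * v x) <= B" for x
 proof -
  have "cmod (cx t * u x + cx (1 - t) * v x) <= t * cmod (u x) + (1 - t) * cmod (v x)"
   using norm_triangle_ineq[of "cx t * u x" "cx (1 - t) * v x"] hull_conv
   by (simp add: norm_mult del: of_real_diff)
  also have "... <= B" using hull_conv by (intro convex_bound) auto
  finally show ?thesis .
 qed
 moreover have "nrm (%x. cx t * u x + cx (1 - t) * v x) <= 1"
 proof -
  have "nrm (%x. cx t * u x + cx (1 - t) * v x) <= t * nrm u + (1 - t) * nrm v"
   using nrm_triangle[of "%x. cx t * u x" "%x. cx (1 - t) * v x"] hull_conv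
   by (simp add: nrm_scale A_intros del: of_real_diff)
  also have "... <= 1" using hull_conv by (intro convex_bound) auto
  finally show ?thesis .
 qed
 ultimately show ?case using hull_conv by (auto intro!: A_intros)
qed

lemma hull_A: "u : cvx T ==> T <= S ==> u : A" using hull_props by blast

lemma hull_R: assumes "u : cvx T" "T <= S" "x : A" "!!l. l : T ==> c <= R (pv l) x" shows "c <= R u x"
 using assms(1)
proof (induction rule: cvx.induct)
 case (hull_base l)
 then show ?case by (rule assms(4))
next
 case (hull_conv u v t)
 have "R (%y. cx t * u y + cx (1 - t) * v y) x = t * R u x + (1 - t) * R v x"
  using hull_A[OF hull_conv(1) assms(2)] hull_A[OF hull_conv(2) assms(2)] assms(3)
  by (simp add: ip_add_left ip_scale_left A_intros del: of_real_diff)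
 moreover have "t * (- R u x) + (1 - t) * (- R v x) <= - c" using hull_conv by (intro convex_bound) auto
 ultimately show ?case by simp
qed

lemma hull_mono: assumes "T <= T'" "u : cvx T" shows "u : cvx T'"
 using assms(2)
proof (induction rule: cvx.induct)
 case (hull_base l)
 then show ?case using assms(1) by (intro cvx.hull_base) auto
next
 case (hull_conv u v t)
 then show ?case by (intro cvx.hull_conv)
qed

lemma hull_avg:
 assumes "finite J" "J ~= {}" "!!j. j : J ==> l j : T"
 shows "(%x. cx (1 / real (card J)) * (\<Sum>j\<in>J. pv (l j) x)) : cvx T"
 using assms
proof (induction J rule: finite_ne_induct)
 case (singleton j)
 then show ?case using hull_base[of "l j" T] by simp
next
 case (insert j J)
 define k where "k = real (card J)"
 have k: "0 < k" using insert by (simp add: k_def card_gt_0_iff)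
 define t where "t = 1 / (k + 1)"
 have t: "0 <= t" "t <= 1" "1 - t = t * k" using k by (simp_all add: t_def field_simps)
 have "(%x. cx t * pv (l j) x + cx (1 - t) * (cx (1 / k) * (\<Sum>j\<in>J. pv (l j) x))) : cvx T"
  using insert t unfolding k_def by (intro hull_conv hull_base) auto
 moreover have "cx (1 - t) * cx (1 / k) = cx t"
  unfolding of_real_mult[symmetric] t(3) using k by simp
 ultimately have "(%x. cx t * pv (l j) x + cx t * (\<Sum>j\<in>J. pv (l j) x)) : cvx T"
  by (simp only: mult.assoc[symmetric])
 moreover have c: "1 / real (card (insert j J)) = t" using insert.hyps by (simp add: t_def k_def)
 ultimately show ?case unfolding c sum.insert[OF insert.hyps(1,3)] distrib_left by simp
qed

text \<open>Distance of the hull from 0. For nonempty \<open>T\<close> it grows as \<open>T\<close>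
  shrinks, and the correlation with \<open>g\<close> keeps it at least \<eta>.\<close>

definition NN :: "'a set => real" where "NN T = Inf (nrm ` cvx T)"

lemma NN_le: assumes "u : cvx T" "T <= S" shows "NN T <= nrm u"
 unfolding NN_def using assms by (intro cInf_lower bdd_belowI[of _ 0]) (auto intro: nrm_nonneg hull_A)

lemma NN_ge: assumes "T ~= {}" "!!u. u : cvx T ==> c <= nrm u" shows "c <= NN T"
 unfolding NN_def using assms hull_base by (intro cInf_greatest) auto

lemma NN_approx: assumes "T ~= {}" "T <= S" "0 < eps" obtains u where "u : cvx T" "nrm u < NN T + eps"
proof -
 have ne: "nrm ` cvx T ~= {}" using assms(1) hull_base by blast
 have bb: "bdd_below (nrm ` cvx T)" using assms(2) by (auto intro!: bdd_belowI[of _ 0] nrm_nonneg hull_A)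
 have "Inf (nrm ` cvx T) < NN T + eps" using assms by (simp add: NN_def)
 then obtain x where "x : nrm ` cvx T" "x < NN T + eps" unfolding cInf_less_iff[OF ne bb] by blast
 then show ?thesis using that by blast
qed

lemma hull_R_g: assumes "u : cvx T" "T <= S" shows "\<eta> <= R u g" "\<eta> <= nrm u"
proof -
 show 1: "\<eta> <= R u g" by (rule hull_R[OF assms gA]) (use corr assms in \<open>auto simp: pv_def[abs_def]\<close>)
 have "R u g <= nrm u * nrm g" by (intro R_le hull_A[OF assms] gA)
 also have "... <= nrm u * 1" using gn nrm_nonneg[OF hull_A[OF assms]] by (intro mult_left_mono) auto
 finally show "\<eta> <= nrm u" using 1 by simp
qed

text \<open>Passing to a subset of positive measure hardly increases the distance. A property that
  would increase it can then hold on null sets only.\<close>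

definition good :: "'a set => real => bool" where
 "good T eps \<longleftrightarrow> T <= S & 0 < msr T & (ALL T'<=T. 0 < msr T' --> NN T' <= NN T + eps)"

lemma good_exists: assumes "T <= S" "0 < msr T" "0 < eps" obtains T' where "T' <= T" "good T' eps"
proof -
 define X where "X = {NN T' | T'. T' <= T & 0 < msr T'}"
 have "NN T' <= 1" if T': "T' <= T" "0 < msr T'" for T'
 proof -
  obtain l where "l : T'" using msr_pos_nonempty[OF T'(2)] by blast
  then show ?thesis using NN_le[OF hull_base, of l T'] pv_nrm[of l] T' assms(1) by force
 qed
 then have X: "bdd_above X" "X ~= {}" unfolding X_def using assms by (auto intro!: bdd_aboveI[of _ 1])
 then obtain x where "x : X" "Sup X - eps < x" using less_cSupD[of X "Sup X - eps"] assms(3) by auto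
 then obtain T' where T': "T' <= T" "0 < msr T'" "Sup X - eps < NN T'" unfolding X_def by blast
 have "NN T'' <= NN T' + eps" if "T'' <= T'" "0 < msr T''" for T''
 proof -
  have "NN T'' : X" using that T' unfolding X_def by blast
  then have "NN T'' <= Sup X" by (rule cSup_upper[OF _ X(1)])
  then show ?thesis using T' by simp
 qed
 then have "good T' eps" using T' assms(1) unfolding good_def by auto
 with T'(1) show ?thesis by (rule that)
qed

end

context sys
begin

lemma co_tr: assumes "F : A" "chr zt" shows "cmod (co zt (tr a F)) = cmod (co zt F)"
proof -
 have "co zt F = ip (tr a F) (tr a (ch zt))" unfolding co_def by (simp add: ip_tr assms A_ch)
 also have "... = cnj (zt a) * co zt (tr a F)" by (simp add: tr_ch assms ip_scale_right A_intros co_def)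
 finally show ?thesis by (simp add: norm_mult chr_norm assms)
qed

lemma nrm_sum_sq_le:
 assumes "finite J" "!!j. j : J ==> F j : A" "!!j. j : J ==> nrm (F j) <= 2" "0 <= eps"
  "!!i j. i : J ==> j : J ==> i ~= j ==> R (F i) (F j) <= eps"
 shows "(nrm (%x. \<Sum>j\<in>J. F j x))^2 <= (real (card J))^2 * eps + 4 * real (card J)"
proof -
 have "(nrm (%x. \<Sum>j\<in>J. F j x))^2 = R (%x. \<Sum>j\<in>J. F j x) (%x. \<Sum>j\<in>J. F j x)"
  by (intro R_self[symmetric] A_sum assms)
 also have "... = (\<Sum>i\<in>J. \<Sum>j\<in>J. R (F i) (F j))"
  by (simp add: ip_sum_left ip_sum_right assms A_sum)
 also have "... <= (\<Sum>i\<in>J. \<Sum>j\<in>J. eps + (if i = j then 4 else 0))"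
 proof (intro sum_mono)
  fix i j assume ij: "i : J" "j : J"
  show "R (F i) (F j) <= eps + (if i = j then 4 else 0)"
  proof (cases "i = j")
   case True
   have "R (F j) (F j) <= 2^2" unfolding R_self[OF assms(2)[OF ij(2)]]
    by (intro power_mono assms ij nrm_nonneg)
   then show ?thesis using True assms(4) by simp
  qed (use assms(5)[OF ij] in simp)
 qed
 also have "... = (real (card J))^2 * eps + 4 * real (card J)"
  using assms(1) by (simp add: sum.distrib power2_eq_square sum.delta algebra_simps)
 finally show ?thesis .
qed

end

context pvec
begin

text \<open>Parallelogram law, with the midpoint again in the hull and hence of norm at least
  \<open>NN T\<close>.\<close>

lemma cvx_close: assumes "T <= S" "T ~= {}" "u : cvx T" "v : cvx T" "nrm u <= NN T + d" "nrm v <= NN T + d" "0 <= d" "d <= 1"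
 shows "(dst u v)^2 <= 12 * d"
proof -
 have A: "u : A" "v : A" using assms hull_A by auto
 let ?h = "%x. cx (1/2) * u x + cx (1 - 1/2) * v x"
 have "?h : cvx T" by (intro hull_conv assms) auto
 from NN_le[OF this assms(1)] have 1: "NN T <= nrm ?h" .
 have e: "?h = (%x. cx (1/2) * (u x + v x))" by (rule HOL.ext) (simp add: algebra_simps)
 have "nrm ?h = (1/2) * nrm (%x. u x + v x)" unfolding e by (subst nrm_scale) (auto intro: A_add A)
 then have 2: "2 * NN T <= nrm (%x. u x + v x)" using 1 by simp
 have N0: "0 <= NN T" by (rule NN_ge[OF assms(2)], rule nrm_nonneg, rule hull_A[OF _ assms(1)])
 obtain l where l: "l : T" using assms(2) by blast
 have N1: "NN T <= 1" using NN_le[OF hull_base[OF l] assms(1)] pv_nrm[of l] l assms(1) by auto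
 have sq: "(2 * NN T)^2 <= (nrm (%x. u x + v x))^2" using 2 N0 by (intro power_mono) auto
 have "(nrm u)^2 <= (NN T + d)^2" "(nrm v)^2 <= (NN T + d)^2" using assms A by (intro power_mono nrm_nonneg; simp)+
 moreover have "NN T * d <= 1 * d" "d * d <= 1 * d" using N1 assms by (intro mult_right_mono; simp)+
 moreover have "(NN T + d)^2 = (NN T)^2 + 2 * (NN T * d) + d * d" by (simp add: power2_eq_square algebra_simps)
 moreover have "(2 * NN T)^2 = 4 * (NN T)^2" by simp
 ultimately show ?thesis using sq unfolding nrm_add_sq[OF A] nrm_diff_sq[OF A] by linarith
qed

definition nl :: "('x => complex) => 'a => 'x => complex" where "nl v l x = pv l x - v x"

text \<open>The accuracy \<open>s^2\<close> is matched to variations by a step of size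
  \<open>s\<close>, whose first order effect is thereby determined up to a multiple of
  \<open>s\<close>.\<close>

definition near :: "'a set => ('x => complex) => real => bool" where
 "near T v s \<longleftrightarrow> good T (s^2) & v : cvx T & nrm v <= NN T + s^2 & 0 < s & s <= 1"

lemma near_props: assumes "near T v s"
 shows "T <= S" "0 < msr T" "T ~= {}" "v : cvx T" "v : A" "nrm v <= 1" "\<eta> <= nrm v" "NN T <= nrm v" "nrm v <= NN T + s^2"
  "0 < s" "s <= 1" "0 <= NN T" "NN T <= 1" "!!T'. T' <= T ==> 0 < msr T' ==> NN T' <= NN T + s^2"
proof -
 show 1: "T <= S" "0 < msr T" "v : cvx T" "nrm v <= NN T + s^2" "0 < s" "s <= 1"
  "!!T'. T' <= T ==> 0 < msr T' ==> NN T' <= NN T + s^2" using assms unfolding near_def good_def by auto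
 show 2: "T ~= {}" using 1(2) by auto
 show 3: "v : A" "nrm v <= 1" using hull_props[OF 1(3,1)] by auto
 show "\<eta> <= nrm v" by (rule hull_R_g(2)[OF 1(3,1)])
 show 4: "NN T <= nrm v" by (rule NN_le[OF 1(3,1)])
 show "0 <= NN T" by (rule NN_ge[OF 2], rule nrm_nonneg, rule hull_A[OF _ 1(1)])
 show "NN T <= 1" using 3 4 by simp
qed

lemma nlA: "near T v s ==> l : T ==> nl v l : A"
 unfolding nl_def[abs_def] using near_props(1,5) pvA by (blast intro: A_diff)

lemma nl_nrm: assumes "near T v s" "l : T" shows "nrm (nl v l) <= 2"
proof -
 have l: "l : S" using near_props(1)[OF assms(1)] assms(2) by blast
 have "nrm (nl v l) <= nrm (pv l) + nrm v" unfolding nl_def[abs_def]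
  by (intro nrm_diff_triangle pvA l near_props(5)[OF assms(1)])
 then show ?thesis using pv_nrm[OF l] near_props(6)[OF assms(1)] by simp
qed

lemma nl_nrm_sq: assumes "near T v s" "l : T" shows "(nrm (nl v l))^2 <= 4"
 using power_mono[OF nl_nrm[OF assms] nrm_nonneg[OF nlA[OF assms]], of 2] by simp

lemma R_pv: assumes "near T v s" "l : T" "x : A" shows "R (pv l) x = R (nl v l) x + R v x"
proof -
 have "l : S" using near_props(1)[OF assms(1)] assms(2) by blast
 then have "ip (nl v l) x = ip (pv l) x - ip v x" unfolding nl_def[abs_def]
  by (intro ip_diff_left pvA assms near_props(5)[OF assms(1)])
 then show ?thesis by simp
qed

text \<open>Moving from \<open>v\<close> towards \<open>pv l\<close> by the step \<open>s\<close>
  stays in the hull, so the norm cannot fall below \<open>NN T\<close>; the second order term and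
  the defect of \<open>v\<close> are both of order \<open>s^2\<close>.\<close>

lemma nl_lower: assumes "near T v s" "l : T" shows "- (4 * s) <= R (nl v l) v"
proof -
 note n = near_props[OF assms(1)]
 have nA: "nl v l : A" by (rule nlA[OF assms])
 let ?u = "%x. cx s * pv l x + cx (1 - s) * v x"
 have "?u : cvx T" using n by (intro hull_conv hull_base assms) auto
 from NN_le[OF this n(1)] have 1: "NN T <= nrm ?u" .
 have e: "?u = (%x. v x + cx s * nl v l x)" by (rule HOL.ext) (simp add: nl_def algebra_simps)
 have "(NN T)^2 <= (nrm ?u)^2" using 1 n(12) by (rule power_mono)
 also have "... = (nrm v)^2 + 2 * s * R v (nl v l) + s^2 * (nrm (nl v l))^2" unfolding e by (rule nrm_line_sq[OF n(5) nA])
 also have "... <= (nrm v)^2 + 2 * s * R v (nl v l) + s^2 * 4"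
  using nl_nrm_sq[OF assms] by (intro add_left_mono mult_left_mono) auto
 finally have a: "(NN T)^2 <= (nrm v)^2 + 2 * s * R v (nl v l) + s^2 * 4" .
 have "(nrm v)^2 <= (NN T + s^2)^2" using n by (intro power_mono nrm_nonneg) auto
 moreover have "NN T * s^2 <= 1 * s^2" using n by (intro mult_right_mono) auto
 moreover have "s^2 * s^2 <= 1 * s^2" using n by (intro mult_right_mono) (auto simp: power_le_one)
 moreover have "(NN T + s^2)^2 = (NN T)^2 + 2 * (NN T * s^2) + s^2 * s^2" by (simp add: power2_eq_square algebra_simps)
 ultimately have "0 <= 2 * s * R v (nl v l) + 8 * s^2" using a zero_le_power2[of s] by linarith
 then have "0 <= s * (R v (nl v l) + 4 * s)" by (simp add: power2_eq_square algebra_simps)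
 then have "0 <= R v (nl v l) + 4 * s" using n(10) by (simp add: zero_le_mult_iff)
 then show ?thesis using R_sym[OF n(5) nA] by simp
qed

text \<open>Over a set of positive measure with such inner products the whole hull would have norm
  at least \<open>nrm v + 5 * s\<close>, against the goodness of \<open>T\<close>.\<close>

lemma nl_upper: assumes "near T v s" shows "msr {l : T. 5 * s <= R (nl v l) v} = 0"
proof (rule ccontr)
 note n = near_props[OF assms]
 define T' where "T' = {l : T. 5 * s <= R (nl v l) v}"
 assume "msr {l : T. 5 * s <= R (nl v l) v} ~= 0"
 then have T': "T' <= T" "0 < msr T'" using msr_nonneg[of T'] by (auto simp: T'_def)
 then have T'S: "T' <= S" "T' ~= {}" using n(1) by auto
 have vp: "0 < nrm v" using n(7) eta by simp
 have "nrm v + 5 * s <= NN T'"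
 proof (rule NN_ge[OF T'S(2)])
  fix u assume u: "u : cvx T'"
  have uA: "u : A" by (rule hull_A[OF u T'S(1)])
  have "(nrm v)^2 + 5 * s <= R u v"
  proof (rule hull_R[OF u T'S(1) n(5)])
   fix l assume l: "l : T'"
   then have "l : T" "5 * s <= R (nl v l) v" by (auto simp: T'_def)
   then show "(nrm v)^2 + 5 * s <= R (pv l) v" using R_pv[OF assms _ n(5), of l] R_self[OF n(5)] by simp
  qed
  also have "... <= nrm u * nrm v" by (rule R_le[OF uA n(5)])
  finally have "(nrm v)^2 + 5 * s <= nrm u * nrm v" .
  moreover have "5 * s * nrm v <= 5 * s * 1" using n by (intro mult_left_mono) auto
  ultimately have "(nrm v + 5 * s) * nrm v <= nrm u * nrm v" by (simp add: power2_eq_square algebra_simps)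
  then show "nrm v + 5 * s <= nrm u" using vp by simp
 qed
 moreover have "NN T' <= NN T + s^2" using n(14)[OF T'] .
 moreover have "s^2 <= s * 1" unfolding power2_eq_square using n by (intro mult_left_mono) auto
 ultimately show False using n(8,10) by simp
qed

text \<open>If many deviations correlated with that of \<open>l'\<close>, every vector in their hull
  would have a large inner product with \<open>v\<close> plus a small multiple of
  \<open>nl v l'\<close>, and its norm would exceed what goodness allows. Both signs matter: upper
  bounds enter \<open>greedy\<close>, lower bounds enter \<open>approx_shift\<close>.\<close>

lemma nl_pair:
 assumes near: "near T v s" and l': "l' : T" "R (nl v l') v <= 5 * s" and sg: "sg = 1 | sg = (-1::real)"
  and e: "0 < eps" "eps <= 1" "240 * s <= eps\<^sup>2"
 shows "msr {l : T. eps <= sg * R (nl v l) (nl v l')} = 0"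
proof (rule ccontr)
 note n = near_props[OF near]
 define T' where "T' = {l : T. eps <= sg * R (nl v l) (nl v l')}"
 assume "msr {l : T. eps <= sg * R (nl v l) (nl v l')} ~= 0"
 then have T': "T' <= T" "0 < msr T'" using msr_nonneg[of T'] by (auto simp: T'_def)
 then have T'S: "T' <= S" "T' ~= {}" using n(1) by auto
 \<comment> \<open>Balances the gain \<open>t * eps\<close> against the second order loss
   \<open>2 * t^2\<close>. What remains is a bound of \<open>eps\<^sup>2\<close> by 168 times
   \<open>s\<close>, excluded by the hypothesis.\<close>
 define t where "t = eps / 4"
 have t: "0 <= t" "t <= 1" using e by (simp_all add: t_def)
 have nA: "nl v l' : A" by (rule nlA[OF near l'(1)])
 have nv: "\<bar>R v (nl v l')\<bar> <= 5 * s" using l'(2) nl_lower[OF near l'(1)] R_sym[OF n(5) nA] n(10) by simp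
 have sgnv: "\<bar>sg * R v (nl v l')\<bar> <= 5 * s" using nv sg by auto
 let ?x = "%y. v y + cx (t * sg) * nl v l' y"
 have xA: "?x : A" by (intro A_intros n(5) nA)
 have x2: "(nrm ?x)^2 <= (nrm v)^2 + 10 * t * s + 4 * t^2"
 proof -
  have "(t * sg)^2 = t^2" using sg by (auto simp: power_mult_distrib)
  then have "(nrm ?x)^2 = (nrm v)^2 + 2 * (t * (sg * R v (nl v l'))) + t^2 * (nrm (nl v l'))^2"
   unfolding nrm_line_sq[OF n(5) nA] by (simp add: mult_ac)
  moreover have "t * (sg * R v (nl v l')) <= t * (5 * s)" using sgnv t by (intro mult_left_mono) auto
  moreover have "t^2 * (nrm (nl v l'))^2 <= t^2 * 4" using nl_nrm_sq[OF near l'(1)] by (intro mult_left_mono) auto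
  ultimately show ?thesis by (simp add: mult_ac)
 qed
 define c where "c = (nrm v)^2 + t * eps - 10 * s"
 have Rc: "c <= R u ?x" if u: "u : cvx T'" for u
 proof (rule hull_R[OF u T'S(1) xA])
  fix l assume "l : T'"
  then have l: "l : T" "eps <= sg * R (nl v l) (nl v l')" by (auto simp: T'_def)
  have pA: "pv l : A" using l n(1) pvA by blast
  have "R (pv l) ?x = R (pv l) v + t * (sg * R (pv l) (nl v l'))"
   by (simp add: ip_add_right ip_scale_right A_intros pA n(5) nA mult_ac)
  also have "sg * R (pv l) (nl v l') = sg * R (nl v l) (nl v l') + sg * R v (nl v l')"
   unfolding R_pv[OF near l(1) nA] by (simp add: algebra_simps)
  also have "R (pv l) v = R (nl v l) v + (nrm v)^2" unfolding R_pv[OF near l(1) n(5)] R_self[OF n(5)] ..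
  finally have "R (pv l) ?x = R (nl v l) v + (nrm v)^2 + t * (sg * R (nl v l) (nl v l') + sg * R v (nl v l'))" .
  moreover have "t * (eps + - (5 * s)) <= t * (sg * R (nl v l) (nl v l') + sg * R v (nl v l'))"
   using l sgnv t by (intro mult_left_mono add_mono) auto
  moreover have "t * s <= 1 * s" using t n by (intro mult_right_mono) auto
  moreover have "t * (eps + - (5 * s)) = t * eps - 5 * (t * s)" by (simp add: algebra_simps)
  moreover have "- (4 * s) <= R (nl v l) v" by (rule nl_lower[OF near l(1)])
  ultimately show "c <= R (pv l) ?x" unfolding c_def using n(10) by linarith
 qed
 have s2: "0 < s^2" using n(10) by simp
 obtain u where u: "u : cvx T'" "nrm u < NN T' + s^2" using NN_approx[OF T'S(2,1) s2] by blast
 have uA: "u : A" by (rule hull_A[OF u(1) T'S(1)])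
 have un: "nrm u <= nrm v + 2 * s^2" using u(2) n(14)[OF T'] n(8) by simp
 have x3: "nrm ?x <= 3"
 proof -
  have "nrm ?x <= nrm v + nrm (%y. cx (t * sg) * nl v l' y)" by (intro nrm_triangle A_intros n(5) nA)
  also have "nrm (%y. cx (t * sg) * nl v l' y) = t * nrm (nl v l')" unfolding nrm_scale[OF nA] norm_of_real using t sg by auto
  also have "... <= 1 * 2" using t nl_nrm[OF near l'(1)] nrm_nonneg[OF nA] by (intro mult_mono) auto
  finally show ?thesis using n(6) by simp
 qed
 define X where "X = nrm ?x"
 have X: "X^2 <= (nrm v)^2 + 10 * t * s + 4 * t^2" "X <= 3" "0 <= X" using x2 x3 nrm_nonneg[OF xA] by (simp_all only: X_def)
 have "c <= nrm u * X" using order_trans[OF Rc[OF u(1)] R_le[OF uA xA]] by (simp only: X_def)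
 also have "... <= (nrm v + 2 * s^2) * X" by (rule mult_right_mono[OF un X(3)])
 also have "... = nrm v * X + 2 * s^2 * X" by (simp add: algebra_simps)
 finally have cX: "c <= nrm v * X + 2 * s^2 * X" .
 have "2 * (nrm v * X) <= (nrm v)^2 + X^2" using sum_squares_bound[of "nrm v" X] by (simp add: mult.assoc)
 moreover have "s^2 * X <= s^2 * 3" using X(2) by (intro mult_left_mono) auto
 ultimately have "2 * c <= (nrm v)^2 + X^2 + 12 * s^2" using cX by linarith
 then have "2 * (t * eps) <= 20 * s + 10 * (t * s) + 4 * t^2 + 12 * s^2" using X(1) unfolding c_def by (simp add: mult_ac)
 moreover have "t * s <= 1 * s" using t n by (intro mult_right_mono) auto
 moreover have "s^2 <= s * 1" unfolding power2_eq_square using n by (intro mult_left_mono) auto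
 ultimately have "2 * (t * eps) <= 42 * s + 4 * t^2" by simp
 then have "eps\<^sup>2 / 2 <= 42 * s + eps\<^sup>2 / 4" unfolding t_def by (simp add: power2_eq_square)
 then show False using e(3) n(10) by simp
qed

text \<open>Each new index has to avoid finitely many null sets only. Since the deviations are
  pairwise at most slightly positively correlated, averages of many of them are small.\<close>

lemma greedy:
 assumes near: "near T v s" and e: "0 < eps" "eps <= 1" "240 * s <= eps\<^sup>2"
 shows "EX l :: nat => 'a. ALL j<K. l j : T & R (nl v (l j)) v <= 5 * s & (ALL i<j. R (nl v (l j)) (nl v (l i)) < eps)"
proof (induction K)
 case (Suc K)
 then obtain l where l: "!!j. j < K ==> l j : T" "!!j. j < K ==> R (nl v (l j)) v <= 5 * s"
  "!!j i. j < K ==> i < j ==> R (nl v (l j)) (nl v (l i)) < eps" by blast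
 define N where "N i = {l' : T. eps <= 1 * R (nl v l') (nl v (l i))}" for i
 have N: "msr (N i) = 0" if "i < K" for i
  unfolding N_def using that by (intro nl_pair[OF near l(1,2) _ e]) auto
 define U where "U = {l' : T. 5 * s <= R (nl v l') v}"
 have U: "msr U = 0" unfolding U_def by (rule nl_upper[OF near])
 have "msr (\<Union>i<K. N i) <= (\<Sum>i<K. msr (N i))" by (rule msr_UN) simp
 also have "... = 0" using N by simp
 finally have N0: "msr (\<Union>i<K. N i) = 0" using msr_nonneg[of "\<Union>i<K. N i"] by simp
 have "0 < msr (T - U - (\<Union>i<K. N i))" unfolding msr_diff_null[OF N0] msr_diff_null[OF U] by (rule near_props(2)[OF near])
 then obtain k where "k : T - U - (\<Union>i<K. N i)" using msr_pos_nonempty by blast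
 then have k: "k : T" "R (nl v k) v <= 5 * s" "!!i. i < K ==> R (nl v k) (nl v (l i)) < eps"
  by (auto simp: U_def N_def not_le)
 show ?case
 proof (intro exI[of _ "l(K := k)"] allI impI)
  fix j assume "j < Suc K"
  then consider "j = K" | "j < K" by linarith
  then show "(l(K := k)) j : T & R (nl v ((l(K := k)) j)) v <= 5 * s & (ALL i<j. R (nl v ((l(K := k)) j)) (nl v ((l(K := k)) i)) < eps)"
   using l k by cases auto
 qed
qed simp

section \<open>Shift relations for near minimal vectors\<close>

definition Fy :: "'a => 'x => complex" where "Fy y x = tr (zsmul p y) g x * cnj (g x)"

lemma FyA: "Fy y : A" unfolding Fy_def[abs_def] by (intro A_intros gA)

lemma Fy_nrm: "nrm (Fy y) <= B * B"
proof (rule nrm_bound[OF FyA])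
 have "0 <= B" using gB norm_ge_zero order_trans by blast
 then have "cmod (tr (zsmul p y) g x) * cmod (g x) <= B * B" for x by (intro mult_mono gB) (auto simp: tr_def gB)
 then show "cmod (Fy y x) <= B * B" for x by (simp add: Fy_def norm_mult)
qed

text \<open>Moving the index by \<open>y\<close> acts as the shift by \<open>zsmul p y\<close>, up
  to a phase and the quotient of the characters \<open>z (y + l)\<close> and
  \<open>z l\<close>.\<close>

lemma pv_shift:
 assumes "l : S" "y + l : S"
 shows "pv (y + l) x = (w (y + l) * cnj (w l) * z l (zsmul p y)) * (cnj (ch (%x. cnj (z l x) * z (y + l) x) x) * tr (zsmul p y) (pv l) x)"
proof -
 have t: "tr (zsmul p y) (pv l) x = w l * (cnj (z l (zsmul p y)) * cnj (ch (z l) x) * tr (zsmul p (y + l)) g x)"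
  unfolding pv_def[abs_def] tr_scale tr_mult tr_cnj tr_ch[OF z[OF assms(1)]] tr_tr by (simp add: zsmul_add_right)
 have one: "w l * cnj (w l) = 1" "z l (zsmul p y) * cnj (z l (zsmul p y)) = 1" "ch (z l) x * cnj (ch (z l) x) = 1"
  by (rule norm1_cnj(1), simp add: w z assms chr_norm ch_norm)+
 have c: "cnj (ch (%x. cnj (z l x) * z (y + l) x) x) = ch (z l) x * cnj (ch (z (y + l)) x)" by (simp add: ch_def)
 have "(w (y + l) * cnj (w l) * z l (zsmul p y)) * (cnj (ch (%x. cnj (z l x) * z (y + l) x) x) * tr (zsmul p y) (pv l) x)
  = (w l * cnj (w l)) * (z l (zsmul p y) * cnj (z l (zsmul p y))) * (ch (z l) x * cnj (ch (z l) x)) *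
   (w (y + l) * (cnj (ch (z (y + l)) x) * tr (zsmul p (y + l)) g x))"
  unfolding t c by (simp add: mult_ac)
 then show ?thesis unfolding one mult_1_left pv_def[of "y + l"] by (rule sym)
qed

text \<open>A large inner product thus puts the quotient character into the large spectrum of
  \<open>Fy y\<close>, which is finite with a bound uniform in \<open>y\<close>.\<close>

lemma pv_corr:
 assumes "l : S" "y + l : S"
 shows "cmod (ip (pv (y + l)) (pv l)) = cmod (co (%x. cnj (z l x) * z (y + l) x) (Fy y))"
proof -
 let ?\<kappa> = "%x. cnj (z l x) * z (y + l) x"
 have \<kappa>: "chr ?\<kappa>" by (intro chr_mult chr_cnj z assms)
 have "ip (pv (y + l)) (pv l) = I (%x. (w (y + l) * cnj (w l)) * (tr (zsmul p l) (Fy y) x * cnj (ch ?\<kappa> x)))"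
  unfolding ip_def pv_def Fy_def[abs_def] tr_mult tr_cnj tr_tr by (simp add: ch_def zsmul_add_right mult_ac add.commute)
 also have "... = (w (y + l) * cnj (w l)) * co ?\<kappa> (tr (zsmul p l) (Fy y))"
  unfolding co_def ip_def by (intro I_scale A_intros FyA \<kappa>)
 finally show ?thesis using co_tr[OF FyA \<kappa>] by (simp add: norm_mult w assms)
qed

lemma pigeonhole_classes:
 assumes "finite X" "!!j. j : J ==> EX i:X. Q i j" "finite J" "card X * k < card J"
 obtains i where "i : X" "k < card {j : J. Q i j}"
proof -
 have "EX i:X. k < card {j : J. Q i j}"
 proof (rule ccontr)
  assume "~ ?thesis"
  then have le: "card {j : J. Q i j} <= k" if "i : X" for i using that by (auto simp: not_less)
  have "card J <= card (\<Union>i\<in>X. {j : J. Q i j})" using assms by (intro card_mono) auto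
  also have "... <= (\<Sum>i\<in>X. card {j : J. Q i j})" by (rule card_UN_le[OF assms(1)])
  also have "... <= card X * k" using sum_bounded_above[OF le, of X] by simp
  finally show False using assms(4) by simp
 qed
 then show ?thesis using that by blast
qed

text \<open>For many \<open>y\<close>, many indices of a long greedy list have
  \<open>pv (y + l j)\<close> well correlated with \<open>pv (l j)\<close>. The quotient characters
  then come from a finite set and the phases from a finite net, so many indices share both up to a
  small error. Averaging over these turns the individual shift relations into one for
  \<open>v\<close>, because the average of the \<open>pv (l j)\<close> is close to
  \<open>v\<close>.\<close>

lemma approx_shift:
 assumes near: "near T v s" and e: "0 < eps" "eps <= 1" "240 * s <= eps\<^sup>2" "8 * eps <= \<eta>\<^sup>2" and e2: "0 < e2" "8 * eps <= e2^2"
 obtains Y where "0 < msr Y" "!!y. y : Y ==> EX ps c u. chr ps & cmod c = 1 & u : cvx T &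
  nrm (%x. u x - (c * ch ps x) * tr (zsmul p y) v x) <= e2"
proof -
 note n = near_props[OF near]
 \<comment> \<open>With more than \<open>k0\<close> indices the diagonal term \<open>4 / k\<close>
   of the squared norm of the averaged deviations is at most \<open>e2^2 / 8\<close>, and
   \<open>eps\<close> accounts for an equal share.\<close>
 define k0 where "k0 = nat \<lceil>32 / e2^2\<rceil>"
 have k0: "4 / k <= e2^2 / 8" "0 < k" if "real k0 < k" for k :: real
 proof -
  have "32 / e2^2 <= k" using that unfolding k0_def by linarith
  moreover have "0 < 32 / e2^2" using e2 by simp
  ultimately show "0 < k" by linarith
  then show "4 / k <= e2^2 / 8" using \<open>32 / e2^2 <= k\<close> e2(1) by (simp add: field_simps)
 qed
 define Cn where "Cn = nat \<lceil>(B * B)\<^sup>2 / (\<eta>\<^sup>2 / 2)^2\<rceil>"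
 define D where "D y = {\<kappa>. chr \<kappa> & \<eta>\<^sup>2 / 2 <= cmod (co \<kappa> (Fy y))}" for y
 have h2: "0 < \<eta>\<^sup>2 / 2" using eta by simp
 have D: "finite (D y)" "card (D y) <= Cn" for y
 proof -
  show f: "finite (D y)" unfolding D_def by (rule spec_finite[OF FyA h2])
  have "real (card (D y)) <= n2 (Fy y) / (\<eta>\<^sup>2 / 2)^2"
   by (rule spec_card[OF FyA h2 _ f]) (simp add: D_def)
  also have "... <= (B * B)^2 / (\<eta>\<^sup>2 / 2)^2"
   unfolding nrm_sq[OF FyA, symmetric] by (intro divide_right_mono power_mono Fy_nrm nrm_nonneg FyA) auto
  finally show "card (D y) <= Cn" unfolding Cn_def by linarith
 qed
 have "0 < e2 / 8" using e2 by simp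
 from complex_disc_net[OF this, of 1] obtain N where N: "finite N" "!!c. cmod c <= 1 ==> EX c':N. cmod (c - c') < e2 / 8" by blast
 define \<nu> where "\<nu> = msr T"
 have nu: "0 < \<nu>" using n(2) by (simp add: \<nu>_def)
 \<comment> \<open>Long enough that half the expected number of hits exceeds \<open>k0\<close> times
   the number of classes.\<close>
 obtain K where K: "2 * real (Cn * card N * k0) / \<nu> < real K" using reals_Archimedean2 by blast
 then have K': "real (Cn * card N * k0) < real K * \<nu> / 2" using nu by (simp add: field_simps)
 obtain l where l: "!!j. j < K ==> l j : T" "!!j. j < K ==> R (nl v (l j)) v <= 5 * s"
  "!!j i. j < K ==> i < j ==> R (nl v (l j)) (nl v (l i)) < eps" using greedy[OF near e(1-3), of K] by blast
 define G where "G j = T - {l' : T. eps <= - 1 * R (nl v l') (nl v (l j))}" for j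
 have mG: "msr (G j) = \<nu>" if "j < K" for j
  unfolding G_def \<nu>_def using that by (intro msr_diff_null nl_pair[OF near l(1,2) _ e(1-3)]) auto
 define f where "f y = (\<Sum>j<K. indicat_real (G j) (y + l j))" for y
 have bf: "bdd f" unfolding f_def by (intro bdd_sum bdd_indicator)
 have mf: "m f = real K * \<nu>"
 proof -
  have "m f = (\<Sum>j<K. m (%y. indicat_real (G j) (y + l j)))" unfolding f_def by (intro m_sum bdd_indicator)
  also have "... = (\<Sum>j<K. \<nu>)"
  proof (intro sum.cong refl)
   fix j assume "j : {..<K}"
   then have "m (indicat_real (G j)) = \<nu>" using mG by (simp add: msr_def)
   then show "m (%y. indicat_real (G j) (y + l j)) = \<nu>" using m_shift[OF bdd_indicator', of "G j" "l j"] by simp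
  qed
  finally show ?thesis by simp
 qed
 \<comment> \<open>\<open>f\<close> has mean \<open>real K * \<nu>\<close> and never exceeds
   \<open>real K\<close>, so it is at least half its mean on a set of positive measure.\<close>
 define Y where "Y = {y. real K * \<nu> / 2 <= f y}"
 have K0: "0 < real K" using K nu by (smt (verit) divide_nonneg_pos of_nat_0_le_iff)
 have "0 < msr Y"
 proof -
  have "f y <= real K * \<nu> / 2 + real K * indicat_real Y y" for y
  proof (cases "y : Y")
   case True
   have "f y <= (\<Sum>j<K. 1)" unfolding f_def by (intro sum_mono) (simp add: indicator_def)
   then show ?thesis using True nu by (simp add: add_increasing)
  qed (simp add: Y_def)
  then have "m f <= m (%y. real K * \<nu> / 2 + real K * indicat_real Y y)"
   by (intro m_mono bf bdd_add bdd_mult bdd_const bdd_indicator')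
  also have "... = real K * \<nu> / 2 + real K * msr Y" by (simp add: m_add m_scale bdd_const bdd_mult bdd_indicator' msr_def)
  finally have "real K * (\<nu> / 2) <= real K * msr Y" unfolding mf by simp
  then show ?thesis using K0 nu by simp
 qed
 then show ?thesis
 proof (rule that)
  fix y assume y: "y : Y"
  define J0 where "J0 = {j : {..<K}. y + l j : G j}"
  have J0: "finite J0" "real K * \<nu> / 2 <= real (card J0)"
  proof -
   show "finite J0" by (simp add: J0_def)
   have "f y = (\<Sum>j<K. if y + l j : G j then 1 else 0)" unfolding f_def by (intro sum.cong refl) (simp add: indicator_def)
   also have "... = real (card J0)" unfolding J0_def by (subst sum.inter_filter[symmetric]) auto
   finally show "real K * \<nu> / 2 <= real (card J0)" using y by (simp add: Y_def)
  qed
  have jT: "l j : T" "y + l j : T" "l j : S" "y + l j : S" "R (nl v (y + l j)) (nl v (l j)) > - eps" if "j : J0" for j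
   using that l(1)[of j] n(1) by (auto simp: J0_def G_def not_le)
  define \<kappa> where "\<kappa> j x = cnj (z (l j) x) * z (y + l j) x" for j x
  define \<theta> where "\<theta> j = w (y + l j) * cnj (w (l j)) * z (l j) (zsmul p y)" for j
  have \<theta>1: "cmod (\<theta> j) = 1" if "j : J0" for j using jT[OF that] by (simp add: \<theta>_def norm_mult w chr_norm z)
  \<comment> \<open>Expanding both vectors around \<open>v\<close>, the deviations contribute at
    worst \<open>- eps - 8 * s\<close>, so at least half of the square of \<eta> is left.\<close>
  have \<kappa>D: "\<kappa> j : D y" if j: "j : J0" for j
  proof -
   note t = jT[OF j]
   have c: "chr (\<kappa> j)" unfolding \<kappa>_def[abs_def] by (intro chr_mult chr_cnj z t)
   have pA: "pv (l j) : A" and nA: "nl v (l j) : A" "nl v (y + l j) : A" using t pvA nlA[OF near] by auto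
   have "R (pv (y + l j)) (pv (l j)) = R (nl v (y + l j)) (pv (l j)) + R v (pv (l j))" by (rule R_pv[OF near t(2) pA])
   also have "R (nl v (y + l j)) (pv (l j)) = R (nl v (l j)) (nl v (y + l j)) + R v (nl v (y + l j))"
    unfolding R_sym[OF nA(2) pA] by (rule R_pv[OF near t(1) nA(2)])
   also have "R v (pv (l j)) = R (nl v (l j)) v + R v v" unfolding R_sym[OF n(5) pA] by (rule R_pv[OF near t(1) n(5)])
   also have "R v (nl v (y + l j)) = R (nl v (y + l j)) v" by (rule R_sym[OF n(5) nA(2)])
   also have "R (nl v (l j)) (nl v (y + l j)) = R (nl v (y + l j)) (nl v (l j))" by (rule R_sym[OF nA])
   also have "R v v = (nrm v)^2" by (rule R_self[OF n(5)])
   finally have "- eps - 8 * s + (nrm v)^2 <= R (pv (y + l j)) (pv (l j))"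
    using t(5) nl_lower[OF near t(1)] nl_lower[OF near t(2)] by linarith
   moreover have "\<eta>\<^sup>2 <= (nrm v)^2" using n(7) eta by (intro power_mono) auto
   moreover have "eps\<^sup>2 <= eps * 1" unfolding power2_eq_square using e by (intro mult_left_mono) auto
   ultimately have "\<eta>\<^sup>2 / 2 <= R (pv (y + l j)) (pv (l j))" using e by linarith
   also have "... <= cmod (ip (pv (y + l j)) (pv (l j)))" by (rule complex_Re_le_cmod)
   also have "... = cmod (co (\<kappa> j) (Fy y))" unfolding \<kappa>_def[abs_def] by (rule pv_corr[OF t(3,4)])
   finally show ?thesis using c by (simp add: D_def)
  qed
  define X where "X = D y \<times> N"
  have X: "finite X" unfolding X_def using D(1) N(1) by simp
  have cl: "EX i:X. \<kappa> j = fst i & cmod (\<theta> j - snd i) < e2 / 8" if j: "j : J0" for j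
  proof -
   obtain c where "c : N" "cmod (\<theta> j - c) < e2 / 8" using N(2)[of "\<theta> j"] \<theta>1[OF j] by auto
   then show ?thesis using \<kappa>D[OF j] by (intro bexI[of _ "(\<kappa> j, c)"]) (auto simp: X_def)
  qed
  have "card X * k0 < card J0"
  proof -
   have "card X * k0 <= Cn * card N * k0" unfolding X_def card_cartesian_product using D(2) by (intro mult_right_mono) auto
   then have "real (card X * k0) <= real (Cn * card N * k0)" by (simp only: of_nat_le_iff)
   then have "real (card X * k0) < real (card J0)" using K' J0(2) by linarith
   then show ?thesis by (simp only: of_nat_less_iff)
  qed
  from pigeonhole_classes[where Q = "%i j. \<kappa> j = fst i & cmod (\<theta> j - snd i) < e2 / 8", OF X cl J0(1) this]
  obtain i where i: "i : X" "k0 < card {j : J0. \<kappa> j = fst i & cmod (\<theta> j - snd i) < e2 / 8}" by blast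
  define J where "J = {j : J0. \<kappa> j = fst i & cmod (\<theta> j - snd i) < e2 / 8}"
  have J: "finite J" "J <= J0" "k0 < card J" using i(2) J0(1) by (auto simp: J_def)
  then have Jne: "J ~= {}" by auto
  then obtain j0 where j0: "j0 : J" by blast
  define k where "k = real (card J)"
  have kk: "4 / k <= e2^2 / 8" "0 < k" using k0[of k] J(3) by (simp_all add: k_def)
  have kb: "cx (1 / k) * (\<Sum>j\<in>J. c) = c" for c using kk(2) by (simp add: k_def)
  define ps where "ps x = cnj (fst i x)" for x
  have ci: "chr (fst i)" using i(1) by (auto simp: X_def D_def)
  have ps: "chr ps" unfolding ps_def[abs_def] by (rule chr_cnj[OF ci])
  define c where "c = \<theta> j0"
  have c1: "cmod c = 1" unfolding c_def using j0 J(2) \<theta>1 by blast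
  have cc: "cmod (\<theta> j - c) <= e2 / 4" if "j : J" for j
  proof -
   have "cmod (\<theta> j - snd i) < e2 / 8" "cmod (\<theta> j0 - snd i) < e2 / 8" using that j0 by (auto simp: J_def)
   then show ?thesis using norm_triangle_ineq4[of "\<theta> j - snd i" "\<theta> j0 - snd i"] by (simp add: c_def)
  qed
  have JT: "l j : T" "y + l j : T" "l j : S" "y + l j : S" if "j : J" for j using jT[of j] J(2) that by auto
  define u where "u x = cx (1 / k) * (\<Sum>j\<in>J. pv (y + l j) x)" for x
  define V where "V x = cx (1 / k) * (\<Sum>j\<in>J. pv (l j) x)" for x
  have u: "u : cvx T" unfolding u_def[abs_def] k_def using JT(2) by (intro hull_avg J Jne)
  have VA: "V : A" unfolding V_def[abs_def] using JT by (intro A_intros pvA)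
  have Vv: "dst V v <= e2 / 2"
  proof -
   have e': "(%x. V x - v x) = (%x. cx (1 / k) * (\<Sum>j\<in>J. nl v (l j) x))"
    unfolding V_def nl_def sum_subtractf right_diff_distrib kb ..
   have sA: "(%x. \<Sum>j\<in>J. nl v (l j) x) : A" using JT by (intro A_sum nlA[OF near])
   have "(nrm (%x. \<Sum>j\<in>J. nl v (l j) x))^2 <= (real (card J))^2 * eps + 4 * real (card J)"
   proof (rule nrm_sum_sq_le[OF J(1)])
    fix a b assume ab: "a : J" "b : J" "a ~= b"
    then have aK: "a < K" "b < K" using J(2) by (auto simp: J0_def)
    have s: "R (nl v (l a)) (nl v (l b)) = R (nl v (l b)) (nl v (l a))" using JT ab by (intro R_sym nlA[OF near])
    from ab(3) consider "a < b" | "b < a" by linarith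
    then show "R (nl v (l a)) (nl v (l b)) <= eps"
    proof cases
     case 1 then show ?thesis unfolding s using l(3)[OF aK(2) 1] by simp
    next
     case 2 then show ?thesis using l(3)[OF aK(1) 2] by simp
    qed
   qed (use JT nlA[OF near] nl_nrm[OF near] e(1) in auto)
   then have "(nrm (%x. \<Sum>j\<in>J. nl v (l j) x))^2 <= k^2 * eps + 4 * k" by (simp add: k_def)
   moreover have "(dst V v)^2 = (1 / k)^2 * (nrm (%x. \<Sum>j\<in>J. nl v (l j) x))^2"
    unfolding e' nrm_scale[OF sA] using kk(2) by (simp add: power_mult_distrib power_divide norm_divide)
   ultimately have "(dst V v)^2 <= (1 / k)^2 * (k^2 * eps + 4 * k)" by (simp add: mult_left_mono del: One_nat_def)
   also have "... = eps + 4 / k" using kk(2) by (simp add: power2_eq_square field_simps)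
   also have "... <= (e2 / 2)^2" using kk(1) e2(2) by (simp add: power_divide)
   finally show ?thesis by (rule power2_le_imp_le) (use e2 in simp)
  qed
  have tA: "tr (zsmul p y) V : A" "tr (zsmul p y) v : A" by (intro A_tr VA n(5))+
  have "nrm (%x. u x - (c * ch ps x) * tr (zsmul p y) v x) <=
   nrm (%x. u x - (c * ch ps x) * tr (zsmul p y) V x) + nrm (%x. (c * ch ps x) * tr (zsmul p y) V x - (c * ch ps x) * tr (zsmul p y) v x)"
   by (intro nrm_triangle3 A_intros hull_A[OF u n(1)] VA n(5) ps)
  also have "nrm (%x. (c * ch ps x) * tr (zsmul p y) V x - (c * ch ps x) * tr (zsmul p y) v x)
   = nrm (%x. (c * ch ps x) * tr (zsmul p y) (%x. V x - v x) x)" unfolding tr_diff by (simp add: algebra_simps)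
  also have "... = dst V v"
   by (subst nrm_mult1) (auto intro!: A_intros VA n(5) ps simp: norm_mult c1 ch_norm ps nrm_tr A_diff VA n(5))
  also have "nrm (%x. u x - (c * ch ps x) * tr (zsmul p y) V x) <= e2 / 4"
  proof -
   let ?t = "%j x. (\<theta> j - c) * (ch ps x * tr (zsmul p y) (pv (l j)) x)"
   have pj: "pv (y + l j) x = \<theta> j * (ch ps x * tr (zsmul p y) (pv (l j)) x)" if "j : J" for j x
   proof -
    have "(%x. cnj (z (l j) x) * z (y + l j) x) = fst i" using that by (auto simp: J_def \<kappa>_def[abs_def])
    then show ?thesis unfolding pv_shift[OF JT(3,4)[OF that]] \<theta>_def ps_def[abs_def] by (simp add: ch_cnj)
   qed
   have "tr (zsmul p y) V x = cx (1 / k) * (\<Sum>j\<in>J. tr (zsmul p y) (pv (l j)) x)" for x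
    unfolding V_def[abs_def] tr_scale tr_sum ..
   moreover have "u x = cx (1 / k) * (\<Sum>j\<in>J. \<theta> j * (ch ps x * tr (zsmul p y) (pv (l j)) x))" for x
    unfolding u_def using pj by (simp cong: sum.cong)
   ultimately have "u x - (c * ch ps x) * tr (zsmul p y) V x = cx (1 / k) * (\<Sum>j\<in>J. ?t j x)" for x
    by (simp only: left_diff_distrib sum_subtractf right_diff_distrib sum_distrib_left mult_ac)
   then have "nrm (%x. u x - (c * ch ps x) * tr (zsmul p y) V x) = nrm (%x. cx (1 / k) * (\<Sum>j\<in>J. ?t j x))" by (simp only:)
   also have "... = (1 / k) * nrm (%x. \<Sum>j\<in>J. ?t j x)"
    using kk(2) JT by (subst nrm_scale) (auto intro!: A_intros pvA ps simp: norm_divide)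
   also have "... <= (1 / k) * (\<Sum>j\<in>J. nrm (?t j))"
    using kk(2) JT by (intro mult_left_mono nrm_sum A_intros pvA ps) auto
   also have "... <= (1 / k) * (\<Sum>j\<in>J. e2 / 4)"
   proof (intro mult_left_mono sum_mono)
    fix j assume j: "j : J"
    have "nrm (?t j) = cmod (\<theta> j - c) * nrm (%x. ch ps x * tr (zsmul p y) (pv (l j)) x)"
     by (rule nrm_scale) (intro A_intros pvA ps JT j)
    also have "nrm (%x. ch ps x * tr (zsmul p y) (pv (l j)) x) = nrm (pv (l j))"
     by (subst nrm_mult1) (auto intro!: A_intros pvA ps JT j simp: ch_norm ps nrm_tr pvA JT j)
    also have "cmod (\<theta> j - c) * nrm (pv (l j)) <= (e2 / 4) * 1"
     using cc[OF j] pv_nrm[OF JT(3)[OF j]] nrm_nonneg[OF pvA[OF JT(3)[OF j]]] e2 by (intro mult_mono) auto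
    finally show "nrm (?t j) <= e2 / 4" by simp
   qed (use kk in simp)
   also have "... = e2 / 4" using kk(2) by (simp add: k_def)
   finally show ?thesis .
  qed
  finally have "nrm (%x. u x - (c * ch ps x) * tr (zsmul p y) v x) <= e2" using Vv e2 by simp
  with ps c1 u show "EX ps c u. chr ps & cmod c = 1 & u : cvx T &
   nrm (%x. u x - (c * ch ps x) * tr (zsmul p y) v x) <= e2" by blast
 qed
qed

text \<open>The twisted shift of \<open>v\<close> has the norm of \<open>v\<close> and lies close to
  a hull vector \<open>u\<close>. Hence \<open>u\<close> is nearly minimal and close to
  \<open>v\<close> by \<open>cvx_close\<close>, and so is the twisted shift.\<close>

lemma approx_rel:
 assumes near: "near T v s" and e: "0 < eps" "eps <= 1" "240 * s <= eps\<^sup>2" "8 * eps <= \<eta>\<^sup>2" and e2: "0 < e2" "8 * eps <= e2^2" "s^2 + e2 <= 1"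
 obtains Y where "0 < msr Y" "!!y. y : Y ==> rel v (zsmul p y) (e2 + sqrt (12 * (s^2 + e2)))"
proof -
 note n = near_props[OF near]
 obtain Y where Y: "0 < msr Y" "!!y. y : Y ==> EX ps c u. chr ps & cmod c = 1 & u : cvx T &
  nrm (%x. u x - (c * ch ps x) * tr (zsmul p y) v x) <= e2" by (rule approx_shift[OF near e e2(1,2)]) blast
 show ?thesis
 proof (rule that[OF Y(1)])
  fix y assume "y : Y"
  then obtain ps c u where h: "chr ps" "cmod c = 1" "u : cvx T" "nrm (%x. u x - (c * ch ps x) * tr (zsmul p y) v x) <= e2"
   using Y(2) by blast
  have uA: "u : A" by (rule hull_A[OF h(3) n(1)])
  let ?w = "%x. (c * ch ps x) * tr (zsmul p y) v x"
  have wA: "?w : A" by (intro A_intros h n(5))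
  have wn: "nrm ?w = nrm v"
   by (subst nrm_mult1) (auto intro!: A_intros n(5) h simp: norm_mult h ch_norm nrm_tr n(5))
  have "nrm u <= nrm ?w + e2" using nrm_diff_ge[OF uA wA] h(4) by simp
  then have un: "nrm u <= NN T + (s^2 + e2)" using n(9) wn by simp
  have "(dst u v)^2 <= 12 * (s^2 + e2)"
   by (rule cvx_close[OF n(1,3) h(3) n(4) un]) (use n(9) e2 in auto)
  then have uv: "dst u v <= sqrt (12 * (s^2 + e2))" by (rule real_le_rsqrt)
  have "nrm (%x. ?w x - v x) <= nrm (%x. ?w x - u x) + dst u v" by (rule nrm_triangle3[OF wA uA n(5)])
  also have "nrm (%x. ?w x - u x) = nrm (%x. u x - ?w x)" by (rule nrm_diff_commute[OF wA uA])
  finally have wv: "nrm (%x. ?w x - v x) <= e2 + sqrt (12 * (s^2 + e2))" using uv h(4) by simp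
  let ?ps = "%x. cnj (ps x)"
  have one: "c * cnj c = 1" "ch ps x * cnj (ch ps x) = 1" for x by (rule norm1_cnj(1), simp add: h ch_norm)+
  have "tr (zsmul p y) v x - cnj c * (ch ?ps x * v x) = cnj c * cnj (ch ps x) * (?w x - v x)" for x
  proof -
   have "cnj c * cnj (ch ps x) * (?w x - v x) = (c * cnj c) * (ch ps x * cnj (ch ps x)) * tr (zsmul p y) v x - cnj c * (cnj (ch ps x) * v x)"
    by (simp add: algebra_simps)
   then show ?thesis unfolding one by (simp add: ch_cnj)
  qed
  then have "nrm (%x. tr (zsmul p y) v x - cnj c * (ch ?ps x * v x)) = nrm (%x. cnj c * cnj (ch ps x) * (?w x - v x))" by (simp only:)
  also have "... = nrm (%x. ?w x - v x)" by (intro nrm_mult1 A_intros wA n(5) h) (auto simp: norm_mult h ch_norm)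
  finally have "nrm (%x. tr (zsmul p y) v x - cnj c * (ch ?ps x * v x)) <= e2 + sqrt (12 * (s^2 + e2))" using wv by simp
  then show "rel v (zsmul p y) (e2 + sqrt (12 * (s^2 + e2)))"
   using h(2) by (intro relI[OF relcI[OF chr_cnj[OF h(1)], of "cnj c"]]) simp_all
 qed
qed

lemma approx_rel':
 assumes "0 < e"
 obtains \<sigma> where "0 < \<sigma>" "!!T v s. near T v s ==> s <= \<sigma> ==> EX Y. 0 < msr Y & (ALL y:Y. rel v (zsmul p y) e)"
proof -
 define e1 where "e1 = min e 1"
 have e1: "0 < e1" "e1 <= 1" "e1 <= e" using assms by (auto simp: e1_def)
 define e2 where "e2 = e1^2 / 64"
 have e1s: "e1^2 <= e1 * 1" "0 < e1^2" unfolding power2_eq_square using e1 by (intro mult_left_mono, simp_all)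
 have e2: "0 < e2" "e2 <= 1 / 64" "e2 <= e1 / 64" using e1s e1 by (auto simp: e2_def)
 define eps where "eps = min (e2^2 / 8) (\<eta>\<^sup>2 / 8)"
 have e2s: "e2^2 <= e2 * 1" unfolding power2_eq_square using e2 by (intro mult_left_mono) auto
 have eps: "0 < eps" "eps <= 1" "8 * eps <= \<eta>\<^sup>2" "8 * eps <= e2^2" using e2 e2s eta by (auto simp: eps_def)
 define \<sigma> where "\<sigma> = min (eps\<^sup>2 / 240) e2"
 have \<sigma>: "0 < \<sigma>" "240 * \<sigma> <= eps\<^sup>2" "\<sigma> <= e2" using eps e2 by (auto simp: \<sigma>_def)
 show ?thesis
 proof (rule that[OF \<sigma>(1)])
  fix T v s assume n: "near T v s" "s <= \<sigma>"
  note np = near_props[OF n(1)]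
  have s2: "s^2 <= s * 1" unfolding power2_eq_square using np by (intro mult_left_mono) auto
  have "s^2 + e2 <= 2 * e2" using s2 n(2) \<sigma> by simp
  then have le1: "s^2 + e2 <= 1" and l24: "12 * (s^2 + e2) <= 24 * e2" using e2(2) by auto
  moreover have "24 * e2 <= (e1 * 5 / 8)^2" using e1s by (simp add: e2_def power_mult_distrib power_divide)
  ultimately have "12 * (s^2 + e2) <= (e1 * 5 / 8)^2" using l24 by linarith
  then have "sqrt (12 * (s^2 + e2)) <= e1 * 5 / 8" using e1 by (intro real_le_lsqrt) auto
  then have b: "e2 + sqrt (12 * (s^2 + e2)) <= e" using e2(3) e1 by simp
  have "240 * s <= eps\<^sup>2" using n(2) \<sigma> by simp
  from approx_rel[OF n(1) eps(1,2) this eps(3) e2(1) eps(4) le1]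
  obtain Y where "0 < msr Y" "!!y. y : Y ==> rel v (zsmul p y) (e2 + sqrt (12 * (s^2 + e2)))" by blast
  then show "EX Y. 0 < msr Y & (ALL y:Y. rel v (zsmul p y) e)" using rel_mono[OF _ b] by blast
 qed
qed

text \<open>Nearly minimal vectors over nested good sets with errors tending to 0 form a Cauchy
  sequence, and their common sup bound \<open>B\<close> permits a limit. The shift relation holds
  first for \<open>y\<close> in a set of positive measure; \<open>bogolyubov_zsmul\<close> spreads
  it to a Bohr neighbourhood at four times the error.\<close>

lemma pure_near: obtains v where "pure v" "nrm v <= 1" "\<eta> <= R v g"
proof -
 \<comment> \<open>The offset 2 keeps \<open>s k\<close> at most \<open>1 / 2\<close>, so that
   \<open>2 * (s k)^2\<close> meets the hypothesis \<open>d <= 1\<close> of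
   \<open>cvx_close\<close>.\<close>
 define s where "s k = 1 / (real k + 2)" for k :: nat
 have s: "0 < s k" "s k <= 1 / 2" "0 < (s k)^2" for k by (auto simp: s_def field_simps)
 have s_anti: "s l <= s k" if "k <= l" for k l using that by (auto simp: s_def intro!: divide_left_mono)
 have "EX T. ALL k. good (T k) ((s k)^2) & T (Suc k) <= T k"
 proof (rule dependent_nat_choice)
  show "EX T. good T ((s 0)^2)" using good_exists[OF subset_refl S0 s(3)] by blast
  fix T k assume "good T ((s k)^2)"
  then have "T <= S" "0 < msr T" by (auto simp: good_def)
  from good_exists[OF this s(3)] show "EX T'. good T' ((s (Suc k))^2) & T' <= T" by blast
 qed
 then obtain T where T: "!!k. good (T k) ((s k)^2)" "!!k. T (Suc k) <= T k" by blast
 have Tm: "T l <= T k" if "k <= l" for k l using lift_Suc_antimono_le[of T k l] T(2) that by blast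
 have TS: "T k <= S" "T k ~= {}" "0 < msr (T k)" for k using T(1)[of k] unfolding good_def by auto
 have "EX v. v : cvx (T k) & nrm v < NN (T k) + (s k)^2" for k using NN_approx[OF TS(2,1) s(3)] by blast
 then obtain v where v: "!!k. v k : cvx (T k)" "!!k. nrm (v k) < NN (T k) + (s k)^2" by metis
 have near: "near (T k) (v k) (s k)" for k using T v(1)[of k] v(2)[of k] s[of k] by (auto simp: near_def)
 have vA: "v k : A" and vB: "cmod (v k x) <= B" and v1: "nrm (v k) <= 1" for k x using hull_props[OF v(1) TS(1)] by auto
 have ss: "(s k)^2 <= (1/2)^2" for k using s[of k] by (intro power_mono) auto
 have cl: "dst (v k) (v l) <= 5 * s k" if kl: "k <= l" for k l
 proof -
  have "NN (T l) <= NN (T k) + (s k)^2" using T(1)[of k] Tm[OF kl] TS(3)[of l] unfolding good_def by blast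
  moreover have "(s l)^2 <= (s k)^2" using s_anti[OF kl] s[of l] by (intro power_mono) auto
  ultimately have "nrm (v l) <= NN (T k) + 2 * (s k)^2" using v(2)[of l] by simp
  moreover have "nrm (v k) <= NN (T k) + 2 * (s k)^2" using v(2)[of k] s(3)[of k] by linarith
  ultimately have "(dst (v k) (v l))^2 <= 12 * (2 * (s k)^2)"
   using ss[of k] by (intro cvx_close[OF TS(1,2) v(1) hull_mono[OF Tm[OF kl] v(1)]]) (auto simp: power2_eq_square)
  also have "... <= (5 * s k)^2" by (simp add: power_mult_distrib)
  finally show ?thesis by (rule power2_le_imp_le) (use s[of k] in simp)
 qed
 have sm: "EX N. ALL k>=N. s k < e" if e: "0 < e" for e
 proof -
  obtain N where N: "inverse (real (Suc N)) < e" using reals_Archimedean[OF e] by blast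
  have "s k < e" if "N <= k" for k
  proof -
   have "s k <= inverse (real (Suc N))" unfolding s_def inverse_eq_divide using that by (intro divide_left_mono) auto
   with N show ?thesis by simp
  qed
  then show ?thesis by blast
 qed
 have cau: "EX N. ALL k>=N. ALL l>=N. dst (v k) (v l) < e" if e: "0 < e" for e
 proof -
  have "0 < e / 5" using e by simp
  then obtain N where N: "!!k. N <= k ==> s k < e / 5" using sm by blast
  have "dst (v k) (v l) < e" if "N <= k" "N <= l" for k l
  proof (cases "k <= l")
   case True then show ?thesis using cl[OF True] N[OF that(1)] by simp
  next
   case False
   then have "dst (v l) (v k) < e" using cl[of l k] N[OF that(2)] by simp
   then show ?thesis by (simp only: nrm_diff_commute[OF vA vA])
  qed
  then show ?thesis by blast
 qed
 obtain G where G: "G : A" "!!e. 0 < e ==> EX N. ALL k>=N. dst (v k) G < e"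
  by (rule complete_nrm[of v B, OF vA vB], rule cau, assumption, rule that, assumption, assumption)
 have lim: "EX k. dst G (v k) < e & s k < e'" if ee: "0 < e" "0 < e'" for e e'
 proof -
  obtain N M where "!!k. N <= k ==> dst (v k) G < e" "!!k. M <= k ==> s k < e'" using G(2)[OF ee(1)] sm[OF ee(2)] by blast
  then show ?thesis using nrm_diff_commute[OF G(1) vA] by (intro exI[of _ "max N M"]) simp
 qed
 show ?thesis
 proof (rule that)
  show "nrm G <= 1"
  proof (rule field_le_epsilon)
   fix e :: real assume "0 < e"
   then obtain k where "dst G (v k) < e" using lim[of e 1] by auto
   then show "nrm G <= 1 + e" using nrm_diff_ge[OF G(1) vA[of k]] v1[of k] by simp
  qed
  show "\<eta> <= R G g"
  proof (rule field_le_epsilon)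
   fix e :: real assume "0 < e"
   then obtain k where k: "dst G (v k) < e" using lim[of e 1] by auto
   have "R (v k) g - R G g = R (%x. v k x - G x) g" by (simp add: ip_diff_left G vA gA)
   also have "... <= dst (v k) G * nrm g" by (intro R_le A_diff vA G gA)
   also have "... <= e * 1" using k gn nrm_nonneg[OF gA] \<open>0 < e\<close> unfolding nrm_diff_commute[OF G(1) vA] by (intro mult_mono) auto
   finally show "\<eta> <= R G g + e" using hull_R_g(1)[OF v(1)[of k] TS(1)] by simp
  qed
  have "eventually (%h. rel G h e) bohr" if e: "0 < e" for e
  proof -
   have e': "0 < e / 12" using e by simp
   obtain \<sigma> where \<sigma>: "0 < \<sigma>" "!!T v s. near T v s ==> s <= \<sigma> ==> EX Y. 0 < msr Y & (ALL y:Y. rel v (zsmul p y) (e / 12))"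
    by (rule approx_rel'[OF e']) blast
   obtain k where k: "dst G (v k) < e / 12" "s k < \<sigma>" using lim[OF e' \<sigma>(1)] by blast
   obtain Y where Y: "0 < msr Y" "!!y. y : Y ==> rel (v k) (zsmul p y) (e / 12)"
    using \<sigma>(2)[OF near less_imp_le[OF k(2)]] by blast
   have r: "rel G (zsmul p y) (e / 4)" if "y : Y" for y
    using rel_close[OF G(1) vA Y(2)[OF that] less_imp_le[OF k(1)]] by (rule rel_mono) simp
   from bogolyubov_zsmul[OF im Y(1)[unfolded msr_def] p]
   show ?thesis
   proof eventually_elim
    case (elim d)
    then obtain a b c c' where h: "a : Y" "b : Y" "c : Y" "c' : Y" "d = zsmul p (a + b - c - c')" by blast
    show ?case using rel_bogo[OF G(1) r[OF h(1)] r[OF h(2)] r[OF h(3)] r[OF h(4)]] unfolding h(5) by (simp add: zsmul_add_right zsmul_diff_right)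
   qed
  qed
  then show "pure G" using G(1) by (simp add: pure_def)
 qed
qed

end

text \<open>The inverse statement to \<open>gvn\<close>: an exceptional set of positive measure
  forces correlation with an eigenvector modulo characters. The characters are chosen pointwise in
  \<open>l\<close>, and the phase \<open>w l\<close> makes each correlation a positive real.\<close>

lemma (in sysm) pure_exists:
 assumes g: "g : A" "nrm g <= 1" and p: "fin_idx p TYPE('a)" and S: "0 < msr S" and eta: "0 < \<eta>"
  and corr: "!!l. l : S ==> EX zt. chr zt & \<eta> <= cmod (ip (tr (zsmul p l) g) (%x. ch zt x * g x))"
 obtains v where "pure v" "nrm v <= 1" "\<eta> <= R v g"
proof -
 obtain z where z: "!!l. l : S ==> chr (z l)" "!!l. l : S ==> \<eta> <= cmod (ip (tr (zsmul p l) g) (%x. ch (z l) x * g x))"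
  using corr by metis
 obtain B where B: "!!x. cmod (g x) <= B" by (rule A_bound[OF g(1)]) blast
 define c where "c l = ip (tr (zsmul p l) g) (%x. ch (z l) x * g x)" for l
 define w where "w l = cnj (c l) / cmod (c l)" for l
 have nz: "c l ~= 0" if "l : S" for l using z(2)[OF that] eta by (auto simp: c_def)
 interpret pvec A I \<tau> pr m g p S z w \<eta> B
 proof unfold_locales
  fix l assume l: "l : S"
  show "chr (z l)" by (rule z(1)[OF l])
  show "cmod (w l) = 1" using nz[OF l] by (simp add: w_def norm_divide)
  have "ip (%x. w l * (cnj (ch (z l) x) * tr (zsmul p l) g x)) g = w l * ip (%x. cnj (ch (z l) x) * tr (zsmul p l) g x) g"
   by (intro ip_scale_left A_intros g z l)
  also have "ip (%x. cnj (ch (z l) x) * tr (zsmul p l) g x) g = c l" unfolding c_def ip_def by (simp add: mult_ac)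
  also have "w l * c l = (c l * cnj (c l)) / cmod (c l)" by (simp add: w_def mult.commute)
  also have "... = cx (cmod (c l))" unfolding complex_norm_square[symmetric] by (simp add: power2_eq_square)
  finally show "\<eta> <= Re (ip (%x. w l * (cnj (ch (z l) x) * tr (zsmul p l) g x)) g)" using z(2)[OF l] by (simp add: c_def)
 qed (use g p S eta B in auto)
 show ?thesis using pure_near that by blast
qed

section \<open>Products of shifted eigenvectors\<close>

context sysm
begin

lemma relc_zsmul: assumes v: "v : A" and r: "relc v h zt eps"
 shows "relc v (zsmul k h) (%x. zt (zsmul k x)) (\<bar>real_of_int k\<bar> * eps)"
proof -
 have c: "chr zt" using r by (elim relcE)
 have nat: "relc v (zsmul (int n) h) (%x. zt (zsmul (int n) x)) (real n * eps)" for n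
 proof (induction n)
  case 0
  have "nrm (%x. tr 0 v x - 1 * (ch (%x. 1) x * v x)) <= 0" by simp
  then have "relc v 0 (%x. 1) 0" by (intro relcI[where c = 1]) auto
  then show ?case by (simp add: zsmul_0 chr_zero[OF c])
 next
  case (Suc n)
  from relc_add[OF v Suc r] show ?case
   by (simp add: zsmul_add_left zsmul_1 chr_add[OF c] algebra_simps)
 qed
 show ?thesis
 proof (cases "0 <= k")
  case True
  then show ?thesis using nat[of "nat k"] by simp
 next
  case False
  then have k: "k = - int (nat (- k))" "\<bar>real_of_int k\<bar> = real (nat (- k))" by simp_all
  have "relc v (- zsmul (int (nat (- k))) h) (%x. cnj (zt (zsmul (int (nat (- k))) x))) (real (nat (- k)) * eps)"
   by (rule relc_uminus[OF v nat])
  then show ?thesis unfolding k(2) using k(1) by (metis (no_types, lifting) chr_minus[OF c] ext zsmul_minus_left)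
 qed
qed

lemma nrm_cnj: assumes "F : A" shows "nrm (%x. cnj (F x)) = nrm F"
 by (rule antisym; rule nrm_mono) (auto intro: A_cnj assms)

lemma nrm_prod2:
 assumes "F0 : A" "G0 : A" "F1 : A" "G1 : A" "!!x. cmod (F0 x) <= B0" "!!x. cmod (G1 x) <= B1"
  "dst F0 G0 <= e0" "dst F1 G1 <= e1"
 shows "nrm (%x. F0 x * F1 x - G0 x * G1 x) <= B0 * e1 + B1 * e0"
proof -
 have B: "0 <= B0" "0 <= B1" using assms(5,6) norm_ge_zero order_trans by blast+
 have "nrm (%x. F0 x * F1 x - G0 x * G1 x) = nrm (%x. F0 x * (F1 x - G1 x) + G1 x * (F0 x - G0 x))" by (simp add: algebra_simps)
 also have "... <= nrm (%x. F0 x * (F1 x - G1 x)) + nrm (%x. G1 x * (F0 x - G0 x))" by (intro nrm_triangle A_intros assms)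
 also have "... <= B0 * dst F1 G1 + B1 * dst F0 G0" by (intro add_mono nrm_mult_bound A_intros assms)
 also have "... <= B0 * e1 + B1 * e0" using assms B by (intro add_mono mult_left_mono) auto
 finally show ?thesis .
qed

lemma shift1:
 assumes v: "v : A" and r: "relc v l zt eps"
 obtains c where "cmod c = 1" "!!k. nrm (%x. tr (k + zsmul p l) v x - (c * zt (zsmul p k)) * (ch (%x. zt (zsmul p x)) x * tr k v x)) <= \<bar>real_of_int p\<bar> * eps"
proof -
 obtain c where c: "chr (%x. zt (zsmul p x))" "cmod c = 1"
  "nrm (%x. tr (zsmul p l) v x - c * (ch (%x. zt (zsmul p x)) x * v x)) <= \<bar>real_of_int p\<bar> * eps"
  using relc_zsmul[OF v r, of p] by (elim relcE)
 show ?thesis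
 proof (rule that[OF c(2)])
  fix k
  have "tr k (%x. tr (zsmul p l) v x - c * (ch (%x. zt (zsmul p x)) x * v x)) x
   = tr (k + zsmul p l) v x - (c * zt (zsmul p k)) * (ch (%x. zt (zsmul p x)) x * tr k v x)" for x
   unfolding tr_diff tr_scale tr_mult tr_tr tr_ch[OF c(1)] by (simp add: mult_ac)
  then have F: "tr k (%x. tr (zsmul p l) v x - c * (ch (%x. zt (zsmul p x)) x * v x))
   = (%x. tr (k + zsmul p l) v x - (c * zt (zsmul p k)) * (ch (%x. zt (zsmul p x)) x * tr k v x))" by (rule ext)
  have "nrm (%x. tr (k + zsmul p l) v x - (c * zt (zsmul p k)) * (ch (%x. zt (zsmul p x)) x * tr k v x))
   = nrm (tr k (%x. tr (zsmul p l) v x - c * (ch (%x. zt (zsmul p x)) x * v x)))" unfolding F ..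
  also have "... = nrm (%x. tr (zsmul p l) v x - c * (ch (%x. zt (zsmul p x)) x * v x))" by (intro nrm_tr A_intros v c)
  finally show "nrm (%x. tr (k + zsmul p l) v x - (c * zt (zsmul p k)) * (ch (%x. zt (zsmul p x)) x * tr k v x)) <= \<bar>real_of_int p\<bar> * eps"
   using c(3) by simp
 qed
qed

text \<open>The integrand of an inner product of two products of two vectors. The four shifts are
  kept independent so that \<open>shiftP\<close> can move each by a different multiple of
  \<open>l\<close>.\<close>

definition PP where
 "PP v v' u u' k0 k1 k2 k3 x = (tr k0 v x * tr k1 v' x) * (cnj (tr k2 u x) * cnj (tr k3 u' x))"

definition mono :: "int => int => int => int => ('a => complex) => ('a => complex) => ('a => complex) => ('a => complex) => 'a => complex" where
 "mono p q r s X Y Z W h = X (zsmul p h) * Y (zsmul q h) * (Z (zsmul r h) * W (zsmul s h))"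

lemma mono_chr: "chr X ==> chr Y ==> chr Z ==> chr W ==> chr (mono p q r s X Y Z W)"
 unfolding mono_def[abs_def] by (intro chr_mult chr_zsmul)

lemma PP_A: "v : A ==> v' : A ==> u : A ==> u' : A ==> PP v v' u u' k0 k1 k2 k3 : A"
 unfolding PP_def[abs_def] by (intro A_intros)

lemma PP_bound:
 assumes "!!x. cmod (v x) <= B" "!!x. cmod (v' x) <= B" "!!x. cmod (u x) <= B" "!!x. cmod (u' x) <= B"
 shows "cmod (PP v v' u u' k0 k1 k2 k3 x) <= B ^ 4"
proof -
 have "0 <= B" using assms(1) norm_ge_zero order_trans by blast
 then have "cmod (tr k0 v x) * cmod (tr k1 v' x) * (cmod (tr k2 u x) * cmod (tr k3 u' x)) <= (B * B) * (B * B)"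
  by (intro mult_mono tr_cmod_le assms mult_nonneg_nonneg) auto
 then show ?thesis by (simp add: PP_def norm_mult power4_eq_xxxx mult.assoc)
qed

text \<open>Each factor obeys \<open>shift1\<close>. The phases and the character values at the
  \<open>k\<close> variables collect in front, and the four characters multiply to one under the
  integral; conjugation turns the exponents of the last two into \<open>- p2\<close> and
  \<open>- p3\<close>.\<close>

lemma shiftP:
 assumes A: "v : A" "v' : A" "u : A" "u' : A"
  and B: "!!x. cmod (v x) <= B" "!!x. cmod (v' x) <= B" "!!x. cmod (u x) <= B" "!!x. cmod (u' x) <= B"
  and r: "relc v l X eps" "relc v' l Y eps" "relc u l Z eps" "relc u' l W eps"
 obtains c where "cmod c = 1" "!!k0 k1 k2 k3.
  cmod (I (PP v v' u u' (k0 + zsmul p0 l) (k1 + zsmul p1 l) (k2 + zsmul p2 l) (k3 + zsmul p3 l)) -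
   c * (X (zsmul p0 k0) * Y (zsmul p1 k1) * (Z (zsmul (- p2) k2) * W (zsmul (- p3) k3))) *
   I (%x. ch (mono p0 p1 (- p2) (- p3) X Y Z W) x * PP v v' u u' k0 k1 k2 k3 x))
  <= (\<bar>real_of_int p0\<bar> + \<bar>real_of_int p1\<bar> + \<bar>real_of_int p2\<bar> + \<bar>real_of_int p3\<bar>) * B ^ 3 * eps"
proof -
 have C: "chr X" "chr Y" "chr Z" "chr W" using r by (auto elim: relcE)
 have Bn: "0 <= B" using B(1) norm_ge_zero order_trans by blast
 obtain c0 where c0: "cmod c0 = 1" "!!k. nrm (%x. tr (k + zsmul p0 l) v x - (c0 * X (zsmul p0 k)) * (ch (%x. X (zsmul p0 x)) x * tr k v x)) <= \<bar>real_of_int p0\<bar> * eps"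
  by (rule shift1[OF A(1) r(1), of p0]) blast
 obtain c1 where c1: "cmod c1 = 1" "!!k. nrm (%x. tr (k + zsmul p1 l) v' x - (c1 * Y (zsmul p1 k)) * (ch (%x. Y (zsmul p1 x)) x * tr k v' x)) <= \<bar>real_of_int p1\<bar> * eps"
  by (rule shift1[OF A(2) r(2), of p1]) blast
 obtain c2 where c2: "cmod c2 = 1" "!!k. nrm (%x. tr (k + zsmul p2 l) u x - (c2 * Z (zsmul p2 k)) * (ch (%x. Z (zsmul p2 x)) x * tr k u x)) <= \<bar>real_of_int p2\<bar> * eps"
  by (rule shift1[OF A(3) r(3), of p2]) blast
 obtain c3 where c3: "cmod c3 = 1" "!!k. nrm (%x. tr (k + zsmul p3 l) u' x - (c3 * W (zsmul p3 k)) * (ch (%x. W (zsmul p3 x)) x * tr k u' x)) <= \<bar>real_of_int p3\<bar> * eps"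
  by (rule shift1[OF A(4) r(4), of p3]) blast
 define c where "c = c0 * c1 * (cnj c2 * cnj c3)"
 show ?thesis
 proof (rule that)
  show "cmod c = 1" by (simp add: c_def norm_mult c0 c1 c2 c3)
  fix k0 k1 k2 k3
  let ?F0 = "tr (k0 + zsmul p0 l) v" and ?F1 = "tr (k1 + zsmul p1 l) v'" and ?F2 = "tr (k2 + zsmul p2 l) u" and ?F3 = "tr (k3 + zsmul p3 l) u'"
  define G0 where "G0 x = (c0 * X (zsmul p0 k0)) * (ch (%x. X (zsmul p0 x)) x * tr k0 v x)" for x
  define G1 where "G1 x = (c1 * Y (zsmul p1 k1)) * (ch (%x. Y (zsmul p1 x)) x * tr k1 v' x)" for x
  define G2 where "G2 x = (c2 * Z (zsmul p2 k2)) * (ch (%x. Z (zsmul p2 x)) x * tr k2 u x)" for x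
  define G3 where "G3 x = (c3 * W (zsmul p3 k3)) * (ch (%x. W (zsmul p3 x)) x * tr k3 u' x)" for x
  have GA: "G0 : A" "G1 : A" "G2 : A" "G3 : A"
   unfolding G0_def[abs_def] G1_def[abs_def] G2_def[abs_def] G3_def[abs_def] by (intro A_intros A C chr_zsmul)+
  have FA: "?F0 : A" "?F1 : A" "?F2 : A" "?F3 : A" by (intro A_tr A)+
  have GB: "cmod (G0 x) <= B" "cmod (G1 x) <= B" "cmod (G2 x) <= B" "cmod (G3 x) <= B" for x
   unfolding G0_def G1_def G2_def G3_def
   by (simp_all add: norm_mult c0 c1 c2 c3 chr_norm[OF C(1)] chr_norm[OF C(2)] chr_norm[OF C(3)] chr_norm[OF C(4)] ch_def tr_def B)
  have FB: "cmod (?F0 x) <= B" "cmod (?F1 x) <= B" "cmod (?F2 x) <= B" "cmod (?F3 x) <= B" for x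
   by (intro tr_cmod_le B)+
  have d: "nrm (%x. ?F0 x - G0 x) <= \<bar>real_of_int p0\<bar> * eps" "nrm (%x. ?F1 x - G1 x) <= \<bar>real_of_int p1\<bar> * eps"
   "nrm (%x. ?F2 x - G2 x) <= \<bar>real_of_int p2\<bar> * eps" "nrm (%x. ?F3 x - G3 x) <= \<bar>real_of_int p3\<bar> * eps"
   unfolding G0_def G1_def G2_def G3_def by (rule c0 c1 c2 c3)+
  have d': "nrm (%x. cnj (?F2 x) - cnj (G2 x)) <= \<bar>real_of_int p2\<bar> * eps" "nrm (%x. cnj (?F3 x) - cnj (G3 x)) <= \<bar>real_of_int p3\<bar> * eps"
   unfolding complex_cnj_diff[symmetric] using nrm_cnj[OF A_diff[OF FA(3) GA(3)]] nrm_cnj[OF A_diff[OF FA(4) GA(4)]] d by simp_all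
  have e01: "nrm (%x. ?F0 x * ?F1 x - G0 x * G1 x) <= B * (\<bar>real_of_int p1\<bar> * eps) + B * (\<bar>real_of_int p0\<bar> * eps)"
   by (intro nrm_prod2 FA GA FB GB d)
  have e23: "nrm (%x. cnj (?F2 x) * cnj (?F3 x) - cnj (G2 x) * cnj (G3 x)) <= B * (\<bar>real_of_int p3\<bar> * eps) + B * (\<bar>real_of_int p2\<bar> * eps)"
   by (intro nrm_prod2 A_cnj FA GA d') (simp_all add: FB GB)
  have b01: "cmod (?F0 x * ?F1 x) <= B * B" for x unfolding norm_mult by (intro mult_mono FB Bn) auto
  have b23: "cmod (cnj (G2 x) * cnj (G3 x)) <= B * B" for x unfolding norm_mult complex_mod_cnj by (intro mult_mono GB Bn) auto
  have fA: "(%x. ?F0 x * ?F1 x) : A" "(%x. G0 x * G1 x) : A" "(%x. cnj (?F2 x) * cnj (?F3 x)) : A" "(%x. cnj (G2 x) * cnj (G3 x)) : A"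
   by (intro A_mult A_cnj FA GA)+
  have "nrm (%x. (?F0 x * ?F1 x) * (cnj (?F2 x) * cnj (?F3 x)) - (G0 x * G1 x) * (cnj (G2 x) * cnj (G3 x)))
   <= (B * B) * (B * (\<bar>real_of_int p3\<bar> * eps) + B * (\<bar>real_of_int p2\<bar> * eps)) + (B * B) * (B * (\<bar>real_of_int p1\<bar> * eps) + B * (\<bar>real_of_int p0\<bar> * eps))"
   by (rule nrm_prod2[OF fA b01 b23 e01 e23])
  also have "... = (\<bar>real_of_int p0\<bar> + \<bar>real_of_int p1\<bar> + \<bar>real_of_int p2\<bar> + \<bar>real_of_int p3\<bar>) * B ^ 3 * eps"
   by (simp add: power3_eq_cube algebra_simps)
  finally have N: "nrm (%x. (?F0 x * ?F1 x) * (cnj (?F2 x) * cnj (?F3 x)) - (G0 x * G1 x) * (cnj (G2 x) * cnj (G3 x)))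
   <= (\<bar>real_of_int p0\<bar> + \<bar>real_of_int p1\<bar> + \<bar>real_of_int p2\<bar> + \<bar>real_of_int p3\<bar>) * B ^ 3 * eps" .
  define Q where "Q = c * (X (zsmul p0 k0) * Y (zsmul p1 k1) * (Z (zsmul (- p2) k2) * W (zsmul (- p3) k3)))"
  have G: "(G0 x * G1 x) * (cnj (G2 x) * cnj (G3 x)) = Q * (ch (mono p0 p1 (- p2) (- p3) X Y Z W) x * PP v v' u u' k0 k1 k2 k3 x)" for x
   unfolding Q_def c_def G0_def G1_def G2_def G3_def ch_def mono_def PP_def zsmul_minus_left chr_minus[OF C(3)] chr_minus[OF C(4)]
   by (simp add: mult_ac)
  have mA: "(%x. ch (mono p0 p1 (- p2) (- p3) X Y Z W) x * PP v v' u u' k0 k1 k2 k3 x) : A"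
   by (intro A_mult A_ch mono_chr C PP_A A)
  have "I (%x. (?F0 x * ?F1 x) * (cnj (?F2 x) * cnj (?F3 x)) - (G0 x * G1 x) * (cnj (G2 x) * cnj (G3 x)))
   = I (%x. (?F0 x * ?F1 x) * (cnj (?F2 x) * cnj (?F3 x))) - I (%x. (G0 x * G1 x) * (cnj (G2 x) * cnj (G3 x)))"
   by (intro I_diff A_mult fA)
  also have "I (%x. (G0 x * G1 x) * (cnj (G2 x) * cnj (G3 x))) = Q * I (%x. ch (mono p0 p1 (- p2) (- p3) X Y Z W) x * PP v v' u u' k0 k1 k2 k3 x)"
   unfolding G by (rule I_scale[OF mA])
  finally have "cmod (I (%x. (?F0 x * ?F1 x) * (cnj (?F2 x) * cnj (?F3 x))) - Q * I (%x. ch (mono p0 p1 (- p2) (- p3) X Y Z W) x * PP v v' u u' k0 k1 k2 k3 x))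
   <= nrm (%x. (?F0 x * ?F1 x) * (cnj (?F2 x) * cnj (?F3 x)) - (G0 x * G1 x) * (cnj (G2 x) * cnj (G3 x)))"
   using I_le_nrm[OF A_diff[OF A_mult[OF fA(1,3)] A_mult[OF fA(2,4)]]] by simp
  with N show "cmod (I (PP v v' u u' (k0 + zsmul p0 l) (k1 + zsmul p1 l) (k2 + zsmul p2 l) (k3 + zsmul p3 l)) -
   c * (X (zsmul p0 k0) * Y (zsmul p1 k1) * (Z (zsmul (- p2) k2) * W (zsmul (- p3) k3))) *
   I (%x. ch (mono p0 p1 (- p2) (- p3) X Y Z W) x * PP v v' u u' k0 k1 k2 k3 x))
  <= (\<bar>real_of_int p0\<bar> + \<bar>real_of_int p1\<bar> + \<bar>real_of_int p2\<bar> + \<bar>real_of_int p3\<bar>) * B ^ 3 * eps"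
   unfolding Q_def[symmetric] PP_def[abs_def] by simp
 qed
qed

lemma cm_chr_eq: "chr zt ==> chr ps ==> cm (%h. cnj (zt h) * ps h) = (if zt = ps then 1 else 0)"
 using cm_chr_orth[of ps zt] by (simp add: mult.commute eq_commute)

text \<open>Bessel's inequality in both variables at once: products of a character of
  \<open>h\<close> and an eigenfunction of \<open>x\<close> are orthonormal under integration in
  \<open>x\<close> followed by the mean in \<open>h\<close>.\<close>

lemma pair_finite:
 assumes Y: "!!h. Y h : A" "!!h. nrm (Y h) <= M" and \<xi>: "chr \<xi>" and \<kappa>: "0 < (\<kappa>::real)"
 shows "finite {(\<beta>, \<theta>). chr \<beta> & chr \<theta> & \<kappa> <= cmod (cm (%h. \<xi> h * \<beta> h * I (%x. ch \<theta> x * Y h x)))}" (is "finite ?S")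
proof (rule ccontr)
 assume "infinite ?S"
 obtain N where N: "M^2 / \<kappa>\<^sup>2 < real N" using reals_Archimedean2 by blast
 obtain X where X: "X <= ?S" "finite X" "card X = N" using infinite_arbitrarily_large[OF \<open>infinite ?S\<close>] by blast
 have c: "chr (fst p)" "chr (snd p)" if "p : X" for p using X(1) that by (auto simp: split_beta)
 define e where "e p h x = cnj (\<xi> h * fst p h) * cnj (ch (snd p) x)" for p h x
 have eA: "e p h : A" if "p : X" for p h unfolding e_def[abs_def] by (intro A_intros c that)
 have e1: "cmod (e p h x) = 1" if "p : X" for p h x by (simp add: e_def norm_mult chr_norm[OF \<xi>] chr_norm[OF c(1)[OF that]] ch_norm[OF c(2)[OF that]])
 have en: "nrm (e p h) <= 1" if "p : X" for p h by (rule nrm_bound[OF eA[OF that]]) (simp add: e1[OF that])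
 define a where "a p = cm (%h. ip (Y h) (e p h))" for p
 have a: "\<kappa> <= cmod (a p)" if "p : X" for p
 proof -
  have "ip (Y h) (e p h) = \<xi> h * fst p h * I (%x. ch (snd p) x * Y h x)" for h
  proof -
   have "ip (Y h) (e p h) = I (%x. (\<xi> h * fst p h) * (ch (snd p) x * Y h x))" unfolding ip_def e_def by (simp add: mult_ac)
   also have "... = (\<xi> h * fst p h) * I (%x. ch (snd p) x * Y h x)" by (intro I_scale A_intros Y c that)
   finally show ?thesis .
  qed
  then show ?thesis using X(1) that by (auto simp: a_def split_beta)
 qed
 define W where "W h x = (\<Sum>p\<in>X. a p * e p h x)" for h x
 have WA: "W h : A" for h unfolding W_def[abs_def] by (intro A_sum A_mult A_const eA)
 have bYe: "bdd (%h. ip (Y h) (e p h))" if "p : X" for p by (rule bdd_ip[of _ _ M 1]) (use Y eA en that in auto)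
 have bee: "bdd (%h. ip (e p h) (e q h))" if "p : X" "q : X" for p q by (rule bdd_ip[of _ _ 1 1]) (use eA en that in auto)
 define T where "T = (\<Sum>p\<in>X. (cmod (a p))^2)"
 have YW: "ip (Y h) (W h) = (\<Sum>p\<in>X. cnj (a p) * ip (Y h) (e p h))" for h
  unfolding W_def[abs_def] using eA Y by (simp add: ip_sum_right ip_scale_right A_intros)
 have WW: "ip (W h) (W h) = (\<Sum>p\<in>X. \<Sum>q\<in>X. (a p * cnj (a q)) * ip (e p h) (e q h))" for h
  unfolding W_def[abs_def] using eA by (simp add: ip_sum_left ip_sum_right ip_scale_left ip_scale_right A_intros sum_distrib_left mult.assoc)
 have cYW: "cm (%h. ip (Y h) (W h)) = cx T"
 proof -
  have "cm (%h. ip (Y h) (W h)) = (\<Sum>p\<in>X. cnj (a p) * a p)"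
   unfolding YW a_def by (subst cm_sum) (auto intro!: bdd_mult[OF bdd_const] bYe sum.cong cm_scale)
  also have "... = (\<Sum>p\<in>X. cx ((cmod (a p))^2))"
   by (intro sum.cong refl) (simp only: complex_norm_square mult.commute)
  finally show ?thesis by (simp add: T_def)
 qed
 have ee: "cm (%h. ip (e p h) (e q h)) = (if p = q then 1 else 0)" if "p : X" "q : X" for p q
 proof -
  have o: "ip (%x. cnj (ch (snd p) x)) (%x. cnj (ch (snd q) x)) = (if snd p = snd q then 1 else 0)"
  proof -
   have "ip (%x. cnj (ch (snd p) x)) (%x. cnj (ch (snd q) x)) = ip (ch (snd q)) (ch (snd p))" unfolding ip_def by (simp add: mult.commute)
   then show ?thesis using ch_orth[OF c(2)[OF that(2)] c(2)[OF that(1)]] by auto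
  qed
  have x: "cnj (\<xi> h * fst p h) * (\<xi> h * fst q h) = cnj (fst p h) * fst q h" for h
   using norm1_cnj(2)[OF chr_norm[OF \<xi>, of h]] by (simp add: mult_ac norm1_cnj_l chr_norm[OF \<xi>])
  have "ip (e p h) (e q h) = (cnj (fst p h) * fst q h) * (if snd p = snd q then 1 else 0)" for h
  proof -
   have "ip (e p h) (e q h) = cnj (\<xi> h * fst p h) * (cnj (cnj (\<xi> h * fst q h)) * ip (%x. cnj (ch (snd p) x)) (%x. cnj (ch (snd q) x)))"
    unfolding e_def[abs_def] by (subst ip_scale_left, (intro A_intros c that)+, subst ip_scale_right) (intro A_intros c that refl)+
   also have "... = (cnj (\<xi> h * fst p h) * (\<xi> h * fst q h)) * (if snd p = snd q then 1 else 0)" unfolding o by (simp only: complex_cnj_cnj mult.assoc)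
   finally show ?thesis unfolding x .
  qed
  then have "cm (%h. ip (e p h) (e q h)) = cm (%h. (cnj (fst p h) * fst q h) * (if snd p = snd q then 1 else 0))" by (simp only:)
  also have "... = (if fst p = fst q then 1 else 0) * (if snd p = snd q then 1 else 0)"
   unfolding cm_scale_right[OF bdd_mult[OF bdd_cnj[OF chr_bdd[OF c(1)[OF that(1)]]] chr_bdd[OF c(1)[OF that(2)]]]]
    cm_chr_eq[OF c(1)[OF that(1)] c(1)[OF that(2)]] ..
  finally show ?thesis by (auto simp: prod_eq_iff)
 qed
 have bYW: "bdd (%h. ip (Y h) (W h))" unfolding YW by (intro bdd_sum bdd_mult[OF bdd_const] bYe)
 have bWW: "bdd (%h. ip (W h) (W h))" unfolding WW by (intro bdd_sum bdd_mult[OF bdd_const] bee)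
 have cWW: "cm (%h. ip (W h) (W h)) = cx T"
 proof -
  have "cm (%h. ip (W h) (W h)) = (\<Sum>p\<in>X. \<Sum>q\<in>X. cm (%h. (a p * cnj (a q)) * ip (e p h) (e q h)))"
   unfolding WW by (subst cm_sum, intro bdd_sum bdd_mult[OF bdd_const] bee, assumption+) (intro sum.cong refl cm_sum bdd_mult[OF bdd_const] bee)
  also have "... = (\<Sum>p\<in>X. \<Sum>q\<in>X. if q = p then cx ((cmod (a p))^2) else 0)"
  proof (intro sum.cong refl)
   fix p q assume pq: "p : X" "q : X"
   have "cm (%h. (a p * cnj (a q)) * ip (e p h) (e q h)) = (a p * cnj (a q)) * cm (%h. ip (e p h) (e q h))" by (rule cm_scale[OF bee[OF pq]])
   also have "... = (if q = p then cx ((cmod (a p))^2) else 0)" unfolding ee[OF pq] complex_norm_square by simp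
   finally show "cm (%h. (a p * cnj (a q)) * ip (e p h) (e q h)) = (if q = p then cx ((cmod (a p))^2) else 0)" .
  qed
  also have "... = cx T" using X(2) by (simp add: T_def sum.delta')
  finally show ?thesis .
 qed
 have bYY: "bdd (%h. n2 (Y h))"
 proof (rule bddI[of _ "M^2"])
  fix h
  have "(nrm (Y h))^2 <= M^2" using Y by (intro power_mono nrm_nonneg)
  then show "norm (n2 (Y h)) <= M^2" using Y by (simp add: nrm_sq n2_nonneg)
 qed
 have n2M: "n2 (Y h) <= M^2" for h using power_mono[OF Y(2) nrm_nonneg[OF Y(1)], of h 2] by (simp add: nrm_sq Y)
 have "0 <= m (%h. n2 (%x. Y h x - W h x))"
 proof (cases "bdd (%h. n2 (%x. Y h x - W h x))")
  case True
  then show ?thesis by (intro m_nonneg n2_nonneg A_diff Y WA)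
 qed (simp add: m_unbdd)
 also have "... = m (%h. n2 (Y h) - 2 * Re (ip (Y h) (W h)) + Re (ip (W h) (W h)))"
  by (simp add: n2_diff Y WA n2_def[of "W _"])
 also have "... = m (%h. n2 (Y h)) - 2 * T + T"
 proof -
  have "m (%h. Re (ip (Y h) (W h))) = T" "m (%h. Re (ip (W h) (W h))) = T" using cYW cWW by (simp_all flip: Re_cm)
  then show ?thesis by (subst m_add) (auto intro!: bdd_intros bYY bYW bWW simp: m_diff m_scale bdd_mult bdd_const bdd_Re bYY bYW)
 qed
 finally have "T <= m (%h. n2 (Y h))" by simp
 also have "... <= M^2" by (rule m_le[OF bYY n2M])
 finally have "T <= M^2" .
 moreover have "real N * \<kappa>\<^sup>2 <= T"
 proof -
  have "real N * \<kappa>\<^sup>2 = (\<Sum>p\<in>X. \<kappa>\<^sup>2)" using X(3) by simp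
  also have "... <= T" unfolding T_def using a \<kappa> by (intro sum_mono power_mono) auto
  finally show ?thesis .
 qed
 ultimately show False using N \<kappa> by (simp add: divide_less_eq)
qed

section \<open>The alternative for products of two shifted vectors\<close>

definition DD where "DD a b v v' h x = tr (zsmul (- a) h) v x * tr (zsmul b h) v' x"

text \<open>The product returns to its value at \<open>h = 0\<close> up to a phase alone, without
  the character factor permitted in \<open>relc\<close>.\<close>

definition type0 where
 "type0 a b v v' \<longleftrightarrow> (ALL eps>0. eventually (%h. EX \<theta>. cmod \<theta> = 1 & nrm (%x. DD a b v v' h x - \<theta> * (v x * v' x)) <= eps) bohr)"

lemma DD_A: "v : A ==> v' : A ==> DD a b v v' h : A" unfolding DD_def[abs_def] by (intro A_intros)

lemma A_bound2: assumes "v : A" "v' : A" obtains B where "0 < B" "!!x. cmod (v x) <= B" "!!x. cmod (v' x) <= B"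
proof -
 obtain B where B: "0 < B" "!!x. cmod (v x) <= B" by (rule A_bound[OF assms(1)]) blast
 obtain B' where B': "0 < B'" "!!x. cmod (v' x) <= B'" by (rule A_bound[OF assms(2)]) blast
 show ?thesis by (rule that[of "max B B'"]) (use B B' in \<open>auto simp: le_max_iff_disj\<close>)
qed

lemma pure_A: "pure v ==> v : A" by (simp add: pure_def)

text \<open>If the character acquired by the product takes finitely many values, it is a constant
  \<open>E\<close> on a set of positive measure. For \<open>l1 + l2 - l3 - l4\<close> with members
  of that set the characters cancel and a phase remains; \<open>n\<close> times such elements fill a
  Bohr neighbourhood by \<open>bogolyubov_zsmul\<close>.\<close>

lemma type0_finite:
 assumes v: "pure v" "pure v'" and n: "fin_idx n TYPE('a)" and fin: "finite \<Phi>" and e0: "0 < (eps0::real)"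
  and ev: "eventually (%l. ALL X Y. relc v l X eps0 --> relc v' l Y eps0 --> (%h. X (zsmul (- a * n) h) * Y (zsmul (b * n) h)) : \<Phi>) bohr"
 shows "type0 a b v v'"
 unfolding type0_def
proof (intro allI impI)
 fix eps :: real assume e: "0 < eps"
 have vA: "v : A" "v' : A" using v pure_A by auto
 obtain B where B: "0 < B" "!!x. cmod (v x) <= B" "!!x. cmod (v' x) <= B" by (rule A_bound2[OF vA]) blast
 define k where "k = \<bar>real_of_int (- a * n)\<bar> + \<bar>real_of_int (b * n)\<bar> + 1"
 have k: "0 < k" by (simp add: k_def add_nonneg_pos)
 define dl where "dl = min eps0 (eps / (4 * B * k))"
 have d: "0 < dl" "dl <= eps0" "4 * B * k * dl <= eps"
 proof -
  show "0 < dl" "dl <= eps0" using e0 e B k by (auto simp: dl_def)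
  have "4 * B * k * dl <= 4 * B * k * (eps / (4 * B * k))" using B k by (intro mult_left_mono) (auto simp: dl_def)
  then show "4 * B * k * dl <= eps" using B k by simp
 qed
 define V where "V = {l. rel v l dl & rel v' l dl & (ALL X Y. relc v l X eps0 --> relc v' l Y eps0 --> (%h. X (zsmul (- a * n) h) * Y (zsmul (b * n) h)) : \<Phi>)}"
 have "eventually (%l. l : V) bohr"
 proof -
  have "eventually (%l. rel v l dl) bohr" "eventually (%l. rel v' l dl) bohr" using v d(1) by (auto simp: pure_def)
  then show ?thesis using ev by eventually_elim (simp add: V_def)
 qed
 then have mV: "0 < msr V" using bohr_pos[of "%l. l : V"] by simp
 have "ALL l. EX Z. l : V --> relc v l Z dl" by (auto simp: V_def rel_def)
 from choice[OF this] obtain X where X: "!!l. l : V ==> relc v l (X l) dl" by blast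
 have "ALL l. EX Z. l : V --> relc v' l Z dl" by (auto simp: V_def rel_def)
 from choice[OF this] obtain Y where Y: "!!l. l : V ==> relc v' l (Y l) dl" by blast
 have mono: "relc u l Z dl ==> relc u l Z eps0" for u l Z using d(2) unfolding relc_def using order_trans by blast
 have cl: "EX E:\<Phi>. (%h. X l (zsmul (- a * n) h) * Y l (zsmul (b * n) h)) = E" if "l : V" for l
  using that mono[OF X[OF that]] mono[OF Y[OF that]] unfolding V_def by blast
 obtain E where E: "0 < msr {l : V. (%h. X l (zsmul (- a * n) h) * Y l (zsmul (b * n) h)) = E}"
  using msr_classes[where P = "%E l. (%h. X l (zsmul (- a * n) h) * Y l (zsmul (b * n) h)) = E", OF fin cl mV] by blast
 define H where "H = {l : V. (%h. X l (zsmul (- a * n) h) * Y l (zsmul (b * n) h)) = E}"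
 from bogolyubov_zsmul[OF im E[unfolded msr_def, folded H_def] n]
 show "eventually (%h. EX \<theta>. cmod \<theta> = 1 & nrm (%x. DD a b v v' h x - \<theta> * (v x * v' x)) <= eps) bohr"
 proof eventually_elim
  case (elim d')
  then obtain l1 l2 l3 l4 where l: "l1 : H" "l2 : H" "l3 : H" "l4 : H" and d': "d' = zsmul n (l1 + l2 - l3 - l4)" by blast
  have lV: "l : V" "X l (zsmul (- a * n) h) * Y l (zsmul (b * n) h) = E h" if "l : H" for l h
   using that fun_cong[of "%h. X l (zsmul (- a * n) h) * Y l (zsmul (b * n) h)" E h] by (auto simp: H_def)
  define j where "j = l1 + l2 - l3 - l4"
  have j: "j = (l1 + l2 + - l3) + - l4" by (simp add: j_def)
  define XX where "XX x = X l1 x * X l2 x * cnj (X l3 x) * cnj (X l4 x)" for x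
  define YY where "YY x = Y l1 x * Y l2 x * cnj (Y l3 x) * cnj (Y l4 x)" for x
  have rX: "relc v j XX (dl + dl + dl + dl)" unfolding j XX_def[abs_def]
   by (intro relc_add relc_uminus vA X lV l)
  have rY: "relc v' j YY (dl + dl + dl + dl)" unfolding j YY_def[abs_def]
   by (intro relc_add relc_uminus vA Y lV l)
  obtain c where c: "chr (%x. XX (zsmul (- a * n) x))" "cmod c = 1"
   "nrm (%x. tr (zsmul (- a * n) j) v x - c * (ch (%x. XX (zsmul (- a * n) x)) x * v x)) <= \<bar>real_of_int (- a * n)\<bar> * (dl + dl + dl + dl)"
   using relc_zsmul[OF vA(1) rX, of "- a * n"] by (elim relcE)
  obtain c' where c': "chr (%x. YY (zsmul (b * n) x))" "cmod c' = 1"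
   "nrm (%x. tr (zsmul (b * n) j) v' x - c' * (ch (%x. YY (zsmul (b * n) x)) x * v' x)) <= \<bar>real_of_int (b * n)\<bar> * (dl + dl + dl + dl)"
   using relc_zsmul[OF vA(2) rY, of "b * n"] by (elim relcE)
  have E1: "cmod (E h) = 1" for h
  proof -
   have "chr (X l1)" "chr (Y l1)" using X[OF lV(1)[OF l(1)]] Y[OF lV(1)[OF l(1)]] by (auto elim: relcE)
   then show ?thesis unfolding lV(2)[OF l(1), symmetric] by (simp add: norm_mult chr_norm)
  qed
  have one: "XX (zsmul (- a * n) h) * YY (zsmul (b * n) h) = 1" for h
  proof -
   have "XX (zsmul (- a * n) h) * YY (zsmul (b * n) h) = (X l1 (zsmul (- a * n) h) * Y l1 (zsmul (b * n) h)) * (X l2 (zsmul (- a * n) h) * Y l2 (zsmul (b * n) h)) *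
    (cnj (X l3 (zsmul (- a * n) h) * Y l3 (zsmul (b * n) h)) * cnj (X l4 (zsmul (- a * n) h) * Y l4 (zsmul (b * n) h)))"
    unfolding XX_def YY_def by (simp only: complex_cnj_mult mult_ac)
   also have "... = (E h * cnj (E h)) * (E h * cnj (E h))" unfolding lV(2)[OF l(1)] lV(2)[OF l(2)] lV(2)[OF l(3)] lV(2)[OF l(4)] by (simp only: mult_ac)
   also have "... = 1" using norm1_cnj(1)[OF E1] by simp
   finally show ?thesis .
  qed
  have D: "DD a b v v' d' x = tr (zsmul (- a * n) j) v x * tr (zsmul (b * n) j) v' x" for x
   unfolding DD_def d' j_def[symmetric] zsmul_mult[symmetric] ..
  have P: "(c * (ch (%x. XX (zsmul (- a * n) x)) x * v x)) * (c' * (ch (%x. YY (zsmul (b * n) x)) x * v' x)) = (c * c') * (v x * v' x)" for x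
  proof -
   have "(c * (ch (%x. XX (zsmul (- a * n) x)) x * v x)) * (c' * (ch (%x. YY (zsmul (b * n) x)) x * v' x))
    = (XX (zsmul (- a * n) (pr x)) * YY (zsmul (b * n) (pr x))) * ((c * c') * (v x * v' x))" by (simp only: ch_def mult_ac)
   then show ?thesis unfolding one by simp
  qed
  have gB: "cmod (c' * (ch (%x. YY (zsmul (b * n) x)) x * v' x)) <= B" for x using B by (simp add: norm_mult c' ch_norm)
  have "nrm (%x. tr (zsmul (- a * n) j) v x * tr (zsmul (b * n) j) v' x - (c * (ch (%x. XX (zsmul (- a * n) x)) x * v x)) * (c' * (ch (%x. YY (zsmul (b * n) x)) x * v' x)))
   <= B * (\<bar>real_of_int (b * n)\<bar> * (dl + dl + dl + dl)) + B * (\<bar>real_of_int (- a * n)\<bar> * (dl + dl + dl + dl))"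
   by (rule nrm_prod2[OF _ _ _ _ _ gB c(3) c'(3)]) (intro A_intros vA c(1) c'(1) tr_cmod_le B)+
  also have "... = 4 * B * (k - 1) * dl" by (simp add: k_def algebra_simps)
  also have "... <= 4 * B * k * dl" using B d(1) by simp
  also have "... <= eps" by (rule d(3))
  finally have "nrm (%x. DD a b v v' d' x - (c * c') * (v x * v' x)) <= eps" unfolding D P .
  moreover have "cmod (c * c') = 1" by (simp add: norm_mult c c')
  ultimately show ?case by blast
 qed
qed

text \<open>A nonzero average restricts the characters \<open>X\<close>, \<open>Y\<close>,
  \<open>Z\<close>, \<open>W\<close> attached to the four vectors at small shifts: certain monomials
  in them take finitely many values. Exponent vectors with this property are closed under sums and
  multiples, and three relations suffice to isolate a monomial in \<open>X\<close>, \<open>Y\<close>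
  and one in \<open>Z\<close>, \<open>W\<close>, at the price of the factor
  \<open>2 * (a * a - b * b)\<close>.\<close>

lemma type0_corr:
 assumes p: "pure v" "pure v'" "pure u" "pure u'" and \<xi>: "chr \<xi>"
  and nz: "cm (%h. \<xi> h * ip (DD a b v v' h) (DD a b u u' (- h))) ~= 0"
  and n: "fin_idx (2 * (a * a - b * b)) TYPE('a)"
 shows "type0 a b v v' & type0 a b u u'"
proof -
 note A = pure_A[OF p(1)] pure_A[OF p(2)] pure_A[OF p(3)] pure_A[OF p(4)]
 obtain B1 where B1: "0 < B1" "!!x. cmod (v x) <= B1" "!!x. cmod (v' x) <= B1" by (rule A_bound2[OF A(1,2)]) blast
 obtain B2 where B2: "0 < B2" "!!x. cmod (u x) <= B2" "!!x. cmod (u' x) <= B2" by (rule A_bound2[OF A(3,4)]) blast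
 define B where "B = max B1 B2"
 have B: "!!x. cmod (v x) <= B" "!!x. cmod (v' x) <= B" "!!x. cmod (u x) <= B" "!!x. cmod (u' x) <= B" "0 < B"
  using B1 B2 by (auto simp: B_def le_max_iff_disj)
 define P where "P h = PP v v' u u' (zsmul (- a) h) (zsmul b h) (zsmul a h) (zsmul (- b) h)" for h
 have PA: "P h : A" for h unfolding P_def by (intro PP_A A)
 have Pn: "nrm (P h) <= B ^ 4" for h by (rule nrm_bound[OF PA]) (simp add: P_def PP_bound[OF B(1-4)])
 have ipP: "ip (DD a b v v' h) (DD a b u u' (- h)) = I (P h)" for h
  unfolding ip_def DD_def P_def PP_def[abs_def] by (simp add: zsmul_minus_right zsmul_minus_left)
 have bIP: "bdd (%h. I (P h))" by (rule bdd_I[OF PA Pn])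
 have bxi: "bdd (%h. \<xi> h * I (P h))" by (intro bdd_mult chr_bdd \<xi> bIP)
 define \<kappa> where "\<kappa> = cmod (cm (%h. \<xi> h * I (P h)))"
 have \<kappa>: "0 < \<kappa>" using nz unfolding ipP \<kappa>_def by simp
 have "EX h0. \<kappa> / 2 < cmod (I (P h0))"
 proof (rule ccontr)
  assume "~ ?thesis"
  then have "cmod (\<xi> h * I (P h)) <= \<kappa> / 2" for h by (simp add: norm_mult chr_norm[OF \<xi>] not_less)
  from norm_cm_bound[OF bxi this] show False using \<kappa> by (simp add: \<kappa>_def)
 qed
 then obtain h0 where h0: "\<kappa> / 2 < cmod (I (P h0))" by blast
 \<comment> \<open>The first two terms bound the total exponent when \<open>h\<close> is moved by
   \<open>l\<close>; the 4 is the one for a common translation of all four factors.\<close>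
 define k where "k = 2 * \<bar>real_of_int a\<bar> + 2 * \<bar>real_of_int b\<bar> + 4"
 have k: "0 < k" by (simp add: k_def add_nonneg_pos)
 define eps0 where "eps0 = \<kappa> / (4 * k * B ^ 3)"
 have e0: "0 < eps0" "k * B ^ 3 * eps0 = \<kappa> / 4" using \<kappa> k B(5) by (auto simp: eps0_def)
 have BE: "0 <= B ^ 3 * eps0" using B(5) e0(1) by simp
 define QQ where "QQ = {(X, Y, Z, W). EX l. relc v l X eps0 & relc v' l Y eps0 & relc u l Z eps0 & relc u' l W eps0}"
 define FV where "FV p q r s \<longleftrightarrow> finite ((%(X, Y, Z, W). mono p q r s X Y Z W) ` QQ)" for p q r s
 have QC: "chr X" "chr Y" "chr Z" "chr W" if "(X, Y, Z, W) : QQ" for X Y Z W using that unfolding QQ_def by (auto elim: relcE)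
 have FV_add: "FV (p + p') (q + q') (r + r') (s + s')" if "FV p q r s" "FV p' q' r' s'" for p q r s p' q' r' s'
 proof -
  have "(%(X, Y, Z, W). mono (p + p') (q + q') (r + r') (s + s') X Y Z W) ` QQ <=
   (%(f, g) h. f h * g h) ` (((%(X, Y, Z, W). mono p q r s X Y Z W) ` QQ) \<times> ((%(X, Y, Z, W). mono p' q' r' s' X Y Z W) ` QQ))"
  proof (rule image_subsetI, clarify)
   fix X Y Z W assume q: "(X, Y, Z, W) : QQ"
   have "mono (p + p') (q + q') (r + r') (s + s') X Y Z W = (%h. mono p q r s X Y Z W h * mono p' q' r' s' X Y Z W h)"
    by (rule ext) (simp add: mono_def zsmul_add_left chr_add QC[OF q] mult_ac)
   then show "mono (p + p') (q + q') (r + r') (s + s') X Y Z W :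
    (%(f, g) h. f h * g h) ` (((%(X, Y, Z, W). mono p q r s X Y Z W) ` QQ) \<times> ((%(X, Y, Z, W). mono p' q' r' s' X Y Z W) ` QQ))"
    using q by (intro image_eqI[of _ _ "(mono p q r s X Y Z W, mono p' q' r' s' X Y Z W)"]) (auto intro!: rev_image_eqI[OF q])
  qed
  then show ?thesis using that unfolding FV_def by (elim finite_subset) auto
 qed
 have FV_mult: "FV (p * j) (q * j) (r * j) (s * j)" if "FV p q r s" for p q r s j
 proof -
  have "(%(X, Y, Z, W). mono (p * j) (q * j) (r * j) (s * j) X Y Z W) ` QQ <= (%f h. f (zsmul j h)) ` ((%(X, Y, Z, W). mono p q r s X Y Z W) ` QQ)"
  proof (rule image_subsetI, clarify)
   fix X Y Z W assume q: "(X, Y, Z, W) : QQ"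
   have "mono (p * j) (q * j) (r * j) (s * j) X Y Z W = (%h. mono p q r s X Y Z W (zsmul j h))"
    by (rule ext) (simp add: mono_def zsmul_mult)
   then show "mono (p * j) (q * j) (r * j) (s * j) X Y Z W : (%f h. f (zsmul j h)) ` ((%(X, Y, Z, W). mono p q r s X Y Z W) ` QQ)"
    using q by (intro image_eqI[of _ _ "mono p q r s X Y Z W"]) (auto intro!: rev_image_eqI[OF q])
  qed
  then show ?thesis using that unfolding FV_def by (elim finite_subset) auto
 qed
 define PS where "PS = {(\<beta>, \<theta>). chr \<beta> & chr \<theta> & \<kappa> / 2 <= cmod (cm (%h. \<xi> h * \<beta> h * I (%x. ch \<theta> x * P h x)))}"
 have PSf: "finite PS" unfolding PS_def using \<kappa> by (intro pair_finite[OF PA Pn \<xi>]) simp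
 \<comment> \<open>Replacing \<open>h\<close> by \<open>h + l\<close> does not change the average,
   but yields, up to a phase and a small error, the coefficient at the characters \<beta> in
   \<open>h\<close> and \<theta> in \<open>x\<close>. This coefficient is therefore large, and the
   pair lies in the finite set \<open>PS\<close>.\<close>
 have inPS: "(mono (a * a) (b * b) (- (a * a)) (- (b * b)) X Y Z W, mono (- a) b (- a) b X Y Z W) : PS" if q: "(X, Y, Z, W) : QQ" for X Y Z W
 proof -
  obtain l where l: "relc v l X eps0" "relc v' l Y eps0" "relc u l Z eps0" "relc u' l W eps0" using q unfolding QQ_def by blast
  obtain c where c: "cmod c = 1" "!!k0 k1 k2 k3.
   cmod (I (PP v v' u u' (k0 + zsmul (-a) l) (k1 + zsmul b l) (k2 + zsmul a l) (k3 + zsmul (-b) l)) -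
   c * (X (zsmul (-a) k0) * Y (zsmul b k1) * (Z (zsmul (- a) k2) * W (zsmul (- (-b)) k3))) *
   I (%x. ch (mono (-a) b (- a) (- (-b)) X Y Z W) x * PP v v' u u' k0 k1 k2 k3 x))
  <= (\<bar>real_of_int (-a)\<bar> + \<bar>real_of_int b\<bar> + \<bar>real_of_int a\<bar> + \<bar>real_of_int (-b)\<bar>) * B ^ 3 * eps0"
   by (rule shiftP[OF A B(1-4) l, of "-a" b a "-b"]) blast
  define \<beta> where "\<beta> = mono (a * a) (b * b) (- (a * a)) (- (b * b)) X Y Z W"
  define \<theta> where "\<theta> = mono (- a) b (- a) b X Y Z W"
  have ch: "chr \<beta>" "chr \<theta>" unfolding \<beta>_def \<theta>_def by (intro mono_chr QC[OF q])+
  have near: "cmod (I (P (h + l)) - c * (\<beta> h * I (%x. ch \<theta> x * P h x))) <= \<kappa> / 4" for h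
  proof -
   have 1: "I (P (h + l)) = I (PP v v' u u' (zsmul (-a) h + zsmul (-a) l) (zsmul b h + zsmul b l) (zsmul a h + zsmul a l) (zsmul (-b) h + zsmul (-b) l))"
    unfolding P_def by (simp add: zsmul_add_right)
   have 2: "\<beta> h = X (zsmul (-a) (zsmul (-a) h)) * Y (zsmul b (zsmul b h)) * (Z (zsmul (- a) (zsmul a h)) * W (zsmul (- (-b)) (zsmul (-b) h)))"
    unfolding \<beta>_def mono_def zsmul_mult[symmetric] by simp
   have "cmod (I (P (h + l)) - c * (\<beta> h * I (%x. ch \<theta> x * P h x))) <= (\<bar>real_of_int (-a)\<bar> + \<bar>real_of_int b\<bar> + \<bar>real_of_int a\<bar> + \<bar>real_of_int (-b)\<bar>) * B ^ 3 * eps0"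
    using c(2)[of "zsmul (-a) h" "zsmul b h" "zsmul a h" "zsmul (-b) h"] unfolding 1 2 \<theta>_def unfolding P_def by (simp add: mult.assoc)
   also have "... = (k - 4) * (B ^ 3 * eps0)" by (simp add: k_def algebra_simps)
   also have "... <= k * (B ^ 3 * eps0)" by (rule mult_right_mono[OF _ BE]) simp
   also have "... = \<kappa> / 4" using e0(2) by (simp add: mult.assoc)
   finally show ?thesis .
  qed
  have tA: "(%x. ch \<theta> x * P h x) : A" for h by (intro A_intros ch PA)
  have tn: "nrm (%x. ch \<theta> x * P h x) <= B ^ 4" for h
   using Pn[of h] nrm_mult1[OF A_ch[OF ch(2)] PA ch_norm[OF ch(2)], of h] by simp
  have bt: "bdd (%h. \<xi> h * \<beta> h * I (%x. ch \<theta> x * P h x))" by (intro bdd_mult chr_bdd \<xi> ch bdd_I[OF tA tn])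
  have bs: "bdd (%h. \<xi> (h + l) * I (P (h + l)))" by (rule bdd_shift[OF bxi])
  have bt': "bdd (%h. (c * \<xi> l) * (\<xi> h * \<beta> h * I (%x. ch \<theta> x * P h x)))" by (intro bdd_mult[OF bdd_const] bt)
  have "cmod (cm (%h. \<xi> (h + l) * I (P (h + l)) - (c * \<xi> l) * (\<xi> h * \<beta> h * I (%x. ch \<theta> x * P h x)))) <= \<kappa> / 4"
  proof (rule norm_cm_bound[OF bdd_diff[OF bs bt']])
   fix h
   have "\<xi> (h + l) * I (P (h + l)) - (c * \<xi> l) * (\<xi> h * \<beta> h * I (%x. ch \<theta> x * P h x)) = \<xi> (h + l) * (I (P (h + l)) - c * (\<beta> h * I (%x. ch \<theta> x * P h x)))"
    by (simp add: chr_add[OF \<xi>] algebra_simps)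
   then show "cmod (\<xi> (h + l) * I (P (h + l)) - (c * \<xi> l) * (\<xi> h * \<beta> h * I (%x. ch \<theta> x * P h x))) <= \<kappa> / 4"
    using near[of h] by (simp only: norm_mult chr_norm[OF \<xi>])
  qed
  then have "cmod (cm (%h. \<xi> (h + l) * I (P (h + l))) - (c * \<xi> l) * cm (%h. \<xi> h * \<beta> h * I (%x. ch \<theta> x * P h x))) <= \<kappa> / 4"
   unfolding cm_diff[OF bs bt'] cm_scale[OF bt] .
  moreover have "cm (%h. \<xi> (h + l) * I (P (h + l))) = cm (%h. \<xi> h * I (P h))" by (rule cm_shift[OF bxi])
  ultimately have "\<kappa> <= \<kappa> / 4 + cmod ((c * \<xi> l) * cm (%h. \<xi> h * \<beta> h * I (%x. ch \<theta> x * P h x)))"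
   using norm_triangle_sub[of "cm (%h. \<xi> h * I (P h))" "(c * \<xi> l) * cm (%h. \<xi> h * \<beta> h * I (%x. ch \<theta> x * P h x))"] unfolding \<kappa>_def by simp
  then have "\<kappa> / 2 <= cmod (cm (%h. \<xi> h * \<beta> h * I (%x. ch \<theta> x * P h x)))"
   unfolding norm_mult c(1) chr_norm[OF \<xi>] using \<kappa> by simp
  then show ?thesis unfolding PS_def \<beta>_def[symmetric] \<theta>_def[symmetric] using ch by simp
 qed
 have F1: "FV (- a) b (- a) b" unfolding FV_def
  by (rule finite_subset[OF _ finite_imageI[OF PSf, of snd]]) (use inPS in force)
 have F2: "FV (a * a) (b * b) (- (a * a)) (- (b * b))" unfolding FV_def
  by (rule finite_subset[OF _ finite_imageI[OF PSf, of fst]]) (use inPS in force)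
 \<comment> \<open>The third relation comes from translating all four factors by \<open>l\<close> at
   the single point \<open>h0\<close>, where the correlation is large.\<close>
 have F3: "FV 1 1 (- 1) (- 1)"
 proof -
  define T where "T = {zt. chr zt & \<kappa> / 4 <= cmod (co zt (P h0))}"
  have T: "finite T" unfolding T_def using \<kappa> by (intro spec_finite PA) simp
  have "mono 1 1 (- 1) (- 1) X Y Z W : (%zt h. cnj (zt h)) ` T" if q: "(X, Y, Z, W) : QQ" for X Y Z W
  proof -
   obtain l where l: "relc v l X eps0" "relc v' l Y eps0" "relc u l Z eps0" "relc u' l W eps0" using q unfolding QQ_def by blast
   obtain c where c: "cmod c = 1" "!!k0 k1 k2 k3.
    cmod (I (PP v v' u u' (k0 + zsmul 1 l) (k1 + zsmul 1 l) (k2 + zsmul 1 l) (k3 + zsmul 1 l)) -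
    c * (X (zsmul 1 k0) * Y (zsmul 1 k1) * (Z (zsmul (- 1) k2) * W (zsmul (- 1) k3))) *
    I (%x. ch (mono 1 1 (- 1) (- 1) X Y Z W) x * PP v v' u u' k0 k1 k2 k3 x))
   <= (\<bar>real_of_int 1\<bar> + \<bar>real_of_int 1\<bar> + \<bar>real_of_int 1\<bar> + \<bar>real_of_int 1\<bar>) * B ^ 3 * eps0"
    by (rule shiftP[OF A B(1-4) l, of 1 1 1 1]) blast
   define \<theta> where "\<theta> = mono 1 1 (- 1) (- 1) X Y Z W"
   have ch: "chr \<theta>" unfolding \<theta>_def by (intro mono_chr QC[OF q])
   have s: "PP v v' u u' (k0 + zsmul 1 l) (k1 + zsmul 1 l) (k2 + zsmul 1 l) (k3 + zsmul 1 l) = tr l (PP v v' u u' k0 k1 k2 k3)" for k0 k1 k2 k3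
    unfolding PP_def[abs_def] tr_mult[abs_def] tr_cnj tr_tr by (simp add: zsmul_1 add.commute)
   define g where "g = X (zsmul 1 (zsmul (- a) h0)) * Y (zsmul 1 (zsmul b h0)) * (Z (zsmul (- 1) (zsmul a h0)) * W (zsmul (- 1) (zsmul (- b) h0)))"
   have g: "cmod g = 1" by (simp add: g_def norm_mult chr_norm[OF QC(1)[OF q]] chr_norm[OF QC(2)[OF q]] chr_norm[OF QC(3)[OF q]] chr_norm[OF QC(4)[OF q]])
   have "cmod (I (tr l (P h0)) - c * g * I (%x. ch \<theta> x * P h0 x)) <= (\<bar>real_of_int 1\<bar> + \<bar>real_of_int 1\<bar> + \<bar>real_of_int 1\<bar> + \<bar>real_of_int 1\<bar>) * B ^ 3 * eps0"
    using c(2)[of "zsmul (-a) h0" "zsmul b h0" "zsmul a h0" "zsmul (-b) h0"] unfolding s g_def \<theta>_def P_def .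
   also have "... = 4 * (B ^ 3 * eps0)" by simp
   also have "... <= k * (B ^ 3 * eps0)" by (rule mult_right_mono[OF _ BE]) (simp add: k_def)
   also have "... = \<kappa> / 4" using e0(2) by (simp add: mult.assoc)
   finally have "cmod (I (P h0)) <= \<kappa> / 4 + cmod (c * g * I (%x. ch \<theta> x * P h0 x))"
    unfolding I_tr[OF PA] using norm_triangle_sub[of "I (P h0)" "c * g * I (%x. ch \<theta> x * P h0 x)"] by simp
   then have "\<kappa> / 4 <= cmod (I (%x. ch \<theta> x * P h0 x))" unfolding norm_mult c(1) g using h0 by simp
   also have "I (%x. ch \<theta> x * P h0 x) = co (%h. cnj (\<theta> h)) (P h0)" unfolding co_def ip_def by (simp add: ch_def mult.commute)
   finally have "(%h. cnj (\<theta> h)) : T" using chr_cnj[OF ch] by (simp add: T_def)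
   then show ?thesis unfolding \<theta>_def[symmetric] by (intro image_eqI[of _ _ "%h. cnj (\<theta> h)"]) simp_all
  qed
  then have "(%(X, Y, Z, W). mono 1 1 (- 1) (- 1) X Y Z W) ` QQ <= (%zt h. cnj (zt h)) ` T" by auto
  then show ?thesis unfolding FV_def by (rule finite_subset[OF _ finite_imageI[OF T]])
 qed
 define \<Delta> where "\<Delta> = a * a - b * b"
 \<comment> \<open>Linear elimination: \<open>F2\<close> with a multiple of \<open>F3\<close> loses
   two of the four exponents, and combinations with \<open>F1\<close> then isolate either
   pair.\<close>
 have S1: "FV \<Delta> 0 (- \<Delta>) 0" using FV_add[OF F2 FV_mult[OF F3, of "- (b * b)"]] by (simp add: \<Delta>_def)
 have S2: "FV 0 (- \<Delta>) 0 \<Delta>" using FV_add[OF F2 FV_mult[OF F3, of "- (a * a)"]] by (simp add: \<Delta>_def)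
 have E1: "FV (- a * (2 * \<Delta>)) (b * (2 * \<Delta>)) 0 0"
  using FV_add[OF FV_mult[OF F1, of \<Delta>] FV_add[OF FV_mult[OF S1, of "- a"] FV_mult[OF S2, of "- b"]]] by (simp add: algebra_simps)
 have E2: "FV 0 0 (- a * (2 * \<Delta>)) (b * (2 * \<Delta>))"
  using FV_add[OF FV_mult[OF F1, of \<Delta>] FV_add[OF FV_mult[OF S1, of a] FV_mult[OF S2, of b]]] by (simp add: algebra_simps)
 have ev: "eventually (%l. rel v l eps0 & rel v' l eps0 & rel u l eps0 & rel u' l eps0) bohr"
  using p e0(1) unfolding pure_def by (auto intro!: eventually_conj)
 show ?thesis
 proof
  show "type0 a b v v'"
  proof (rule type0_finite[OF p(1,2) n[folded \<Delta>_def] E1[unfolded FV_def] e0(1)])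
   show "eventually (%l. ALL X Y. relc v l X eps0 --> relc v' l Y eps0 --> (%h. X (zsmul (- a * (2 * \<Delta>)) h) * Y (zsmul (b * (2 * \<Delta>)) h))
    : (%(X, Y, Z, W). mono (- a * (2 * \<Delta>)) (b * (2 * \<Delta>)) 0 0 X Y Z W) ` QQ) bohr"
    using ev
   proof eventually_elim
    case (elim l)
    then obtain Z W where zw: "relc u l Z eps0" "relc u' l W eps0" unfolding rel_def by blast
    show ?case
    proof (intro allI impI)
     fix X Y assume xy: "relc v l X eps0" "relc v' l Y eps0"
     have q: "(X, Y, Z, W) : QQ" unfolding QQ_def using xy zw by blast
     show "(%h. X (zsmul (- a * (2 * \<Delta>)) h) * Y (zsmul (b * (2 * \<Delta>)) h)) : (%(X, Y, Z, W). mono (- a * (2 * \<Delta>)) (b * (2 * \<Delta>)) 0 0 X Y Z W) ` QQ"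
      by (rule image_eqI[OF _ q]) (simp add: mono_def[abs_def] zsmul_0 chr_zero QC[OF q])
    qed
   qed
  qed
  show "type0 a b u u'"
  proof (rule type0_finite[OF p(3,4) n[folded \<Delta>_def] E2[unfolded FV_def] e0(1)])
   show "eventually (%l. ALL X Y. relc u l X eps0 --> relc u' l Y eps0 --> (%h. X (zsmul (- a * (2 * \<Delta>)) h) * Y (zsmul (b * (2 * \<Delta>)) h))
    : (%(X, Y, Z, W). mono 0 0 (- a * (2 * \<Delta>)) (b * (2 * \<Delta>)) X Y Z W) ` QQ) bohr"
    using ev
   proof eventually_elim
    case (elim l)
    then obtain X Y where xy: "relc v l X eps0" "relc v' l Y eps0" unfolding rel_def by blast
    show ?case
    proof (intro allI impI)
     fix Z W assume zw: "relc u l Z eps0" "relc u' l W eps0"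
     have q: "(X, Y, Z, W) : QQ" unfolding QQ_def using xy zw by blast
     show "(%h. Z (zsmul (- a * (2 * \<Delta>)) h) * W (zsmul (b * (2 * \<Delta>)) h)) : (%(X, Y, Z, W). mono 0 0 (- a * (2 * \<Delta>)) (b * (2 * \<Delta>)) X Y Z W) ` QQ"
      by (rule image_eqI[OF _ q]) (simp add: mono_def[abs_def] zsmul_0 chr_zero QC[OF q])
    qed
   qed
  qed
 qed
qed

section \<open>Agreement of the phases at h and -h\<close>

text \<open>Closeness together with membership in \<open>A\<close>, so that long chains of
  approximations compose without side conditions.\<close>

definition cl where "cl F G (e::real) \<longleftrightarrow> F : A & G : A & dst F G <= e"

lemma cl_trans: assumes "cl F G d" "cl G H e" shows "cl F H (d + e)"
 using assms nrm_triangle3[of F G H] unfolding cl_def by auto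

lemma cl_sym: assumes "cl F G d" shows "cl G F d"
 using assms nrm_diff_commute[of F G] unfolding cl_def by auto

lemma cl_mult: assumes "cl F G d" "u : A" "!!x. cmod (u x) = 1" shows "cl (%x. u x * F x) (%x. u x * G x) d"
proof -
 have A: "F : A" "G : A" "dst F G <= d" using assms(1) unfolding cl_def by auto
 have "nrm (%x. u x * F x - u x * G x) = dst F G"
  unfolding right_diff_distrib[symmetric] by (intro nrm_mult1 assms A_diff A)
 then show ?thesis unfolding cl_def using A assms by (auto intro: A_mult)
qed

lemma cl_scale: assumes "cl F G d" "cmod c = 1" shows "cl (%x. c * F x) (%x. c * G x) d"
 by (rule cl_mult[OF assms(1) A_const assms(2)])

lemma DD_shift:
 assumes A: "v : A" "v' : A" and B: "!!x. cmod (v x) <= B" "!!x. cmod (v' x) <= B"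
  and r: "relc v k X dl" "relc v' k Y dl"
 obtains c where "cmod c = 1" "!!h. cl (DD a b v v' (h + k))
   (%x. (c * (X (zsmul (- a) (zsmul (- a) h)) * Y (zsmul b (zsmul b h)))) *
    (ch (%x. X (zsmul (- a) x) * Y (zsmul b x)) x * DD a b v v' h x)) (B * (\<bar>real_of_int a\<bar> + \<bar>real_of_int b\<bar>) * dl)"
proof -
 have C: "chr X" "chr Y" using r by (auto elim: relcE)
 obtain c1 where c1: "cmod c1 = 1" "!!k'. nrm (%x. tr (k' + zsmul (- a) k) v x - (c1 * X (zsmul (- a) k')) * (ch (%x. X (zsmul (- a) x)) x * tr k' v x)) <= \<bar>real_of_int (- a)\<bar> * dl"
  by (rule shift1[OF A(1) r(1), of "- a"]) blast
 obtain c2 where c2: "cmod c2 = 1" "!!k'. nrm (%x. tr (k' + zsmul b k) v' x - (c2 * Y (zsmul b k')) * (ch (%x. Y (zsmul b x)) x * tr k' v' x)) <= \<bar>real_of_int b\<bar> * dl"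
  by (rule shift1[OF A(2) r(2), of b]) blast
 show ?thesis
 proof (rule that)
  show "cmod (c1 * c2) = 1" by (simp add: norm_mult c1 c2)
  fix h
  let ?F0 = "tr (zsmul (- a) h + zsmul (- a) k) v" and ?F1 = "tr (zsmul b h + zsmul b k) v'"
  define G0 where "G0 x = (c1 * X (zsmul (- a) (zsmul (- a) h))) * (ch (%x. X (zsmul (- a) x)) x * tr (zsmul (- a) h) v x)" for x
  define G1 where "G1 x = (c2 * Y (zsmul b (zsmul b h))) * (ch (%x. Y (zsmul b x)) x * tr (zsmul b h) v' x)" for x
  have GA: "G0 : A" "G1 : A" unfolding G0_def[abs_def] G1_def[abs_def] by (intro A_intros A C chr_zsmul)+
  have FA: "?F0 : A" "?F1 : A" by (intro A_tr A)+
  have GB: "cmod (G1 x) <= B" for x unfolding G1_def by (simp add: norm_mult c2 chr_norm[OF C(2)] ch_def tr_def B)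
  have "nrm (%x. ?F0 x * ?F1 x - G0 x * G1 x) <= B * (\<bar>real_of_int b\<bar> * dl) + B * (\<bar>real_of_int (- a)\<bar> * dl)"
  proof (rule nrm_prod2[OF FA(1) GA(1) FA(2) GA(2) _ GB])
   show "cmod (?F0 x) <= B" for x by (intro tr_cmod_le B)
   show "nrm (%x. ?F0 x - G0 x) <= \<bar>real_of_int (- a)\<bar> * dl" unfolding G0_def by (rule c1(2))
   show "nrm (%x. ?F1 x - G1 x) <= \<bar>real_of_int b\<bar> * dl" unfolding G1_def by (rule c2(2))
  qed
  also have "... = B * (\<bar>real_of_int a\<bar> + \<bar>real_of_int b\<bar>) * dl" by (simp add: algebra_simps)
  finally have 1: "nrm (%x. ?F0 x * ?F1 x - G0 x * G1 x) <= B * (\<bar>real_of_int a\<bar> + \<bar>real_of_int b\<bar>) * dl" .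
  have 2: "DD a b v v' (h + k) = (%x. ?F0 x * ?F1 x)" by (rule ext) (simp add: DD_def zsmul_add_right)
  have 3: "(%x. ((c1 * c2) * (X (zsmul (- a) (zsmul (- a) h)) * Y (zsmul b (zsmul b h)))) *
    (ch (%x. X (zsmul (- a) x) * Y (zsmul b x)) x * DD a b v v' h x)) = (%x. G0 x * G1 x)"
   by (rule ext) (simp only: DD_def G0_def G1_def ch_def mult_ac)
  show "cl (DD a b v v' (h + k))
   (%x. ((c1 * c2) * (X (zsmul (- a) (zsmul (- a) h)) * Y (zsmul b (zsmul b h)))) *
    (ch (%x. X (zsmul (- a) x) * Y (zsmul b x)) x * DD a b v v' h x)) (B * (\<bar>real_of_int a\<bar> + \<bar>real_of_int b\<bar>) * dl)"
   unfolding 2 3 cl_def using 1 FA GA by (auto intro: A_mult)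
 qed
qed

text \<open>Moving \<open>h\<close> by \<open>k\<close> and \<open>- h\<close> by \<open>- k\<close>
  produces the same factor \<beta>, because the two sign changes cancel. The remaining characters
  are exchanged through \<open>D k\<close> and \<open>D (- k)\<close>, which is possible since
  \<open>D (- h)\<close> is a multiple of the unshifted product. The phase between
  \<open>D h\<close> and \<open>D (- h)\<close> is thereby multiplicative.\<close>

lemma even_step:
 assumes A: "v : A" "v' : A" and B: "!!x. cmod (v x) <= B" "!!x. cmod (v' x) <= B"
  and r: "relc v k X dl" "relc v' k Y dl"
  and h: "cl (DD a b v v' h) (%x. ph * DD a b v v' (- h) x) e1" "cmod ph = 1"
  and k: "cl (DD a b v v' k) (%x. ps * DD a b v v' (- k) x) e2" "cmod ps = 1"
  and th: "cl (DD a b v v' (- h)) (%x. \<theta> * (v x * v' x)) dl" "cmod \<theta> = 1"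
 shows "cl (DD a b v v' (h + k)) (%x. (ph * ps) * DD a b v v' (- (h + k)) x)
  (e1 + e2 + 2 * dl + 4 * (B * (\<bar>real_of_int a\<bar> + \<bar>real_of_int b\<bar>) * dl))"
proof -
 define e where "e = B * (\<bar>real_of_int a\<bar> + \<bar>real_of_int b\<bar>) * dl"
 have C: "chr X" "chr Y" using r by (auto elim: relcE)
 let ?M = "%x. X (zsmul (- a) x) * Y (zsmul b x)"
 have M: "chr ?M" by (intro chr_mult chr_zsmul C)
 define \<beta> where "\<beta> = X (zsmul (- a) (zsmul (- a) h)) * Y (zsmul b (zsmul b h))"
 have \<beta>: "cmod \<beta> = 1" by (simp add: \<beta>_def norm_mult chr_norm C)
 obtain c where c: "cmod c = 1" "!!h. cl (DD a b v v' (h + k))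
   (%x. (c * (X (zsmul (- a) (zsmul (- a) h)) * Y (zsmul b (zsmul b h)))) * (ch ?M x * DD a b v v' h x)) e"
  unfolding e_def by (rule DD_shift[OF A B r]) blast
 let ?X = "%x. cnj (X x)" and ?Y = "%x. cnj (Y x)"
 have r': "relc v (- k) ?X dl" "relc v' (- k) ?Y dl" by (intro relc_uminus A r)+
 let ?M' = "%x. cnj (X (zsmul (- a) x)) * cnj (Y (zsmul b x))"
 have M': "chr ?M'" by (intro chr_mult chr_cnj chr_zsmul C)
 obtain c' where c': "cmod c' = 1" "!!h. cl (DD a b v v' (h + - k))
   (%x. (c' * (cnj (X (zsmul (- a) (zsmul (- a) h))) * cnj (Y (zsmul b (zsmul b h))))) * (ch ?M' x * DD a b v v' h x)) e"
  unfolding e_def by (rule DD_shift[OF A B r', of a b]) blast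
 define P where "P x = v x * v' x" for x
 have D0: "DD a b v v' 0 = P" by (rule ext) (simp add: DD_def P_def)
 define D where "D h = DD a b v v' h" for h
 have D0': "D 0 = P" unfolding D_def by (rule D0)
 have dk: "cl (D k) (%x. c * (ch ?M x * P x)) e"
  using c(2)[of 0] unfolding D_def[symmetric] by (simp add: chr_zero C D0')
 have dk': "cl (D (- k)) (%x. c' * (ch ?M' x * P x)) e"
  using c'(2)[of 0] unfolding D_def[symmetric] by (simp add: chr_zero C D0')
 \<comment> \<open>The chain runs through \<open>D (h + k)\<close>, \<open>D h\<close>,
   \<open>D (- h)\<close>, \<open>P\<close>, \<open>D k\<close>, \<open>D (- k)\<close>,
   \<open>P\<close>, \<open>D (- h)\<close> and \<open>D (- (h + k))\<close>, each up to a phase and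
   possibly a character.\<close>
 have 1: "cl (D (h + k)) (%x. (c * \<beta>) * (ch ?M x * D h x)) e" using c(2)[of h] unfolding \<beta>_def D_def .
 have 8: "cl (D (- (h + k))) (%x. (c' * \<beta>) * (ch ?M' x * D (- h) x)) e"
 proof -
  have "cnj (X (zsmul (- a) (zsmul (- a) (- h)))) * cnj (Y (zsmul b (zsmul b (- h)))) = \<beta>"
   unfolding zsmul_minus_right chr_minus[OF C(1)] chr_minus[OF C(2)] \<beta>_def by simp
  then show ?thesis using c'(2)[of "- h"] unfolding D_def by (simp add: add.commute)
 qed
 have uA: "ch ?M : A" "ch ?M' : A" by (intro A_ch M M')+
 note un = ch_norm[OF M] ch_norm[OF M']
 have 2: "cl (%x. (c * \<beta>) * (ch ?M x * D h x)) (%x. (c * \<beta>) * (ch ?M x * (ph * D (- h) x))) e1"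
  by (intro cl_scale cl_mult uA un h(1)[folded D_def]) (simp add: norm_mult c \<beta>)
 have 3: "cl (%x. (c * \<beta>) * (ch ?M x * (ph * D (- h) x))) (%x. (c * \<beta>) * (ch ?M x * (ph * (\<theta> * P x)))) dl"
  by (intro cl_scale cl_mult uA un h(2) th(1)[folded D_def P_def]) (simp add: norm_mult c \<beta>)
 have 4: "cl (%x. (\<beta> * ph * \<theta>) * (c * (ch ?M x * P x))) (%x. (\<beta> * ph * \<theta>) * D k x) e"
  by (intro cl_scale cl_sym[OF dk]) (simp add: norm_mult h th \<beta>)
 have 5: "cl (%x. (\<beta> * ph * \<theta>) * D k x) (%x. (\<beta> * ph * \<theta>) * (ps * D (- k) x)) e2"
  by (intro cl_scale k(1)[folded D_def]) (simp add: norm_mult h th \<beta>)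
 have 6: "cl (%x. (\<beta> * ph * \<theta>) * (ps * D (- k) x)) (%x. (\<beta> * ph * \<theta>) * (ps * (c' * (ch ?M' x * P x)))) e"
  by (intro cl_scale k(2) dk') (simp add: norm_mult h th \<beta>)
 have 7: "cl (%x. (\<beta> * ph * ps * c') * (ch ?M' x * (\<theta> * P x))) (%x. (\<beta> * ph * ps * c') * (ch ?M' x * D (- h) x)) dl"
  by (intro cl_scale cl_mult uA un cl_sym[OF th(1)[folded D_def P_def]]) (simp add: norm_mult h k c' \<beta>)
 have 9: "cl (%x. (ph * ps) * ((c' * \<beta>) * (ch ?M' x * D (- h) x))) (%x. (ph * ps) * D (- (h + k)) x) e"
  by (intro cl_scale cl_sym[OF 8]) (simp add: norm_mult h k)
 have e34: "(%x. (c * \<beta>) * (ch ?M x * (ph * (\<theta> * P x)))) = (%x. (\<beta> * ph * \<theta>) * (c * (ch ?M x * P x)))" by (simp only: mult_ac)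
 have e67: "(%x. (\<beta> * ph * \<theta>) * (ps * (c' * (ch ?M' x * P x)))) = (%x. (\<beta> * ph * ps * c') * (ch ?M' x * (\<theta> * P x)))" by (simp only: mult_ac)
 have e79: "(%x. (\<beta> * ph * ps * c') * (ch ?M' x * D (- h) x)) = (%x. (ph * ps) * ((c' * \<beta>) * (ch ?M' x * D (- h) x)))" by (simp only: mult_ac)
 have "cl (D (h + k)) (%x. (ph * ps) * D (- (h + k)) x) (e + e1 + dl + e + e2 + e + dl + e)"
  using cl_trans[OF cl_trans[OF cl_trans[OF cl_trans[OF cl_trans[OF cl_trans[OF cl_trans[OF 1 2] 3[unfolded e34]] 4] 5] 6[unfolded e67]] 7[unfolded e79]] 9] .
 then show ?thesis unfolding D_def e_def by (simp add: algebra_simps)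
qed

text \<open>The phase between \<open>D h\<close> and \<open>D (- h)\<close> is approximately
  multiplicative by \<open>even_step\<close> and nearly constant on a set of positive measure, so it
  is nearly 1 on elements \<open>l1 + l2 - l3 - l4\<close>, which fill a Bohr neighbourhood.\<close>

lemma type0_even:
 assumes p: "pure v" "pure v'" and t: "type0 a b v v'" and eps: "0 < (eps::real)"
 shows "eventually (%h. nrm (%x. DD a b v v' h x - DD a b v v' (- h) x) <= eps) bohr"
proof -
 have A: "v : A" "v' : A" using p pure_A by auto
 obtain B where B: "0 < B" "!!x. cmod (v x) <= B" "!!x. cmod (v' x) <= B" by (rule A_bound2[OF A]) blast
 define D where "D h = DD a b v v' h" for h
 have DA: "D h : A" for h unfolding D_def by (rule DD_A[OF A])
 have DB: "nrm (D h) <= B * B" for h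
 proof (rule nrm_bound[OF DA])
  show "cmod (D h x) <= B * B" for x unfolding D_def DD_def norm_mult using B by (intro mult_mono tr_cmod_le) auto
 qed
 define K where "K = B * (\<bar>real_of_int a\<bar> + \<bar>real_of_int b\<bar>)"
 \<comment> \<open>Three uses of \<open>even_step\<close>, starting from the error
   \<open>2 * dl\<close> of each of the four elements, give \<open>14 * dl + 12 * (K * dl)\<close>;
   the phase error \<open>2 * dl\<close> acts on a function of norm at most
   \<open>B * B\<close>.\<close>
 define C where "C = 14 + 12 * K + 2 * (B * B)"
 have K: "0 <= K" using B(1) by (simp add: K_def)
 have C: "0 < C" using K B(1) by (simp add: C_def add_pos_nonneg)
 define dl where "dl = eps / C"
 have dl: "0 < dl" "C * dl = eps" using eps C by (auto simp: dl_def)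
 define T where "T h \<longleftrightarrow> (EX \<theta>. cmod \<theta> = 1 & cl (D h) (%x. \<theta> * (v x * v' x)) dl)" for h
 have evT: "eventually T bohr"
 proof -
  have "eventually (%h. EX \<theta>. cmod \<theta> = 1 & nrm (%x. DD a b v v' h x - \<theta> * (v x * v' x)) <= dl) bohr"
   using t dl(1) unfolding type0_def by blast
  then show ?thesis by eventually_elim (auto simp: T_def cl_def D_def DD_A A intro!: A_intros)
 qed
 define G where "G h \<longleftrightarrow> rel v h dl & rel v' h dl & T h & T (- h)" for h
 have evG: "eventually G bohr"
  unfolding G_def using p dl(1) evT bohr_uminus[OF evT] by (intro eventually_conj) (auto simp: pure_def)
 obtain Q1 where Q1: "eventually Q1 bohr" "!!a b. Q1 a ==> Q1 b ==> G (a + b)" "!!a b. Q1 a ==> Q1 b ==> G (a - b)"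
  by (rule bohr_half[OF evG]) blast
 obtain Q2 where Q2: "eventually Q2 bohr" "!!a b. Q2 a ==> Q2 b ==> Q1 (a + b)" "!!a b. Q2 a ==> Q2 b ==> Q1 (a - b)"
  by (rule bohr_half[OF Q1(1)]) blast
 define V where "V = {h. G h & Q1 h & Q2 h}"
 have "eventually (%h. G h & Q1 h & Q2 h) bohr" by (intro eventually_conj evG Q1 Q2)
 then have mV: "0 < msr V" unfolding V_def by (rule bohr_pos)
 have ex: "EX ph. cmod ph = 1 & cl (D h) (%x. ph * D (- h) x) (2 * dl)" if Gh: "G h" for h
 proof -
  obtain \<theta> \<theta>' where th: "cmod \<theta> = 1" "cl (D h) (%x. \<theta> * (v x * v' x)) dl" "cmod \<theta>' = 1" "cl (D (- h)) (%x. \<theta>' * (v x * v' x)) dl"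
   using Gh unfolding G_def T_def by blast
  have "cl (%x. (\<theta> * cnj \<theta>') * (\<theta>' * (v x * v' x))) (%x. (\<theta> * cnj \<theta>') * D (- h) x) dl"
   by (intro cl_scale cl_sym[OF th(4)]) (simp add: norm_mult th)
  moreover have "(\<theta> * cnj \<theta>') * (\<theta>' * (v x * v' x)) = \<theta> * (v x * v' x)" for x
   using norm1_cnj_l(2)[OF th(3)] by (simp add: mult.assoc)
  ultimately have "cl (%x. \<theta> * (v x * v' x)) (%x. (\<theta> * cnj \<theta>') * D (- h) x) dl" by (simp only:)
  from cl_trans[OF th(2) this] show ?thesis by (intro exI[of _ "\<theta> * cnj \<theta>'"]) (simp add: norm_mult th)
 qed
 have "ALL h. EX ph. h : V --> cmod ph = 1 & cl (D h) (%x. ph * D (- h) x) (2 * dl)" using ex unfolding V_def by blast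
 from choice[OF this] obtain ph where ph: "!!h. h : V ==> cmod (ph h) = 1" "!!h. h : V ==> cl (D h) (%x. ph h * D (- h) x) (2 * dl)" by blast
 have ph1: "cmod (ph h) <= 1" if "h : V" for h using ph(1)[OF that] by simp
 obtain H where H: "H <= V" "0 < msr H" "!!x y. x : H ==> y : H ==> cmod (ph x - ph y) < dl"
  using msr_phase[where \<omega> = ph, OF mV ph1 dl(1)] by blast
 from bogolyubov[OF im H(2)[unfolded msr_def]]
 show ?thesis
 proof eventually_elim
  case (elim d)
  then obtain l1 l2 l3 l4 where l: "l1 : H" "l2 : H" "l3 : H" "l4 : H" and d: "d = l1 + l2 - l3 - l4" by blast
  have V: "G l" "Q1 l" "Q2 l" "cmod (ph l) = 1" "cl (D l) (%x. ph l * D (- l) x) (2 * dl)" if "l : H" for l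
   using that H(1) ph[of l] by (auto simp: V_def)
  have neg: "cl (D (- l)) (%x. cnj (ph l) * D (- (- l)) x) (2 * dl)" if "l : H" for l
  proof -
   have "cl (%x. cnj (ph l) * (ph l * D (- l) x)) (%x. cnj (ph l) * D l x) (2 * dl)"
    by (intro cl_scale cl_sym[OF V(5)[OF that]]) (simp add: V(4) that)
   then show ?thesis by (simp add: norm1_cnj_l(2) V(4) that)
  qed
  have step: "cl (D (h + k)) (%x. (f * g) * D (- (h + k)) x) (e1 + e2 + 2 * dl + 4 * (K * dl))"
   if st: "G h" "rel v k dl" "rel v' k dl" "cl (D h) (%x. f * D (- h) x) e1" "cmod f = 1" "cl (D k) (%x. g * D (- k) x) e2" "cmod g = 1" for h k f g e1 e2
  proof -
   obtain X Y where "relc v k X dl" "relc v' k Y dl" using st(2,3) unfolding rel_def by blast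
   moreover obtain \<theta> where "cmod \<theta> = 1" "cl (D (- h)) (%x. \<theta> * (v x * v' x)) dl" using st(1) unfolding G_def T_def by blast
   ultimately show ?thesis using st(4-7) unfolding D_def K_def by (intro even_step[OF A B(2,3)])
  qed
  have G12: "G (l1 + l2)" by (intro Q1 V l)
  have "Q1 (l1 + l2)" by (intro Q2 V l)
  then have G123: "G (l1 + l2 + - l3)" using Q1(3)[OF _ V(2)[OF l(3)]] by simp
  have rl: "rel v l dl" "rel v' l dl" "rel v (- l) dl" "rel v' (- l) dl" if "l : H" for l
   using V(1)[OF that] rel_uminus A unfolding G_def by auto
  have s2: "cl (D (l1 + l2)) (%x. (ph l1 * ph l2) * D (- (l1 + l2)) x) (2 * dl + 2 * dl + 2 * dl + 4 * (K * dl))"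
   by (intro step V l rl)
  have n2': "cmod (ph l1 * ph l2) = 1" by (simp add: norm_mult V l)
  have s3: "cl (D (l1 + l2 + - l3)) (%x. (ph l1 * ph l2 * cnj (ph l3)) * D (- (l1 + l2 + - l3)) x) ((2 * dl + 2 * dl + 2 * dl + 4 * (K * dl)) + 2 * dl + 2 * dl + 4 * (K * dl))"
   by (intro step[OF G12 _ _ s2 n2' neg] rl l) (simp add: V l)
  have n3: "cmod (ph l1 * ph l2 * cnj (ph l3)) = 1" by (simp add: norm_mult V l)
  have s4: "cl (D (l1 + l2 + - l3 + - l4)) (%x. (ph l1 * ph l2 * cnj (ph l3) * cnj (ph l4)) * D (- (l1 + l2 + - l3 + - l4)) x)
   (((2 * dl + 2 * dl + 2 * dl + 4 * (K * dl)) + 2 * dl + 2 * dl + 4 * (K * dl)) + 2 * dl + 2 * dl + 4 * (K * dl))"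
   by (intro step[OF G123 _ _ s3 n3 neg] rl l) (simp add: V l)
  define f where "f = ph l1 * ph l2 * cnj (ph l3) * cnj (ph l4)"
  have dd: "l1 + l2 + - l3 + - l4 = d" by (simp add: d)
  have "cl (D d) (%x. f * D (- d) x) (14 * dl + 12 * (K * dl))"
   using s4 unfolding dd f_def by (simp add: algebra_simps)
  then have c1: "nrm (%x. D d x - f * D (- d) x) <= 14 * dl + 12 * (K * dl)" unfolding cl_def by blast
  have f1: "cmod (f - 1) <= 2 * dl"
  proof -
   have q: "cmod (ph x * cnj (ph y) - 1) <= dl" if "x : H" "y : H" for x y
   proof -
    have "ph x * cnj (ph y) - 1 = cnj (ph y) * (ph x - ph y)" using norm1_cnj(2)[OF V(4)[OF that(2)]] by (simp add: algebra_simps)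
    then show ?thesis using H(3)[OF that] by (simp add: norm_mult V(4) that)
   qed
   have "f - 1 = (ph l1 * cnj (ph l3)) * (ph l2 * cnj (ph l4) - 1) + (ph l1 * cnj (ph l3) - 1)" by (simp add: f_def algebra_simps)
   then have "cmod (f - 1) <= cmod ((ph l1 * cnj (ph l3)) * (ph l2 * cnj (ph l4) - 1)) + cmod (ph l1 * cnj (ph l3) - 1)" using norm_triangle_ineq by (simp only:)
   also have "cmod ((ph l1 * cnj (ph l3)) * (ph l2 * cnj (ph l4) - 1)) = cmod (ph l2 * cnj (ph l4) - 1)" by (simp only: norm_mult complex_mod_cnj V(4) l mult_1_left)
   finally show ?thesis using q[OF l(1,3)] q[OF l(2,4)] by simp
  qed
  have "nrm (%x. D d x - D (- d) x) <= nrm (%x. D d x - f * D (- d) x) + nrm (%x. f * D (- d) x - D (- d) x)"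
   by (intro nrm_triangle3 A_intros DA)
  also have "nrm (%x. f * D (- d) x - D (- d) x) = cmod (f - 1) * nrm (D (- d))"
   using nrm_scale[OF DA, of "f - 1" "- d"] by (simp add: left_diff_distrib)
  also have "... <= (2 * dl) * (B * B)" using f1 DB nrm_nonneg[OF DA] dl(1) by (intro mult_mono) auto
  finally have "nrm (%x. D d x - D (- d) x) <= C * dl" using c1 by (simp add: C_def algebra_simps)
  then show ?case using dl(2) by (simp add: D_def)
 qed
qed

end

section \<open>Trigonometric weights\<close>

text \<open>Trigonometric polynomials with nonnegative coefficients. Characters may repeat in the
  construction; the sum of the coefficients is the value at 0.\<close>

inductive TP :: "('a::ab_group_add => complex) => bool" where
 TP_0: "TP (%h. 0)"
| TP_add: "chr zt ==> 0 <= (c::real) ==> TP f ==> TP (%h. cx c * zt h + f h)"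

lemma TP_plus: assumes "TP f" "TP g" shows "TP (%h. f h + g h)"
 using assms(1)
proof (induction rule: TP.induct)
 case (TP_add zt c f)
 from TP.TP_add[OF TP_add(1,2,4)] show ?case by (simp only: add.assoc)
qed (use assms(2) in simp)

lemma TP_chr: "chr zt ==> 0 <= c ==> TP (%h. cx c * zt h)"
 using TP_add[OF _ _ TP_0, of zt c] by simp

lemma TP_mult_chr: assumes "chr ps" "0 <= (d::real)" "TP f" shows "TP (%h. cx d * ps h * f h)"
 using assms(3)
proof (induction rule: TP.induct)
 case (TP_add zt c f)
 have "TP (%h. cx (d * c) * (ps h * zt h) + cx d * ps h * f h)"
  using TP_add assms by (intro TP.TP_add chr_mult) auto
 then show ?case by (simp add: algebra_simps)
qed (use TP_0 in simp)

lemma TP_mult: assumes "TP f" "TP g" shows "TP (%h. f h * g h)"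
 using assms(1)
proof (induction rule: TP.induct)
 case (TP_add zt c f)
 from TP_plus[OF TP_mult_chr[OF TP_add(1,2) assms(2)] TP_add(4)] show ?case by (simp only: distrib_right)
qed (use TP_0 in simp)

lemma TP_1: "TP (%h. 1)" using TP_chr[OF chr_one, of 1] by simp

lemma TP_power: assumes "TP f" shows "TP (%h. f h ^ n)"
 by (induction n) (use TP_1 TP_mult[OF assms] in simp_all)

lemma TP_prod: assumes "finite S" "!!i. i : S ==> TP (f i)" shows "TP (%h. \<Prod>i\<in>S. f i h)"
 using assms by (induction S rule: finite_induct) (simp_all add: TP_1 TP_mult)

lemma TP_bdd: "TP f ==> bdd f"
proof (induction rule: TP.induct)
 case (TP_add zt c f)
 then show ?case by (intro bdd_add bdd_mult bdd_const chr_bdd[OF TP_add(1)])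
qed (rule bdd_const)

lemma TP_zero_nonneg: "TP f ==> 0 <= Re (f 0) & Im (f 0) = 0"
 by (induction rule: TP.induct) (auto simp: chr_zero)

lemma pd_chr_mult: assumes "pd k" "chr zt" shows "pd (%h. zt h * k h)"
 unfolding pd_def
proof (intro allI)
 fix n :: nat and p :: "nat => 'a" and c :: "nat => complex"
 have "(\<Sum>i<n. \<Sum>j<n. c i * cnj (c j) * (zt (p i - p j) * k (p i - p j))) = (\<Sum>i<n. \<Sum>j<n. (c i * zt (p i)) * cnj (c j * zt (p j)) * k (p i - p j))"
  by (simp add: chr_diff[OF assms(2)] mult_ac)
 then show "0 <= Re (\<Sum>i<n. \<Sum>j<n. c i * cnj (c j) * (zt (p i - p j) * k (p i - p j))) &
   Im (\<Sum>i<n. \<Sum>j<n. c i * cnj (c j) * (zt (p i - p j) * k (p i - p j))) = 0"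
  using pdD[OF assms(1), where n = n and p = p and c = "%i. c i * zt (p i)"] by simp
qed

context imean
begin

lemma pd_mean_nonneg: assumes "pd k" shows "0 <= Re (cm k)"
proof (rule field_le_epsilon)
 fix e :: real assume "0 < e"
 obtain n p where "0 < n" "Qav n p k <= Re (cm k) + e" by (rule pd_mean_inf[OF assms \<open>0 < e\<close>])
 then show "0 <= Re (cm k) + e" using Qav_nonneg[OF assms, of n p] by simp
qed

lemma TP_bound:
 assumes "TP f" "bdd k" "!!zt. chr zt ==> cmod (cm (%h. zt h * k h)) <= \<sigma>"
 shows "cmod (cm (%h. f h * k h)) <= Re (f 0) * \<sigma>"
 using assms(1)
proof (induction rule: TP.induct)
 case (TP_add zt c f)
 have b: "bdd (%h. zt h * k h)" "bdd (%h. f h * k h)" by (intro bdd_mult chr_bdd TP_add TP_bdd assms)+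
 have "cm (%h. (cx c * zt h + f h) * k h) = cm (%h. cx c * (zt h * k h) + f h * k h)"
  by (simp only: distrib_right mult.assoc)
 also have "... = cx c * cm (%h. zt h * k h) + cm (%h. f h * k h)"
  by (simp add: cm_add cm_scale b bdd_mult bdd_const)
 also have "cmod ... <= c * \<sigma> + Re (f 0) * \<sigma>"
  using TP_add(2) by (intro norm_triangle_mono TP_add(4)) (simp add: norm_mult mult_left_mono assms(3)[OF TP_add(1)])
 finally show ?case by (simp add: chr_zero[OF TP_add(1)] distrib_right)
qed simp

text \<open>The trivial character contributes the constant term, and every other term is nonnegative
  because a character times a positive definite function is positive definite.\<close>

lemma TP_pd:
 assumes "TP f" "pd k"
 shows "Re (cm f) * Re (cm k) <= Re (cm (%h. f h * k h))"
 using assms(1)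
proof (induction rule: TP.induct)
 case (TP_add zt c f)
 have b: "bdd (%h. zt h * k h)" "bdd (%h. f h * k h)" by (intro bdd_mult chr_bdd TP_add TP_bdd pd_bdd assms)+
 have "cm (%h. (cx c * zt h + f h) * k h) = cm (%h. cx c * (zt h * k h) + f h * k h)"
  by (simp only: distrib_right mult.assoc)
 also have "... = cx c * cm (%h. zt h * k h) + cm (%h. f h * k h)"
  by (simp add: cm_add cm_scale b bdd_mult bdd_const)
 finally have e: "Re (cm (%h. (cx c * zt h + f h) * k h)) = c * Re (cm (%h. zt h * k h)) + Re (cm (%h. f h * k h))" by simp
 have "cm (%h. cx c * zt h + f h) = cx c * cm zt + cm f"
  using TP_add by (simp add: cm_add cm_scale bdd_mult bdd_const chr_bdd TP_bdd)
 then have e': "Re (cm (%h. cx c * zt h + f h)) = c * Re (cm zt) + Re (cm f)" by simp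
 have "Re (cm zt) * Re (cm k) <= Re (cm (%h. zt h * k h))"
  using pd_mean_nonneg[OF pd_chr_mult[OF assms(2) TP_add(1)]] by (simp add: cm_chr[OF TP_add(1)])
 then have "c * (Re (cm zt) * Re (cm k)) <= c * Re (cm (%h. zt h * k h))" using TP_add(2) by (rule mult_left_mono)
 then show ?case unfolding e e' using TP_add(4) by (simp add: algebra_simps)
qed simp

definition weight :: "('a => complex) => bool" where
 "weight w \<longleftrightarrow> TP w & (ALL h. Im (w h) = 0 & 0 <= Re (w h)) & cm w = 1"

text \<open>A normalised high power of the product of the factors
  \<open>(1 + Re (zt h)) / 2\<close>. It is at most \<open>(1 - c') ^ N\<close> where
  \<open>P\<close> fails and at least \<open>(1 - c' / 2) ^ N\<close> on a set of positive measure,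
  so division by its mean makes the bad part negligible for large \<open>N\<close>.\<close>

lemma weight_exists:
 assumes "eventually P bohr" "0 < (\<kappa>::real)"
 obtains w where "weight w" "m (%h. Re (w h) * of_bool (~ P h)) <= \<kappa>"
proof -
 obtain \<Phi> \<rho> where h: "finite \<Phi>" "\<Phi> <= Collect chr" "0 < \<rho>" "!!h. h : bset \<Phi> \<rho> ==> P h"
  using assms(1) unfolding eventually_bohr by blast
 have c: "chr zt" if "zt : \<Phi>" for zt using that h(2) by auto
 define r where "r h = (\<Prod>zt\<in>\<Phi>. (1 + Re (zt h)) / 2)" for h
 have f01: "0 <= (1 + Re (zt h)) / 2" "(1 + Re (zt h)) / 2 <= 1" if "zt : \<Phi>" for zt h
  using abs_Re_le_cmod[of "zt h"] chr_norm[OF c[OF that]] by (auto simp: abs_le_iff)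
 have r01: "0 <= r h" "r h <= 1" for h unfolding r_def by (auto intro!: prod_nonneg prod_le_1 f01)
 have TPr: "TP (%h. cx (r h))"
 proof -
  have "TP (%h. cx (1/2) * 1 + (cx (1/4) * zt h + cx (1/4) * cnj (zt h)))" if "zt : \<Phi>" for zt
   by (intro TP_plus TP_chr chr_one c that chr_cnj) auto
  moreover have "cx (1/2) * 1 + (cx (1/4) * zt h + cx (1/4) * cnj (zt h)) = cx ((1 + Re (zt h)) / 2)" for zt :: "'a => complex" and h
   by (simp add: complex_eq_iff)
  ultimately have "TP (%h. cx ((1 + Re (zt h)) / 2))" if "zt : \<Phi>" for zt using that by (simp only:)
  from TP_prod[OF h(1) this] show ?thesis unfolding r_def of_real_prod .
 qed
 have lim: "(r \<longlongrightarrow> 1) bohr"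
 proof -
  have "((%h. (1 + Re (zt h)) / 2) \<longlongrightarrow> (1 + Re 1) / 2) bohr" if "zt : \<Phi>" for zt
  proof -
   have "(zt \<longlongrightarrow> 1) bohr" by (rule tendstoI) (simp add: dist_norm bohr_chr[OF c[OF that]])
   then show ?thesis by (intro tendsto_intros) auto
  qed
  from tendsto_prod[OF this, of \<Phi> "%zt. zt"] show ?thesis unfolding r_def[abs_def] by simp
 qed
 \<comment> \<open>The square of \<open>cmod (zt x - 1)\<close> is \<open>2 - 2 * Re (zt x)\<close>,
   so leaving the Bohr set lowers one factor by at least \<open>\<rho>\<^sup>2 / 4\<close>.\<close>
 define c' where "c' = min (\<rho>\<^sup>2 / 4) 1"
 have c': "0 < c'" "c' <= 1" "c' <= \<rho>\<^sup>2 / 4" using h(3) by (auto simp: c'_def)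
 have bad: "r x <= 1 - c'" if "~ P x" for x
 proof -
  have "x ~: bset \<Phi> \<rho>" using that h(4) by blast
  then obtain zt where z: "zt : \<Phi>" "\<rho> <= cmod (zt x - 1)" unfolding bset_def by (auto simp: not_less)
  have "(Re (zt x))^2 + (Im (zt x))^2 = 1" using chr_norm[OF c[OF z(1)], of x] cmod_power2[of "zt x"] by simp
  then have "(cmod (zt x - 1))^2 = 2 - 2 * Re (zt x)" unfolding cmod_power2 by (simp add: power2_diff)
  moreover have "\<rho>\<^sup>2 <= (cmod (zt x - 1))^2" using z(2) h(3) by (intro power_mono) auto
  ultimately have "(1 + Re (zt x)) / 2 <= 1 - c'" using c'(3) by simp
  moreover have "r x = (1 + Re (zt x)) / 2 * (\<Prod>zt\<in>\<Phi> - {zt}. (1 + Re (zt x)) / 2)" unfolding r_def by (rule prod.remove[OF h(1) z(1)])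
  moreover have "... <= (1 + Re (zt x)) / 2 * 1" using f01 z(1) by (intro mult_left_mono prod_le_1) auto
  ultimately show ?thesis by simp
 qed
 define S where "S = {h. 1 - c' / 2 < r h}"
 have "eventually (%h. 1 - c' / 2 < r h) bohr" by (rule order_tendstoD(1)[OF lim]) (use c' in simp)
 then have S: "0 < msr S" unfolding S_def by (rule bohr_pos)
 define q where "q = (1 - c') / (1 - c' / 2)"
 have q: "q < 1" using c' by (simp add: q_def field_simps)
 have "0 < \<kappa> * msr S" using assms(2) S by simp
 then obtain N where N: "q ^ N < \<kappa> * msr S" using real_arch_pow_inv[OF _ q] by blast
 have br: "bdd (%h. r h ^ N)" by (intro bdd_power bddI[of r 1]) (use r01 in simp)
 define M where "M = m (%h. r h ^ N)"
 have M: "(1 - c' / 2) ^ N * msr S <= M"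
 proof -
  have "(1 - c' / 2) ^ N * msr S = m (%h. (1 - c' / 2) ^ N * indicat_real S h)" by (simp add: m_scale bdd_indicator' msr_def)
  also have "... <= M" unfolding M_def
   using c' r01 by (intro m_mono br bdd_mult bdd_const bdd_indicator') (auto simp: indicator_def S_def intro!: power_mono)
  finally show ?thesis .
 qed
 have pp: "0 < (1 - c' / 2) ^ N" using c' by (intro zero_less_power) simp
 have M0: "0 < M" using M mult_pos_pos[OF pp S] by simp
 define w where "w h = cx (1 / M) * 1 * (cx (r h)) ^ N" for h
 have wr: "w h = cx (r h ^ N / M)" for h by (simp add: w_def)
 show ?thesis
 proof (rule that)
  have "TP w" unfolding w_def[abs_def] using M0 by (intro TP_mult_chr chr_one TP_power TPr) simp
  moreover have "cm w = 1"
  proof -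
   have "cm w = cx (m (%h. (1 / M) * r h ^ N))" unfolding wr[abs_def] cm_of_real by simp
   also have "m (%h. (1 / M) * r h ^ N) = 1" using m_scale[OF br, of "1 / M"] M0 by (simp add: M_def)
   finally show ?thesis by simp
  qed
  ultimately show "weight w" unfolding weight_def using M0 r01 by (simp add: wr)
  have "m (%h. Re (w h) * of_bool (~ P h)) <= (1 - c') ^ N / M"
  proof (rule m_le)
   show "bdd (%h. Re (w h) * of_bool (~ P h))"
   proof (rule bddI[of _ "1 / M"])
    fix h
    have "r h ^ N <= 1" using r01 by (intro power_le_one)
    then show "norm (Re (w h) * of_bool (~ P h)) <= 1 / M" using M0 r01 by (simp add: wr divide_right_mono)
   qed
   fix h
   have "0 <= (1 - c') ^ N / M" using M0 c' by simp
   moreover have "r h ^ N <= (1 - c') ^ N" if "~ P h" using bad[OF that] r01 by (intro power_mono)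
   ultimately show "Re (w h) * of_bool (~ P h) <= (1 - c') ^ N / M" using M0 by (simp add: wr divide_right_mono)
  qed
  also have "(1 - c') ^ N / M <= \<kappa>"
  proof -
   have "(1 - c') ^ N = q ^ N * (1 - c' / 2) ^ N" using c' by (simp add: q_def power_divide)
   also have "... <= (\<kappa> * msr S) * (1 - c' / 2) ^ N" using N pp by (intro mult_right_mono) auto
   also have "... = \<kappa> * ((1 - c' / 2) ^ N * msr S)" by (simp add: mult_ac)
   also have "... <= \<kappa> * M" using M assms(2) by (intro mult_left_mono) auto
   finally show ?thesis using M0 by (simp add: divide_le_eq)
  qed
  finally show "m (%h. Re (w h) * of_bool (~ P h)) <= \<kappa>" .
 qed
qed

end

context sysm
begin

lemma weight_Re: "weight w ==> w h = cx (Re (w h))"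
 by (simp add: weight_def complex_eq_iff)

lemma weight_bdd: "weight w ==> bdd w" by (simp add: weight_def TP_bdd)

lemma weight_mean: assumes "weight w" shows "m (%h. Re (w h)) = 1"
proof -
 have "Re (cm w) = 1" using assms by (simp add: weight_def)
 then show ?thesis by (simp only: Re_cm)
qed

lemma weight_le: assumes w: "weight w" and f: "bdd f" shows "cmod (cm (%h. w h * f h)) <= m (%h. Re (w h) * cmod (f h))"
proof -
 have "cmod (w h * f h) = Re (w h) * cmod (f h)" for h
  by (subst weight_Re[OF w]) (use w in \<open>simp add: norm_mult weight_def\<close>)
 then show ?thesis using norm_cm_le[OF bdd_mult[OF weight_bdd[OF w] f]] by (simp only:)
qed

lemma weight_bound: assumes w: "weight w" and f: "bdd f" "!!h. cmod (f h) <= M" shows "cmod (cm (%h. w h * f h)) <= M"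
proof -
 have "m (%h. Re (w h) * cmod (f h)) <= m (%h. Re (w h) * M)"
  using w f by (intro m_mono bdd_intros weight_bdd[OF w]) (auto simp: weight_def intro!: mult_left_mono)
 also have "... = M" using m_scale[OF bdd_Re[OF weight_bdd[OF w]], of M] weight_mean[OF w] by (simp add: mult.commute)
 finally show ?thesis using weight_le[OF w f(1)] by simp
qed

lemma weight_sq: assumes w: "weight w" and f: "bdd f"
 shows "(cmod (cm (%h. w h * f h)))^2 <= m (%h. Re (w h) * (cmod (f h))^2)"
proof -
 define c where "c = cm (%h. w h * f h)"
 have bw: "bdd (%h. Re (w h))" by (intro bdd_Re weight_bdd w)
 have bwf: "bdd (%h. w h * f h)" by (intro bdd_mult weight_bdd w f)
 have b1: "bdd (%h. Re (w h) * (cmod (f h))^2)" by (intro bdd_mult bw bdd_power bdd_norm f)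
 have b2: "bdd (%h. Re (cnj c * (w h * f h)))" by (intro bdd_Re bdd_mult[OF bdd_const] bwf)
 have e: "Re (w h) * (cmod (f h - c))^2 = Re (w h) * (cmod (f h))^2 - 2 * Re (cnj c * (w h * f h)) + (cmod c)^2 * Re (w h)" for h
 proof -
  have "Im (w h) = 0" using w by (simp add: weight_def)
  then show ?thesis unfolding cmod_power2 by (simp add: power2_eq_square algebra_simps)
 qed
 have "0 <= m (%h. Re (w h) * (cmod (f h - c))^2)"
  using w by (intro m_nonneg bdd_mult bw bdd_power bdd_norm bdd_diff f bdd_const) (simp add: weight_def)
 also have "... = m (%h. Re (w h) * (cmod (f h))^2) - 2 * m (%h. Re (cnj c * (w h * f h))) + (cmod c)^2 * m (%h. Re (w h))"
  unfolding e m_add[OF bdd_diff[OF b1 bdd_mult[OF bdd_const b2]] bdd_mult[OF bdd_const bw]]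
   m_diff[OF b1 bdd_mult[OF bdd_const b2]] m_scale[OF b2] m_scale[OF bw] ..
 also have "m (%h. Re (cnj c * (w h * f h))) = Re (cnj c * cm (%h. w h * f h))"
  unfolding Re_cm[symmetric] cm_scale[OF bwf] ..
 also have "cnj c * cm (%h. w h * f h) = cx ((cmod c)^2)" unfolding c_def[symmetric] complex_norm_square by (simp add: mult.commute)
 finally show ?thesis using weight_mean[OF w] by (simp add: c_def)
qed

lemma pure_one: "pure (%x. 1)"
proof -
 have "rel (%x. 1) h eps" if "0 < eps" for h eps
  by (rule relI[OF relcI[OF chr_one, of 1]]) (use that in simp_all)
 then show ?thesis unfolding pure_def using A_const by simp
qed

lemma pure_scale: assumes "pure v" shows "pure (%x. c * v x)"
proof -
 have A: "v : A" by (rule pure_A[OF assms])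
 have "eventually (%h. rel (%x. c * v x) h eps) bohr" if e: "0 < eps" for eps
 proof -
  define dl where "dl = eps / (cmod c + 1)"
  have d: "0 < dl" "cmod c * dl <= eps"
  proof -
   have p: "0 < cmod c + 1" by (simp add: add_nonneg_pos)
   then show "0 < dl" using e by (simp add: dl_def)
   then have "cmod c * dl <= (cmod c + 1) * dl" by simp
   also have "... = eps" using p by (simp add: dl_def)
   finally show "cmod c * dl <= eps" .
  qed
  have "eventually (%h. rel v h dl) bohr" using assms d(1) by (simp add: pure_def)
  then show ?thesis
  proof eventually_elim
   case (elim h)
   then obtain zt d' where r: "chr zt" "cmod d' = 1" "nrm (%x. tr h v x - d' * (ch zt x * v x)) <= dl"
    unfolding rel_def relc_def by blast
   have "(%x. tr h (%x. c * v x) x - d' * (ch zt x * (c * v x))) = (%x. c * (tr h v x - d' * (ch zt x * v x)))"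
    unfolding tr_scale by (simp add: algebra_simps)
   then have "nrm (%x. tr h (%x. c * v x) x - d' * (ch zt x * (c * v x))) = cmod c * nrm (%x. tr h v x - d' * (ch zt x * v x))"
    using r(1) A by (simp only:) (intro nrm_scale A_intros)
   also have "... <= cmod c * dl" using r(3) by (intro mult_left_mono) auto
   finally have "nrm (%x. tr h (%x. c * v x) x - d' * (ch zt x * (c * v x))) <= eps" using d(2) by simp
   then show ?case by (rule relI[OF relcI[OF r(1,2)]])
  qed
 qed
 then show ?thesis unfolding pure_def using A by (auto intro: A_intros)
qed

lemma pure_cnj: assumes "pure v" shows "pure (%x. cnj (v x))"
proof -
 have A: "v : A" by (rule pure_A[OF assms])
 have "eventually (%h. rel (%x. cnj (v x)) h eps) bohr" if e: "0 < eps" for eps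
 proof -
  have "eventually (%h. rel v h eps) bohr" using assms e by (simp add: pure_def)
  then show ?thesis
  proof eventually_elim
   case (elim h)
   then obtain zt d' where r: "chr zt" "cmod d' = 1" "nrm (%x. tr h v x - d' * (ch zt x * v x)) <= eps"
    unfolding rel_def relc_def by blast
   have "(%x. tr h (%x. cnj (v x)) x - cnj d' * (ch (%x. cnj (zt x)) x * cnj (v x))) = (%x. cnj (tr h v x - d' * (ch zt x * v x)))"
    unfolding tr_cnj ch_cnj by simp
   then have "nrm (%x. tr h (%x. cnj (v x)) x - cnj d' * (ch (%x. cnj (zt x)) x * cnj (v x))) = nrm (%x. tr h v x - d' * (ch zt x * v x))"
    using r(1) A by (simp only:) (intro nrm_cnj A_intros)
   then show ?case using r by (intro relI[OF relcI[OF chr_cnj[OF r(1)], of "cnj d'"]]) simp_all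
  qed
 qed
 then show ?thesis unfolding pure_def using A by (auto intro: A_intros)
qed

text \<open>Pairing with the constant function 1, itself an eigenvector, presents the integral as an
  inner product covered by \<open>type0_corr\<close>.\<close>

lemma type0_corr1:
 assumes p: "pure v" "pure v'" and \<xi>: "chr \<xi>" and nz: "cm (%h. \<xi> h * I (DD a b v v' h)) ~= 0"
  and n: "fin_idx (2 * (a * a - b * b)) TYPE('a)"
 shows "type0 a b v v'"
proof -
 have "ip (DD a b v v' h) (DD a b (%x. 1) (%x. 1) (- h)) = I (DD a b v v' h)" for h
  unfolding ip_def DD_def[of a b "%x. 1"] by simp
 then show ?thesis using type0_corr[OF p pure_one pure_one \<xi> _ n] nz by simp
qed

lemma DD_nrm: assumes "v : A" "v' : A" shows "EX M. 0 <= M & (ALL h. nrm (DD a b v v' h) <= M)"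
proof -
 obtain B where B: "0 < B" "!!x. cmod (v x) <= B" "!!x. cmod (v' x) <= B" by (rule A_bound2[OF assms]) blast
 have "nrm (DD a b v v' h) <= B * B" for h
 proof (rule nrm_bound[OF DD_A[OF assms]])
  show "cmod (DD a b v v' h x) <= B * B" for x unfolding DD_def norm_mult using B by (intro mult_mono tr_cmod_le) auto
 qed
 then show ?thesis using B(1) by (intro exI[of _ "B * B"]) simp
qed

text \<open>Summands not of \<open>type0\<close>, and pairs not both of \<open>type0\<close>,
  average to 0 against every character and hence against \<open>w\<close>. For the rest
  \<open>type0_even\<close> lets \<open>D0 (- h)\<close> be replaced by \<open>D0 h\<close> where
  \<open>w\<close> concentrates; Cauchy-Schwarz in \<open>x\<close> and in the weighted mean then
  produces the squared average of the integral.\<close>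

lemma psd:
 assumes J: "finite J" and p: "!!i. i : J ==> pure (V i)" "!!i. i : J ==> pure (V' i)"
  and n: "fin_idx (2 * (a * a - b * b)) TYPE('a)" and \<kappa>: "0 < (\<kappa>::real)"
  and D: "!!h. D h = (%x. \<Sum>i\<in>J. DD a b (V i) (V' i) h x)"
 obtains w where "weight w" "(cmod (cm (%h. w h * I (D h))))^2 - \<kappa> <= Re (cm (%h. w h * ip (D h) (D (- h))))"
proof -
 define E where "E i h = DD a b (V i) (V' i) h" for i h
 have EA: "E i h : A" if "i : J" for i h unfolding E_def using p[OF that] pure_A by (intro DD_A) auto
 define J0 where "J0 = {i : J. type0 a b (V i) (V' i)}"
 have J0: "finite J0" "J0 <= J" using J by (auto simp: J0_def)
 have "ALL i. EX M. i : J --> 0 <= M & (ALL h. nrm (E i h) <= M)"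
 proof
  fix i
  show "EX M. i : J --> 0 <= M & (ALL h. nrm (E i h) <= M)"
  proof (cases "i : J")
   case True
   from DD_nrm[OF pure_A[OF p(1)[OF True]] pure_A[OF p(2)[OF True]], of a b] show ?thesis unfolding E_def by blast
  qed simp
 qed
 from choice[OF this] obtain Mi where Mi: "!!i. i : J ==> 0 <= Mi i" "!!i h. i : J ==> nrm (E i h) <= Mi i" by blast
 define M where "M = (\<Sum>i\<in>J0. Mi i)"
 have M: "0 <= M" unfolding M_def using J0 Mi(1) by (intro sum_nonneg) auto
 define D0 where "D0 h x = (\<Sum>i\<in>J0. E i h x)" for h x
 have D0A: "D0 h : A" for h unfolding D0_def[abs_def] using J0 EA by (intro A_sum) auto
 have D0M: "nrm (D0 h) <= M" for h
 proof -
  have "nrm (D0 h) <= (\<Sum>i\<in>J0. nrm (E i h))" unfolding D0_def[abs_def] using J0 EA by (intro nrm_sum) auto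
  also have "... <= M" unfolding M_def using J0 Mi by (intro sum_mono) auto
  finally show ?thesis .
 qed
 \<comment> \<open>\<open>\<kappa>1\<close> limits the error where \<open>P\<close> holds and
   \<open>\<kappa>2\<close> the weight of the set where it fails; each costs half of
   \<open>\<kappa>\<close>.\<close>
 define \<kappa>1 where "\<kappa>1 = \<kappa> / (2 * (M + 1))"
 define \<kappa>2 where "\<kappa>2 = \<kappa> / (4 * (M * M + 1))"
 have k1: "0 < \<kappa>1" "M * \<kappa>1 <= \<kappa> / 2"
 proof -
  show "0 < \<kappa>1" using M \<kappa> by (simp add: \<kappa>1_def)
  then have "M * \<kappa>1 <= (M + 1) * \<kappa>1" by simp
  also have "... = \<kappa> / 2" using M by (simp add: \<kappa>1_def field_simps)
  finally show "M * \<kappa>1 <= \<kappa> / 2" .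
 qed
 have k2: "0 < \<kappa>2" "2 * (M * M) * \<kappa>2 <= \<kappa> / 2"
 proof -
  have MM: "0 < M * M + 1" by (simp add: add_nonneg_pos)
  then show "0 < \<kappa>2" using \<kappa> by (simp add: \<kappa>2_def)
  then have "2 * (M * M) * \<kappa>2 <= 2 * (M * M + 1) * \<kappa>2" by simp
  also have "... = \<kappa> / 2" using MM by (simp add: \<kappa>2_def field_simps)
  finally show "2 * (M * M) * \<kappa>2 <= \<kappa> / 2" .
 qed
 define P where "P h \<longleftrightarrow> nrm (%x. D0 h x - D0 (- h) x) <= \<kappa>1" for h
 have "eventually P bohr"
 proof -
  define \<kappa>3 where "\<kappa>3 = \<kappa>1 / (real (card J0) + 1)"
  have k3: "0 < \<kappa>3" "real (card J0) * \<kappa>3 <= \<kappa>1" using k1(1) by (simp_all add: \<kappa>3_def field_simps)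
  have "eventually (%h. ALL i:J0. nrm (%x. E i h x - E i (- h) x) <= \<kappa>3) bohr"
   using J0(1) by (rule eventually_ball_finite) (auto simp: J0_def E_def intro!: type0_even p k3)
  then show ?thesis
  proof eventually_elim
   case (elim h)
   have "nrm (%x. D0 h x - D0 (- h) x) = nrm (%x. \<Sum>i\<in>J0. (E i h x - E i (- h) x))" by (simp add: D0_def sum_subtractf)
   also have "... <= (\<Sum>i\<in>J0. nrm (%x. E i h x - E i (- h) x))" using J0 EA by (intro nrm_sum A_diff) auto
   also have "... <= (\<Sum>i\<in>J0. \<kappa>3)" using elim by (intro sum_mono) auto
   also have "... <= \<kappa>1" using k3(2) by simp
   finally show ?case by (simp add: P_def)
  qed
 qed
 then obtain w where w: "weight w" "m (%h. Re (w h) * of_bool (~ P h)) <= \<kappa>2" by (rule weight_exists[OF _ k2(1)])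
 have TPw: "TP w" using w(1) by (simp add: weight_def)
 have bw: "bdd w" by (rule weight_bdd[OF w(1)])
 have bE: "bdd (%h. ip (E i h) (E j (- h)))" if "i : J" "j : J" for i j
  by (rule bdd_ip[of _ _ "Mi i" "Mi j"]) (use EA Mi that in auto)
 have bEI: "bdd (%h. I (E i h))" if "i : J" for i by (rule bdd_I[of _ "Mi i"]) (use EA Mi that in auto)
 have z2: "cm (%h. w h * ip (E i h) (E j (- h))) = 0" if ij: "i : J" "j : J" "~ (i : J0 & j : J0)" for i j
 proof -
  have "cm (%h. zt h * ip (E i h) (E j (- h))) = 0" if "chr zt" for zt
   using type0_corr[OF p(1)[OF ij(1)] p(2)[OF ij(1)] p(1)[OF ij(2)] p(2)[OF ij(2)] that _ n] ij unfolding E_def J0_def by blast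
  then have "cmod (cm (%h. w h * ip (E i h) (E j (- h)))) <= Re (w 0) * 0"
   by (intro TP_bound[OF TPw bE[OF ij(1,2)]]) simp
  then show ?thesis by simp
 qed
 have z1: "cm (%h. w h * I (E i h)) = 0" if i: "i : J" "i ~: J0" for i
 proof -
  have "cm (%h. zt h * I (E i h)) = 0" if "chr zt" for zt
   using type0_corr1[OF p(1)[OF i(1)] p(2)[OF i(1)] that _ n] i unfolding E_def J0_def by blast
  then have "cmod (cm (%h. w h * I (E i h))) <= Re (w 0) * 0"
   by (intro TP_bound[OF TPw bEI[OF i(1)]]) simp
  then show ?thesis by simp
 qed
 have DE: "D h = (%x. \<Sum>i\<in>J. E i h x)" for h unfolding D E_def ..
 have ipsum: "cm (%h. w h * ip (%x. \<Sum>i\<in>K. E i h x) (%x. \<Sum>j\<in>K. E j (- h) x)) = (\<Sum>i\<in>K. \<Sum>j\<in>K. cm (%h. w h * ip (E i h) (E j (- h))))"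
  if K: "K <= J" for K
 proof -
  have "w h * ip (%x. \<Sum>i\<in>K. E i h x) (%x. \<Sum>j\<in>K. E j (- h) x) = (\<Sum>i\<in>K. \<Sum>j\<in>K. w h * ip (E i h) (E j (- h)))" for h
   using K EA by (simp add: ip_sum_left ip_sum_right A_sum subset_iff sum_distrib_left)
  then have "cm (%h. w h * ip (%x. \<Sum>i\<in>K. E i h x) (%x. \<Sum>j\<in>K. E j (- h) x)) = cm (%h. \<Sum>i\<in>K. \<Sum>j\<in>K. w h * ip (E i h) (E j (- h)))" by (simp only:)
  also have "... = (\<Sum>i\<in>K. cm (%h. \<Sum>j\<in>K. w h * ip (E i h) (E j (- h))))" using K by (intro cm_sum bdd_sum bdd_mult bw bE) auto
  also have "... = (\<Sum>i\<in>K. \<Sum>j\<in>K. cm (%h. w h * ip (E i h) (E j (- h))))" using K by (intro sum.cong refl cm_sum bdd_mult bw bE) auto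
  finally show ?thesis .
 qed
 have A1: "cm (%h. w h * ip (D h) (D (- h))) = cm (%h. w h * ip (D0 h) (D0 (- h)))"
 proof -
  have "(\<Sum>i\<in>J. \<Sum>j\<in>J. cm (%h. w h * ip (E i h) (E j (- h)))) = (\<Sum>i\<in>J. \<Sum>j\<in>J0. cm (%h. w h * ip (E i h) (E j (- h))))"
   using J J0 z2 by (intro sum.cong refl sum.mono_neutral_right) auto
  also have "... = (\<Sum>i\<in>J0. \<Sum>j\<in>J0. cm (%h. w h * ip (E i h) (E j (- h))))"
  proof (rule sum.mono_neutral_right[OF J J0(2)], intro ballI sum.neutral)
   fix i j assume ij: "i : J - J0" "j : J0"
   then have "j : J" using J0(2) by blast
   with ij show "cm (%h. w h * ip (E i h) (E j (- h))) = 0" by (intro z2) auto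
  qed
  finally show ?thesis using ipsum[OF subset_refl] ipsum[OF J0(2)] unfolding DE D0_def[abs_def] by simp
 qed
 have Isum: "cm (%h. w h * I (%x. \<Sum>i\<in>K. E i h x)) = (\<Sum>i\<in>K. cm (%h. w h * I (E i h)))" if K: "K <= J" for K
 proof -
  have "w h * I (%x. \<Sum>i\<in>K. E i h x) = (\<Sum>i\<in>K. w h * I (E i h))" for h
   using K EA by (subst I_sum) (auto simp: sum_distrib_left)
  then have "cm (%h. w h * I (%x. \<Sum>i\<in>K. E i h x)) = cm (%h. \<Sum>i\<in>K. w h * I (E i h))" by (simp only:)
  also have "... = (\<Sum>i\<in>K. cm (%h. w h * I (E i h)))" using K by (intro cm_sum bdd_mult bw bEI) auto
  finally show ?thesis .
 qed
 have A2: "cm (%h. w h * I (D h)) = cm (%h. w h * I (D0 h))"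
  using Isum[OF subset_refl] Isum[OF J0(2)] sum.mono_neutral_right[OF J J0(2), of "%i. cm (%h. w h * I (E i h))"] z1
  unfolding DE D0_def[abs_def] by simp
 have bI0: "bdd (%h. I (D0 h))" by (rule bdd_I[OF D0A D0M])
 have b00: "bdd (%h. ip (D0 h) (D0 h))" by (rule bdd_ip[OF D0A D0A D0M D0M])
 have b0m: "bdd (%h. ip (D0 h) (D0 (- h)))" by (rule bdd_ip[OF D0A D0A D0M D0M])
 have diff: "cmod (ip (D0 h) (D0 (- h)) - ip (D0 h) (D0 h)) <= M * \<kappa>1 + 2 * (M * M) * of_bool (~ P h)" for h
 proof -
  have e: "ip (D0 h) (D0 (- h)) - ip (D0 h) (D0 h) = ip (D0 h) (%x. D0 (- h) x - D0 h x)" by (simp add: ip_diff_right D0A)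
  have c: "nrm (%x. D0 (- h) x - D0 h x) = nrm (%x. D0 h x - D0 (- h) x)" by (rule nrm_diff_commute[OF D0A D0A])
  show ?thesis
  proof (cases "P h")
   case True
   then have "cmod (ip (D0 h) (%x. D0 (- h) x - D0 h x)) <= M * \<kappa>1" by (intro ip_bound A_diff D0A D0M) (simp add: c P_def)
   then show ?thesis using True by (simp add: e)
  next
   case False
   have "nrm (%x. D0 (- h) x - D0 h x) <= M + M" using nrm_diff_triangle[OF D0A D0A, of "- h" h] D0M[of h] D0M[of "- h"] by simp
   then have "cmod (ip (D0 h) (%x. D0 (- h) x - D0 h x)) <= M * (M + M)" by (intro ip_bound A_diff D0A D0M)
   moreover have "0 <= M * \<kappa>1" using M k1(1) by simp
   ultimately show ?thesis using False by (simp add: e algebra_simps)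
  qed
 qed
 have bw': "bdd (%h. Re (w h))" by (rule bdd_Re[OF bw])
 have bP: "bdd (%h. Re (w h) * of_bool (~ P h))" by (intro bdd_mult bw' bddI[of _ 1]) simp
 have "cmod (cm (%h. w h * (ip (D0 h) (D0 (- h)) - ip (D0 h) (D0 h)))) <= m (%h. Re (w h) * cmod (ip (D0 h) (D0 (- h)) - ip (D0 h) (D0 h)))"
  by (rule weight_le[OF w(1) bdd_diff[OF b0m b00]])
 also have "... <= m (%h. (M * \<kappa>1) * Re (w h) + (2 * (M * M)) * (Re (w h) * of_bool (~ P h)))"
 proof (rule m_mono)
  show "bdd (%h. Re (w h) * cmod (ip (D0 h) (D0 (- h)) - ip (D0 h) (D0 h)))" by (intro bdd_mult bw' bdd_norm bdd_diff b0m b00)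
  show "bdd (%h. (M * \<kappa>1) * Re (w h) + (2 * (M * M)) * (Re (w h) * of_bool (~ P h)))" by (intro bdd_add bdd_mult[OF bdd_const] bw' bP)
  fix h
  have "0 <= Re (w h)" using w(1) by (simp add: weight_def)
  from mult_left_mono[OF diff this, of h]
  show "Re (w h) * cmod (ip (D0 h) (D0 (- h)) - ip (D0 h) (D0 h)) <= (M * \<kappa>1) * Re (w h) + (2 * (M * M)) * (Re (w h) * of_bool (~ P h))"
   by (simp only: distrib_left mult_ac)
 qed
 also have "... = M * \<kappa>1 + 2 * (M * M) * m (%h. Re (w h) * of_bool (~ P h))"
  by (simp only: m_add[OF bdd_mult[OF bdd_const bw'] bdd_mult[OF bdd_const bP]] m_scale[OF bw'] m_scale[OF bP] weight_mean[OF w(1)] mult_1_right)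
 also have "... <= M * \<kappa>1 + 2 * (M * M) * \<kappa>2" using w(2) M by (intro add_left_mono mult_left_mono) auto
 also have "... <= \<kappa>" using k1 k2 by linarith
 finally have le: "cmod (cm (%h. w h * (ip (D0 h) (D0 (- h)) - ip (D0 h) (D0 h)))) <= \<kappa>" .
 have "cm (%h. w h * (ip (D0 h) (D0 (- h)) - ip (D0 h) (D0 h))) = cm (%h. w h * ip (D0 h) (D0 (- h))) - cm (%h. w h * ip (D0 h) (D0 h))"
  unfolding right_diff_distrib by (intro cm_diff bdd_mult bw b0m b00)
 then have "Re (cm (%h. w h * ip (D0 h) (D0 h))) - \<kappa> <= Re (cm (%h. w h * ip (D0 h) (D0 (- h))))"
  using le abs_Re_le_cmod[of "cm (%h. w h * ip (D0 h) (D0 (- h))) - cm (%h. w h * ip (D0 h) (D0 h))"] by (simp add: abs_le_iff)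
 moreover have "(cmod (cm (%h. w h * I (D0 h))))^2 <= Re (cm (%h. w h * ip (D0 h) (D0 h)))"
 proof -
  have "(cmod (cm (%h. w h * I (D0 h))))^2 <= m (%h. Re (w h) * (cmod (I (D0 h)))^2)" by (rule weight_sq[OF w(1) bI0])
  also have "... <= m (%h. Re (w h * ip (D0 h) (D0 h)))"
  proof (rule m_mono)
   show "bdd (%h. Re (w h) * (cmod (I (D0 h)))^2)" by (intro bdd_mult bw' bdd_power bdd_norm bI0)
   show "bdd (%h. Re (w h * ip (D0 h) (D0 h)))" by (intro bdd_Re bdd_mult bw b00)
   fix h
   have "(cmod (I (D0 h)))^2 <= (nrm (D0 h))^2" by (intro power_mono I_le_nrm D0A) simp
   also have "... = Re (ip (D0 h) (D0 h))" by (rule R_self[OF D0A, symmetric])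
   finally have "Re (w h) * (cmod (I (D0 h)))^2 <= Re (w h) * Re (ip (D0 h) (D0 h))" using w(1) by (intro mult_left_mono) (auto simp: weight_def)
   then show "Re (w h) * (cmod (I (D0 h)))^2 <= Re (w h * ip (D0 h) (D0 h))" using w(1) by (simp add: weight_def)
  qed
  finally show ?thesis by (simp only: Re_cm)
 qed
 ultimately show ?thesis using that[OF w(1)] unfolding A1 A2 by simp
qed

subsection \<open>Approximation by sums of eigenvectors\<close>

definition psum :: "('x => complex) => bool" where
 "psum F \<longleftrightarrow> (EX N v. (ALL i<(N::nat). pure (v i)) & F = (%x. \<Sum>i<N. v i x))"

lemma psum_A: assumes "psum F" shows "F : A"
proof -
 obtain N :: nat and v where h: "!!i. i < N ==> pure (v i)" "F = (%x. \<Sum>i<N. v i x)" using assms unfolding psum_def by blast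
 then have "v i : A" if "i : {..<N}" for i using that by (intro pure_A) simp
 then show ?thesis unfolding h(2) by (rule A_sum)
qed

lemma psum_add: assumes "psum F" "psum G" shows "psum (%x. F x + G x)"
proof -
 obtain N M :: nat and v u where h: "!!i. i < N ==> pure (v i)" "F = (%x. \<Sum>i<N. v i x)" "!!i. i < M ==> pure (u i)" "G = (%x. \<Sum>i<M. u i x)"
  using assms unfolding psum_def by blast
 show ?thesis unfolding psum_def h(2,4)
  by (rule exI[of _ "N + M"], rule exI[of _ "%i. if i < N then v i else u (i - N)"]) (use h in \<open>auto simp: sum_lessThan_split\<close>)
qed

lemma psum_scale: assumes "psum F" shows "psum (%x. c * F x)"
proof -
 obtain N :: nat and v where h: "!!i. i < N ==> pure (v i)" "F = (%x. \<Sum>i<N. v i x)" using assms unfolding psum_def by blast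
 show ?thesis unfolding psum_def h(2)
  by (rule exI[of _ N], rule exI[of _ "%i x. c * v i x"]) (use h in \<open>auto simp: sum_distrib_left intro: pure_scale\<close>)
qed

lemma psum_pure: "pure v ==> psum v"
 unfolding psum_def by (rule exI[of _ 1], rule exI[of _ "%_. v"]) simp

text \<open>A minimising sequence for the distance from \<open>f\<close> to the span. Variation by a
  pure vector bounds the correlations of the residual, and the parallelogram law makes the sequence
  Cauchy. The sequence is kept instead of a limit because its sup bounds may fail to be
  uniform.\<close>

lemma psum_approx:
 assumes f: "f : A" "nrm f <= 1"
 obtains s :: "nat => 'x => complex" where "!!n. psum (s n)" "!!n. dst f (s n) <= 2"
  "!!n v. pure v ==> nrm v <= 1 ==> R v (%x. f x - s n x) <= 1 / real (Suc n)"
  "!!e. 0 < e ==> EX N. ALL m>=N. ALL n>=N. dst (s m) (s n) <= e"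
proof -
 define X where "X = {(dst f F)\<^sup>2 | F. psum F}"
 define d where "d = Inf X"
 have z: "psum (%x. 0)" unfolding psum_def by (rule exI[of _ 0]) simp
 have X: "X ~= {}" "bdd_below X" unfolding X_def using z by (auto intro!: bdd_belowI[of _ 0])
 have lo: "d <= (dst f F)^2" if "psum F" for F
  unfolding d_def by (rule cInf_lower[OF _ X(2)]) (use that in \<open>auto simp: X_def\<close>)
 have d1: "d <= 1" using lo[OF z] f power_mono[OF f(2) nrm_nonneg[OF f(1)], of 2] by simp
 define e where "e n = 1 / real (Suc n)" for n
 have e: "0 < e n" "e n <= 1" for n by (auto simp: e_def)
 have "EX F. psum F & (dst f F)^2 < d + (e n)^2" for n
 proof -
  have "Inf X < d + (e n)^2" using e(1)[of n] by (simp add: d_def)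
  then show ?thesis unfolding cInf_less_iff[OF X] by (auto simp: X_def)
 qed
 then obtain s where s: "!!n. psum (s n)" "!!n. (dst f (s n))^2 < d + (e n)^2" by metis
 have sA: "s n : A" for n by (rule psum_A[OF s(1)])
 have gA: "(%x. f x - s n x) : A" for n by (intro A_diff f sA)
 have e2: "(e n)^2 <= 1" for n using e[of n] by (simp add: power_le_one)
 show ?thesis
 proof (rule that[OF s(1)])
  show "dst f (s n) <= 2" for n
  proof (rule power2_le_imp_le)
   show "(dst f (s n))^2 <= 2^2" using s(2)[of n] d1 e2[of n] by simp
  qed simp
  show "R v (%x. f x - s n x) <= 1 / real (Suc n)" if v: "pure v" "nrm v <= 1" for n v
  proof -
   have vA: "v : A" by (rule pure_A[OF v(1)])
   have "psum (%x. s n x + cx (e n) * v x)" by (intro psum_add s psum_scale psum_pure v)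
   from lo[OF this] have "d <= (nrm (%x. (f x - s n x) + cx (- e n) * v x))^2" by (simp add: algebra_simps)
   also have "... = (dst f (s n))^2 + 2 * (- e n) * R (%x. f x - s n x) v + (- e n)^2 * (nrm v)^2" by (rule nrm_line_sq[OF gA vA])
   also have "(- e n)^2 * (nrm v)^2 <= (e n)^2 * 1" using power_mono[OF v(2) nrm_nonneg[OF vA], of 2] by (intro mult_mono) auto
   finally have "2 * e n * R (%x. f x - s n x) v <= 2 * (e n)^2" using s(2)[of n] by simp
   then have "e n * R (%x. f x - s n x) v <= e n * e n" by (simp add: power2_eq_square)
   then have "R (%x. f x - s n x) v <= e n" using e(1)[of n] by simp
   then show ?thesis unfolding R_sym[OF vA gA] e_def .
  qed
  have cl: "(dst (s m) (s n))^2 <= 2 * (e m)^2 + 2 * (e n)^2" for m n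
  proof -
   have "psum (%x. cx (1/2) * (s m x + s n x))" by (intro psum_scale psum_add s)
   from lo[OF this] have "d <= (nrm (%x. cx (1/2) * ((f x - s m x) + (f x - s n x))))^2" by (simp add: algebra_simps)
   also have "... = (1/4) * (nrm (%x. (f x - s m x) + (f x - s n x)))^2"
    by (subst nrm_scale) (auto intro!: A_intros f sA simp: power2_eq_square)
   finally have "4 * d <= (dst f (s m))^2 + 2 * R (%x. f x - s m x) (%x. f x - s n x) + (dst f (s n))^2"
    unfolding nrm_add_sq[OF gA gA] by simp
   moreover have "(nrm (%x. (f x - s n x) - (f x - s m x)))^2 = (dst f (s n))^2 - 2 * R (%x. f x - s n x) (%x. f x - s m x) + (dst f (s m))^2"
    by (rule nrm_diff_sq[OF gA gA])
   moreover have "R (%x. f x - s n x) (%x. f x - s m x) = R (%x. f x - s m x) (%x. f x - s n x)" by (rule R_sym[OF gA gA])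
   moreover have "(%x. (f x - s n x) - (f x - s m x)) = (%x. s m x - s n x)" by (simp add: algebra_simps)
   ultimately show ?thesis using s(2)[of m] s(2)[of n] by simp
  qed
  show "EX N. ALL m>=N. ALL n>=N. dst (s m) (s n) <= t" if t: "0 < t" for t
  proof -
   have "0 < t / 2" using t by simp
   then obtain N where N: "inverse (real (Suc N)) < t / 2" using reals_Archimedean by blast
   have le: "(e n)^2 <= (t / 2)^2" if "N <= n" for n
   proof -
    have "e n <= inverse (real (Suc N))" unfolding e_def inverse_eq_divide using that by (intro divide_left_mono) auto
    then show ?thesis using N e(1)[of n] by (intro power_mono) auto
   qed
   have "dst (s m) (s n) <= t" if "N <= m" "N <= n" for m n
   proof (rule power2_le_imp_le)
    show "(dst (s m) (s n))^2 <= t^2" using cl[of m n] le[OF that(1)] le[OF that(2)] by (simp add: power_divide)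
   qed (use t in simp)
   then show ?thesis by blast
  qed
 qed
qed

section \<open>Removal of residuals from the fourfold correlation\<close>

text \<open>If the exceptional set of \<open>gvn\<close> had positive measure,
  \<open>pure_exists\<close> would give a pure vector correlating too well with \<open>g\<close>.
  The threshold does not depend on \<xi>, so it serves all characters of a weight at once.\<close>

lemma van:
 assumes p: "fin_idx (q1 - q0) TYPE('a)" "fin_idx (q2 - q0) TYPE('a)" "fin_idx (q1 - q2) TYPE('a)" "fin_idx (q0 - q3) TYPE('a)"
  and K: "0 < (K::real)" and \<kappa>: "0 < (\<kappa>::real)"
 obtains \<sigma> where "0 < \<sigma>" "!!g F1 F2 F3 \<xi>. g : A ==> nrm g <= 2 ==> (!!v. pure v ==> nrm v <= 1 ==> R v g <= \<sigma>) ==>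
   F1 : A ==> F2 : A ==> F3 : A ==> (!!x. cmod (F1 x) <= K) ==> (!!x. cmod (F2 x) <= K) ==> (!!x. cmod (F3 x) <= K) ==> chr \<xi> ==>
   cmod (cm (%h. \<xi> h * cor4 q0 q1 q2 q3 g F1 F2 F3 h)) <= \<kappa>"
proof -
 obtain C where C: "0 < C" "!!g k1 k2 k3 \<xi> \<eta>. g : A ==> k1 : A ==> k2 : A ==> k3 : A ==> nrm g <= 1 ==> (!!x. cmod (k1 x) <= 1) ==>
   (!!x. cmod (k2 x) <= 1) ==> nrm k3 <= 1 ==> chr \<xi> ==> 0 <= \<eta> ==>
   (cmod (cm (%h. \<xi> h * cor4 q0 q1 q2 q3 g k1 k2 k3 h)))^2 <=
   C * \<eta> + msr {l. EX zt. chr zt & \<eta> < cmod (ip (tr (zsmul (q0 - q3) l) g) (%x. ch zt x * g x))}"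
  by (rule gvn[OF p(1-3), of q3]) blast
 \<comment> \<open>Undoes the normalisation of \<open>g\<close> by 2 and of the other three
   functions by \<open>K\<close>.\<close>
 define c where "c = 2 * K ^ 3"
 have c: "0 < c" using K by (simp add: c_def)
 define \<sigma> where "\<sigma> = (\<kappa> / c)^2 / C"
 have \<sigma>: "0 < \<sigma>" "C * \<sigma> = (\<kappa> / c)^2" using C(1) \<kappa> c by (auto simp: \<sigma>_def)
 show ?thesis
 proof (rule that[OF \<sigma>(1)])
  fix g F1 F2 F3 \<xi>
  assume g: "g : A" "nrm g <= 2" and pv: "!!v. pure v ==> nrm v <= 1 ==> R v g <= \<sigma>"
   and F: "F1 : A" "F2 : A" "F3 : A" and B: "!!x. cmod (F1 x) <= K" "!!x. cmod (F2 x) <= K" "!!x. cmod (F3 x) <= K" and \<xi>: "chr (\<xi> :: 'a => complex)"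
  define g' where "g' x = cx (1/2) * g x" for x
  define N where "N F x = cx (1/K) * F x" for F :: "'x => complex" and x
  have gA: "g' : A" unfolding g'_def[abs_def] by (intro A_intros g)
  have NA: "N F : A" if "F : A" for F unfolding N_def[abs_def] by (intro A_intros that)
  have gn: "nrm g' <= 1" unfolding g'_def[abs_def] using g by (subst nrm_scale) auto
  have NB: "cmod (N F x) <= 1" if "!!x. cmod (F x) <= K" for F x using that[of x] K by (simp add: N_def norm_mult norm_divide)
  have N3: "nrm (N F3) <= 1" by (intro nrm_bound NA F NB B)
  define S where "S = {l. EX zt. chr zt & \<sigma> < cmod (ip (tr (zsmul (q0 - q3) l) g') (%x. ch zt x * g' x))}"
  have S: "msr S = 0"
  proof (rule ccontr)
   assume "msr S ~= 0"
   then have "0 < msr S" using msr_nonneg[of S] by simp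
   moreover have "EX zt. chr zt & \<sigma> <= cmod (ip (tr (zsmul (q0 - q3) l) g') (%x. ch zt x * g' x))" if "l : S" for l
    using that unfolding S_def by (auto intro: less_imp_le)
   ultimately obtain v where v: "pure v" "nrm v <= 1" "\<sigma> <= R v g'"
    using pure_exists[OF gA gn p(4) _ \<sigma>(1), of S] by blast
   have "ip v g' = cnj (cx (1/2)) * ip v g" unfolding g'_def[abs_def] by (intro ip_scale_right pure_A v g)
   then have "R v g' = Re (cnj (cx (1/2)) * ip v g)" by (rule arg_cong)
   also have "... = (1/2) * R v g" unfolding times_complex.sel by simp
   also have "... <= (1/2) * \<sigma>" using pv[OF v(1,2)] by simp
   finally show False using v(3) \<sigma>(1) by simp
  qed
  define G where "G h = I (%x. tr (zsmul q0 h) g' x * tr (zsmul q1 h) (N F1) x * tr (zsmul q2 h) (N F2) x * tr (zsmul q3 h) (N F3) x)" for h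
  have "(cmod (cm (%h. \<xi> h * G h)))^2 <= C * \<sigma> + msr S"
   unfolding G_def S_def by (intro C(2) gA NA F gn NB B N3 \<xi> less_imp_le \<sigma>)
  then have "(cmod (cm (%h. \<xi> h * G h)))^2 <= (\<kappa> / c)^2" unfolding S \<sigma>(2) by simp
  then have leq: "cmod (cm (%h. \<xi> h * G h)) <= \<kappa> / c" by (rule power2_le_imp_le) (use \<kappa> c in simp)
  have e: "cor4 q0 q1 q2 q3 g F1 F2 F3 h = cx c * G h" for h
  proof -
   have "cx c * G h = I (%x. cx c * (tr (zsmul q0 h) g' x * tr (zsmul q1 h) (N F1) x * tr (zsmul q2 h) (N F2) x * tr (zsmul q3 h) (N F3) x))"
    unfolding G_def by (intro I_scale[symmetric] A_intros gA NA F)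
   moreover have "cx c * (tr (zsmul q0 h) g' x * tr (zsmul q1 h) (N F1) x * tr (zsmul q2 h) (N F2) x * tr (zsmul q3 h) (N F3) x)
    = tr (zsmul q0 h) g x * tr (zsmul q1 h) F1 x * tr (zsmul q2 h) F2 x * tr (zsmul q3 h) F3 x" for x
    unfolding g'_def[abs_def] N_def[abs_def] tr_scale c_def using K by (simp add: power3_eq_cube)
   ultimately show ?thesis by simp
  qed
  have bd: "bdd (%h. \<xi> h * G h)"
  proof -
   have "bdd G"
   proof (rule bddI[of _ 1])
    fix h
    have "nrm (%x. (tr (zsmul q1 h) (N F1) x * tr (zsmul q2 h) (N F2) x * tr (zsmul q3 h) (N F3) x) * tr (zsmul q0 h) g' x) <= 1 * nrm (tr (zsmul q0 h) g')"
    proof (rule nrm_mult_bound(1))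
     fix x
     have "cmod (tr (zsmul q1 h) (N F1) x) * cmod (tr (zsmul q2 h) (N F2) x) * cmod (tr (zsmul q3 h) (N F3) x) <= 1 * 1 * 1"
      by (intro mult_mono tr_cmod_le NB B mult_nonneg_nonneg) auto
     then show "cmod (tr (zsmul q1 h) (N F1) x * tr (zsmul q2 h) (N F2) x * tr (zsmul q3 h) (N F3) x) <= 1" by (simp add: norm_mult)
    qed (intro A_intros NA F gA)+
    then have "nrm (%x. tr (zsmul q0 h) g' x * tr (zsmul q1 h) (N F1) x * tr (zsmul q2 h) (N F2) x * tr (zsmul q3 h) (N F3) x) <= 1"
     using gn by (simp add: nrm_tr gA mult_ac)
    then show "cmod (G h) <= 1" unfolding G_def using I_le_nrm[OF A_mult[OF A_mult[OF A_mult[OF A_tr[OF gA] A_tr[OF NA[OF F(1)]]] A_tr[OF NA[OF F(2)]]] A_tr[OF NA[OF F(3)]]]] order_trans by blast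
   qed
   then show ?thesis by (rule bdd_mult[OF chr_bdd[OF \<xi>]])
  qed
  have "cm (%h. \<xi> h * (cx c * G h)) = cm (%h. cx c * (\<xi> h * G h))" by (simp only: mult.left_commute)
  also have "... = cx c * cm (%h. \<xi> h * G h)" by (rule cm_scale[OF bd])
  finally have "cmod (cm (%h. \<xi> h * (cx c * G h))) = c * cmod (cm (%h. \<xi> h * G h))" using c by (simp add: norm_mult)
  also have "... <= c * (\<kappa> / c)" using leq c by (intro mult_left_mono) auto
  also have "... = \<kappa>" using c by simp
  finally have "cmod (cm (%h. \<xi> h * (cx c * G h))) <= \<kappa>" .
  then show "cmod (cm (%h. \<xi> h * cor4 q0 q1 q2 q3 g F1 F2 F3 h)) <= \<kappa>"
   unfolding e .
 qed
qed

end

section \<open>The weighted average of the correlation\<close>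

context sysm
begin

text \<open>The residual of \<open>f\<close> against \<open>u k\<close> is negligible by
  \<open>van\<close>, with \<open>k\<close> chosen after the weight and the sup bounds of the other
  factors. The difference of \<open>u k\<close> and \<open>t\<close> is small in L2 uniformly in
  \<open>k\<close>, and costs sup bounds on two of the other factors and an L2 bound on the
  third.\<close>

lemma repl:
 assumes p: "fin_idx (q1 - q0) TYPE('a)" "fin_idx (q2 - q0) TYPE('a)" "fin_idx (q1 - q2) TYPE('a)" "fin_idx (q0 - q3) TYPE('a)"
  and w: "weight w" and A: "f : A" "!!k. u k : A" "t : A" "F1 : A" "F2 : A" "F3 : A"
  and n2: "!!k. dst f (u k) <= 2"
  and R: "!!k v. pure v ==> nrm v <= 1 ==> R v (%x. f x - u k x) <= 1 / real (Suc k)"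
  and cl: "!!k. n0 <= k ==> dst (u k) t <= e"
  and b: "!!x. cmod (F1 x) <= b1" "!!x. cmod (F2 x) <= b2" "nrm F3 <= b3" and c: "e * (b1 * b2 * b3) <= c"
  and T: "!!g h. T g h = cor4 q0 q1 q2 q3 g F1 F2 F3 h"
 shows "cmod (cm (%h. w h * T f h) - cm (%h. w h * T t h)) <= c"
proof -
 have TPw: "TP w" using w by (simp add: weight_def)
 have bw: "bdd w" by (rule weight_bdd[OF w])
 obtain B1 where B1: "0 < B1" "!!x. cmod (F1 x) <= B1" by (rule A_bound[OF A(4)]) blast
 obtain B2 where B2: "0 < B2" "!!x. cmod (F2 x) <= B2" by (rule A_bound[OF A(5)]) blast
 obtain B3 where B3: "0 < B3" "!!x. cmod (F3 x) <= B3" by (rule A_bound[OF A(6)]) blast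
 define K where "K = B1 + B2 + B3"
 have K: "0 < K" "cmod (F1 x) <= K" "cmod (F2 x) <= K" "cmod (F3 x) <= K" for x
  using B1(1) B2(1) B3(1) B1(2)[of x] B2(2)[of x] B3(2)[of x] unfolding K_def by linarith+
 have fA: "(%x. tr (zsmul q1 h) F1 x * tr (zsmul q2 h) F2 x * tr (zsmul q3 h) F3 x) : A" for h by (intro A_intros A)
 have TI: "T g h = I (%x. tr (zsmul q0 h) g x * (tr (zsmul q1 h) F1 x * tr (zsmul q2 h) F2 x * tr (zsmul q3 h) F3 x))" for g h
  unfolding T by (simp only: mult.assoc)
 have Tb: "cmod (T g h) <= nrm g * (b1 * b2 * b3)" if g: "g : A" for g h
 proof -
  have "T g h = ip (tr (zsmul q0 h) g) (%x. cnj (tr (zsmul q1 h) F1 x * tr (zsmul q2 h) F2 x * tr (zsmul q3 h) F3 x))"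
   unfolding TI ip_def complex_cnj_cnj ..
  also have "cmod ... <= nrm g * (b1 * b2 * b3)"
  proof (rule ip_bound[OF A_tr[OF g] A_cnj[OF fA]])
   show "nrm (tr (zsmul q0 h) g) <= nrm g" by (simp add: nrm_tr g)
   show "nrm (%x. cnj (tr (zsmul q1 h) F1 x * tr (zsmul q2 h) F2 x * tr (zsmul q3 h) F3 x)) <= b1 * b2 * b3"
    unfolding nrm_cnj[OF fA] by (intro nrm_prod3 A_tr A tr_cmod_le b) (simp add: nrm_tr A b)
  qed
  finally show ?thesis .
 qed
 have bT: "bdd (T g)" if "g : A" for g by (rule bddI[of _ "nrm g * (b1 * b2 * b3)"]) (rule Tb[OF that])
 have Td: "T (%x. g x - g' x) h = T g h - T g' h" if "g : A" "g' : A" for g g' h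
  unfolding TI tr_diff left_diff_distrib by (intro I_diff A_mult A_tr fA that)
 have dA: "(%x. f x - u k x) : A" "(%x. u k x - t x) : A" for k by (intro A_diff A)+
 show ?thesis
 proof (rule field_le_epsilon)
  fix \<kappa> :: real assume kp: "0 < \<kappa>"
  define W where "W = Re (w 0) + 1"
  have W: "0 < W" "Re (w 0) <= W" using TP_zero_nonneg[OF TPw] by (simp_all add: W_def)
  have kW: "0 < \<kappa> / W" using kp W by simp
  obtain \<sigma> where s: "0 < \<sigma>" "!!g F1 F2 F3 \<xi>. g : A ==> nrm g <= 2 ==> (!!v. pure v ==> nrm v <= 1 ==> R v g <= \<sigma>) ==>
   F1 : A ==> F2 : A ==> F3 : A ==> (!!x. cmod (F1 x) <= K) ==> (!!x. cmod (F2 x) <= K) ==> (!!x. cmod (F3 x) <= K) ==> chr \<xi> ==>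
   cmod (cm (%h. \<xi> h * cor4 q0 q1 q2 q3 g F1 F2 F3 h)) <= \<kappa> / W"
   by (rule van[OF p K(1) kW]) blast
  obtain N where N: "inverse (real (Suc N)) < \<sigma>" using reals_Archimedean[OF s(1)] by blast
  define k where "k = max N n0"
  have k1: "1 / real (Suc k) <= \<sigma>"
  proof -
   have "1 / real (Suc k) <= inverse (real (Suc N))" unfolding inverse_eq_divide by (intro divide_left_mono) (auto simp: k_def)
   then show ?thesis using N by simp
  qed
  have 1: "cmod (cm (%h. w h * T (%x. f x - u k x) h)) <= Re (w 0) * (\<kappa> / W)"
  proof (rule TP_bound[OF TPw bT[OF dA(1)]])
   fix zt :: "'a => complex" assume z: "chr zt"
   show "cmod (cm (%h. zt h * T (%x. f x - u k x) h)) <= \<kappa> / W"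
    unfolding T by (rule s(2)[OF dA(1) n2 order_trans[OF R k1] A(4-6) K(2-4) z])
  qed
  also have "... <= W * (\<kappa> / W)" using W kW by (intro mult_right_mono) auto
  also have "... = \<kappa>" using W by simp
  finally have 1: "cmod (cm (%h. w h * T (%x. f x - u k x) h)) <= \<kappa>" .
  have "cmod (T (%x. u k x - t x) h) <= c" for h
  proof -
   have b0: "0 <= b1 * b2 * b3"
   proof -
    have "0 <= b1" "0 <= b2" "0 <= b3" using b norm_ge_zero nrm_nonneg[OF A(6)] order_trans by blast+
    then show ?thesis by simp
   qed
   have "cmod (T (%x. u k x - t x) h) <= dst (u k) t * (b1 * b2 * b3)" by (rule Tb[OF dA(2)])
   also have "... <= e * (b1 * b2 * b3)" by (rule mult_right_mono[OF cl b0]) (simp add: k_def)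
   finally show ?thesis using c by simp
  qed
  from weight_bound[OF w bT[OF dA(2)] this] have 2: "cmod (cm (%h. w h * T (%x. u k x - t x) h)) <= c" .
  have "w h * T f h = (w h * T (%x. f x - u k x) h + w h * T (%x. u k x - t x) h) + w h * T t h" for h
   unfolding Td[OF A(1,2)] Td[OF A(2,3)] by (simp add: algebra_simps)
  then have "cm (%h. w h * T f h) = cm (%h. (w h * T (%x. f x - u k x) h + w h * T (%x. u k x - t x) h) + w h * T t h)" by (simp only:)
  also have "... = cm (%h. w h * T (%x. f x - u k x) h) + cm (%h. w h * T (%x. u k x - t x) h) + cm (%h. w h * T t h)"
   by (subst cm_add, (intro bdd_add bdd_mult bw bT dA A)+, subst cm_add) (intro bdd_mult bw bT dA refl)+
  finally have "cmod (cm (%h. w h * T f h) - cm (%h. w h * T t h)) <= cmod (cm (%h. w h * T (%x. f x - u k x) h)) + cmod (cm (%h. w h * T (%x. u k x - t x) h))"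
   using norm_triangle_ineq by simp
  then show "cmod (cm (%h. w h * T f h) - cm (%h. w h * T t h)) <= c + \<kappa>" using 1 2 by simp
 qed
qed

lemma pd_zsmul: assumes "pd ph" shows "pd (%h. ph (zsmul k h))"
 unfolding pd_def zsmul_diff_right
 using pdD[OF assms, where p = "%i. zsmul k (p i)" for p] by blast

text \<open>Subtracting the constant \<open>dl\<close> from \<open>f\<close> subtracts its square
  from the correlation function, which stays positive definite and so has nonnegative mean.\<close>

lemma mean_corr: assumes f: "f : A" "!!x. cnj (f x) = f x" "I f = cx dl"
 shows "dl\<^sup>2 <= Re (cm (%h. ip (tr (zsmul k h) f) f))"
proof -
 let ?F = "%x. f x - cx dl"
 have FA: "?F : A" by (intro A_intros f)
 have e: "ip (tr g ?F) ?F = ip (tr g f) f - cx (dl\<^sup>2)" for g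
 proof -
  have t: "tr g ?F = (%x. tr g f x - cx dl)" by (rule ext) (simp add: tr_def)
  have "ip (tr g ?F) ?F = ip (tr g f) f - ip (tr g f) (%x. cx dl) - (ip (%x. cx dl) f - ip (%x. cx dl) (%x. cx dl))"
   unfolding t by (simp add: ip_diff_left ip_diff_right A_intros f)
  also have "ip (tr g f) (%x. cx dl) = cx (dl\<^sup>2)"
  proof -
   have "ip (tr g f) (%x. cx dl) = I (%x. cx dl * tr g f x)" unfolding ip_def by (simp add: mult.commute)
   also have "... = cx dl * I (tr g f)" by (intro I_scale A_tr f)
   finally show ?thesis using f by (simp add: I_tr power2_eq_square)
  qed
  also have "ip (%x. cx dl) f = cx (dl\<^sup>2)"
   unfolding ip_def f(2) using I_scale[OF f(1)] f(3) by (simp add: power2_eq_square)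
  also have "ip (%x. cx dl) (%x. cx dl) = cx (dl\<^sup>2)" unfolding ip_def by (simp add: power2_eq_square)
  finally show ?thesis by simp
 qed
 have "0 <= Re (cm (%h. ip (tr (zsmul k h) ?F) ?F))" by (intro pd_mean_nonneg pd_zsmul gam_pd FA)
 also have "cm (%h. ip (tr (zsmul k h) ?F) ?F) = cm (%h. ip (tr (zsmul k h) f) f) - cx (dl\<^sup>2)"
  unfolding e by (subst cm_diff) (auto intro!: bdd_gam f bdd_const simp del: of_real_power)
 finally show ?thesis by simp
qed

text \<open>The outer two factors are exchanged for \<open>s n0\<close> and its conjugate while the
  others are still bounded by 1; the inner two need the finer index \<open>n1\<close>, chosen after
  the sup bound \<open>K\<close> of \<open>s n0\<close>. Equal indices at opposite shifts are what
  turns the correlation into the inner product of \<open>D h\<close> and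
  \<open>D (- h)\<close>.\<close>

lemma core:
 assumes f: "f : A" "!!x. cnj (f x) = f x" "!!x. cmod (f x) <= 1" "I f = cx dl" "0 <= dl" "dl <= 1"
  and fi: "fin_idx (a + b) TYPE('a)" "fin_idx (a - b) TYPE('a)" "fin_idx (2 * a) TYPE('a)" "fin_idx (2 * b) TYPE('a)"
  and eps: "0 < (eps::real)"
 obtains w where "weight w" "dl ^ 4 - eps <= Re (cm (%h. w h *
  cor4 (- a) b (- b) a f f f f h))"
proof -
 have e1: "- (a + b) = - a - b" "- (a + b) = - b - a" "- (a - b) = b - a" "- (a - b) = - a + b" by simp_all
 note fm = fin_idx_minus[OF fi(1), unfolded e1(1)] fin_idx_minus[OF fi(1), unfolded e1(2)] fin_idx_minus[OF fi(2), unfolded e1(3)]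
  fin_idx_minus[OF fi(2), unfolded e1(4)] fin_idx_minus[OF fi(3)] fin_idx_minus[OF fi(4)] fi(1)[unfolded add.commute[of a b]]
 have fi': "fin_idx (- a - b) TYPE('a)" "fin_idx (b - a) TYPE('a)" "fin_idx (- a + b) TYPE('a)" "fin_idx (- (2 * a)) TYPE('a)" "fin_idx (- (2 * b)) TYPE('a)" "fin_idx (b + a) TYPE('a)" "fin_idx (- b - a) TYPE('a)"
  by (rule fm)+
 have n: "fin_idx (2 * (a * a - b * b)) TYPE('a)"
 proof -
  have "fin_idx 2 TYPE('a)" using fi(3) by (rule fin_idx_dvd) simp
  from fin_idx_mult[OF this fin_idx_mult[OF fi(1,2)]] show ?thesis by (simp add: algebra_simps)
 qed
 have fn: "nrm f <= 1" by (rule nrm_bound[OF f(1,3)])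
 obtain s where s: "!!k. psum (s k)" "!!k. dst f (s k) <= 2"
  "!!k v. pure v ==> nrm v <= 1 ==> R v (%x. f x - s k x) <= 1 / real (Suc k)"
  "!!e. 0 < e ==> EX N. ALL k>=N. ALL l>=N. dst (s k) (s l) <= e"
  by (rule psum_approx[OF f(1) fn]) blast
 have sA: "s k : A" for k by (rule psum_A[OF s(1)])
 \<comment> \<open>Conjugate approximants serve for the two factors belonging to
   \<open>D (- h)\<close>; as \<open>f\<close> is real, they approximate it equally well.\<close>
 define sc where "sc k x = cnj (s k x)" for k x
 have scA: "sc k : A" for k unfolding sc_def[abs_def] by (intro A_intros sA)
 have sn: "nrm (s k) <= 3" for k
  using nrm_diff_ge[OF sA f(1), of k] s(2)[of k] fn nrm_diff_commute[OF sA f(1), of k] by simp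
 have scn: "nrm (sc k) <= 3" for k unfolding sc_def[abs_def] nrm_cnj[OF sA] by (rule sn)
 have sc2: "dst f (sc k) <= 2" for k
 proof -
  have "(%x. f x - sc k x) = (%x. cnj (f x - s k x))" by (simp add: sc_def f(2))
  then show ?thesis using nrm_cnj[OF A_diff[OF f(1) sA]] s(2)[of k] by simp
 qed
 have sc3: "R v (%x. f x - sc k x) <= 1 / real (Suc k)" if v: "pure v" "nrm v <= 1" for k v
 proof -
  have vA: "v : A" by (rule pure_A[OF v(1)])
  have "ip v (%x. f x - sc k x) = cnj (ip (%x. cnj (v x)) (%x. f x - s k x))"
   unfolding ip_def sc_def by (subst I_cnj[symmetric]) (auto intro!: A_intros vA f sA simp: f(2))
  then have "R v (%x. f x - sc k x) = R (%x. cnj (v x)) (%x. f x - s k x)" by simp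
  then show ?thesis using s(3)[OF pure_cnj[OF v(1)], of k] nrm_cnj[OF vA] v(2) by simp
 qed
 have sc4: "dst (sc k) (sc l) = dst (s k) (s l)" for k l
  unfolding sc_def complex_cnj_diff[symmetric] by (rule nrm_cnj[OF A_diff[OF sA sA]])
 \<comment> \<open>Spent are 10 parts on the four exchanges, 1 on \<open>psd\<close> and 8 on
   squaring the lower bound for the integral.\<close>
 define e where "e = eps / 20"
 have e: "0 < e" using eps by (simp add: e_def)
 obtain n0 where n0: "!!k. n0 <= k ==> dst (s k) (s n0) <= e" using s(4)[OF e] by blast
 obtain K0 where K0: "0 < K0" "!!x. cmod (s n0 x) <= K0" by (rule A_bound[OF sA[of n0]]) blast
 define K where "K = max K0 1"
 have K: "1 <= K" "!!x. cmod (s n0 x) <= K" using K0 by (auto simp: K_def le_max_iff_disj)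
 have Kc: "cmod (sc n0 x) <= K" for x using K(2) by (simp add: sc_def)
 \<comment> \<open>Compensates the factor \<open>K * K\<close> from the sup norms of two factors
   already exchanged.\<close>
 define e' where "e' = e / (K * K)"
 have KK: "1 * 1 <= K * K" by (rule mult_mono) (use K in auto)
 have e': "0 < e'" "e' * (K * 1 * 3) <= 3 * e" "e' * (K * K * 3) <= 3 * e" "e' * (1 * 1 * 3) <= 3 * e"
 proof -
  show p: "0 < e'" using e K by (simp add: e'_def)
  have q: "e' * (K * K) = e" using K by (simp add: e'_def)
  show "e' * (K * K * 3) <= 3 * e" using q by (simp add: mult.assoc[symmetric])
  have "e' * K <= e' * (K * K)" using p K by (intro mult_left_mono) auto
  then show "e' * (K * 1 * 3) <= 3 * e" using q by simp
  have "e' * 1 <= e' * (K * K)" using p KK by (intro mult_left_mono) auto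
  then show "e' * (1 * 1 * 3) <= 3 * e" using q by simp
 qed
 obtain n1 where n1: "!!k. n1 <= k ==> dst (s k) (s n1) <= e'" using s(4)[OF e'(1)] by blast
 obtain N v where v: "!!i. i < (N::nat) ==> pure (v i)" "s n0 = (%x. \<Sum>i<N. v i x)" using s(1)[of n0] unfolding psum_def by blast
 obtain N' v' where v': "!!i. i < (N'::nat) ==> pure (v' i)" "s n1 = (%x. \<Sum>i<N'. v' i x)" using s(1)[of n1] unfolding psum_def by blast
 define D where "D h = DD a b (s n0) (s n1) h" for h
 have Dsum: "D h = (%x. \<Sum>i\<in>{..<N} \<times> {..<N'}. DD a b (v (fst i)) (v' (snd i)) h x)" for h
  unfolding D_def v(2) v'(2) DD_def[abs_def] tr_sum sum_product sum.cartesian_product by (simp add: split_beta)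
 obtain w where w: "weight w" "(cmod (cm (%h. w h * I (D h))))^2 - e <= Re (cm (%h. w h * ip (D h) (D (- h))))"
  by (rule psd[of "{..<N} \<times> {..<N'}" "%i. v (fst i)" "%i. v' (snd i)" a b e D]) (use v(1) v'(1) n e Dsum in auto)
 define Q where "Q F0 F1 F2 F3 h = cor4 (- a) b (- b) a F0 F1 F2 F3 h" for F0 F1 F2 F3 h
 define C where "C F0 F1 F2 F3 = cm (%h. w h * Q F0 F1 F2 F3 h)" for F0 F1 F2 F3
 have one: "(%x. 1) : A" by (rule A_const)
 have s1: "e * (1 * 1 * 3) <= 3 * e" "e * (1 * 1 * 1) <= e" by simp_all
 have c4: "dst (sc k) (sc n0) <= e" if "n0 <= k" for k unfolding sc4 by (rule n0[OF that])
 have c4': "dst (sc k) (sc n1) <= e'" if "n1 <= k" for k unfolding sc4 by (rule n1[OF that])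
 have E3: "cmod (C f f f f - C f f f (sc n0)) <= e"
  unfolding C_def
  by (rule repl[where ?q0.0 = a and ?q1.0 = b and ?q2.0 = "- b" and ?q3.0 = "- a" and u = sc and ?F1.0 = f and ?F2.0 = f and ?F3.0 = f, OF _ _ _ _ w(1) f(1) scA scA f(1) f(1) f(1) sc2 sc3 c4 f(3) f(3) fn s1(2)])
   (use fi fi' in \<open>simp_all add: Q_def mult_ac add.commute\<close>)
 have E0: "cmod (C f f f (sc n0) - C (s n0) f f (sc n0)) <= 3 * e"
  unfolding C_def
  by (rule repl[where ?q0.0 = "- a" and ?q1.0 = b and ?q2.0 = "- b" and ?q3.0 = a and u = s and ?F1.0 = f and ?F2.0 = f and ?F3.0 = "sc n0", OF _ _ _ _ w(1) f(1) sA sA f(1) f(1) scA s(2) s(3) n0 f(3) f(3) scn s1(1)])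
   (use fi fi' in \<open>simp_all add: Q_def mult_ac add.commute\<close>)
 have E1: "cmod (C (s n0) f f (sc n0) - C (s n0) (s n1) f (sc n0)) <= 3 * e"
  unfolding C_def
  by (rule repl[where ?q0.0 = b and ?q1.0 = "- a" and ?q2.0 = "- b" and ?q3.0 = a and u = s and ?F1.0 = "s n0" and ?F2.0 = f and ?F3.0 = "sc n0", OF _ _ _ _ w(1) f(1) sA sA sA f(1) scA s(2) s(3) n1 K(2) f(3) scn e'(2)])
   (use fi fi' in \<open>simp_all add: Q_def mult_ac add.commute\<close>)
 have E2: "cmod (C (s n0) (s n1) f (sc n0) - C (s n0) (s n1) (sc n1) (sc n0)) <= 3 * e"
  unfolding C_def
  by (rule repl[where ?q0.0 = "- b" and ?q1.0 = "- a" and ?q2.0 = a and ?q3.0 = b and u = sc and ?F1.0 = "s n0" and ?F2.0 = "sc n0" and ?F3.0 = "s n1", OF _ _ _ _ w(1) f(1) scA scA sA scA sA sc2 sc3 c4' K(2) Kc sn e'(3)])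
   (use fi fi' in \<open>simp_all add: Q_def mult_ac add.commute\<close>)
 have c1: "cmod (1::complex) <= 1" by simp
 have D0: "cmod (C f f (%x. 1) (%x. 1) - C (s n0) f (%x. 1) (%x. 1)) <= e"
  unfolding C_def
  by (rule repl[where ?q0.0 = "- a" and ?q1.0 = b and ?q2.0 = "- b" and ?q3.0 = a and u = s and ?F1.0 = f and ?F2.0 = "%x. 1" and ?F3.0 = "%x. 1" and ?b3.0 = 1, OF _ _ _ _ w(1) f(1) sA sA f(1) one one s(2) s(3) n0 f(3) c1 _ s1(2)])
   (use fi fi' in \<open>simp_all add: Q_def mult_ac add.commute\<close>)
 have D1: "cmod (C (s n0) f (%x. 1) (%x. 1) - C (s n0) (s n1) (%x. 1) (%x. 1)) <= 3 * e"
  unfolding C_def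
  by (rule repl[where ?q0.0 = b and ?q1.0 = a and ?q2.0 = "- b" and ?q3.0 = "- a" and u = s and ?F1.0 = "%x. 1" and ?F2.0 = "%x. 1" and ?F3.0 = "s n0", OF _ _ _ _ w(1) f(1) sA sA one one sA s(2) s(3) n1 c1 c1 sn e'(4)])
   (use fi fi' in \<open>simp_all add: Q_def mult_ac add.commute\<close>)
 have QD: "Q (s n0) (s n1) (sc n1) (sc n0) h = ip (D h) (D (- h))" for h
  unfolding Q_def ip_def D_def DD_def sc_def[abs_def] tr_cnj by (simp add: zsmul_minus_left zsmul_minus_right mult_ac)
 have QI: "Q (s n0) (s n1) (%x. 1) (%x. 1) h = I (D h)" for h
  unfolding Q_def D_def DD_def[abs_def] by simp
 \<comment> \<open>The pair correlation is positive definite in \<open>h\<close>, so by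
   \<open>TP_pd\<close> its weighted average is at least its plain mean.\<close>
 have low: "dl\<^sup>2 <= Re (C f f (%x. 1) (%x. 1))"
 proof -
  have q: "Q f f (%x. 1) (%x. 1) h = ip (tr (zsmul (a + b) h) f) f" for h
  proof -
   have "Q f f (%x. 1) (%x. 1) h = I (%x. tr (zsmul (- a) h) f x * tr (zsmul b h) f x)" unfolding Q_def by simp
   also have "... = I (%x. tr (zsmul (- a) h) f (\<tau> (zsmul a h) x) * tr (zsmul b h) f (\<tau> (zsmul a h) x))"
    by (rule I_tau[symmetric]) (intro A_intros f)
   also have "... = ip (tr (zsmul (a + b) h) f) f"
    unfolding tr_tau ip_def f(2) by (simp add: zsmul_minus_left zsmul_add_left mult.commute add.commute)
   finally show ?thesis .
  qed
  have "Re (cm w) * Re (cm (%h. ip (tr (zsmul (a + b) h) f) f)) <= Re (cm (%h. w h * ip (tr (zsmul (a + b) h) f) f))"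
   using w(1) by (intro TP_pd pd_zsmul gam_pd f) (simp add: weight_def)
  moreover have "Re (cm w) = 1" using w(1) by (simp add: weight_def)
  ultimately show ?thesis using mean_corr[OF f(1,2,4), of "a + b"] unfolding C_def q by simp
 qed
 define z where "z = cmod (C (s n0) (s n1) (%x. 1) (%x. 1))"
 have z: "dl\<^sup>2 - 4 * e <= z"
 proof -
  have "cmod (C f f (%x. 1) (%x. 1) - C (s n0) (s n1) (%x. 1) (%x. 1)) <= 4 * e"
   using norm_triangle_ineq[of "C f f (%x. 1) (%x. 1) - C (s n0) f (%x. 1) (%x. 1)" "C (s n0) f (%x. 1) (%x. 1) - C (s n0) (s n1) (%x. 1) (%x. 1)"] D0 D1 by simp
  then have "cmod (C f f (%x. 1) (%x. 1)) <= z + 4 * e"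
   using norm_triangle_sub[of "C f f (%x. 1) (%x. 1)" "C (s n0) (s n1) (%x. 1) (%x. 1)"] unfolding z_def by linarith
  then show ?thesis using low complex_Re_le_cmod[of "C f f (%x. 1) (%x. 1)"] by linarith
 qed
 have z2: "dl ^ 4 - 8 * e <= z^2"
 proof -
  have d2: "0 <= dl\<^sup>2" "dl\<^sup>2 <= 1" using f(5,6) by (auto simp: power_le_one)
  have d4: "dl ^ 4 = dl\<^sup>2 * dl\<^sup>2" by (simp flip: power_add)
  have ed: "e * dl\<^sup>2 <= e * 1" using d2 e by (intro mult_left_mono) auto
  show ?thesis
  proof (cases "0 <= dl\<^sup>2 - 4 * e")
   case True
   have "(dl\<^sup>2 - 4 * e)^2 <= z^2" using z True by (rule power_mono)
   moreover have "(dl\<^sup>2 - 4 * e)^2 = dl\<^sup>2 * dl\<^sup>2 - 8 * (e * dl\<^sup>2) + 16 * (e * e)" by (simp add: power2_eq_square algebra_simps)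
   moreover have "0 <= e * e" by simp
   ultimately show ?thesis using ed unfolding d4 by linarith
  next
   case False
   have "dl\<^sup>2 * dl\<^sup>2 <= dl\<^sup>2 * 1" using d2 by (intro mult_left_mono) auto
   then show ?thesis unfolding d4 using False e zero_le_power2[of z] by linarith
  qed
 qed
 have P: "z^2 - e <= Re (C (s n0) (s n1) (sc n1) (sc n0))" using w(2) unfolding z_def C_def QD QI .
 have "cmod (C f f f f - C (s n0) (s n1) (sc n1) (sc n0)) <= 10 * e"
 proof -
  have "C f f f f - C (s n0) (s n1) (sc n1) (sc n0) = (C f f f f - C f f f (sc n0)) + (C f f f (sc n0) - C (s n0) f f (sc n0))
   + (C (s n0) f f (sc n0) - C (s n0) (s n1) f (sc n0)) + (C (s n0) (s n1) f (sc n0) - C (s n0) (s n1) (sc n1) (sc n0))" by simp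
  also have "cmod ... <= e + 3 * e + 3 * e + 3 * e" by (intro norm_triangle_mono E0 E1 E2 E3)
  finally show ?thesis by simp
 qed
 then have "Re (C (s n0) (s n1) (sc n1) (sc n0)) - 10 * e <= Re (C f f f f)"
  using abs_Re_le_cmod[of "C f f f f - C (s n0) (s n1) (sc n1) (sc n0)"] by (simp add: abs_le_iff)
 then have "dl ^ 4 - eps <= Re (C f f f f)" using P z2 e unfolding e_def by linarith
 then show ?thesis using that[OF w(1)] unfolding C_def Q_def by blast
qed

end

section \<open>Transfer to the group and conclusion\<close>

text \<open>Functions on the group enter the system as constant sequences, on which
  \<open>GI\<close> is the mean \<open>L\<close>.\<close>

lemma gns_core:
 fixes L m :: "('a::{ab_group_add, countable} => real) => real" and E :: "'a set"
 assumes L: "ext_mean L" and m: "inv_mean m"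
  and fi: "fin_idx (a + b) TYPE('a)" "fin_idx (a - b) TYPE('a)" "fin_idx (2 * a) TYPE('a)" "fin_idx (2 * b) TYPE('a)"
  and eps: "0 < (eps::real)"
 obtains w where "imean.weight m w" "L (indicat_real E) ^ 4 - eps <= Re (imean.cm m (%h. w h *
   cx (L (indicat_real {x. x + zsmul (- a) h : E & x + zsmul b h : E & x + zsmul (- b) h : E & x + zsmul a h : E}))))"
proof -
 interpret E: emean L by unfold_locales fact
 interpret S: sysm E.GA E.GI E.Gtau snd m using gns[OF L] m by (intro sysm.intro imean.intro)
 have const: "E.GI G = E.cm (%x. G (0, x))" if "!!n x. G (n, x) = G (0, x)" for G :: "nat \<times> 'a => complex"
 proof -
  have "(%n. E.cm (%x. G (n, x))) = (%n. E.cm (%x. G (0, x)))"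
   by (rule HOL.ext, rule arg_cong[where f = E.cm], rule HOL.ext, rule that)
  then show ?thesis unfolding E.GI_def by (simp only: lim_const)
 qed
 define f :: "nat \<times> 'a => complex" where "f z = of_bool (snd z : E)" for z
 have fA: "f : E.GA" by (simp add: E.GA_def E.l2_def f_def bddI[of _ 1])
 define dl where "dl = L (indicat_real E)"
 have d: "0 <= dl" "dl <= 1" unfolding dl_def by (auto intro!: E.m_nonneg E.m_le bdd_indicator' simp: indicator_def)
 have fI: "E.GI f = cx dl"
 proof -
  have "(%x. f (0, x)) = (%x. cx (indicat_real E x))" by (intro HOL.ext) (simp add: f_def indicator_def)
  then show ?thesis using const[of f] by (simp add: f_def E.cm_of_real dl_def)
 qed
 have f1: "cnj (f x) = f x" "cmod (f x) <= 1" for x by (simp_all add: f_def)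
 obtain w where w: "S.weight w" "dl ^ 4 - eps <= Re (S.cm (%h. w h *
  E.GI (%x. S.tr (zsmul (- a) h) f x * S.tr (zsmul b h) f x * S.tr (zsmul (- b) h) f x * S.tr (zsmul a h) f x)))"
  by (rule S.core[OF fA f1 fI d fi eps]) blast
 have "E.GI (%x. S.tr (zsmul (- a) h) f x * S.tr (zsmul b h) f x * S.tr (zsmul (- b) h) f x * S.tr (zsmul a h) f x)
  = cx (L (indicat_real {x. x + zsmul (- a) h : E & x + zsmul b h : E & x + zsmul (- b) h : E & x + zsmul a h : E}))" for h
 proof -
  let ?G = "%x. S.tr (zsmul (- a) h) f x * S.tr (zsmul b h) f x * S.tr (zsmul (- b) h) f x * S.tr (zsmul a h) f x"
  let ?D = "{x. x + zsmul (- a) h : E & x + zsmul b h : E & x + zsmul (- b) h : E & x + zsmul a h : E}"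
  have G: "?G (n, x) = cx (indicat_real ?D x)" for n x
   by (simp add: S.tr_def f_def E.Gtau_def indicator_def)
  have "E.GI ?G = E.cm (%x. ?G (0, x))" by (rule const) (simp only: G)
  also have "... = cx (L (indicat_real ?D))" unfolding G E.cm_of_real ..
  finally show ?thesis .
 qed
 with w show ?thesis using that unfolding dl_def by simp
qed

lemma set_shift_iff: "x : set_shift E h \<longleftrightarrow> x + h : E"
 unfolding set_shift_def by (auto intro: image_eqI[of _ _ "x + h"])

lemma syndetic_zsmul:
 fixes S :: "'a::ab_group_add set"
 assumes "fin_idx k TYPE('a)" "syndetic {h. zsmul k h : S}" shows "syndetic S"
proof -
 obtain R :: "'a set" where R: "finite R" "!!g. EX c:R. EX h. g = c + zsmul k h"
  using assms(1) unfolding fin_idx_def by blast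
 obtain T where T: "finite T" "(\<Union>t\<in>T. (+) t ` {h. zsmul k h : S}) = UNIV" using assms(2) unfolding syndetic_def by blast
 have "g : (\<Union>t\<in>(%(c, t). c + zsmul k t) ` (R \<times> T). (+) t ` S)" for g
 proof -
  obtain c h where c: "c : R" "g = c + zsmul k h" using R(2) by blast
  have "h : (\<Union>t\<in>T. (+) t ` {h. zsmul k h : S})" using T(2) by simp
  then obtain t l where t: "t : T" "h = t + l" "zsmul k l : S" by blast
  have "g = (c + zsmul k t) + zsmul k l" unfolding c(2) t(2) by (simp add: zsmul_add_right add.assoc)
  then show ?thesis using c(1) t by blast
 qed
 then show ?thesis unfolding syndetic_def using R(1) T(1) by (intro exI[of _ "(%(c, t). c + zsmul k t) ` (R \<times> T)"]) auto
qed

theorem theorem1p15: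
  fixes r s :: int and E :: "'a::{ab_group_add, countable} set" and \<epsilon> :: real
  assumes "r \<noteq> 0" and "s \<noteq> 0" and "r \<noteq> s"
    and "finite_index (mult_subgroup r :: 'a set)"
    and "finite_index (mult_subgroup s :: 'a set)"
    and "finite_index (mult_subgroup (r + s) :: 'a set)"
    and "finite_index (mult_subgroup (r - s) :: 'a set)"
    and "upper_banach_density E > 0"
    and "\<epsilon> > 0"
  shows "syndetic {g. upper_banach_density
            (E \<inter> set_shift E (zsmul r g) \<inter> set_shift E (zsmul s g) \<inter> set_shift E (zsmul (r + s) g))
            > upper_banach_density E ^ 4 - \<epsilon>}"
proof -
  have fi: "fin_idx r TYPE('a)" "fin_idx s TYPE('a)" "fin_idx (r + s) TYPE('a)" "fin_idx (r - s) TYPE('a)"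
    by (rule finite_index_fin_idx, fact)+
  have "even r \<or> even s \<or> even (r + s)" by auto
  then have two: "fin_idx 2 TYPE('a)" using fi fin_idx_dvd by blast
  let ?d = "upper_banach_density E"
  define X where "X g = E \<inter> set_shift E (zsmul r g) \<inter> set_shift E (zsmul s g) \<inter> set_shift E (zsmul (r + s) g)" for g
  define Good where "Good = {g. ?d ^ 4 - \<epsilon> < upper_banach_density (X g)}"
  define S where "S = {h. zsmul 2 h \<in> Good}"
  have "syndetic S"
  proof (rule ccontr)
    assume nS: "\<not> syndetic S"
    \<comment> \<open>Positive density guarantees that some Folner sequence exists; it serves both
      for the mean vanishing on \<open>S\<close> and for \<open>mean_le_density\<close>.\<close>
    obtain F0 :: "nat \<Rightarrow> 'a set" where F0: "folner F0" using density_approx[OF assms(8) zero_less_one] by blast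
    obtain m where m: "inv_mean m" "m (indicat_real S) = 0" by (rule nonsyndetic_mean[OF nS F0]) blast
    interpret M: imean m by unfold_locales fact
    obtain L :: "('a \<Rightarrow> real) \<Rightarrow> real" where L: "ext_mean L" "\<And>m. inv_mean m \<Longrightarrow> m (indicat_real E) \<le> L (indicat_real E)"
      by (rule ext_mean_exists[OF m(1), of "indicat_real E"]) blast
    interpret E: emean L by unfold_locales fact
    have dL: "?d \<le> L (indicat_real E)"
    proof (rule field_le_epsilon)
      fix e :: real assume e: "0 < e"
      obtain F where F: "folner F" "\<And>N. ?d - e \<le> avg (F N) (indicat_real E)" by (rule density_approx[OF assms(8) e]) blast
      obtain m' where m': "inv_mean m'" "\<And>f c. bdd f \<Longrightarrow> (\<And>N. c \<le> avg (F N) f) \<Longrightarrow> c \<le> m' f" by (rule mean_of_folner[OF F(1)]) blast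
      have "?d - e \<le> m' (indicat_real E)" by (rule m'(2)[OF bdd_indicator' F(2)])
      then show "?d \<le> L (indicat_real E) + e" using L(2)[OF m'(1)] by simp
    qed
    define a where "a = r + s"
    define b where "b = r - s"
    define c where "c h = L (indicat_real {x. x + zsmul (- a) h \<in> E \<and> x + zsmul b h \<in> E \<and> x + zsmul (- b) h \<in> E \<and> x + zsmul a h \<in> E})" for h
    have cX: "c h \<le> upper_banach_density (X (zsmul 2 h))" for h
    proof -
      have "{x. x + zsmul (- a) h \<in> E \<and> x + zsmul b h \<in> E \<and> x + zsmul (- b) h \<in> E \<and> x + zsmul a h \<in> E} = {x. x + zsmul (- a) h \<in> X (zsmul 2 h)}"
      proof (rule Collect_cong)
        fix x
        have e: "zsmul (- a) h + zsmul r (zsmul 2 h) = zsmul b h" "zsmul (- a) h + zsmul s (zsmul 2 h) = zsmul (- b) h"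
          "zsmul (- a) h + zsmul (r + s) (zsmul 2 h) = zsmul a h"
          unfolding zsmul_mult[symmetric] zsmul_add_left[symmetric] by (simp_all add: a_def b_def algebra_simps)
        show "(x + zsmul (- a) h \<in> E \<and> x + zsmul b h \<in> E \<and> x + zsmul (- b) h \<in> E \<and> x + zsmul a h \<in> E) = (x + zsmul (- a) h \<in> X (zsmul 2 h))"
          unfolding X_def Int_iff set_shift_iff add.assoc e by blast
      qed
      then have "c h = E.msr {x. x + zsmul (- a) h \<in> X (zsmul 2 h)}" by (simp only: c_def E.msr_def)
      also have "\<dots> = E.msr (X (zsmul 2 h))" by (rule E.msr_shift)
      also have "\<dots> = L (indicat_real (X (zsmul 2 h)))" by (rule E.msr_def)
      also have "\<dots> \<le> upper_banach_density (X (zsmul 2 h))" by (rule mean_le_density[OF E.im F0])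
      finally show ?thesis .
    qed
    have c1: "0 \<le> c h" "c h \<le> 1" for h unfolding c_def by (auto intro!: E.m_nonneg E.m_le bdd_indicator' simp: indicator_def)
    have cS: "c h \<le> ?d ^ 4 - \<epsilon>" if "h \<notin> S" for h
      using cX[of h] that by (simp add: S_def Good_def not_less)
    have fi': "fin_idx (a + b) TYPE('a)" "fin_idx (a - b) TYPE('a)" "fin_idx (2 * a) TYPE('a)" "fin_idx (2 * b) TYPE('a)"
      using fin_idx_mult[OF two fi(1)] fin_idx_mult[OF two fi(2)] fin_idx_mult[OF two fi(3)] fin_idx_mult[OF two fi(4)]
      by (simp_all add: a_def b_def)
    have e2: "0 < \<epsilon> / 2" using assms(9) by simp
    \<comment> \<open>Half of the allowance goes to \<open>gns_core\<close>; the other half is the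
      gap that yields the contradiction.\<close>
    obtain w where w: "M.weight w" "L (indicat_real E) ^ 4 - \<epsilon> / 2 \<le> Re (M.cm (\<lambda>h. w h * cx (c h)))"
      by (rule gns_core[OF L(1) m(1) fi' e2, of E]) (auto simp: c_def)
    have bw: "bdd w" using w(1) by (simp add: M.weight_def TP_bdd)
    obtain B where B: "0 \<le> B" "\<And>h. cmod (w h) \<le> B" using bw by (rule bddE) blast
    have wR: "0 \<le> Re (w h)" "Im (w h) = 0" "Re (w h) \<le> B" for h
      using w(1) B(2)[of h] complex_Re_le_cmod[of "w h"] by (auto simp: M.weight_def)
    have mw: "m (\<lambda>h. Re (w h)) = 1"
    proof -
      have "Re (M.cm w) = 1" using w(1) by (simp add: M.weight_def)
      then show ?thesis by (simp only: M.Re_cm)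
    qed
    have bR: "bdd (\<lambda>h. Re (w h))" by (rule bdd_Re[OF bw])
    have bc: "bdd c" by (rule bddI[of _ 1]) (simp add: c1)
    have "Re (M.cm (\<lambda>h. w h * cx (c h))) = m (\<lambda>h. Re (w h) * c h)" unfolding M.Re_cm by simp
    \<comment> \<open>On \<open>S\<close> the correlation may be as large as 1. The excess is
      carried by a multiple of the indicator of \<open>S\<close>, which has mean 0, with
      \<open>B\<close> bounding the weight.\<close>
    also have "\<dots> \<le> m (\<lambda>h. (?d ^ 4 - \<epsilon>) * Re (w h) + (B * (1 + \<epsilon>)) * indicat_real S h)"
    proof (rule M.m_mono)
      show "bdd (\<lambda>h. Re (w h) * c h)" by (rule bdd_mult[OF bR bc])
      show "bdd (\<lambda>h. (?d ^ 4 - \<epsilon>) * Re (w h) + (B * (1 + \<epsilon>)) * indicat_real S h)"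
        by (intro bdd_add bdd_mult[OF bdd_const] bR bdd_indicator')
      fix h
      show "Re (w h) * c h \<le> (?d ^ 4 - \<epsilon>) * Re (w h) + (B * (1 + \<epsilon>)) * indicat_real S h"
      proof (cases "h \<in> S")
        case True
        have "0 \<le> ?d ^ 4" using assms(8) by simp
        then have "c h \<le> (?d ^ 4 - \<epsilon>) + (1 + \<epsilon>)" using c1(2)[of h] by linarith
        then have "Re (w h) * c h \<le> Re (w h) * ((?d ^ 4 - \<epsilon>) + (1 + \<epsilon>))" using wR(1) by (rule mult_left_mono)
        also have "\<dots> = (?d ^ 4 - \<epsilon>) * Re (w h) + Re (w h) * (1 + \<epsilon>)" by (simp add: algebra_simps)
        also have "\<dots> \<le> (?d ^ 4 - \<epsilon>) * Re (w h) + B * (1 + \<epsilon>)" using wR(3) assms(9) by (intro add_left_mono mult_right_mono) auto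
        finally show ?thesis using True by simp
      next
        case False
        then show ?thesis using mult_left_mono[OF cS[OF False] wR(1)[of h]] by (simp add: mult.commute)
      qed
    qed
    also have "\<dots> = ?d ^ 4 - \<epsilon>"
      unfolding M.m_add[OF bdd_mult[OF bdd_const bR] bdd_mult[OF bdd_const bdd_indicator']] M.m_scale[OF bR] M.m_scale[OF bdd_indicator'] mw m(2) by simp
    finally have "L (indicat_real E) ^ 4 - \<epsilon> / 2 \<le> ?d ^ 4 - \<epsilon>" using w(2) by simp
    moreover have "?d ^ 4 \<le> L (indicat_real E) ^ 4" using dL assms(8) by (intro power_mono) auto
    ultimately show False using assms(9) by simp
  qed
  then have "syndetic Good" unfolding S_def by (rule syndetic_zsmul[OF two])
  then show ?thesis by (simp only: Good_def X_def)
qed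

end
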